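(* Let $n\ge 1$ and let $A$ be a continuous complex $n\times n$ matrix-valued function on $\mathbb{C}^n$ vanishing on $\mathbb{C}^n\setminus\Sigma$, where $\Sigma=\Delta\times\mathbb{C}^{n-1}$ and $\Delta=\{z\in\mathbb{C}: 0<\operatorname{Im} z<1-|\operatorname{Re} z|\}$. Suppose there is a constant $0<a<1$ such that $\|A(Z)\|\le a$ for all $Z\in\Sigma$. Then there exists $p>2$ such that for every point $(z^0,w^0)\in\Sigma$ (with $z^0\in\Delta$, $w^0\in\mathbb{C}^{n-1}$) there is a map $Z\in W^{1,p}(\mathbb{D})$, $Z:\mathbb{D}\to\mathbb{C}^n$, which is a solution of $$\frac{\partial Z}{\partial\overline{\zeta}}=A(Z)\,\frac{\partial\overline{Z}}{\partial\overline{\zeta}},\qquad \zeta\in\mathbb{D},$$ such that $Z(\overline{\mathbb{D}})\subset\overline{\Sigma}$, $(z^0,w^0)\in Z(\mathbb{D})$, $\operatorname{Area}(Z)=1$, and $$Z(\partial\mathbb{D})\subset\partial\Sigma=(\partial\Delta)\times\mathbb{C}^{n-1}.$$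
   Context: $\mathbb{D}$ is the open unit disc in $\mathbb{C}$, with boundary the unit circle $\partial\mathbb{D}$. The matrix norm $\|\cdot\|$ is the operator norm induced by the Euclidean inner product on $\mathbb{C}^n$. $W^{1,p}(\mathbb{D})$ is the Sobolev class of maps from $\mathbb{D}$ (here to $\mathbb{C}^n$) with first partial derivatives in $L^p$; for $p>2$ its elements are identified with their continuous representatives on $\overline{\mathbb{D}}$, so that $Z(\overline{\mathbb{D}})$ and $Z(\partial\mathbb{D})$ make sense. The equation is understood with Sobolev (weak) derivatives, i.e. almost everywhere on $\mathbb{D}$; $\overline{Z}$ is the componentwise complex conjugate, so $\partial\overline{Z}/\partial\overline{\zeta}=\overline{\partial Z/\partial\zeta}$. The symplectic area of $Z$ is $\operatorname{Area}(Z)=\int_{\mathbb{D}}Z^*\omega$, where $\omega=\frac{i}{2}\sum_{j=1}^n dZ_j\wedge d\overline{Z_j}$ is the standard symplectic form on $\mathbb{C}^n$. *)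

theory Defs
  imports "HOL-Analysis.Analysis"
begin

primrec Ck :: "nat \<Rightarrow> ('a::euclidean_space \<Rightarrow> real) \<Rightarrow> bool" where
  "Ck 0 \<phi> \<longleftrightarrow> continuous_on UNIV \<phi>"
| "Ck (Suc k) \<phi> \<longleftrightarrow>
     (\<forall>x. \<phi> differentiable (at x)) \<and>
     (\<forall>b\<in>Basis. Ck k (\<lambda>x. frechet_derivative \<phi> (at x) b))"

definition test_fun_on :: "'a::euclidean_space set \<Rightarrow> ('a \<Rightarrow> real) \<Rightarrow> bool" where
  "test_fun_on U \<phi> \<longleftrightarrow>
     (\<forall>k. Ck k \<phi>) \<and> compact (closure {x. \<phi> x \<noteq> 0}) \<and> closure {x. \<phi> x \<noteq> 0} \<subseteq> U"

definition locally_integrable_on ::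
    "('a::euclidean_space \<Rightarrow> 'b::euclidean_space) \<Rightarrow> 'a set \<Rightarrow> bool" where
  "locally_integrable_on f U \<longleftrightarrow> (\<forall>K. compact K \<and> K \<subseteq> U \<longrightarrow> integrable (lebesgue_on K) f)"

definition has_weak_deriv ::
    "('a::euclidean_space \<Rightarrow> 'b::euclidean_space) \<Rightarrow> ('a \<Rightarrow> 'b) \<Rightarrow> 'a \<Rightarrow> 'a set \<Rightarrow> bool" where
  "has_weak_deriv f g v U \<longleftrightarrow>
     locally_integrable_on f U \<and> locally_integrable_on g U \<and>
     (\<forall>\<phi>. test_fun_on U \<phi> \<longrightarrow>
        (LINT x|lebesgue_on U. frechet_derivative \<phi> (at x) v *\<^sub>R f x) =
        - (LINT x|lebesgue_on U. \<phi> x *\<^sub>R g x))"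

text \<open>A representative of the weak derivative of \<open>f\<close> on \<open>U\<close> in the direction \<open>v\<close>. It is
  determined only up to a null set, so it may be used only inside a.e. statements and integrals,
  and only for \<open>f\<close> that do possess a weak derivative.\<close>

definition weak_deriv ::
    "'a::euclidean_space set \<Rightarrow> 'a \<Rightarrow> ('a \<Rightarrow> 'b::euclidean_space) \<Rightarrow> 'a \<Rightarrow> 'b" where
  "weak_deriv U v f = (SOME g. has_weak_deriv f g v U)"

definition Lp_on :: "real \<Rightarrow> 'a::euclidean_space set \<Rightarrow> ('a \<Rightarrow> 'b::euclidean_space) set" where
  "Lp_on p U = {f. f \<in> borel_measurable (lebesgue_on U) \<and>
                   integrable (lebesgue_on U) (\<lambda>x. norm (f x) powr p)}"

definition W1p :: "real \<Rightarrow> 'a::euclidean_space set \<Rightarrow> ('a \<Rightarrow> 'b::euclidean_space) set" where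
  "W1p p U = {f. f \<in> Lp_on p U \<and> (\<forall>b\<in>Basis. \<exists>g\<in>Lp_on p U. has_weak_deriv f g b U)}"

abbreviation unit_disc :: "complex set" where
  "unit_disc \<equiv> ball 0 1"

definition dbar :: "(complex \<Rightarrow> complex^'n) \<Rightarrow> complex \<Rightarrow> complex^'n" where
  "dbar Z \<zeta> =
     (1 / 2) *s (weak_deriv unit_disc 1 Z \<zeta> + \<i> *s weak_deriv unit_disc \<i> Z \<zeta>)"

definition cnj_vec :: "complex^'n \<Rightarrow> complex^'n" where
  "cnj_vec v = (\<chi> j. cnj (v $ j))"

text \<open>The value at the tangent vectors \<open>u\<close>, \<open>v\<close> of the form \<open>(\<i>/2) \<Sum>\<^sub>j dZ\<^sub>j \<and> d(cnj Z\<^sub>j)\<close>, where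
  \<open>(\<alpha> \<and> \<beta>)(u, v) = \<alpha>(u) \<beta>(v) - \<alpha>(v) \<beta>(u)\<close>. The number inside \<^const>\<open>Re\<close> is already real.\<close>

definition std_symplectic :: "complex^'n \<Rightarrow> complex^'n \<Rightarrow> real" where
  "std_symplectic u v =
     Re (\<i> / 2 * (\<Sum>j\<in>UNIV. u $ j * cnj (v $ j) - v $ j * cnj (u $ j)))"

text \<open>The pullback of \<open>\<omega>\<close> by \<open>Z\<close> is \<open>\<omega>(\<partial>Z/\<partial>x, \<partial>Z/\<partial>y) dx \<and> dy\<close>, with \<open>\<zeta> = x + \<i>y\<close>.\<close>

definition symplectic_area :: "(complex \<Rightarrow> complex^'n) \<Rightarrow> real" where
  "symplectic_area Z =
     (LINT \<zeta>|lebesgue_on unit_disc.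
        std_symplectic (weak_deriv unit_disc 1 Z \<zeta>) (weak_deriv unit_disc \<i> Z \<zeta>))"

definition Triangle :: "complex set" where
  "Triangle = {z. 0 < Im z \<and> Im z < 1 - \<bar>Re z\<bar>}"

text \<open>The product of \<open>Triangle\<close> with \<open>\<complex>\<^sup>n\<^sup>-\<^sup>1\<close>: the index \<open>k\<close> singles out the coordinate \<open>z\<close> of a point
  \<open>(z, w)\<close>, the other \<open>n - 1\<close> coordinates (none if \<open>n = 1\<close>) form \<open>w\<close>.\<close>

definition Cylinder :: "'n::finite \<Rightarrow> (complex^'n) set" where
  "Cylinder k = {Z. Z $ k \<in> Triangle}"

end

theory Submission
  imports Defs "HOL-Complex_Analysis.Riemann_Mapping"
begin

text \<open>The equation is conformally invariant, so the disc may be replaced by the triangle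
  \<open>TT = {0 < Re w < Im w < 2}\<close>, which \<open>w / (1 + \<i>) - 1\<close> maps onto \<open>Triangle\<close>. There we look for
  \<open>Z = (w e + F(w)) / (1 + \<i>) + const\<close>. Reflection in the sides turns the boundary condition into
  symmetries of the 4-periodic correction \<open>F\<close>, and \<open>u = \<partial>F/\<partial>cnj w\<close> solves \<open>u = \<i> A(Z) cnj(e + S u)\<close>,
  where the Beurling transform \<open>S\<close> of the torus is isometric in \<open>L^2\<close> up to constants. Brouwer's theorem gives
  Galerkin solutions. As \<open>|A| <= a < 1\<close> and \<open>S\<close> is bounded on \<open>L^4\<close>, they are bounded in some \<open>L^p\<close>,
  \<open>p > 2\<close>, hence equicontinuous, and a subsequence converges strongly. Where \<open>Z\<close> leaves the cylinder
  its \<open>k\<close>-th coordinate is holomorphic, which the maximum principle excludes. Since \<open>S\<close> is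
  isometric, \<open>|e + S u|^2 - |u|^2\<close> has the same integral as \<open>|e|^2\<close>, whence the area 1. Finally, the
  Riemann map of the triangle extends continuously to the boundary and its derivative is in \<open>L^r\<close>
  for some \<open>r > 2\<close>.\<close>

section \<open>Trigonometric polynomials on the torus\<close>

text \<open>The right isosceles shape matters: the reflections in the sides tile the plane, so
  functions with these symmetries live on a flat torus, where the operators are explicit Fourier
  multipliers and no boundary integral is left. The symbol of \<open>S\<close> has modulus 1, so
  \<open>a < 1\<close> gives a contraction in L^2 once \<open>A(Z)\<close> is frozen.
  \<open>A\<close> is merely continuous, so the full equation is no contraction; freezing
  \<open>A(Z)\<close> yields bounds independent of the truncation, and only the existence of
  truncated solutions needs a topological argument. The reflected right-hand side is continuous
  because \<open>Z\<close> sends each side into its side line and \<open>A\<close> vanishes outside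
  the cylinder. Passing through the given point is one more condition; it is met by making the
  parameter sent there an extra unknown. The gain \<open>p > 2\<close> comes from a Neumann series
  whose terms decay in L^2 and grow at most geometrically in L^4: close to 2, interpolation keeps
  some decay. The L^4 bound for \<open>S\<close> rests on half-plane projections alone. The area is
  that of \<open>Triangle\<close> itself.\<close>

lemma cbox_Complex_iff: "z \<in> cbox (Complex a c) (Complex b d) \<longleftrightarrow> a <= Re z & Re z <= b & c <= Im z & Im z <= d"
 by (auto simp: in_cbox_complex_iff)

lemma content_complex_cbox:
 assumes "a <= b" "c <= d"
 shows "measure lborel (cbox (Complex a c) (Complex b d)) = (b - a) * (d - c)"
 using assms by (subst content_cbox) (auto simp: Basis_complex_def inner_complex_def)

text \<open>The map to (Re, Im) is a content-preserving bijection of boxes, so Fubini on pairs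
  becomes available on complex boxes.\<close>

lemma has_integral_complex_pair:
 fixes f :: "complex => 'b::banach"
 assumes "((%(x, y). f (Complex x y)) has_integral I) (cbox (a, c) (b, d))"
 shows "(f has_integral I) (cbox (Complex a c) (Complex b d))"
proof -
 let ?g = "%z. (Re z, Im z)" and ?h = "%(x, y). Complex x y"
 have img: "?g ` cbox u v = cbox (Re u, Im u) (Re v, Im v)" for u v
 proof (intro set_eqI iffI)
  fix p assume "p \<in> cbox (Re u, Im u) (Re v, Im v)"
  hence "Complex (fst p) (snd p) \<in> cbox u v" "p = ?g (Complex (fst p) (snd p))"
   by (auto simp: in_cbox_complex_iff cbox_Pair_eq)
  thus "p \<in> ?g ` cbox u v" by blast
 qed (auto simp: in_cbox_complex_iff cbox_Pair_eq)
 have img': "?h ` cbox u v = cbox (?h u) (?h v)" for u v :: "real \<times> real"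
  by (cases u; cases v)
   (auto simp: in_cbox_complex_iff image_iff cbox_Pair_eq complex_eq_iff intro!: exI[of _ "Re _"] exI[of _ "Im _"])
 have "((%x. (%(x, y). f (Complex x y)) (?g x)) has_integral (1 / 1) *\<^sub>R I) (?h ` cbox (a, c) (b, d))"
 proof (rule has_integral_twiddle[OF _ _ _ _ _ _ _ assms])
  show "measure lborel (?g ` cbox u v) = 1 * measure lborel (cbox u v)" for u v
  proof -
   have "measure lborel (cbox (Re u, Im u) (Re v, Im v)) = measure lborel (cbox (Re u) (Re v)) * measure lborel (cbox (Im u) (Im v))"
    by (rule content_Pair)
   also have "... = measure lborel (cbox u v)"
    by (auto simp: content_cbox_if box_eq_empty Basis_complex_def inner_complex_def content_real_if)
   finally show ?thesis by (simp add: img)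
  qed
 qed (auto simp: img img' complex_eq_iff intro!: continuous_intros)
 thus ?thesis
  by (simp add: img')
qed

lemma integral_complex_iterated:
 fixes f :: "complex => 'b::euclidean_space"
 assumes "continuous_on (cbox (Complex a c) (Complex b d)) f"
 shows "integral (cbox (Complex a c) (Complex b d)) f = integral {a..b} (%x. integral {c..d} (%y. f (Complex x y)))"
proof -
 have c: "continuous_on (cbox (a, c) (b, d)) (%(x, y). f (Complex x y))"
  unfolding case_prod_beta
 proof (rule continuous_on_compose2[OF assms])
  show "continuous_on (cbox (a, c) (b, d)) (%p. Complex (fst p) (snd p))"
   unfolding Complex_eq by (intro continuous_intros)
 qed (auto simp: cbox_Complex_iff cbox_Pair_eq)
 have "((%(x, y). f (Complex x y)) has_integral integral (cbox (a, c) (b, d)) (%(x, y). f (Complex x y))) (cbox (a, c) (b, d))"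
  using c integrable_continuous by blast
 from has_integral_complex_pair[OF this]
 have "integral (cbox (Complex a c) (Complex b d)) f = integral (cbox (a, c) (b, d)) (%(x, y). f (Complex x y))"
  by (rule integral_unique)
 also have "... = integral {a..b} (%x. integral {c..d} (%y. f (Complex x y)))"
  using integral_prod_continuous[OF c] by simp
 finally show ?thesis .
qed

text \<open>One period cell of the lattice 4Z + 4iZ, centred at 0 so that the maps
  \<open>cnj w\<close>, \<open>- cnj w\<close> and \<open>\<i> * cnj w\<close> preserve it.\<close>

definition QQ :: "complex set" where "QQ = cbox (Complex (-2) (-2)) (Complex 2 2)"

lemma QQ_iff: "z \<in> QQ \<longleftrightarrow> -2 <= Re z & Re z <= 2 & -2 <= Im z & Im z <= 2"
 by (auto simp: QQ_def in_cbox_complex_iff)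

lemma content_QQ: "measure lborel QQ = 16"
 unfolding QQ_def by (subst content_complex_cbox) auto

lemma compact_QQ [simp]: "compact QQ" by (simp add: QQ_def)

lemma integrable_QQ [intro, simp]:
 fixes f :: "complex => 'b::euclidean_space"
 shows "continuous_on QQ f ==> f integrable_on QQ"
 unfolding QQ_def by (rule integrable_continuous)

text \<open>The characters of the torus C / (4Z + 4iZ).\<close>

definition ek :: "int * int => complex => complex" where
 "ek k w = cis (pi / 2 * (of_int (fst k) * Re w + of_int (snd k) * Im w))"

lemma ek_0 [simp]: "ek 0 w = 1" and ek_zero [simp]: "ek (0,0) w = 1"
 by (auto simp: ek_def zero_prod_def)

lemma ek_add: "ek (k + l) w = ek k w * ek l w"
 by (simp add: ek_def cis_mult algebra_simps)

lemma ek_cnj: "cnj (ek k w) = ek (- k) w"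
 by (simp add: ek_def cis_cnj algebra_simps)

lemma norm_ek [simp]: "norm (ek k w) = 1"
 by (simp add: ek_def)

lemma continuous_ek [continuous_intros]:
 "continuous_on S g ==> continuous_on S (%x. ek k (g x))"
 unfolding ek_def cis_conv_exp by (intro continuous_intros)

lemma integral_cis_period:
 fixes m :: int
 assumes "m ~= 0"
 shows "integral {-2..2::real} (%x. cis (pi / 2 * (of_int m * x))) = 0"
proof -
 let ?c = "\<i> * (pi / 2 * of_int m)"
 have "((%x. cis (pi / 2 * (of_int m * x))) has_integral
    (exp (?c * of_real 2) / ?c - exp (?c * of_real (-2)) / ?c)) {-2..2::real}"
 proof (rule fundamental_theorem_of_calculus)
  fix x :: real
  have "((%z. exp (?c * z) / ?c) has_field_derivative exp (?c * of_real x)) (at (of_real x))"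
   using assms by (auto intro!: derivative_eq_intros)
  hence "((%x. exp (?c * of_real x) / ?c) has_vector_derivative exp (?c * of_real x)) (at x within {-2..2})"
   by (rule has_vector_derivative_real_field)
  thus "((%x. exp (?c * of_real x) / ?c) has_vector_derivative cis (pi / 2 * (of_int m * x))) (at x within {-2..2})"
   by (simp add: cis_conv_exp algebra_simps)
 qed simp
 moreover have "exp (?c * of_real 2) = exp (?c * of_real (-2))"
 proof -
  have "exp (?c * of_real 2) = exp (?c * of_real (-2) + 2 * of_int m * of_real pi * \<i>)"
   by (simp add: algebra_simps)
  also have "... = exp (?c * of_real (-2))"
   by (subst exp_eq) (auto intro!: exI[of _ m])
  finally show ?thesis .
 qed
 ultimately show ?thesis by (auto dest: integral_unique)
qed

lemma integral_ek: "integral QQ (ek k) = (if k = 0 then 16 else 0)"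
proof (cases "k = 0")
 case True
 hence "ek k = (%_. 1)" by auto
 thus ?thesis using content_QQ True by (simp add: QQ_def scaleR_conv_of_real)
next
 case False
 have e: "ek k (Complex x y) = cis (pi / 2 * (of_int (fst k) * x)) * cis (pi / 2 * (of_int (snd k) * y))" for x y
  by (simp add: ek_def cis_mult algebra_simps)
 have "integral QQ (ek k) = integral {-2..2} (%x. integral {-2..2} (%y. ek k (Complex x y)))"
  unfolding QQ_def by (rule integral_complex_iterated) (intro continuous_intros)
 also have "... = integral {-2..2} (%x. cis (pi / 2 * (of_int (fst k) * x))) *
         integral {-2..2} (%y. cis (pi / 2 * (of_int (snd k) * y)))"
  unfolding e by simp
 also have "... = 0"
  using False integral_cis_period[of "fst k"] integral_cis_period[of "snd k"]
  by (cases k) (auto simp: zero_prod_def)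
 finally show ?thesis using False by simp
qed

lemma integral_ek_sum:
 assumes "finite I"
 shows "integral QQ (%w. SUM i:I. c i * ek (ka i) w) = 16 * (SUM i:I. if ka i = 0 then c i else 0)"
proof -
 have "integral QQ (%w. SUM i:I. c i * ek (ka i) w) = (SUM i:I. integral QQ (%w. c i * ek (ka i) w))"
  by (rule integral_sum[OF assms]) (intro integrable_QQ continuous_intros)
 also have "... = 16 * (SUM i:I. if ka i = 0 then c i else 0)"
  by (auto simp: integral_ek sum_distrib_left if_distrib intro!: sum.cong)
 finally show ?thesis .
qed

definition BX :: "nat => (int * int) set" where
 "BX N = {- int N..int N} \<times> {- int N..int N}"

lemma finite_BX [simp]: "finite (BX N)" by (simp add: BX_def)

definition tp :: "nat => (int * int => complex) => complex => complex" where
 "tp N c w = (SUM k:BX N. c k * ek k w)"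

lemma continuous_tp [continuous_intros]:
 "continuous_on S g ==> continuous_on S (%x. tp N c (g x))"
 unfolding tp_def by (intro continuous_intros)

lemma Parseval_tp: "integral QQ (%w. (cmod (tp N c w))^2) = 16 * (SUM k:BX N. (cmod (c k))^2)"
proof -
 let ?I = "BX N \<times> BX N"
 have "of_real ((cmod (tp N c w))^2) = (SUM i:?I. (c (fst i) * cnj (c (snd i))) * ek (fst i - snd i) w)" for w
 proof -
  have "of_real ((cmod (tp N c w))^2) = tp N c w * cnj (tp N c w)"
   by (rule complex_norm_square)
  also have "... = (SUM k:BX N. SUM l:BX N. (c k * ek k w) * cnj (c l * ek l w))"
   unfolding tp_def cnj_sum sum_product ..
  also have "... = (SUM i:?I. (c (fst i) * cnj (c (snd i))) * ek (fst i - snd i) w)"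
   unfolding sum.cartesian_product
   by (intro sum.cong refl) (auto simp: ek_cnj diff_conv_add_uminus ek_add simp del: add_uminus_conv_diff)
  finally show ?thesis .
 qed
 hence "integral QQ (%w. of_real ((cmod (tp N c w))^2)) =
   16 * (SUM i:?I. if fst i - snd i = 0 then c (fst i) * cnj (c (snd i)) else 0)"
  by (simp add: integral_ek_sum)
 also have "(SUM i:?I. if fst i - snd i = 0 then c (fst i) * cnj (c (snd i)) else 0) =
   (SUM k:BX N. SUM l:BX N. if k = l then c k * cnj (c l) else 0)"
  unfolding sum.cartesian_product by (intro sum.cong refl) auto
 also have "... = (SUM k:BX N. c k * cnj (c k))" by simp
 also have "... = of_real (SUM k:BX N. (cmod (c k))^2)" by (simp add: complex_norm_square[symmetric])
 also have "integral QQ (%w. of_real ((cmod (tp N c w))^2)) = complex_of_real (integral QQ (%w. (cmod (tp N c w))^2))"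
  using integral_linear[of "%w. (cmod (tp N c w))^2" QQ complex_of_real]
  by (simp add: bounded_linear_of_real o_def continuous_intros)
 finally have "complex_of_real (integral QQ (%w. (cmod (tp N c w))^2)) = of_real (16 * (SUM k:BX N. (cmod (c k))^2))"
  by simp
 thus ?thesis using of_real_eq_iff by blast
qed

text \<open>Cotlar's argument: with \<open>v = a + b\<close>, where \<open>a\<close> has its frequencies in a half-plane and \<open>b\<close> in
 the complement, \<open>b^2 cnj a^2\<close> has mean zero and \<open>|a|\<^sup>4 = 2 v a cnj a^2 - v^2 cnj a^2 + b^2 cnj a^2\<close>.\<close>

lemma halfplane_projection_L4:
 fixes t p q :: real
 assumes P: "!!k. P k \<longleftrightarrow> t <= p * of_int (fst k) + q * of_int (snd k)"
 shows "integral QQ (%w. (cmod (tp N (%k. if P k then c k else 0) w)) ^ 4) <=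
   300 * integral QQ (%w. (cmod (tp N c w)) ^ 4)"
proof -
 define a where "a = tp N (%k. if P k then c k else 0)"
 define b where "b = tp N (%k. if P k then 0 else c k)"
 define v where "v = tp N c"
 have vab: "v w = a w + b w" for w
  unfolding v_def a_def b_def tp_def sum.distrib[symmetric] by (intro sum.cong) auto
 note [continuous_intros] = continuous_tp[where N=N, folded a_def]
 have ca: "continuous_on S a" "continuous_on S b" "continuous_on S v" for S
  unfolding a_def b_def v_def by (intro continuous_tp continuous_on_id)+
 \<comment> \<open>Each term of the expanded product has two frequencies below the threshold
   \<open>t\<close> and two at or above it with the opposite sign. The linear functional
   \<open>?l\<close> is then nonzero on the total frequency, so no term has a mean.\<close>
 have zero: "integral QQ (%w. (b w)^2 * (cnj (a w))^2) = 0"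
 proof -
  let ?I = "(BX N \<times> BX N) \<times> (BX N \<times> BX N)"
  let ?a = "%k. if P k then c k else 0" and ?b = "%k. if P k then 0 else c k"
  let ?K = "%i. fst (fst i) + snd (fst i) - fst (snd i) - snd (snd i)"
  let ?C = "%i. ?b (fst (fst i)) * ?b (snd (fst i)) * cnj (?a (fst (snd i))) * cnj (?a (snd (snd i)))"
  have "(b w)^2 * (cnj (a w))^2 = (SUM i:?I. ?C i * ek (?K i) w)" for w
  proof -
   have "(b w)^2 * (cnj (a w))^2 = ((SUM k:BX N. ?b k * ek k w) * (SUM k:BX N. ?b k * ek k w)) *
     ((SUM k:BX N. cnj (?a k * ek k w)) * (SUM k:BX N. cnj (?a k * ek k w)))"
    unfolding power2_eq_square a_def b_def tp_def cnj_sum ..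
   also have "... = (SUM i:?I. ((?b (fst (fst i)) * ek (fst (fst i)) w) * (?b (snd (fst i)) * ek (snd (fst i)) w)) *
     (cnj (?a (fst (snd i)) * ek (fst (snd i)) w) * cnj (?a (snd (snd i)) * ek (snd (snd i)) w)))"
    unfolding sum_product sum.cartesian_product by (simp add: case_prod_beta)
   also have "... = (SUM i:?I. ?C i * ek (?K i) w)"
    by (intro sum.cong refl)
     (simp add: ek_cnj diff_conv_add_uminus ek_add mult_ac del: add_uminus_conv_diff)
   finally show ?thesis .
  qed
  hence "integral QQ (%w. (b w)^2 * (cnj (a w))^2) = 16 * (SUM i:?I. if ?K i = 0 then ?C i else 0)"
   by (simp only: integral_ek_sum finite_cartesian_product finite_BX)
  also have "(SUM i:?I. if ?K i = 0 then ?C i else 0) = 0"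
  proof (intro sum.neutral ballI)
   fix i
   let ?l = "%k::int * int. p * of_int (fst k) + q * of_int (snd k)"
   have "?C i = 0" if "?K i = 0"
   proof (rule ccontr)
    assume "?C i ~= 0"
    hence "\<not> P (fst (fst i))" "\<not> P (snd (fst i))" "P (fst (snd i))" "P (snd (snd i))"
     by (auto split: if_splits)
    hence "?l (fst (fst i)) + ?l (snd (fst i)) < ?l (fst (snd i)) + ?l (snd (snd i))"
     by (simp add: P)
    moreover have "?l (?K i) = ?l (fst (fst i)) + ?l (snd (fst i)) - ?l (fst (snd i)) - ?l (snd (snd i))"
     by (simp add: algebra_simps)
    ultimately show False using that by simp
   qed
   thus "(if ?K i = 0 then ?C i else 0) = 0" by simp
  qed
  finally show ?thesis by simp
 qed
 \<comment> \<open>The summand \<open>1/2 * (cmod (a w)) ^ 4\<close> is absorbed after integration,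
   which doubles 150 to the constant 300 of the lemma.\<close>
 have le: "(cmod (a w)) ^ 4 <= 150 * (cmod (v w)) ^ 4 + 1/2 * (cmod (a w)) ^ 4 + Re ((b w)^2 * (cnj (a w))^2)" for w
 proof -
  define x y where "x = cmod (a w)" and "y = cmod (v w)"
  have "of_real (x ^ 4) = (a w * cnj (a w))^2"
   unfolding x_def by (simp add: complex_norm_square[symmetric])
  also have "... = (2 * v w * a w - (v w)^2) * (cnj (a w))^2 + (b w)^2 * (cnj (a w))^2"
   unfolding vab by (simp add: power2_eq_square algebra_simps)
  finally have "x ^ 4 = Re ((2 * v w * a w - (v w)^2) * (cnj (a w))^2) + Re ((b w)^2 * (cnj (a w))^2)"
   by (metis Re_complex_of_real plus_complex.simps(1))
  also have "Re ((2 * v w * a w - (v w)^2) * (cnj (a w))^2) <= cmod ((2 * v w * a w - (v w)^2) * (cnj (a w))^2)"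
   by (rule complex_Re_le_cmod)
  also have "... <= (2 * y * x + y^2) * x^2"
   unfolding norm_mult norm_power complex_mod_cnj x_def[symmetric]
   by (intro mult_right_mono order_trans[OF norm_triangle_ineq4])
    (auto simp: norm_mult norm_power x_def y_def)
  also have "... <= x ^ 4 / 2 + 150 * y ^ 4"
  proof -
   have 1: "2 * y * x <= x^2 / 8 + 8 * y^2"
    using zero_le_power2[of "x - 8 * y"] by (simp add: power2_eq_square algebra_simps)
   have "(2 * y * x + y^2) * x^2 <= (x^2 / 8 + 9 * y^2) * x^2"
    using 1 by (intro mult_right_mono) auto
   also have "... = x ^ 4 / 8 + 9 * (y^2 * x^2)" by (simp add: power4_eq_xxxx power2_eq_square algebra_simps)
   also have "9 * (y^2 * x^2) <= 3 * x ^ 4 / 8 + 150 * y ^ 4"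
   proof -
    have "0 <= (x^2 - 12 * y^2)^2" by simp
    hence "24 * (y^2 * x^2) <= x ^ 4 + 144 * y ^ 4"
     by (simp add: power2_diff power_mult_distrib algebra_simps)
    hence "9 * (y^2 * x^2) <= 3 * x ^ 4 / 8 + 54 * y ^ 4" by simp
    moreover have "54 * y ^ 4 <= 150 * y ^ 4" by simp
    ultimately show ?thesis by linarith
   qed
   finally show ?thesis by simp
  qed
  finally show ?thesis unfolding x_def y_def by simp
 qed
 have "integral QQ (%w. (cmod (a w)) ^ 4) <=
  integral QQ (%w. 150 * (cmod (v w)) ^ 4 + 1/2 * (cmod (a w)) ^ 4 + Re ((b w)^2 * (cnj (a w))^2))"
  by (intro integral_le integrable_QQ continuous_intros ca le)
 also have "... = 150 * integral QQ (%w. (cmod (v w)) ^ 4) + 1/2 * integral QQ (%w. (cmod (a w)) ^ 4) +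
    integral QQ (%w. Re ((b w)^2 * (cnj (a w))^2))"
  by (simp add: integral_add integrable_QQ ca continuous_intros)
 also have "integral QQ (%w. Re ((b w)^2 * (cnj (a w))^2)) = Re (integral QQ (%w. (b w)^2 * (cnj (a w))^2))"
  using integral_linear[OF _ bounded_linear_Re, of "%w. (b w)^2 * (cnj (a w))^2" QQ]
  by (simp add: o_def ca continuous_intros)
 finally have "integral QQ (%w. (cmod (a w)) ^ 4) <= 300 * integral QQ (%w. (cmod (v w)) ^ 4)"
  by (simp add: zero)
 thus ?thesis unfolding a_def v_def .
qed

section \<open>The Riesz and Beurling multipliers on \<open>L^4\<close>\<close>

lemma bounded_borel_integrable_on_interval:
 fixes f :: "real => 'b::euclidean_space"
 assumes "f \<in> borel_measurable borel" "!!x. norm (f x) <= B"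
 shows "f integrable_on {a..b}"
proof (rule measurable_bounded_by_integrable_imp_integrable[where g = "%_. B"])
 have "f \<in> borel_measurable lebesgue" using assms(1) by (simp add: measurable_completion)
 thus "f \<in> borel_measurable (lebesgue_on {a..b})" by (rule measurable_restrict_space1)
qed (use assms(2) in "auto simp: integrable_on_const")

lemma integral_period_shift:
 fixes g :: "real => 'b::euclidean_space"
 assumes int: "!!a b. g integrable_on {a..b}" and per: "!!x. g (x + p) = g x" and b: "0 <= b" "b <= p"
 shows "integral {b..b + p} g = integral {0..p} g"
proof -
 have "integral {b..b + p} g = integral {b..p} g + integral {p..b + p} g"
  using Henstock_Kurzweil_Integration.integral_combine[where a=b and c=p and b="b+p" and f=g] b int by simp
 also have "integral {p..b + p} g = integral {0..b} (%x. g (x + p))"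
  using integral_shift_real_ivl[where a=p and b="b + p" and c=p and f=g] by simp
 also have "integral {0..b} (%x. g (x + p)) = integral {0..b} g" by (simp add: per)
 also have "integral {b..p} g + integral {0..b} g = integral {0..p} g"
  using Henstock_Kurzweil_Integration.integral_combine[where a=0 and c=b and b=p and f=g] b int by (simp add: add.commute)
 finally show ?thesis .
qed

text \<open>On \<open>ek k\<close> the derivatives in w and in cnj w act as multiplication by
  \<open>\<i> * pi / 4\<close> times \<open>cnj (kap k)\<close> and \<open>kap k\<close>
  respectively.\<close>

definition kap :: "int * int => complex" where "kap k = Complex (of_int (fst k)) (of_int (snd k))"

lemma kap_0 [simp]: "kap k = 0 \<longleftrightarrow> k = 0"
 by (cases k) (auto simp: kap_def complex_eq_iff zero_prod_def)

lemma kap_zero [simp]: "kap 0 = 0" by simp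

definition in_half_plane :: "real => int * int => bool" where
 "in_half_plane u k \<longleftrightarrow> 0 <= cos u * of_int (fst k) + sin u * of_int (snd k)"

text \<open>Averaging the half-plane multipliers over all directions gives the Riesz multiplier.\<close>

lemma integral_half_planes:
 "integral {0..2*pi} (%u. cis (- u) * of_bool (in_half_plane u k)) = 2 * (cnj (kap k) / cmod (kap k))"
proof -
 let ?g = "%u. cis (- u) * of_bool (in_half_plane u k) :: complex"
 have meas: "?g \<in> borel_measurable borel"
  unfolding in_half_plane_def cis_conv_exp of_bool_def by measurable
 have int: "?g integrable_on {a..b}" for a b
  by (rule bounded_borel_integrable_on_interval[OF meas, where B = 1]) (auto simp: norm_mult)
 have per: "?g (x + 2 * pi) = ?g x" for x
 proof -
  have "cis (- (x + 2 * pi)) = cis (- x)"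
   unfolding complex_eq_iff cis.sel by (metis cos_minus cos_periodic sin_minus sin_periodic)
  thus ?thesis by (simp add: in_half_plane_def)
 qed
 define r where "r = cmod (kap k)"
 \<comment> \<open>Writing \<open>kap k\<close> as \<open>\<i> * r * cis s\<close> turns the
   half-plane condition into \<open>0 <= r * sin (u - s)\<close>, so for \<open>r > 0\<close> the
   directions that keep \<open>k\<close> form the half period from \<open>s\<close> to
   \<open>s + pi\<close>.\<close>
 define s where "s = Arg2pi (kap k / \<i>)"
 have s: "0 <= s" "s < 2 * pi" and kb: "kap k / \<i> = of_real (cmod (kap k / \<i>)) * exp (\<i> * of_real s)"
  unfolding s_def using Arg2pi[of "kap k / \<i>"] by (auto simp: is_Arg_def)
 have "kap k = \<i> * (kap k / \<i>)" by simp
 also have "... = \<i> * of_real r * cis s"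
  by (subst kb) (simp add: cis_conv_exp r_def norm_divide norm_mult mult.assoc)
 finally have kb: "kap k = \<i> * of_real r * cis s" .
 have ks: "of_int (fst k) = - r * sin s" "of_int (snd k) = r * cos s"
  using arg_cong[OF kb, of Re] arg_cong[OF kb, of Im] by (auto simp: kap_def)
 have H: "in_half_plane u k \<longleftrightarrow> 0 <= r * sin (u - s)" for u
  unfolding in_half_plane_def ks by (simp add: sin_diff algebra_simps)
 have half: "((%u. cis (- u)) has_integral (\<i> * cis (- (b + pi)) - \<i> * cis (- b))) {b..b + pi}" for b
 proof (rule fundamental_theorem_of_calculus)
  fix x
  show "((%u. \<i> * cis (- u)) has_vector_derivative cis (- x)) (at x within {b..b + pi})"
   unfolding has_vector_derivative_def
   by (rule has_derivative_eq_rhs, rule has_derivative_mult_right, rule has_derivative_cis, rule derivative_intros, rule has_derivative_ident)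
    (auto simp: fun_eq_iff scaleR_conv_of_real complex_eq_iff)
 qed simp
 have cpi: "cis (- (b + pi)) = - cis (- b)" for b
  by (simp add: complex_eq_iff)
 show ?thesis
 proof (cases "r = 0")
  \<comment> \<open>At \<open>kap k = 0\<close> every direction keeps \<open>k\<close>; the integral
    of \<open>cis\<close> over a full period is 0, and so is the right-hand side by the convention
    for division by 0.\<close>
  case True
  hence "kap k = 0" by (simp add: r_def)
  have "integral {0..2*pi} ?g = integral {0..2*pi} (%u. cis (- u))"
   using True by (simp add: H)
  also have "... = integral {0..pi} (%u. cis (- u)) + integral {pi..2*pi} (%u. cis (- u))"
   by (rule Henstock_Kurzweil_Integration.integral_combine[symmetric])
    (auto intro!: integrable_continuous_real continuous_intros simp: cis_conv_exp)
  also have "... = 0"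
   using integral_unique[OF half[of 0]] integral_unique[OF half[of pi]] cpi[of 0] cpi[of pi] by simp
  finally show ?thesis using \<open>kap k = 0\<close> by simp
 next
  case False
  hence r: "r > 0" by (simp add: r_def)
  have "integral {0..2*pi} ?g = integral {s..s + 2*pi} ?g"
   using integral_period_shift[of ?g "2*pi" s] int per s by simp
  also have "... = integral {s..s+pi} ?g + integral {s+pi..s+2*pi} ?g"
   by (rule Henstock_Kurzweil_Integration.integral_combine[symmetric]) (auto simp: int)
  also have "integral {s..s+pi} ?g = integral {s..s+pi} (%u. cis (- u))"
   by (rule integral_cong) (use r in "auto simp: H sin_ge_zero")
  also have "integral {s+pi..s+2*pi} ?g = integral {s+pi..s+2*pi} (%_. 0)"
  proof (rule integral_spike[of "{s+pi, s+2*pi}"])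
   fix x assume x: "x \<in> {s+pi..s+2*pi} - {s+pi, s+2*pi}"
   hence "sin (x - s) < 0" using sin_lt_zero[of "x - s"] by auto
   thus "0 = ?g x" using r by (simp add: H mult_less_0_iff not_le)
  qed simp
  finally show ?thesis
   using integral_unique[OF half[of s]] cpi[of s] r unfolding kb
   by (simp add: norm_mult cis_cnj)
 qed
qed

text \<open>Cauchy-Schwarz with weights, applied twice. It moves the fourth power inside the average
  of half-plane projections.\<close>

lemma weighted_power4_le:
 fixes w a :: "'i => real"
 assumes w: "!!i. i \<in> I ==> 0 <= w i"
 shows "(SUM i:I. w i * a i) ^ 4 <= (SUM i:I. w i) ^ 3 * (SUM i:I. w i * a i ^ 4)"
proof -
 have CS: "(SUM i:I. w i * b i)^2 <= (SUM i:I. w i) * (SUM i:I. w i * (b i)^2)" for b :: "'i => real"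
 proof -
  have "(SUM i:I. sqrt (w i) * (sqrt (w i) * b i))^2 <= (SUM i:I. (sqrt (w i))^2) * (SUM i:I. (sqrt (w i) * b i)^2)"
   by (rule Cauchy_Schwarz_ineq_sum)
  moreover have "(SUM i:I. sqrt (w i) * (sqrt (w i) * b i)) = (SUM i:I. w i * b i)"
   using w by (intro sum.cong) (auto simp: mult.assoc[symmetric])
  moreover have "(SUM i:I. (sqrt (w i))^2) = (SUM i:I. w i)"
   using w by (intro sum.cong) auto
  moreover have "(SUM i:I. (sqrt (w i) * b i)^2) = (SUM i:I. w i * (b i)^2)"
   using w by (intro sum.cong) (auto simp: power_mult_distrib)
  ultimately show ?thesis by simp
 qed
 let ?W = "SUM i:I. w i"
 have W: "0 <= ?W" using w by (rule sum_nonneg)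
 have "(SUM i:I. w i * a i) ^ 4 = ((SUM i:I. w i * a i)^2)^2" by simp
 also have "... <= (?W * (SUM i:I. w i * (a i)^2))^2"
  by (intro power_mono CS) simp
 also have "... = ?W^2 * (SUM i:I. w i * (a i)^2)^2" by (simp add: power_mult_distrib)
 also have "... <= ?W^2 * (?W * (SUM i:I. w i * ((a i)^2)^2))"
  by (intro mult_left_mono CS) simp
 also have "... = ?W ^ 3 * (SUM i:I. w i * a i ^ 4)"
  by (simp add: power2_eq_square power3_eq_cube power4_eq_xxxx mult.assoc)
 finally show ?thesis .
qed

text \<open>Only finitely many frequencies matter, so the directions \<open>u\<close> are grouped by
  the set \<open>Ht u\<close> of frequencies they keep. The average over directions becomes a finite
  combination of projections with complex weights \<open>W H\<close> of total mass at most
  \<open>pi\<close>, which gives \<open>pi ^ 3\<close> from \<open>weighted_power4_le\<close> and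
  one more \<open>pi\<close> from the sum of the projection bounds.\<close>

lemma Riesz_multiplier_L4:
 "integral QQ (%y. (cmod (tp N (%k. cnj (kap k) / cmod (kap k) * c k) y)) ^ 4) <=
   300 * pi ^ 4 * integral QQ (%y. (cmod (tp N c y)) ^ 4)"
proof -
 define Ht where "Ht u = {k \<in> BX N. in_half_plane u k}" for u
 define W where "W H = integral {0..2*pi} (%u. cis (- u) * of_bool (Ht u = H)) / 2" for H
 define v where "v H = tp N (%k. if k \<in> H then c k else 0)" for H
 define J where "J = integral QQ (%y. (cmod (tp N c y)) ^ 4)"
 have J0: "0 <= J" unfolding J_def by (intro integral_nonneg integrable_QQ continuous_intros) auto
 have meas: "(%u. of_bool (Ht u = H) :: 'z::{zero_neq_one,second_countable_topology}) \<in> borel_measurable borel"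
  if "H \<subseteq> BX N" for H
 proof -
  have eq: "Ht u = H \<longleftrightarrow> (ALL k:BX N. in_half_plane u k \<longleftrightarrow> k \<in> H)" for u
   using that unfolding Ht_def by blast
  have "Measurable.pred borel (%u. ALL k:BX N. in_half_plane u k \<longleftrightarrow> k \<in> H)"
   unfolding in_half_plane_def by measurable
  thus ?thesis unfolding eq of_bool_def by measurable
 qed
 have cis_meas: "(%u::real. cis (- u)) \<in> borel_measurable borel"
  by (intro borel_measurable_continuous_onI) (auto intro!: continuous_intros simp: cis_conv_exp)
 have int1: "(%u. cis (- u) * of_bool (Ht u = H)) integrable_on {0..2*pi}" if "H \<subseteq> BX N" for H
  by (rule bounded_borel_integrable_on_interval[where B = 1])
   (use borel_measurable_times[OF cis_meas meas[OF that]] in "auto simp: norm_mult")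
 have int2: "(%u. of_bool (Ht u = H) :: real) integrable_on {0..2*pi}" if "H \<subseteq> BX N" for H
  by (rule bounded_borel_integrable_on_interval[where B = 1]) (use meas[OF that] in auto)
 have mult: "(SUM H:Pow (BX N). W H * of_bool (k \<in> H)) = cnj (kap k) / cmod (kap k)" if k: "k \<in> BX N" for k
 proof -
  have "(SUM H:Pow (BX N). W H * of_bool (k \<in> H)) =
   (SUM H:Pow (BX N). integral {0..2*pi} (%u. of_bool (k \<in> H) * (cis (- u) * of_bool (Ht u = H)))) / 2"
   unfolding W_def sum_divide_distrib by (intro sum.cong refl) auto
  also have "(SUM H:Pow (BX N). integral {0..2*pi} (%u. of_bool (k \<in> H) * (cis (- u) * of_bool (Ht u = H)))) =
   integral {0..2*pi} (%u. SUM H:Pow (BX N). of_bool (k \<in> H) * (cis (- u) * of_bool (Ht u = H)))"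
   by (rule integral_sum[symmetric]) (use int1 in auto)
  also have "(%u. SUM H:Pow (BX N). of_bool (k \<in> H) * (cis (- u) * of_bool (Ht u = H))) =
   (%u. cis (- u) * of_bool (in_half_plane u k))"
  proof
   fix u
   have "(SUM H:Pow (BX N). of_bool (k \<in> H) * (cis (- u) * of_bool (Ht u = H))) =
    (SUM H:Pow (BX N). if Ht u = H then of_bool (k \<in> Ht u) * cis (- u) else 0)"
    by (intro sum.cong) auto
   also have "... = of_bool (k \<in> Ht u) * cis (- u)"
    by (subst sum.delta') (auto simp: Ht_def)
   finally show "(SUM H:Pow (BX N). of_bool (k \<in> H) * (cis (- u) * of_bool (Ht u = H))) = cis (- u) * of_bool (in_half_plane u k)"
    using k by (simp add: Ht_def)
  qed
  finally show ?thesis unfolding integral_half_planes by simp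
 qed
 \<comment> \<open>The bound is half the length of the interval of directions.\<close>
 have total: "(SUM H:Pow (BX N). cmod (W H)) <= pi"
 proof -
  have "(SUM H:Pow (BX N). cmod (W H)) <= (SUM H:Pow (BX N). integral {0..2*pi} (%u. of_bool (Ht u = H)) / 2)"
  proof (intro sum_mono)
   fix H assume "H \<in> Pow (BX N)"
   hence "cmod (integral {0..2*pi} (%u. cis (- u) * of_bool (Ht u = H))) <= integral {0..2*pi} (%u. of_bool (Ht u = H))"
    by (intro integral_norm_bound_integral int1 int2) (auto simp: norm_mult)
   thus "cmod (W H) <= integral {0..2*pi} (%u. of_bool (Ht u = H)) / 2"
    unfolding W_def by (simp add: norm_divide)
  qed
  also have "... = integral {0..2*pi} (%u. SUM H:Pow (BX N). of_bool (Ht u = H)) / 2"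
   unfolding sum_divide_distrib[symmetric] by (subst integral_sum) (use int2 in auto)
  also have "(%u. SUM H:Pow (BX N). of_bool (Ht u = H) :: real) = (%_. 1)"
  proof
   fix u
   have "(SUM H:Pow (BX N). of_bool (Ht u = H) :: real) = (SUM H:Pow (BX N). if Ht u = H then 1 else 0)"
    by (intro sum.cong) auto
   also have "... = 1" by (subst sum.delta') (auto simp: Ht_def)
   finally show "(SUM H:Pow (BX N). of_bool (Ht u = H) :: real) = 1" .
  qed
  finally show ?thesis by simp
 qed
 have rep: "tp N (%k. cnj (kap k) / cmod (kap k) * c k) y = (SUM H:Pow (BX N). W H * v H y)" for y
 proof -
  have "(SUM H:Pow (BX N). W H * v H y) = (SUM H:Pow (BX N). SUM k:BX N. (W H * of_bool (k \<in> H)) * (c k * ek k y))"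
   unfolding v_def tp_def sum_distrib_left by (intro sum.cong) auto
  also have "... = (SUM k:BX N. (SUM H:Pow (BX N). W H * of_bool (k \<in> H)) * (c k * ek k y))"
   by (subst sum.swap) (simp only: sum_distrib_right)
  also have "... = tp N (%k. cnj (kap k) / cmod (kap k) * c k) y"
   unfolding tp_def by (intro sum.cong refl) (simp only: mult mult.assoc)
  finally show ?thesis by simp
 qed
 \<comment> \<open>A set \<open>H\<close> that no direction produces need not be cut out by a
   half-plane, but then its weight is 0.\<close>
 have vH: "cmod (W H) * integral QQ (%y. (cmod (v H y)) ^ 4) <= cmod (W H) * (300 * J)" for H
 proof (cases "EX u. H = Ht u")
  case True
  then obtain u where H: "H = Ht u" ..
  have "v H = tp N (%k. if in_half_plane u k then c k else 0)"
   unfolding v_def tp_def fun_eq_iff H Ht_def by (intro allI sum.cong) auto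
  hence "integral QQ (%y. (cmod (v H y)) ^ 4) <= 300 * J"
   unfolding J_def using halfplane_projection_L4[of "in_half_plane u" 0 "cos u" "sin u" N c]
   by (simp add: in_half_plane_def)
  thus ?thesis by (intro mult_left_mono) auto
 next
  case False
  have "Ht u ~= H" for u using False by blast
  hence "W H = 0" unfolding W_def by simp
  thus ?thesis by simp
 qed
 have contv: "continuous_on S (v H)" for S H unfolding v_def by (intro continuous_tp continuous_on_id)
 have "integral QQ (%y. (cmod (tp N (%k. cnj (kap k) / cmod (kap k) * c k) y)) ^ 4) <=
  integral QQ (%y. pi ^ 3 * (SUM H:Pow (BX N). cmod (W H) * (cmod (v H y)) ^ 4))"
 proof (intro integral_le integrable_QQ continuous_intros contv)
  fix y
  have "cmod (SUM H:Pow (BX N). W H * v H y) <= (SUM H:Pow (BX N). cmod (W H) * cmod (v H y))"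
   by (rule order_trans[OF norm_sum]) (simp add: norm_mult)
  hence "(cmod (SUM H:Pow (BX N). W H * v H y)) ^ 4 <= (SUM H:Pow (BX N). cmod (W H) * cmod (v H y)) ^ 4"
   by (intro power_mono) auto
  also have "... <= (SUM H:Pow (BX N). cmod (W H)) ^ 3 * (SUM H:Pow (BX N). cmod (W H) * (cmod (v H y)) ^ 4)"
   by (rule weighted_power4_le) simp
  also have "... <= pi ^ 3 * (SUM H:Pow (BX N). cmod (W H) * (cmod (v H y)) ^ 4)"
   by (intro mult_right_mono power_mono total sum_nonneg) auto
  finally show "(cmod (tp N (%k. cnj (kap k) / cmod (kap k) * c k) y)) ^ 4 <=
    pi ^ 3 * (SUM H:Pow (BX N). cmod (W H) * (cmod (v H y)) ^ 4)"
   unfolding rep .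
 qed
 also have "... = pi ^ 3 * (SUM H:Pow (BX N). cmod (W H) * integral QQ (%y. (cmod (v H y)) ^ 4))"
  by (simp, subst integral_sum) (auto intro!: integrable_QQ continuous_intros contv)
 also have "... <= pi ^ 3 * (SUM H:Pow (BX N). cmod (W H) * (300 * J))"
  by (intro mult_left_mono sum_mono vH) auto
 also have "... = pi ^ 3 * ((SUM H:Pow (BX N). cmod (W H)) * (300 * J))"
  by (simp add: sum_distrib_right)
 also have "... <= pi ^ 3 * (pi * (300 * J))"
  using J0 by (intro mult_left_mono mult_right_mono total) auto
 also have "... = 300 * pi ^ 4 * J" by (simp add: power4_eq_xxxx power3_eq_cube)
 finally show ?thesis unfolding J_def .
qed

text \<open>The symbol \<open>cnj (kap k) / kap k\<close> is the square of the Riesz symbol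
  \<open>cnj (kap k) / cmod (kap k)\<close>, so the Riesz bound is used twice.\<close>

lemma Beurling_multiplier_L4:
 "integral QQ (%y. (cmod (tp N (%k. cnj (kap k) / kap k * c k) y)) ^ 4) <=
   (300 * pi ^ 4)^2 * integral QQ (%y. (cmod (tp N c y)) ^ 4)"
proof -
 let ?r = "%k. cnj (kap k) / cmod (kap k)"
 have m: "cnj (kap k) / kap k = ?r k * ?r k" for k
  by (cases "kap k = 0")
   (auto simp: field_simps complex_norm_square[symmetric] power2_eq_square)
 have "integral QQ (%y. (cmod (tp N (%k. ?r k * (?r k * c k)) y)) ^ 4) <=
  300 * pi ^ 4 * (300 * pi ^ 4 * integral QQ (%y. (cmod (tp N c y)) ^ 4))"
  by (rule order_trans[OF Riesz_multiplier_L4] mult_left_mono Riesz_multiplier_L4)+ simp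
 thus ?thesis unfolding m by (simp add: power2_eq_square mult_ac)
qed

text \<open>A box of frequencies is the intersection of four half-planes, each costing a factor
  300.\<close>

lemma truncation_L4:
 assumes "N <= M"
 shows "integral QQ (%y. (cmod (tp N c y)) ^ 4) <= 300 ^ 4 * integral QQ (%y. (cmod (tp M c y)) ^ 4)"
proof -
 let ?P1 = "%k::int\<times>int. - int N <= fst k" and ?P2 = "%k::int\<times>int. fst k <= int N"
 let ?P3 = "%k::int\<times>int. - int N <= snd k" and ?P4 = "%k::int\<times>int. snd k <= int N"
 define c1 where "c1 k = (if ?P1 k then c k else 0)" for k
 define c2 where "c2 k = (if ?P2 k then c1 k else 0)" for k
 define c3 where "c3 k = (if ?P3 k then c2 k else 0)" for k
 define c4 where "c4 k = (if ?P4 k then c3 k else 0)" for k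
 let ?I = "%c. integral QQ (%y. (cmod (tp M c y)) ^ 4)"
 have "?I c1 <= 300 * ?I c" unfolding c1_def
  by (rule halfplane_projection_L4[where t = "- real N" and p = 1 and q = 0]) (simp, linarith)
 moreover have "?I c2 <= 300 * ?I c1" unfolding c2_def
  by (rule halfplane_projection_L4[where t = "- real N" and p = "-1" and q = 0]) (simp, linarith)
 moreover have "?I c3 <= 300 * ?I c2" unfolding c3_def
  by (rule halfplane_projection_L4[where t = "- real N" and p = 0 and q = 1]) (simp, linarith)
 moreover have "?I c4 <= 300 * ?I c3" unfolding c4_def
  by (rule halfplane_projection_L4[where t = "- real N" and p = 0 and q = "-1"]) (simp, linarith)
 moreover have "tp M c4 = tp N c"
 proof
  fix y
  have "tp M c4 y = (SUM k:BX M. if k \<in> BX N then c k * ek k y else 0)"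
   unfolding tp_def c4_def c3_def c2_def c1_def by (intro sum.cong refl) (auto simp: BX_def)
  also have "... = tp N c y"
   unfolding tp_def using assms by (subst sum.inter_restrict[symmetric]) (auto simp: BX_def intro!: sum.cong)
  finally show "tp M c4 y = tp N c y" .
 qed
 ultimately show ?thesis by simp
qed

section \<open>Fourier coefficients\<close>

definition fc :: "(complex => complex) => int * int => complex" where
 "fc h k = integral QQ (%v. h v * ek (- k) v) / 16"

lemma fc_tp: "fc (tp M c) k = (if k \<in> BX M then c k else 0)"
proof -
 have "tp M c v * ek (- k) v = (SUM l:BX M. c l * ek (l - k) v)" for v
  unfolding tp_def sum_distrib_right
  by (intro sum.cong refl) (simp add: diff_conv_add_uminus ek_add del: add_uminus_conv_diff)
 hence "fc (tp M c) k = (SUM l:BX M. if l - k = 0 then c l else 0)"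
  unfolding fc_def by (simp only: integral_ek_sum finite_BX) simp
 also have "... = (if k \<in> BX M then c k else 0)"
  by (subst eq_iff_diff_eq_0[symmetric]) simp
 finally show ?thesis .
qed

lemma norm_integral_QQ_le:
 fixes f :: "complex => 'b::euclidean_space"
 assumes "continuous_on QQ f" "!!x. x \<in> QQ ==> norm (f x) <= B"
 shows "norm (integral QQ f) <= 16 * B"
proof -
 have "norm (integral QQ f) <= integral QQ (%_::complex. B)"
  by (rule integral_norm_bound_integral) (use assms in auto)
 also have "... = 16 * B" using content_QQ by (simp add: QQ_def)
 finally show ?thesis .
qed

lemma fc_diff:
 assumes "continuous_on QQ f" "continuous_on QQ g"
 shows "fc (%v. f v - g v) k = fc f k - fc g k"
 unfolding fc_def left_diff_distrib
 by (subst integral_diff) (auto intro!: integrable_QQ continuous_intros assms simp: diff_divide_distrib)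

lemma fc_add:
 assumes "continuous_on QQ f" "continuous_on QQ g"
 shows "fc (%v. f v + g v) k = fc f k + fc g k"
 unfolding fc_def distrib_right
 by (subst integral_add) (auto intro!: integrable_QQ continuous_intros assms simp: add_divide_distrib)

lemma norm_fc_le:
 assumes "continuous_on QQ f" "!!x. x \<in> QQ ==> cmod (f x) <= B"
 shows "cmod (fc f k) <= B"
 unfolding fc_def norm_divide
 using norm_integral_QQ_le[of "%v. f v * ek (- k) v" B] assms
 by (simp add: norm_mult continuous_intros)

lemma integral_QQ_Re:
 assumes "continuous_on QQ f"
 shows "integral QQ (%v. Re (f v)) = Re (integral QQ f)"
 using integral_linear[OF integrable_QQ[OF assms] bounded_linear_Re] by (simp add: o_def)

text \<open>Completing the square separates the error of the best approximation from the distance of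
  \<open>c\<close> to the Fourier coefficients. Hence truncated Fourier series minimise the L^2
  error, and the coefficient map is an L^2 contraction.\<close>

lemma integral_diff_tp:
 assumes h: "continuous_on QQ h"
 shows "integral QQ (%v. (cmod (h v - tp N c v))^2) =
  integral QQ (%v. (cmod (h v))^2) - 16 * (SUM k:BX N. (cmod (fc h k))^2) + 16 * (SUM k:BX N. (cmod (fc h k - c k))^2)"
proof -
 have e: "(cmod (x - y))^2 = (cmod x)^2 - 2 * Re (x * cnj y) + (cmod y)^2" for x y
  unfolding cmod_power2 by (simp add: power2_eq_square algebra_simps)
 have "integral QQ (%v. (cmod (h v - tp N c v))^2) =
  integral QQ (%v. (cmod (h v))^2) - 2 * integral QQ (%v. Re (h v * cnj (tp N c v))) + integral QQ (%v. (cmod (tp N c v))^2)"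
  unfolding e by (simp add: integral_add integral_diff integrable_QQ h continuous_intros)
 also have "integral QQ (%v. Re (h v * cnj (tp N c v))) = Re (integral QQ (%v. h v * cnj (tp N c v)))"
  by (intro integral_QQ_Re continuous_intros h)
 also have "integral QQ (%v. h v * cnj (tp N c v)) = integral QQ (%v. SUM k:BX N. cnj (c k) * (h v * ek (- k) v))"
  unfolding tp_def cnj_sum sum_distrib_left by (intro integral_cong sum.cong) (auto simp: ek_cnj)
 also have "... = (SUM k:BX N. cnj (c k) * (16 * fc h k))"
  unfolding fc_def by (subst integral_sum) (auto intro!: integrable_QQ continuous_intros h)
 also have "integral QQ (%v. (cmod (tp N c v))^2) = 16 * (SUM k:BX N. (cmod (c k))^2)"
  by (rule Parseval_tp)
 moreover have "- 2 * Re (SUM k:BX N. cnj (c k) * (16 * fc h k)) + 16 * (SUM k:BX N. (cmod (c k))^2) =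
   - 16 * (SUM k:BX N. (cmod (fc h k))^2) + 16 * (SUM k:BX N. (cmod (fc h k - c k))^2)"
  unfolding e Re_sum sum_distrib_left sum.distrib[symmetric]
  by (intro sum.cong) (auto simp: algebra_simps)
 ultimately show ?thesis by linarith
qed

lemma fc_projection_le:
 assumes h: "continuous_on QQ h"
 shows "16 * (SUM k:BX N. (cmod (fc h k - c k))^2) <= integral QQ (%v. (cmod (h v - tp N c v))^2)"
proof -
 have "0 <= integral QQ (%v. (cmod (h v - tp N (fc h) v))^2)"
  by (intro integral_nonneg integrable_QQ continuous_intros h) auto
 thus ?thesis unfolding integral_diff_tp[OF h] by simp
qed

lemma tp_0 [simp]: "tp N (%_. 0) v = 0" by (simp add: tp_def)

section \<open>Density of trigonometric polynomials\<close>

definition trig_poly :: "(complex => complex) => bool" where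
 "trig_poly t \<longleftrightarrow> (EX M c. ALL v. t v = tp M c v)"

text \<open>Frequencies may repeat among the indices; equal ones are collected here once, so that
  sums and products need no normal form.\<close>

lemma trig_poly_sum:
 assumes "finite I" "!!v. t v = (SUM i:I. a i * ek (ka i) v)"
 shows "trig_poly t"
proof -
 define M where "M = Max (insert 0 ((%i. nat \<bar>fst (ka i)\<bar> + nat \<bar>snd (ka i)\<bar>) ` I))"
 have M: "nat \<bar>fst (ka i)\<bar> + nat \<bar>snd (ka i)\<bar> <= M" if "i \<in> I" for i
  unfolding M_def using assms(1) that by (intro Max_ge) auto
 have sub: "ka ` I \<subseteq> BX M"
 proof
  fix k assume "k \<in> ka ` I"
  then obtain i where "i \<in> I" "k = ka i" by auto
  with M[of i] show "k \<in> BX M" by (cases "ka i") (auto simp: BX_def)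
 qed
 have "t v = tp M (%k. SUM i:{i \<in> I. ka i = k}. a i) v" for v
 proof -
  have "t v = (SUM k:BX M. SUM i:{i \<in> I. ka i = k}. a i * ek (ka i) v)"
   unfolding assms(2) by (rule sum.group[symmetric]) (use assms(1) sub in auto)
  also have "... = tp M (%k. SUM i:{i \<in> I. ka i = k}. a i) v"
   unfolding tp_def sum_distrib_right by (intro sum.cong) auto
  finally show ?thesis .
 qed
 thus ?thesis unfolding trig_poly_def by blast
qed

lemma trig_poly_ek: "trig_poly (%v. a * ek k v)"
 by (rule trig_poly_sum[of "{()}" _ "%_. a" "%_. k"]) auto

lemma trig_poly_const: "trig_poly (%v. a)"
 using trig_poly_ek[of a 0] by simp

lemma trig_poly_add:
 assumes "trig_poly f" "trig_poly g" shows "trig_poly (%v. f v + g v)"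
proof -
 obtain M c M' c' where f: "!!v. f v = tp M c v" and g: "!!v. g v = tp M' c' v"
  using assms unfolding trig_poly_def by blast
 show ?thesis
  by (rule trig_poly_sum[of "BX M <+> BX M'" _ "case_sum c c'" "case_sum id id"])
   (auto simp: f g tp_def sum.Plus)
qed

lemma trig_poly_mult:
 assumes "trig_poly f" "trig_poly g" shows "trig_poly (%v. f v * g v)"
proof -
 obtain M c M' c' where f: "!!v. f v = tp M c v" and g: "!!v. g v = tp M' c' v"
  using assms unfolding trig_poly_def by blast
 show ?thesis
 proof (rule trig_poly_sum[of "BX M \<times> BX M'" _ "%i. c (fst i) * c' (snd i)" "%i. fst i + snd i"])
  fix v
  show "f v * g v = (SUM i:BX M \<times> BX M'. c (fst i) * c' (snd i) * ek (fst i + snd i) v)"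
   unfolding f g tp_def sum_product sum.cartesian_product
   by (intro sum.cong) (auto simp: ek_add)
 qed simp
qed

text \<open>A continuous map from a compact space to a Hausdorff space is closed, hence a quotient
  map onto its image.\<close>

lemma continuous_on_factor:
 fixes E :: "'a::t2_space => 'b::t2_space" and g :: "'b => 'c::topological_space"
 assumes "compact K" "continuous_on K E" "continuous_on K (%x. g (E x))"
 shows "continuous_on (E ` K) g"
 unfolding continuous_on_closed_vimage[OF compact_imp_closed[OF compact_continuous_image[OF assms(2,1)]]]
proof (intro allI impI)
 fix B :: "'c set" assume "closed B"
 have "closed ((%x. g (E x)) -` B \<inter> K)"
  using assms(3) \<open>closed B\<close> continuous_on_closed_vimage[OF compact_imp_closed[OF assms(1)]] by blast
 hence "compact ((%x. g (E x)) -` B \<inter> K)"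
  using assms(1) by (metis Int_commute compact_Int_closed inf.left_idem)
 hence "compact (E ` ((%x. g (E x)) -` B \<inter> K))"
  using assms(2) continuous_on_subset by (blast intro: compact_continuous_image)
 moreover have "E ` ((%x. g (E x)) -` B \<inter> K) = g -` B \<inter> E ` K" by auto
 ultimately show "closed (g -` B \<inter> E ` K)" by (simp add: compact_imp_closed)
qed

definition biperiodic :: "(complex => 'b) => bool" where
 "biperiodic h \<longleftrightarrow> (ALL v. h (v + 4) = h v & h (v + 4 * \<i>) = h v)"

lemma biperiodicD:
 assumes "biperiodic h"
 shows "h (v + 4) = h v" "h (v + 4 * \<i>) = h v" "h (v - 4) = h v" "h (v - 4 * \<i>) = h v"
 using assms unfolding biperiodic_def by (metis diff_add_cancel)+

lemma biperiodic_int: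
 assumes "biperiodic h"
 shows "h (v + 4 * of_int m + 4 * of_int n * \<i>) = h v"
proof -
 have 1: "h (v + 4 * of_int m) = h v" for v m
 proof (induction m rule: int_induct[where k = 0])
  case (step1 i)
  have "h (v + 4 * of_int (i + 1)) = h (v + 4 * of_int i + 4)" by (simp add: algebra_simps)
  thus ?case using biperiodicD[OF assms] step1 by simp
 next
  case (step2 i)
  have "h (v + 4 * of_int (i - 1)) = h (v + 4 * of_int i - 4)" by (simp add: algebra_simps)
  thus ?case using biperiodicD[OF assms] step2 by simp
 qed simp_all
 have 2: "h (v + 4 * of_int n * \<i>) = h v" for v n
 proof (induction n rule: int_induct[where k = 0])
  case (step1 i)
  have "h (v + 4 * of_int (i + 1) * \<i>) = h (v + 4 * of_int i * \<i> + 4 * \<i>)" by (simp add: algebra_simps)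
  thus ?case using biperiodicD[OF assms] step1 by simp
 next
  case (step2 i)
  have "h (v + 4 * of_int (i - 1) * \<i>) = h (v + 4 * of_int i * \<i> - 4 * \<i>)" by (simp add: algebra_simps)
  thus ?case using biperiodicD[OF assms] step2 by simp
 qed simp_all
 show ?thesis by (simp add: 1 2)
qed

lemma cis_eq_period: "cis (pi / 2 * x) = cis (pi / 2 * y) \<longleftrightarrow> (\<exists>n::int. x = y + 4 * of_int n)"
proof -
 have "cis (pi / 2 * x) = cis (pi / 2 * y) \<longleftrightarrow> (\<exists>n::int. pi / 2 * x = pi / 2 * y + 2 * pi * n)"
  unfolding cis_conv_exp exp_eq by (auto simp: complex_eq_iff)
 also have "... \<longleftrightarrow> (\<exists>n::int. x = y + 4 * of_int n)"
 proof (intro ex_cong1)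
  fix n :: int
  have "pi / 2 * x = pi / 2 * y + 2 * pi * n \<longleftrightarrow> pi / 2 * x = pi / 2 * (y + 4 * n)"
   by (simp add: algebra_simps)
  thus "pi / 2 * x = pi / 2 * y + 2 * pi * n \<longleftrightarrow> x = y + 4 * of_int n" by simp
 qed
 finally show ?thesis .
qed

text \<open>Real and imaginary parts of \<open>ek (1,0)\<close> and \<open>ek (0,1)\<close> are
  combinations of these characters and their conjugates, which are again characters.\<close>

lemma trig_poly_real_polynomial:
 fixes p :: "complex \<times> complex => real"
 assumes "real_polynomial_function p"
 shows "trig_poly (%v. of_real (p (ek (1,0) v, ek (0,1) v)))"
 using assms
proof (induction rule: real_polynomial_function.induct)
 case (linear f)
 have conj: "cnj (ek k v) = ek (-k) v" for k v by (rule ek_cnj)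
 have *: "f (z, w) = Re z * f (1, 0) + Im z * f (\<i>, 0) + Re w * f (0, 1) + Im w * f (0, \<i>)" for z w
 proof -
  interpret bounded_linear f by (rule linear)
  have "(z, w) = Re z *\<^sub>R (1, 0) + Im z *\<^sub>R (\<i>, 0) + Re w *\<^sub>R (0, 1) + Im w *\<^sub>R (0, \<i>)"
   by (auto simp: complex_eq_iff)
  thus ?thesis by (simp only: add scaleR real_scaleR_def)
 qed
 have re: "of_real (Re z) = (z + cnj z) / 2" and im: "of_real (Im z) = (z - cnj z) / (2 * \<i>)" for z
  by (auto simp: complex_eq_iff)
 have "of_real (f (ek (1,0) v, ek (0,1) v)) =
   (f (1,0) / 2 + f (\<i>,0) / (2 * \<i>)) * ek (1,0) v + (f (1,0) / 2 - f (\<i>,0) / (2 * \<i>)) * ek (-1,0) v +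
   (f (0,1) / 2 + f (0,\<i>) / (2 * \<i>)) * ek (0,1) v + (f (0,1) / 2 - f (0,\<i>) / (2 * \<i>)) * ek (0,-1) v" for v
  unfolding *[of "ek (1,0) v" "ek (0,1) v"] of_real_add of_real_mult re im conj by (simp add: field_simps)
 thus ?case by (simp only:) (intro trig_poly_add trig_poly_ek)
qed (auto intro: trig_poly_const trig_poly_add trig_poly_mult)

text \<open>The pair of basic characters \<open>E\<close> embeds the torus in C^2. A biperiodic
  function descends to the compact image, where Stone-Weierstrass supplies a polynomial in the
  characters.\<close>

lemma trig_poly_dense:
 assumes "continuous_on UNIV h" "biperiodic h" "0 < e"
 obtains M c where "!!v. v \<in> QQ ==> cmod (h v - tp M c v) < e"
proof -
 define E where "E v = (ek (1,0) v, ek (0,1) v)" for v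
 have contE: "continuous_on S E" for S unfolding E_def by (intro continuous_intros)
 define g where "g y = h (inv_into QQ E y)" for y
 have gE: "g (E v) = h v" if "v \<in> QQ" for v
 proof -
  define q where "q = inv_into QQ E (E v)"
  have "E q = E v" unfolding q_def by (rule f_inv_into_f) (use that in auto)
  then obtain m n :: int where "Re q = Re v + 4 * of_int m" "Im q = Im v + 4 * of_int n"
   unfolding E_def ek_def by (auto simp: cis_eq_period[simplified])
  hence "q = v + 4 * of_int m + 4 * of_int n * \<i>" by (simp add: complex_eq_iff)
  thus ?thesis using biperiodic_int[OF assms(2)] unfolding g_def q_def[symmetric] by simp
 qed
 have "continuous_on QQ (%x. g (E x))"
  using continuous_on_subset[OF assms(1), of QQ] gE by (simp cong: continuous_on_cong)
 hence contg: "continuous_on (E ` QQ) g"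
  by (intro continuous_on_factor contE) auto
 have "compact (E ` QQ)" by (intro compact_continuous_image contE) simp
 then obtain p where p: "polynomial_function p" "!!y. y \<in> E ` QQ ==> norm (g y - p y) < e"
  using Stone_Weierstrass_polynomial_function[OF _ contg assms(3)] by blast
 have "real_polynomial_function (Re \<circ> p)" "real_polynomial_function (Im \<circ> p)"
  using p(1) bounded_linear_Re bounded_linear_Im unfolding polynomial_function_def by blast+
 from this[THEN trig_poly_real_polynomial]
 have "trig_poly (%v. of_real ((Re \<circ> p) (E v)) + \<i> * of_real ((Im \<circ> p) (E v)))"
  unfolding E_def by (intro trig_poly_add trig_poly_mult trig_poly_const)
 moreover have "(%v. of_real ((Re \<circ> p) (E v)) + \<i> * of_real ((Im \<circ> p) (E v))) = (%v. p (E v))"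
  by (auto simp: complex_eq_iff)
 ultimately have "trig_poly (%v. p (E v))" by simp
 then obtain M c where "!!v. p (E v) = tp M c v" unfolding trig_poly_def by blast
 thus ?thesis using p(2) gE that by (metis imageI)
qed

lemma integral_power4_LIMSEQ:
 assumes u: "uniform_limit QQ f g sequentially"
  and f: "!!n. continuous_on QQ (f n)" and g: "continuous_on QQ g"
 shows "(%n. integral QQ (%v. (cmod (f n v)) ^ 4)) \<longlonglongrightarrow> integral QQ (%v. (cmod (g v)) ^ 4)"
proof -
 have "uniform_limit QQ (%n v. (cmod (f n v)) ^ 4) (%v. (cmod (g v)) ^ 4) sequentially"
 proof -
  have b: "bounded ((%v. cmod (g v)) ` QQ)"
   by (intro compact_imp_bounded compact_continuous_image continuous_intros g) simp
  have b2: "bounded ((%v. cmod (g v) * cmod (g v)) ` QQ)"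
   by (intro compact_imp_bounded compact_continuous_image continuous_intros g) simp
  have 1: "uniform_limit QQ (%n v. cmod (f n v)) (%v. cmod (g v)) sequentially"
   by (rule uniform_limit_norm[OF u])
  have 2: "uniform_limit QQ (%n v. cmod (f n v) * cmod (f n v)) (%v. cmod (g v) * cmod (g v)) sequentially"
   by (rule bounded_bilinear.bounded_uniform_limit[OF bounded_bilinear_mult 1 1 b b])
  show ?thesis
   using bounded_bilinear.bounded_uniform_limit[OF bounded_bilinear_mult 2 2 b2 b2]
   by (simp add: power4_eq_xxxx mult.assoc)
 qed
 then obtain I J where "!!n. ((%v. (cmod (f n v)) ^ 4) has_integral I n) QQ"
   "((%v. (cmod (g v)) ^ 4) has_integral J) QQ" "I \<longlonglongrightarrow> J"
  unfolding QQ_def by (rule uniform_limit_integral_cbox) (use f in "auto simp: QQ_def intro!: continuous_intros")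
 hence "(%n. integral QQ (%v. (cmod (f n v)) ^ 4)) = I" "integral QQ (%v. (cmod (g v)) ^ 4) = J"
  by (auto simp: fun_eq_iff integral_unique)
 with \<open>I \<longlonglongrightarrow> J\<close> show ?thesis by simp
qed

lemma uniform_limit_tp:
 assumes "!!k. (%n. d n k) \<longlonglongrightarrow> c k"
 shows "uniform_limit S (%n. tp N (d n)) (tp N c) sequentially"
proof (rule uniform_limitI)
 fix e :: real assume "e > 0"
 have "(%n. SUM k:BX N. cmod (d n k - c k)) \<longlonglongrightarrow> (SUM k:BX N. cmod (c k - c k))"
  by (intro tendsto_intros assms)
 hence "\<forall>\<^sub>F n in sequentially. (SUM k:BX N. cmod (d n k - c k)) < e"
  using \<open>e > 0\<close> by (simp add: order_tendstoD(2))
 thus "\<forall>\<^sub>F n in sequentially. ALL x:S. dist (tp N (d n) x) (tp N c x) < e"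
 proof eventually_elim
  case (elim n)
  have "dist (tp N (d n) x) (tp N c x) <= (SUM k:BX N. cmod (d n k - c k))" for x
  proof -
   have "tp N (d n) x - tp N c x = (SUM k:BX N. (d n k - c k) * ek k x)"
    unfolding tp_def by (simp add: sum_subtractf left_diff_distrib)
   thus ?thesis unfolding dist_norm
    by (simp only:) (rule order_trans[OF norm_sum], simp add: norm_mult)
  qed
  thus ?case using elim le_less_trans by blast
 qed
qed

text \<open>Uniform approximation by trigonometric polynomials makes each Fourier coefficient
  converge, so \<open>truncation_L4\<close> passes to the limit on both sides.\<close>

lemma fc_projection_L4:
 assumes h: "continuous_on UNIV h" "biperiodic h"
 shows "integral QQ (%v. (cmod (tp N (fc h) v)) ^ 4) <= 300 ^ 4 * integral QQ (%v. (cmod (h v)) ^ 4)"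
proof -
 have ch: "continuous_on QQ h" using h(1) continuous_on_subset by blast
 have "EX M c. ALL v:QQ. cmod (h v - tp M c v) < inverse (real (Suc n))" for n
  using trig_poly_dense[OF h, of "inverse (real (Suc n))"] by (metis inverse_positive_iff_positive of_nat_0_less_iff zero_less_Suc)
 then obtain M c where Mc: "!!n v. v \<in> QQ ==> cmod (h v - tp (M n) (c n) v) < inverse (real (Suc n))"
  by metis
 define d where "d n k = (if k \<in> BX (M n) then c n k else 0)" for n k
 have td: "tp (M n) (d n) = tp (M n) (c n)" for n
  unfolding tp_def d_def fun_eq_iff by (auto intro!: sum.cong)
 have dk: "d n k = fc (tp (M n) (c n)) k" for n k unfolding d_def fc_tp by simp
 have conv: "(%n. d n k) \<longlonglongrightarrow> fc h k" for k
 proof (rule LIMSEQ_I)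
  fix r :: real assume "0 < r"
  then obtain n0 where n0: "inverse (real (Suc n0)) < r" using reals_Archimedean by blast
  show "EX no. ALL n>=no. norm (d n k - fc h k) < r"
  proof (intro exI[of _ n0] allI impI)
   fix n assume "n0 <= n"
   have "norm (fc (%v. h v - tp (M n) (c n) v) k) <= inverse (real (Suc n))"
    by (rule norm_fc_le) (use Mc[of _ n] in "auto intro!: continuous_intros ch less_imp_le")
   also have "... <= inverse (real (Suc n0))" using \<open>n0 <= n\<close> by (simp add: field_simps)
   finally show "norm (d n k - fc h k) < r"
    using n0 unfolding dk by (subst (asm) fc_diff) (auto intro!: continuous_intros ch simp: norm_minus_commute)
  qed
 qed
 have le: "integral QQ (%v. (cmod (tp N (d n) v)) ^ 4) <= 300 ^ 4 * integral QQ (%v. (cmod (tp (M n) (c n) v)) ^ 4)" for n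
 proof -
  \<comment> \<open>The approximating polynomial may have degree below \<open>N\<close>. Since
    \<open>d n\<close> vanishes outside \<open>BX (M n)\<close>, the larger box gives the same
    polynomial and \<open>truncation_L4\<close> applies.\<close>
  have "tp (max N (M n)) (d n) = tp (M n) (c n)"
  proof
   fix v
   have "tp (max N (M n)) (d n) v = (SUM k:BX (max N (M n)). if k \<in> BX (M n) then c n k * ek k v else 0)"
    unfolding tp_def d_def by (intro sum.cong) auto
   also have "... = tp (M n) (c n) v" unfolding tp_def
    by (subst sum.inter_restrict[symmetric]) (auto simp: BX_def intro!: sum.cong)
   finally show "tp (max N (M n)) (d n) v = tp (M n) (c n) v" .
  qed
  thus ?thesis using truncation_L4[of N "max N (M n)" "d n"] by simp
 qed
 have "(%n. integral QQ (%v. (cmod (tp N (d n) v)) ^ 4)) \<longlonglongrightarrow> integral QQ (%v. (cmod (tp N (fc h) v)) ^ 4)"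
 proof (rule integral_power4_LIMSEQ)
  show "uniform_limit QQ (%n. tp N (d n)) (tp N (fc h)) sequentially"
   by (rule uniform_limit_tp[OF conv])
 qed (intro continuous_intros)+
 moreover have "(%n. integral QQ (%v. (cmod (tp (M n) (c n) v)) ^ 4)) \<longlonglongrightarrow> integral QQ (%v. (cmod (h v)) ^ 4)"
 proof (rule integral_power4_LIMSEQ)
  show "uniform_limit QQ (%n. tp (M n) (c n)) h sequentially"
  proof (rule uniform_limitI)
   fix e :: real assume "e > 0"
   hence "\<forall>\<^sub>F n in sequentially. inverse (real (Suc n)) < e"
    using order_tendstoD(2)[OF LIMSEQ_inverse_real_of_nat] by blast
   thus "\<forall>\<^sub>F n in sequentially. ALL x:QQ. dist (tp (M n) (c n) x) (h x) < e"
   proof eventually_elim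
    case (elim n)
    thus ?case using Mc[of _ n] less_trans by (force simp: dist_norm norm_minus_commute)
   qed
  qed
 qed (intro continuous_intros ch)+
 ultimately show ?thesis
  using le by (intro LIMSEQ_le[OF _ tendsto_mult_left]) auto
qed

section \<open>Reflection symmetries of the triangle\<close>

lemma half_pi_period: "pi / 2 * (t + 4) = pi / 2 * t + 2 * pi"
 by (simp add: algebra_simps)

lemma ek_plus: "ek k (w + v) = ek k w * ek k v"
 by (simp add: ek_def cis_mult algebra_simps)

lemma biperiodic_ek: "biperiodic (ek k)"
proof -
 have "cis (pi / 2 * (0 + 4 * of_int a)) = cis (pi / 2 * 0)" for a :: int
  using cis_eq_period by blast
 hence "ek k 4 = 1" "ek k (4 * \<i>) = 1"
  by (auto simp: ek_def mult.commute)
 thus ?thesis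
  unfolding biperiodic_def ek_plus by simp
qed

lemma biperiodic_tp: "biperiodic (tp N c)"
 using biperiodic_ek unfolding biperiodic_def tp_def by simp

text \<open>The triangle wave of period 4 that equals the absolute value on [-2, 2]; with
  \<open>arccos (cos _)\<close> its evenness, period and continuity are immediate.\<close>

definition tri :: "real => real" where "tri t = 2 / pi * arccos (cos (pi / 2 * t))"

lemma tri_range: "0 <= tri t" "tri t <= 2"
 using arccos_lbound[of "cos (pi / 2 * t)"] arccos_ubound[of "cos (pi / 2 * t)"]
 by (auto simp: tri_def field_simps)

lemma cos_tri: "cos (pi / 2 * tri t) = cos (pi / 2 * t)"
 by (simp add: tri_def)

lemma tri_id: "0 <= t ==> t <= 2 ==> tri t = t"
 by (simp add: tri_def arccos_cos)

lemma tri_minus [simp]: "tri (- t) = tri t"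
 by (simp add: tri_def)

lemma tri_period [simp]: "tri (t + 4) = tri t"
 unfolding tri_def half_pi_period cos_periodic ..

lemma tri_eq: "\<exists>m::int. tri t = t + 4 * of_int m \<or> tri t = - t + 4 * of_int m"
proof -
 obtain n where n: "n \<in> \<int>" "pi / 2 * tri t = pi / 2 * t + 2 * n * pi \<or> pi / 2 * tri t = - (pi / 2 * t) + 2 * n * pi"
  using cos_tri[of t] unfolding cos_eq by blast
 obtain m :: int where m: "n = of_int m" using n(1) by (auto elim: Ints_cases)
 have "pi / 2 * tri t = pi / 2 * (t + 4 * m) \<or> pi / 2 * tri t = pi / 2 * (- t + 4 * m)"
  using n(2) unfolding m by (simp add: algebra_simps)
 thus ?thesis by auto
qed

lemma continuous_tri [continuous_intros]:
 assumes "continuous_on S g" shows "continuous_on S (%x. tri (g x))"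
proof -
 have "continuous_on UNIV (%t. tri t)"
  unfolding tri_def by (intro continuous_intros continuous_on_arccos) auto
 thus ?thesis by (rule continuous_on_compose2) (use assms in auto)
qed

text \<open>The right isosceles triangle with vertices 0, 2i and 2 + 2i. Its eight images under the
  symmetries of the square fill \<open>QQ\<close> up to lines.\<close>

definition TT :: "complex set" where "TT = {w. 0 < Re w & Re w < Im w & Im w < 2}"
definition TC :: "complex set" where "TC = {w. 0 <= Re w & Re w <= Im w & Im w <= 2}"

text \<open>The retraction of the plane onto the closed triangle that identifies all points of an
  orbit of the reflection group: \<open>tri\<close> folds across horizontal and vertical lines, the
  ordering by \<open>min\<close> and \<open>max\<close> across the diagonal.\<close>

definition fold_TC :: "complex => complex" where
 "fold_TC w = Complex (min (tri (Re w)) (tri (Im w))) (max (tri (Re w)) (tri (Im w)))"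

lemma TT_subset: "TT \<subseteq> TC" and TC_subset_QQ: "TC \<subseteq> QQ"
 by (auto simp: TT_def TC_def QQ_iff)

lemma fold_in_TC: "fold_TC w \<in> TC"
 using tri_range by (auto simp: fold_TC_def TC_def min_def max_def)

lemma fold_id: "w \<in> TC ==> fold_TC w = w"
 by (auto simp: fold_TC_def TC_def tri_id min_def max_def complex_eq_iff)

lemma fold_cnj [simp]: "fold_TC (cnj w) = fold_TC w" "fold_TC (- cnj w) = fold_TC w" "fold_TC (\<i> * cnj w) = fold_TC w"
 by (auto simp: fold_TC_def min.commute max.commute)

lemma biperiodic_fold: "biperiodic fold_TC"
 by (simp add: biperiodic_def fold_TC_def)

lemma continuous_fold [continuous_intros]: "continuous_on S g ==> continuous_on S (%x. fold_TC (g x))"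
 unfolding fold_TC_def Complex_eq by (intro continuous_intros continuous_on_min continuous_on_max)

text \<open>\<open>tri x\<close> differs from \<open>x\<close> or \<open>- x\<close> by a multiple
  of 4, and exchanging the coordinates is \<open>\<i> * cnj w\<close>. Hence
  \<open>fold_TC w\<close> is reached from \<open>w\<close> by the listed symmetries and
  periods.\<close>

lemma fold_invariant:
 assumes "biperiodic G" "!!w. G (cnj w) = G w" "!!w. G (- cnj w) = G w" "!!w. G (\<i> * cnj w) = G w"
 shows "G (fold_TC w) = G w"
proof -
 have X: "G (Complex (tri x) y) = G (Complex x y)" for x y
 proof -
  obtain m :: int where "tri x = x + 4 * of_int m \<or> tri x = - x + 4 * of_int m" using tri_eq by blast
  hence "Complex (tri x) y = Complex x y + 4 * of_int m + 4 * of_int 0 * \<i> \<or>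
    Complex (tri x) y = - cnj (Complex x y) + 4 * of_int m + 4 * of_int 0 * \<i>"
   by (auto simp: complex_eq_iff)
  thus ?thesis using biperiodic_int[OF assms(1), where n = 0] assms(3) by metis
 qed
 have Y: "G (Complex x (tri y)) = G (Complex x y)" for x y
 proof -
  obtain m :: int where "tri y = y + 4 * of_int m \<or> tri y = - y + 4 * of_int m" using tri_eq by blast
  hence "Complex x (tri y) = Complex x y + 4 * of_int 0 + 4 * of_int m * \<i> \<or>
    Complex x (tri y) = cnj (Complex x y) + 4 * of_int 0 + 4 * of_int m * \<i>"
   by (auto simp: complex_eq_iff)
  thus ?thesis using biperiodic_int[OF assms(1), where m = 0] assms(2) by metis
 qed
 have S: "G (Complex y x) = G (Complex x y)" for x y
 proof -
  have "\<i> * cnj (Complex x y) = Complex y x" by (simp add: complex_eq_iff)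
  thus ?thesis using assms(4)[of "Complex x y"] by simp
 qed
 have "G (fold_TC w) = G (Complex (tri (Re w)) (tri (Im w)))"
  unfolding fold_TC_def by (cases "tri (Re w) <= tri (Im w)") (auto simp: min_def max_def S)
 also have "... = G w" by (simp add: X Y)
 finally show ?thesis .
qed

text \<open>\<open>DD\<close> and \<open>EE\<close> supply the signs for the reflected right-hand
  side: both are positive on \<open>TT\<close>; \<open>DD\<close> is odd only under the reflection
  in the hypotenuse, \<open>EE\<close> only under the reflections \<open>cnj w\<close> and
  \<open>- cnj w\<close>. This is the parity wanted for the real and the imaginary part of the
  derivative of \<open>F\<close> in cnj w.\<close>

definition DD :: "complex => real" where "DD w = cos (pi / 2 * Re w) - cos (pi / 2 * Im w)"
definition EE :: "complex => real" where "EE w = sin (pi / 2 * Re w) * sin (pi / 2 * Im w)"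

lemma biperiodic_DD: "biperiodic DD" and biperiodic_EE: "biperiodic EE"
 unfolding biperiodic_def DD_def EE_def by (simp_all add: half_pi_period del: times_divide_eq_left)

lemma continuous_DD: "continuous_on UNIV DD" and continuous_EE: "continuous_on UNIV EE"
 unfolding DD_def EE_def by (intro continuous_intros)+

lemma DD_sym: "DD (cnj w) = DD w" "DD (- cnj w) = DD w" "DD (\<i> * cnj w) = - DD w"
 by (auto simp: DD_def)

lemma EE_sym: "EE (cnj w) = - EE w" "EE (- cnj w) = - EE w" "EE (\<i> * cnj w) = EE w"
 by (auto simp: EE_def)

lemma fold_notin_TT:
 assumes "DD w = 0 \<or> EE w = 0"
 shows "fold_TC w \<notin> TT"
proof -
 have s: "tri t \<in> {0, 2}" if "sin (pi / 2 * t) = 0" for t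
 proof -
  have "cos (pi / 2 * t) = 1 \<or> cos (pi / 2 * t) = -1"
   using that sin_cos_squared_add[of "pi / 2 * t"] by (simp add: power2_eq_1_iff)
  thus ?thesis by (auto simp: tri_def)
 qed
 have "tri (Re w) = tri (Im w) \<or> tri (Re w) \<in> {0, 2} \<or> tri (Im w) \<in> {0, 2}"
  using assms s by (auto simp: DD_def EE_def tri_def)
 thus ?thesis using tri_range[of "Re w"] tri_range[of "Im w"]
  by (auto simp: fold_TC_def TT_def min_def max_def split: if_splits)
qed

lemma DD_EE_pos:
 assumes "w \<in> TT"
 shows "0 < DD w" "0 < EE w"
proof -
 have "cos (pi / 2 * Im w) < cos (pi / 2 * Re w)"
  by (rule cos_monotone_0_pi) (use assms in "auto simp: TT_def")
 thus "0 < DD w" by (simp add: DD_def)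
 have "0 < sin (pi / 2 * t)" if "0 < t" "t < 2" for t
  using that by (intro sin_gt_zero) auto
 thus "0 < EE w" using assms unfolding EE_def TT_def by auto
qed

text \<open>The jump of the sign is killed where \<open>g\<close> vanishes, and elsewhere the sign
  is locally constant.\<close>

lemma continuous_sgn_mult:
 fixes d g :: "'a::topological_space => real"
 assumes "continuous_on S d" "continuous_on S g" "!!x. x \<in> S ==> d x = 0 ==> g x = 0"
 shows "continuous_on S (%x. sgn (d x) * g x)"
 unfolding continuous_on_def
proof (intro ballI)
 fix x assume x: "x \<in> S"
 have d: "(d \<longlongrightarrow> d x) (at x within S)" and g: "(g \<longlongrightarrow> g x) (at x within S)"
  using assms x by (auto simp: continuous_on_def)
 show "((%x. sgn (d x) * g x) \<longlongrightarrow> sgn (d x) * g x) (at x within S)"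
 proof (cases "d x = 0")
  case True
  hence "(g \<longlongrightarrow> 0) (at x within S)" using g assms(3)[OF x] by simp
  hence "((%x. sgn (d x) * g x) \<longlongrightarrow> 0) (at x within S)"
   by (rule Lim_null_comparison[rotated, OF tendsto_norm_zero])
    (auto simp: abs_mult abs_sgn_eq intro!: always_eventually)
  thus ?thesis using True by simp
 next
  case False
  thus ?thesis by (intro tendsto_mult tendsto_sgn d g)
 qed
qed

text \<open>The extension of \<open>h\<close> from the triangle to the plane with the symmetry of \<open>\<partial>F/\<partial>cnj w\<close>.\<close>

definition tw :: "(complex => complex) => complex => complex" where
 "tw h w = Complex (sgn (DD w) * Re (h (fold_TC w))) (sgn (EE w) * Im (h (fold_TC w)))"

definition fsym :: "complex => complex => complex => (complex => complex) => bool" where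
 "fsym a1 a2 a3 f \<longleftrightarrow> (ALL w. f (cnj w) = a1 * cnj (f w) & f (- cnj w) = a2 * cnj (f w) & f (\<i> * cnj w) = a3 * cnj (f w))"

text \<open>The Fourier side of \<open>fsym\<close>. Conjugating the value negates the frequency, so
  the reflection \<open>cnj w\<close> relates (k, l) to (-k, l) and not to (k, -l).\<close>

definition csym :: "complex => complex => complex => (int * int => complex) => bool" where
 "csym a1 a2 a3 c \<longleftrightarrow> (ALL k l. c (-k, l) = a1 * cnj (c (k, l)) & c (k, -l) = a2 * cnj (c (k, l)) & c (-l, -k) = a3 * cnj (c (k, l)))"

lemma csymD:
 assumes "csym a1 a2 a3 c"
 shows "c (-k, l) = a1 * cnj (c (k, l))" "c (k, -l) = a2 * cnj (c (k, l))" "c (-l, -k) = a3 * cnj (c (k, l))"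
 using assms unfolding csym_def by blast+

lemma fsym_tw: "fsym 1 1 (-1) (tw h)"
 unfolding fsym_def tw_def fold_cnj DD_sym EE_sym by (auto simp: complex_eq_iff)

lemma biperiodic_tw: "biperiodic (tw h)"
 using biperiodic_fold biperiodic_DD biperiodic_EE unfolding biperiodic_def tw_def by simp

lemma norm_tw_le: "cmod (tw h w) <= cmod (h (fold_TC w))"
proof -
 have "(sgn x * y)^2 <= y^2" for x y :: real by (auto simp: sgn_if)
 thus ?thesis unfolding tw_def cmod_def by (intro real_sqrt_le_mono add_mono) auto
qed

lemma tw_TT: "w \<in> TT ==> tw h w = h w"
 using DD_EE_pos[of w] fold_id[of w] TT_subset by (auto simp: tw_def)

lemma tw_add: "tw (%w. f w + g w) w = tw f w + tw g w"
 and tw_diff: "tw (%w. f w - g w) w = tw f w - tw g w"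
 by (auto simp: tw_def complex_eq_iff algebra_simps)

text \<open>Both signs can change only at points folded to the boundary, where \<open>h\<close> is
  0. The parameter \<open>x\<close> is carried along because the fixed-point map has to depend
  continuously on its unknowns.\<close>

lemma continuous_tw:
 assumes h: "continuous_on (S \<times> TC) (%(x, w). h x w)" and z: "!!x w. x \<in> S ==> w \<in> TC - TT ==> h x w = 0"
 shows "continuous_on (S \<times> U) (%(x, w). tw (h x) w)"
proof -
 have 1: "continuous_on (S \<times> U) (%p. h (fst p) (fold_TC (snd p)))"
  by (rule continuous_on_compose2[OF h, of _ "%p. (fst p, fold_TC (snd p))", simplified])
   (auto intro!: continuous_intros simp: fold_in_TC)
 have zero: "h (fst p) (fold_TC (snd p)) = 0" if "p \<in> S \<times> U" "DD (snd p) = 0 \<or> EE (snd p) = 0" for p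
  using z[of "fst p" "fold_TC (snd p)"] fold_in_TC fold_notin_TT[OF that(2)] that(1) by auto
 have d: "continuous_on (S \<times> U) (%p. DD (snd p))" "continuous_on (S \<times> U) (%p. EE (snd p))"
  by (rule continuous_on_compose2[OF continuous_DD] continuous_on_compose2[OF continuous_EE]; auto intro!: continuous_intros)+
 have A: "continuous_on (S \<times> U) (%p. sgn (DD (snd p)) * Re (h (fst p) (fold_TC (snd p))))"
  by (rule continuous_sgn_mult[OF d(1)]) (use zero in "auto intro!: continuous_intros 1")
 have B: "continuous_on (S \<times> U) (%p. sgn (EE (snd p)) * Im (h (fst p) (fold_TC (snd p))))"
  by (rule continuous_sgn_mult[OF d(2)]) (use zero in "auto intro!: continuous_intros 1")
 show ?thesis
  unfolding tw_def case_prod_beta Complex_eq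
  by (rule continuous_on_add[OF continuous_on_of_real[OF A]
     continuous_on_mult[OF continuous_on_const continuous_on_of_real[OF B]]])
qed

lemma continuous_tw1:
 fixes h :: "complex => complex"
 assumes h: "continuous_on TC h" and z: "!!w. w \<in> TC - TT ==> h w = 0"
 shows "continuous_on U (tw h)"
proof -
 have "continuous_on (UNIV \<times> TC) (%p::real \<times> complex. h (snd p))"
  by (rule continuous_on_compose2[OF h]) (auto intro!: continuous_intros)
 hence "continuous_on (UNIV \<times> U) (%p::real \<times> complex. tw h (snd p))"
  using continuous_tw[of "UNIV :: real set" "%_. h" U] z by (simp add: case_prod_beta)
 hence "continuous_on U (%w. tw h (snd (0::real, w)))"
  by (rule continuous_on_compose2) (auto intro!: continuous_intros)
 thus ?thesis by simp
qed

lemma integral_QQ_iterated_swap: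
 fixes f :: "complex => 'b::euclidean_space"
 assumes g: "continuous_on QQ f"
 shows "integral QQ f = integral {-2..2} (%y. integral {-2..2} (%x. f (Complex x y)))"
proof -
 have "continuous_on (cbox (-2,-2) (2,2)) (%(x, y). f (Complex x y))"
  unfolding case_prod_beta
 proof (rule continuous_on_compose2[OF g])
  show "continuous_on (cbox (-2,-2) (2,2)) (%p. Complex (fst p) (snd p))"
   unfolding Complex_eq by (intro continuous_intros)
 qed (auto simp: QQ_iff cbox_Pair_eq)
 from integral_swap_continuous[OF this] show ?thesis
  using integral_complex_iterated[of "-2" "-2" 2 2 f] g by (simp add: QQ_def)
qed

lemma integral_QQ_cnj:
 fixes g :: "complex => complex"
 assumes g: "continuous_on QQ g"
 shows "integral QQ (%w. g (cnj w)) = integral QQ g"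
  and "integral QQ (%w. g (- cnj w)) = integral QQ g"
  and "integral QQ (%w. g (\<i> * cnj w)) = integral QQ g"
proof -
 have c: "continuous_on QQ (%w. g (f w))" if "continuous_on QQ f" "f ` QQ \<subseteq> QQ" for f
  using continuous_on_compose2[OF g that] .
 have *: "integral QQ f = integral {-2..2} (%x. integral {-2..2} (%y. f (Complex x y)))" if "continuous_on QQ f" for f :: "complex => complex"
  using integral_complex_iterated that unfolding QQ_def by blast
 have r: "integral {-2..2} (%x. f (- x)) = integral {-2..2} f" for f :: "real => complex"
  using Henstock_Kurzweil_Integration.integral_reflect_real[of 2 "-2" f] by simp
 have [simp]: "cnj (Complex x y) = Complex x (- y)" "- Complex x y = Complex (- x) (- y)" "\<i> * Complex x y = Complex (- y) x" for x y
  by (auto simp: complex_eq_iff)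
 have cc: "continuous_on QQ (%w. g (cnj w))" "continuous_on QQ (%w. g (- cnj w))" "continuous_on QQ (%w. g (\<i> * cnj w))"
  by (intro c continuous_intros; force simp: QQ_iff)+
 show "integral QQ (%w. g (cnj w)) = integral QQ g"
  using r[of "%y. g (Complex x y)" for x] by (simp add: * g cc)
 show "integral QQ (%w. g (- cnj w)) = integral QQ g"
  using r[of "%x. integral {-2..2} (%y. g (Complex x y))"] by (simp add: * g cc)
 show "integral QQ (%w. g (\<i> * cnj w)) = integral QQ g"
  using integral_QQ_iterated_swap[OF g] by (simp add: *[OF cc(3)])
qed

lemma integral_QQ_of_cnj:
 assumes "continuous_on QQ f"
 shows "integral QQ (%w. cnj (f w)) = cnj (integral QQ f)"
 using integral_linear[OF integrable_QQ[OF assms] bounded_linear_cnj] by (simp add: o_def)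

section \<open>Symmetries of Fourier coefficients\<close>

lemma csym_fc:
 assumes h: "continuous_on QQ h" and s: "fsym a1 a2 a3 h"
 shows "csym a1 a2 a3 (fc h)"
proof -
 have ekc: "ek (k,l) (cnj w) = ek (k,-l) w" "ek (k,l) (- cnj w) = ek (-k,l) w" "ek (k,l) (\<i> * cnj w) = ek (l,k) w" for k l w
  by (auto simp: ek_def algebra_simps)
 have c: "continuous_on QQ (%w. h w * ek k w)" "continuous_on QQ (%w. h w * ek k (f w))" if "continuous_on QQ f" for k f
  by (intro continuous_intros h that)+
 have cn: "cnj (fc h (k, l)) = integral QQ (%w. cnj (h w) * ek (k, l) w) / 16" for k l
  unfolding fc_def complex_cnj_divide
  by (subst integral_QQ_of_cnj[symmetric]) (auto simp: ek_cnj intro!: c continuous_intros)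
 show ?thesis
  unfolding csym_def
 proof (intro allI conjI)
  fix k l
  have "fc h (-k, l) = integral QQ (%w. h (cnj w) * ek (k, -l) (cnj w)) / 16"
   unfolding fc_def by (subst integral_QQ_cnj(1)) (auto intro!: c continuous_intros)
  thus "fc h (-k, l) = a1 * cnj (fc h (k, l))"
   using s unfolding cn fsym_def by (simp add: ekc mult.assoc)
  have "fc h (k, -l) = integral QQ (%w. h (- cnj w) * ek (-k, l) (- cnj w)) / 16"
   unfolding fc_def by (subst integral_QQ_cnj(2)) (auto intro!: c continuous_intros)
  thus "fc h (k, -l) = a2 * cnj (fc h (k, l))"
   using s unfolding cn fsym_def by (simp add: ekc mult.assoc)
  have "fc h (-l, -k) = integral QQ (%w. h (\<i> * cnj w) * ek (l, k) (\<i> * cnj w)) / 16"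
   unfolding fc_def by (subst integral_QQ_cnj(3)) (auto intro!: c continuous_intros)
  thus "fc h (-l, -k) = a3 * cnj (fc h (k, l))"
   using s unfolding cn fsym_def by (simp add: ekc mult.assoc)
 qed
qed

lemma fsym_tp:
 assumes "csym a1 a2 a3 c"
 shows "fsym a1 a2 a3 (tp N c)"
proof -
 have ekc: "ek k (cnj w) = cnj (ek (- fst k, snd k) w)" "ek k (- cnj w) = cnj (ek (fst k, - snd k) w)"
   "ek k (\<i> * cnj w) = cnj (ek (- snd k, - fst k) w)" for k w
  by (auto simp: ek_def cis_cnj algebra_simps)
 have re: "tp N c w = (SUM k:BX N. c (f k) * ek (f k) w)"
  if "!!k. f (f k) = k" "f ` BX N \<subseteq> BX N" for f w
  unfolding tp_def
  by (rule sum.reindex_bij_witness[of _ f f]) (use that in auto)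
 have "tp N c (cnj w) = a1 * cnj (tp N c w)" for w
 proof -
  have "tp N c (cnj w) = (SUM k:BX N. c k * cnj (ek (- fst k, snd k) w))"
   unfolding tp_def ekc ..
  also have "... = (SUM k:BX N. c (- fst k, snd k) * cnj (ek k w))"
   by (rule sum.reindex_bij_witness[of _ "%k. (- fst k, snd k)" "%k. (- fst k, snd k)"]) (auto simp: BX_def)
  also have "... = a1 * cnj (tp N c w)"
   unfolding tp_def cnj_sum sum_distrib_left using assms by (intro sum.cong) (auto simp: csym_def)
  finally show ?thesis .
 qed
 moreover have "tp N c (- cnj w) = a2 * cnj (tp N c w)" for w
 proof -
  have "tp N c (- cnj w) = (SUM k:BX N. c k * cnj (ek (fst k, - snd k) w))"
   unfolding tp_def ekc ..
  also have "... = (SUM k:BX N. c (fst k, - snd k) * cnj (ek k w))"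
   by (rule sum.reindex_bij_witness[of _ "%k. (fst k, - snd k)" "%k. (fst k, - snd k)"]) (auto simp: BX_def)
  also have "... = a2 * cnj (tp N c w)"
   unfolding tp_def cnj_sum sum_distrib_left using assms by (intro sum.cong) (auto simp: csym_def)
  finally show ?thesis .
 qed
 moreover have "tp N c (\<i> * cnj w) = a3 * cnj (tp N c w)" for w
 proof -
  have "tp N c (\<i> * cnj w) = (SUM k:BX N. c k * cnj (ek (- snd k, - fst k) w))"
   unfolding tp_def ekc ..
  also have "... = (SUM k:BX N. c (- snd k, - fst k) * cnj (ek k w))"
   by (rule sum.reindex_bij_witness[of _ "%k. (- snd k, - fst k)" "%k. (- snd k, - fst k)"]) (auto simp: BX_def)
  also have "... = a3 * cnj (tp N c w)"
   unfolding tp_def cnj_sum sum_distrib_left using csymD(3)[OF assms]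
   by (intro sum.cong refl) (metis complex_cnj_mult mult.assoc prod.collapse)
  finally show ?thesis .
 qed
 ultimately show ?thesis unfolding fsym_def by blast
qed

text \<open>Multipliers of the Beurling transform \<open>u \<mapsto> \<partial>F/\<partial>w\<close> and of \<open>u \<mapsto> F\<close>, where \<open>u = \<partial>F/\<partial>cnj w\<close>.\<close>

definition Smul :: "(int * int => complex) => int * int => complex" where
 "Smul c k = cnj (kap k) / kap k * c k"
definition Fmul :: "(int * int => complex) => int * int => complex" where
 "Fmul c k = 4 / (\<i> * pi * kap k) * c k"

lemma kap_sym: "kap (-k, l) = - cnj (kap (k, l))" "kap (k, -l) = cnj (kap (k, l))" "kap (-l, -k) = - \<i> * cnj (kap (k, l))"
 by (auto simp: kap_def complex_eq_iff)

lemma csym_Smul: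
 assumes "csym 1 1 (-1) c" shows "csym 1 1 1 (Smul c)"
 unfolding csym_def
proof (intro allI conjI)
 fix k l
 note c = csymD[OF assms, where k=k and l=l] and K = kap_sym[where k=k and l=l]
 show "Smul c (-k, l) = 1 * cnj (Smul c (k, l))" unfolding Smul_def K c by simp
 show "Smul c (k, -l) = 1 * cnj (Smul c (k, l))" unfolding Smul_def K c by simp
 show "Smul c (-l, -k) = 1 * cnj (Smul c (k, l))" unfolding Smul_def K c by simp
qed

lemma csym_Fmul:
 assumes "csym 1 1 (-1) c" shows "csym 1 (-1) \<i> (Fmul c)"
 unfolding csym_def
proof (intro allI conjI)
 fix k l
 note c = csymD[OF assms, where k=k and l=l] and K = kap_sym[where k=k and l=l]
 show "Fmul c (-k, l) = 1 * cnj (Fmul c (k, l))" unfolding Fmul_def K c by simp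
 show "Fmul c (k, -l) = -1 * cnj (Fmul c (k, l))" unfolding Fmul_def K c by simp
 show "Fmul c (-l, -k) = \<i> * cnj (Fmul c (k, l))" unfolding Fmul_def K c
  by (cases "kap (k, l) = 0") (simp_all add: divide_simps)
qed

section \<open>Brouwer's theorem in coordinates\<close>

text \<open>The dimension \<open>n\<close> is a number because it grows with the truncation. Kuhn's
  combinatorial lemma gives, for every mesh, a small grid cube in which each coordinate is pushed up
  at one corner and down at another; a limit point of such cubes is fixed.\<close>

lemma Brouwer_nat_cube:
 fixes f :: "(nat => real) => nat => real"
 defines "K \<equiv> {x. ALL i. x i \<in> {0..1}}"
 assumes cont: "!!i. i < n ==> continuous_on K (%x. f x i)"
  and range: "!!x i. x \<in> K ==> i < n ==> f x i \<in> {0..1}"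
 shows "EX x:K. ALL i<n. f x i = x i"
proof -
 have "K = PiE UNIV (%_. {0..1::real})" by (auto simp: K_def PiE_def)
 hence "compact K"
  using compactin_PiE[of "%_. euclidean :: real topology" "UNIV :: nat set" "%_. {0..1}"]
  by (simp add: euclidean_product_topology)
 hence sK: "seq_compact K" by (rule compact_imp_seq_compact)
 have tend: "(X \<longlonglongrightarrow> x) \<longleftrightarrow> (ALL i. (%m. X m i) \<longlonglongrightarrow> x i)" for X and x :: "nat => real"
  using limitin_componentwise[of "%_. euclidean :: real topology" UNIV X x sequentially]
  by (simp add: euclidean_product_topology)
 \<comment> \<open>Grid points of mesh 1/p. Cutting at 1 and putting 0 in the coordinates beyond
   \<open>n\<close> keeps all of them in the compact set \<open>K\<close>.\<close>
 define pt where "pt p x i = (if i < n then min 1 (real (x i) / real p) else 0)" for p :: nat and x :: "nat => nat" and i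
 have ptK: "pt p x \<in> K" for p x by (auto simp: pt_def K_def)
 have step: "EX q. ALL i<n. q i < p & (EX r s. (ALL j<n. q j <= r j & r j <= q j + 1) & (ALL j<n. q j <= s j & s j <= q j + 1) &
    pt p r i <= f (pt p r) i & f (pt p s) i <= pt p s i)" if p: "p > 0" for p
 proof -
  \<comment> \<open>Label 0 stands for \<open>f\<close> not decreasing coordinate \<open>i\<close>,
    label 1 for not increasing it. On the faces \<open>x i = 0\<close> and \<open>x i = p\<close>
    the label is forced, as Kuhn's lemma demands, and the inequalities hold there because
    \<open>f\<close> stays in [0, 1].\<close>
  define label where "label x i = (if x i = p \<or> (x i ~= 0 & f (pt p x) i < pt p x i) then 1 else 0 :: nat)" for x i
  have lab0: "pt p x i <= f (pt p x) i" if "label x i = 0" "i < n" for x i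
   using that range[OF ptK that(2), of p x] by (auto simp: label_def pt_def split: if_splits)
  have lab1: "f (pt p x) i <= pt p x i" if "label x i ~= 0" "i < n" for x i
   using that range[OF ptK that(2), of p x] p by (auto simp: label_def pt_def split: if_splits)
  obtain q where q: "ALL i<n. q i < p" "ALL i<n. EX r s. (ALL j<n. q j <= r j & r j <= q j + 1) &
    (ALL j<n. q j <= s j & s j <= q j + 1) & label r i ~= label s i"
   by (rule kuhn_lemma[of p n label]) (use p in "auto simp: label_def")
  show ?thesis
  proof (rule exI[of _ q], intro allI impI conjI)
   fix i assume i: "i < n"
   thus "q i < p" using q(1) by blast
   obtain r s where rs: "ALL j<n. q j <= r j & r j <= q j + 1" "ALL j<n. q j <= s j & s j <= q j + 1" "label r i ~= label s i"
    using q(2) i by blast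
   show "EX r s. (ALL j<n. q j <= r j & r j <= q j + 1) & (ALL j<n. q j <= s j & s j <= q j + 1) &
    pt p r i <= f (pt p r) i & f (pt p s) i <= pt p s i"
   proof (cases "label r i = 0")
    case True
    hence "label s i ~= 0" using rs(3) by simp
    thus ?thesis using lab0[OF True i] lab1[of s i, OF _ i] rs by blast
   next
    case False
    hence "label s i = 0" using rs(3) by (auto simp: label_def split: if_splits)
    thus ?thesis using lab1[OF False i] lab0[of s i, OF _ i] rs by blast
   qed
  qed
 qed
 hence "ALL m. EX q. ALL i<n. EX r s. (ALL j<n. q j <= r j & r j <= q j + 1) & (ALL j<n. q j <= s j & s j <= q j + 1) &
    pt (Suc m) r i <= f (pt (Suc m) r) i & f (pt (Suc m) s) i <= pt (Suc m) s i"
  by (metis zero_less_Suc)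
 then obtain q r s where
  r: "!!m i j. i < n ==> j < n ==> q m j <= r m i j & r m i j <= q m j + 1" and
  s: "!!m i j. i < n ==> j < n ==> q m j <= s m i j & s m i j <= q m j + 1" and
  fr: "!!m i. i < n ==> pt (Suc m) (r m i) i <= f (pt (Suc m) (r m i)) i" and
  fs: "!!m i. i < n ==> f (pt (Suc m) (s m i)) i <= pt (Suc m) (s m i) i"
  by metis
 define X where "X m = pt (Suc m) (q m)" for m
 obtain x z where x: "x \<in> K" "strict_mono z" "(X \<circ> z) \<longlonglongrightarrow> x"
  using sK ptK unfolding seq_compact_def X_def by (metis (no_types, lifting))
 have close: "\<bar>pt p a j - pt p b j\<bar> <= 1 / real p" if "j < n ==> b j <= a j & a j <= b j + 1" for p a b j
 proof (cases "j < n")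
  case True
  hence "real (b j) / real p <= real (a j) / real p" "real (a j) / real p <= real (b j) / real p + 1 / real p"
   using that by (auto simp: divide_right_mono add_divide_distrib[symmetric])
  thus ?thesis by (auto simp: pt_def min_def)
 qed (simp add: pt_def)
 \<comment> \<open>The corners \<open>r\<close> and \<open>s\<close> vary with the coordinate, but
   all lie within one mesh of the base corner, so every choice has the same limit.\<close>
 have lim: "(%m. pt (Suc (z m)) (t (z m))) \<longlonglongrightarrow> x"
  if t: "!!m j. j < n ==> q m j <= t m j & t m j <= q m j + 1" for t
  unfolding tend
 proof
  fix j
  have 1: "(%m. (X \<circ> z) m j) \<longlonglongrightarrow> x j" using x(3) unfolding tend by blast
  have "(%m. 1 / real (Suc (z m))) \<longlonglongrightarrow> 0"
   using LIMSEQ_subseq_LIMSEQ[OF LIMSEQ_inverse_real_of_nat x(2)] by (simp add: o_def inverse_eq_divide)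
  hence "(%m. pt (Suc (z m)) (t (z m)) j - (X \<circ> z) m j) \<longlonglongrightarrow> 0"
  proof (rule Lim_null_comparison[rotated], intro always_eventually allI)
   fix m show "norm (pt (Suc (z m)) (t (z m)) j - (X \<circ> z) m j) <= 1 / real (Suc (z m))"
    using close[of j "q (z m)" "t (z m)" "Suc (z m)"] t unfolding X_def by (simp only: o_def real_norm_def)
  qed
  from tendsto_add[OF this 1] show "(%m. pt (Suc (z m)) (t (z m)) j) \<longlonglongrightarrow> x j" by simp
 qed
 have "f x i = x i" if i: "i < n" for i
 proof (rule antisym)
  have c: "(%m. f (Y m) i) \<longlonglongrightarrow> f x i" if "Y \<longlonglongrightarrow> x" "!!m. Y m \<in> K" for Y
   by (rule continuous_on_tendsto_compose[OF cont[OF i] that(1) x(1)]) (use that in auto)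
  have l: "(%m. Y m i) \<longlonglongrightarrow> x i" if "Y \<longlonglongrightarrow> x" for Y
   using that unfolding tend by blast
  have R: "(%m. pt (Suc (z m)) (r (z m) i)) \<longlonglongrightarrow> x" by (rule lim[of "%m. r m i"]) (use r i in auto)
  have S: "(%m. pt (Suc (z m)) (s (z m) i)) \<longlonglongrightarrow> x" by (rule lim[of "%m. s m i"]) (use s i in auto)
  show "x i <= f x i"
   by (rule LIMSEQ_le[OF l[OF R] c[OF R]]) (use ptK fr i in auto)
  show "f x i <= x i"
   by (rule LIMSEQ_le[OF c[OF S] l[OF S]]) (use ptK fs i in auto)
 qed
 thus ?thesis using x(1) by blast
qed

text \<open>An enumeration of \<open>I\<close> and the affine map \<open>D\<close> of [0, 1] onto
  [-R, R] reduce this to the unit cube. Boundedness on the whole space takes the place of an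
  invariant cube.\<close>

lemma Brouwer_finite_cube:
 fixes f :: "('i => real) => 'i => real"
 assumes "finite I" and R: "0 < R"
  and cont: "!!i. i \<in> I ==> continuous_on UNIV (%x. f x i)"
  and range: "!!x i. i \<in> I ==> \<bar>f x i\<bar> <= R"
 shows "EX x. ALL i:I. f x i = x i"
proof -
 obtain e where e: "bij_betw e {..<card I} I"
  using ex_bij_betw_nat_finite[OF \<open>finite I\<close>] by (auto simp: lessThan_atLeast0)
 define d where "d = the_inv_into {..<card I} e"
 define D where "D y i = R * (2 * y (d i) - 1)" for y :: "nat => real" and i
 have ed: "e m \<in> I" "d (e m) = m" if "m < card I" for m
  using e that bij_betw_apply[OF e] by (auto simp: d_def the_inv_into_f_f bij_betw_def)
 have de: "e (d i) = i" "d i < card I" if "i \<in> I" for i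
 proof -
  show "e (d i) = i" unfolding d_def using e that by (metis bij_betw_def f_the_inv_into_f)
  show "d i < card I" unfolding d_def using e that by (metis bij_betw_def lessThan_iff subset_refl the_inv_into_into)
 qed
 define g where "g y m = (f (D y) (e m) / R + 1) / 2" for y m
 have "EX y:{x. ALL i. x i \<in> {0..1}}. ALL m<card I. g y m = y m"
 proof (rule Brouwer_nat_cube)
  fix m assume m: "m < card I"
  have "continuous_on UNIV D"
   unfolding D_def by (intro continuous_on_coordinatewise_then_product continuous_intros) auto
  hence "continuous_on UNIV (%y. f (D y) (e m))"
   by (rule continuous_on_compose2[OF cont[OF ed(1)[OF m]]]) auto
  thus "continuous_on {x. ALL i. x i \<in> {0..1}} (%x. g x m)"
   unfolding g_def using R by (intro continuous_intros) (auto elim: continuous_on_subset)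
  fix x
  show "g x m \<in> {0..1}" using range[OF ed(1)[OF m], of "D x"] R
   by (auto simp: g_def field_simps abs_le_iff)
 qed
 then obtain y where y: "!!m. m < card I ==> g y m = y m" by blast
 have "f (D y) i = D y i" if "i \<in> I" for i
 proof -
  have "y (d i) = (f (D y) i / R + 1) / 2" using y[OF de(2)[OF that]] de(1)[OF that] by (simp add: g_def)
  hence "2 * y (d i) - 1 = f (D y) i / R" by (simp add: field_simps)
  thus ?thesis using R by (simp add: D_def)
 qed
 thus ?thesis by blast
qed

section \<open>The right-hand side of the equation\<close>

lemma norm_vec_sq: "(norm (v :: complex^'n))^2 = (SUM j:UNIV. (cmod (v $ j))^2)"
 by (simp add: norm_vec_def L2_set_def sum_nonneg)

lemma norm_svec: "norm (z *s v :: complex^'n) = cmod z * norm v"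
proof -
 have "(norm (z *s v))^2 = (cmod z * norm v)^2"
  unfolding norm_vec_sq power_mult_distrib by (simp add: norm_mult power_mult_distrib sum_distrib_left)
 thus ?thesis by (metis norm_ge_zero power2_eq_iff_nonneg zero_le_mult_iff)
qed

lemma norm_vec_four_le: "(norm (v :: complex^'n)) ^ 4 <= real CARD('n) * (SUM j:UNIV. (cmod (v $ j)) ^ 4)"
proof -
 have "(norm v) ^ 4 = (SUM j:UNIV. 1 * (cmod (v $ j))^2)^2"
  using norm_vec_sq[of v] by (simp add: power2_eq_square power4_eq_xxxx)
 also have "... <= (SUM j:(UNIV::'n set). 1^2) * (SUM j:UNIV. ((cmod (v $ j))^2)^2)"
  by (rule Cauchy_Schwarz_ineq_sum)
 finally show ?thesis by simp
qed

lemma continuous_on_matrix_vector_mult [continuous_intros]: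
 fixes M :: "'a::topological_space => complex^'n^'m"
 assumes "continuous_on S M" "continuous_on S w"
 shows "continuous_on S (%x. M x *v w x)"
 unfolding matrix_vector_mult_def by (intro continuous_on_vec_lambda continuous_intros assms)

lemma continuous_on_cnj_vec [continuous_intros]:
 "continuous_on S w ==> continuous_on S (%x. cnj_vec (w x))"
 unfolding cnj_vec_def by (intro continuous_on_vec_lambda continuous_intros)

lemma norm_cnj_vec [simp]: "norm (cnj_vec v) = norm v"
 by (simp add: cnj_vec_def norm_vec_def)

definition vtp :: "nat => ('n => int * int => complex) => complex => complex^'n" where
 "vtp N c u = (\<chi> j. tp N (c j) u)"

lemma vtp_nth [simp]: "vtp N c u $ j = tp N (c j) u" by (simp add: vtp_def)

lemma continuous_vtp [continuous_intros]:
 "continuous_on S g ==> continuous_on S (%x. vtp N c (g x))"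
 unfolding vtp_def by (intro continuous_on_vec_lambda continuous_intros)

lemma integral_QQ_norm_sq:
 fixes w :: "complex => complex^'n"
 assumes "continuous_on QQ w"
 shows "integral QQ (%u. (norm (w u))^2) = (SUM j:UNIV. integral QQ (%u. (cmod (w u $ j))^2))"
 unfolding norm_vec_sq by (rule integral_sum) (auto intro!: integrable_QQ continuous_intros assms)

text \<open>The squared L^2 norm over \<open>QQ\<close> of the field with coefficients
  \<open>c\<close>, by Parseval; 16 is the area of \<open>QQ\<close>.\<close>

definition csq :: "nat => ('n::finite => int * int => complex) => real" where
 "csq N c = 16 * (SUM j:UNIV. SUM k:BX N. (cmod (c j k))^2)"

lemma Parseval_vtp: "integral QQ (%u. (norm (vtp N c u))^2) = csq N c"
 by (subst integral_QQ_norm_sq) (auto intro!: continuous_intros simp: Parseval_tp csq_def sum_distrib_left)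

lemma csq_nonneg: "0 <= csq N c" by (simp add: csq_def sum_nonneg)

text \<open>The Beurling symbol has modulus 1 off frequency 0 and is 0 there.\<close>

lemma csq_Smul: "csq N (%j. Smul (c j)) <= csq N c"
proof -
 have "cmod (Smul b k) <= cmod (b k)" for b k
  by (cases "kap k = 0") (auto simp: Smul_def norm_mult norm_divide)
 thus ?thesis unfolding csq_def by (intro mult_left_mono sum_mono power_mono) auto
qed

lemma Smul_0 [simp]: "Smul c 0 = 0" by (simp add: Smul_def)

lemma Parseval_const_add:
 assumes "!!j. c j 0 = 0"
 shows "integral QQ (%u. (norm (e + vtp N c u))^2) = 16 * (norm e)^2 + csq N c"
proof -
 define d where "d j k = (if k = 0 then e $ j else c j k)" for j k
 have z: "0 \<in> BX N" by (simp add: BX_def zero_prod_def)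
 have "tp N (d j) u = e $ j + tp N (c j) u" for j u
  unfolding tp_def using assms by (simp add: sum.remove[OF finite_BX z] d_def)
 hence "e + vtp N c u = vtp N d u" for u by (simp add: vec_eq_iff)
 hence "integral QQ (%u. (norm (e + vtp N c u))^2) = csq N d" by (simp add: Parseval_vtp)
 also have "... = 16 * (norm e)^2 + csq N c"
  unfolding csq_def norm_vec_sq using assms
  by (simp add: sum.remove[OF finite_BX z] d_def sum.distrib algebra_simps)
 finally show ?thesis .
qed

text \<open>The right-hand side \<open>A(Z) cnj(w)\<close> of the equation, extended from the triangle to the plane.\<close>

definition TW :: "(complex => complex^'n^'n) => (complex => complex^'n) => complex => complex^'n" where
 "TW M w u = (\<chi> j. tw (%y. \<i> * (M y *v cnj_vec (w y)) $ j) u)"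

text \<open>What is used of \<open>A\<close> along a map: the values on the closed triangle, the
  bound by \<open>a\<close> as an operator, and vanishing on the boundary, without which the
  reflected field \<open>TW\<close> would jump.\<close>

definition good_coeff :: "real => (complex => complex^'n^'n) => bool" where
 "good_coeff a M \<longleftrightarrow> 0 <= a & continuous_on TC M & (ALL y:TC - TT. M y = 0) & (ALL y:TC. ALL v. norm (M y *v v) <= a * norm v)"

lemma good_coeffD:
 assumes "good_coeff a M"
 shows "0 <= a" "continuous_on TC M" "!!y. y \<in> TC - TT ==> M y = 0" "!!y v. y \<in> TC ==> norm (M y *v v) <= a * norm v"
 using assms unfolding good_coeff_def by auto

lemma norm_TW_le0: "norm (TW M w u) <= norm (M (fold_TC u) *v cnj_vec (w (fold_TC u)))"
proof -
 have "norm (TW M w u) <= norm (\<i> *s (M (fold_TC u) *v cnj_vec (w (fold_TC u))))"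
  unfolding norm_vec_def L2_set_def TW_def
  by (intro real_sqrt_le_mono sum_mono power_mono) (auto intro: order_trans[OF norm_tw_le])
 also have "... = norm (M (fold_TC u) *v cnj_vec (w (fold_TC u)))"
  by (simp add: norm_vec_def norm_mult)
 finally show ?thesis .
qed

lemma norm_TW_le:
 assumes "good_coeff a M"
 shows "norm (TW M w u) <= a * norm (w (fold_TC u))"
 using norm_TW_le0[of M w u] good_coeffD(4)[OF assms fold_in_TC, of u "cnj_vec (w (fold_TC u))"] by simp

lemma continuous_TW:
 assumes "good_coeff a M" "continuous_on TC w"
 shows "continuous_on S (TW M w)"
 unfolding TW_def
 by (intro continuous_on_vec_lambda continuous_tw1)
  (auto intro!: continuous_intros good_coeffD(2)[OF assms(1)] assms(2) simp: good_coeffD(3)[OF assms(1)])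

lemma biperiodic_TW: "biperiodic (%u. TW M w u $ j)"
 unfolding TW_def by (simp add: biperiodic_tw)

lemma fsym_TW: "fsym 1 1 (-1) (%u. TW M w u $ j)"
 unfolding TW_def by (simp add: fsym_tw)

lemma cnj_vec_add: "cnj_vec (v + w) = cnj_vec v + cnj_vec w" and cnj_vec_diff: "cnj_vec (v - w) = cnj_vec v - cnj_vec w"
 by (auto simp: cnj_vec_def vec_eq_iff)

lemma TW_add: "TW M (%u. v u + w u) u = TW M v u + TW M w u"
 unfolding TW_def by (auto simp: vec_eq_iff cnj_vec_add matrix_vector_right_distrib distrib_left tw_add)

lemma TW_diff: "TW M (%u. v u - w u) u = TW M v u - TW M w u"
 unfolding TW_def by (auto simp: vec_eq_iff cnj_vec_diff matrix_vector_mult_diff_distrib right_diff_distrib tw_diff)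

lemma TW_diff_left: "TW M w u - TW M' w u = TW (%y. M y - M' y) w u"
 unfolding TW_def by (auto simp: vec_eq_iff matrix_vector_mult_diff_rdistrib right_diff_distrib tw_diff)

definition ssym :: "(complex => complex^'n) => bool" where
 "ssym w \<longleftrightarrow> (ALL j. fsym 1 1 1 (%u. w u $ j)) & biperiodic w"

text \<open>Each generating reflection replaces the components of \<open>w\<close> by their
  conjugates; \<open>e\<close> is real, so the norm of the sum is unchanged and
  \<open>fold_invariant\<close> applies.\<close>

lemma norm_fold_ssym:
 fixes e :: "complex^'n"
 assumes "ssym w" and e: "!!j. cnj (e $ j) = e $ j"
 shows "norm (e + w (fold_TC u)) = norm (e + w u)"
proof (rule fold_invariant)
 show "biperiodic (%u. norm (e + w u))" using assms(1) by (auto simp: ssym_def biperiodic_def)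
 have c: "norm (e + v) = norm (e + w)" if "!!j. v $ j = cnj (w $ j)" for v w :: "complex^'n"
 proof -
  have "e + v = cnj_vec (e + w)" using that by (simp add: vec_eq_iff cnj_vec_def e)
  thus ?thesis by simp
 qed
 have "w (cnj u) $ j = cnj (w u $ j)" "w (- cnj u) $ j = cnj (w u $ j)" "w (\<i> * cnj u) $ j = cnj (w u $ j)" for j u
  using assms(1) by (auto simp: ssym_def fsym_def)
 thus "norm (e + w (cnj u)) = norm (e + w u)" "norm (e + w (- cnj u)) = norm (e + w u)"
   "norm (e + w (\<i> * cnj u)) = norm (e + w u)" for u
  by (auto intro!: c)
qed

text \<open>The pointwise bound for \<open>TW\<close> is available only at the folded point. The
  norm of \<open>e + w\<close> is invariant under folding, so the integrals over the whole cell can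
  be compared with the factor \<open>a\<close> and nothing lost.\<close>

lemma integral_TW_le:
 fixes e :: "complex^'n"
 assumes M: "good_coeff a M" and w: "ssym w" "continuous_on UNIV w" and e: "!!j. cnj (e $ j) = e $ j"
 shows "integral QQ (%u. (norm (TW M (%u. e + w u) u)) ^ m) <= a ^ m * integral QQ (%u. (norm (e + w u)) ^ m)"
proof -
 have wc: "continuous_on S w" for S using w(2) continuous_on_subset by blast
 have "integral QQ (%u. (norm (TW M (%u. e + w u) u)) ^ m) <= integral QQ (%u. a ^ m * (norm (e + w u)) ^ m)"
 proof (intro integral_le integrable_QQ continuous_intros continuous_TW[OF M] wc)
  fix u
  have "norm (TW M (%u. e + w u) u) <= a * norm (e + w u)"
   using norm_TW_le[OF M, of "%u. e + w u" u] norm_fold_ssym[OF w(1) e] by simp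
  thus "(norm (TW M (%u. e + w u) u)) ^ m <= a ^ m * (norm (e + w u)) ^ m"
   unfolding power_mult_distrib[symmetric] by (rule power_mono) simp
 qed
 thus ?thesis by simp
qed

lemma ssym_vtp:
 assumes "!!j. csym 1 1 1 (c j)"
 shows "ssym (vtp N c)"
 using fsym_tp[OF assms] biperiodic_tp unfolding ssym_def vtp_def biperiodic_def by (auto simp: vec_eq_iff)

definition vfc :: "(complex => complex^'n) => 'n => int * int => complex" where
 "vfc h j = fc (%u. h u $ j)"

text \<open>Truncated Fourier projection is orthogonal, so it does not increase the L^2 distance to
  a field that it leaves fixed.\<close>

lemma csq_vfc_diff_le:
 assumes h: "continuous_on QQ h"
 shows "csq N (%j k. vfc h j k - c j k) <= integral QQ (%u. (norm (h u - vtp N c u))^2)"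
proof -
 have "csq N (%j k. vfc h j k - c j k) = (SUM j:UNIV. 16 * (SUM k:BX N. (cmod (fc (%u. h u $ j) k - c j k))^2))"
  unfolding csq_def vfc_def by (simp add: sum_distrib_left)
 also have "... <= (SUM j:UNIV. integral QQ (%u. (cmod (h u $ j - tp N (c j) u))^2))"
  by (intro sum_mono fc_projection_le continuous_intros h)
 also have "... = integral QQ (%u. (norm (h u - vtp N c u))^2)"
  by (subst integral_QQ_norm_sq) (auto intro!: continuous_intros h)
 finally show ?thesis .
qed

lemma csq_vfc_le:
 fixes h :: "complex => complex^'n"
 assumes h: "continuous_on QQ h"
 shows "csq N (vfc h) <= integral QQ (%u. (norm (h u))^2)"
proof -
 have z: "vtp N (%_ _. 0) u = (0::complex^'n)" for u by (simp add: vec_eq_iff)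
 show ?thesis using csq_vfc_diff_le[OF h, of N "%_ _. 0"] by (simp add: z)
qed

text \<open>Passing between the norm and its components costs the factor n^2, which only enlarges
  the later constants.\<close>

lemma integral_norm4_le:
 fixes w :: "complex => complex^'n"
 assumes w: "continuous_on QQ w" and v: "continuous_on QQ v" and C: "0 <= C"
  and le: "!!j. integral QQ (%u. (cmod (w u $ j)) ^ 4) <= C * integral QQ (%u. (cmod (v u $ j)) ^ 4)"
 shows "integral QQ (%u. (norm (w u)) ^ 4) <= (real CARD('n))^2 * C * integral QQ (%u. (norm (v u :: complex^'n)) ^ 4)"
proof -
 have "integral QQ (%u. (norm (w u)) ^ 4) <= integral QQ (%u. real CARD('n) * (SUM j:UNIV. (cmod (w u $ j)) ^ 4))"
  by (intro integral_le integrable_QQ continuous_intros w norm_vec_four_le)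
 also have "... = real CARD('n) * (SUM j:UNIV. integral QQ (%u. (cmod (w u $ j)) ^ 4))"
  by (simp, subst integral_sum) (auto intro!: integrable_QQ continuous_intros w)
 also have "... <= real CARD('n) * (SUM j:(UNIV::'n set). C * integral QQ (%u. (norm (v u)) ^ 4))"
 proof (intro mult_left_mono sum_mono order_trans[OF le])
  fix j
  show "integral QQ (%u. (cmod (v u $ j)) ^ 4) <= integral QQ (%u. (norm (v u)) ^ 4)"
   by (intro integral_le integrable_QQ continuous_intros v power_mono Finite_Cartesian_Product.norm_nth_le) auto
 qed (use C in auto)
 also have "... = (real CARD('n))^2 * C * integral QQ (%u. (norm (v u :: complex^'n)) ^ 4)"
  by (simp add: power2_eq_square)
 finally show ?thesis .
qed

lemma vtp_Smul_L4:
 "integral QQ (%u. (norm (vtp N (%j. Smul (c j)) u :: complex^'n)) ^ 4) <= (real CARD('n))^2 * (300 * pi ^ 4)^2 * integral QQ (%u. (norm (vtp N c u)) ^ 4)"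
proof (rule integral_norm4_le)
 show "integral QQ (%u. (cmod (vtp N (%j. Smul (c j)) u $ j)) ^ 4) <= (300 * pi ^ 4)^2 * integral QQ (%u. (cmod (vtp N c u $ j)) ^ 4)" for j
  unfolding vtp_nth Smul_def[abs_def] by (rule Beurling_multiplier_L4)
qed (auto intro!: continuous_intros)

lemma vtp_vfc_L4:
 assumes h: "continuous_on UNIV h" "!!j. biperiodic (%u. h u $ j)"
 shows "integral QQ (%u. (norm (vtp N (vfc h) u :: complex^'n)) ^ 4) <= (real CARD('n))^2 * 300 ^ 4 * integral QQ (%u. (norm (h u)) ^ 4)"
proof (rule integral_norm4_le)
 show "continuous_on QQ h" using h(1) continuous_on_subset by blast
 show "integral QQ (%u. (cmod (vtp N (vfc h) u $ j)) ^ 4) <= 300 ^ 4 * integral QQ (%u. (cmod (h u $ j)) ^ 4)" for j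
  using fc_projection_L4[of "%u. h u $ j" N] h by (auto simp: vfc_def intro!: continuous_intros)
qed (auto intro!: continuous_intros)

section \<open>Galerkin solutions\<close>

text \<open>A point of a side line is fixed by the reflection in that line, so its value is fixed by
  the corresponding reflection of values. For \<open>Im u = 2\<close> the reflection is
  \<open>cnj u + 4 * \<i>\<close>, that is \<open>cnj\<close> followed by a period.\<close>

lemma fsym_edges:
 assumes f: "fsym 1 (-1) \<i> f" "biperiodic f"
 shows "Re u = 0 ==> Re (f u) = 0" "Im u = 2 ==> Im (f u) = 0" "Re u = Im u ==> Re (f u) = Im (f u)"
proof -
 have s: "f (cnj u) = cnj (f u)" "f (- cnj u) = - cnj (f u)" "f (\<i> * cnj u) = \<i> * cnj (f u)"
  using f(1) by (auto simp: fsym_def)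
 show "Re (f u) = 0" if "Re u = 0"
 proof -
  have "- cnj u = u" using that by (simp add: complex_eq_iff)
  hence "Re (f u) = Re (- cnj (f u))" using s(2) by simp
  thus ?thesis by simp
 qed
 show "Im (f u) = 0" if "Im u = 2"
 proof -
  have "cnj u + 4 * \<i> = u" using that by (simp add: complex_eq_iff)
  hence "f u = cnj (f u)" using s(1) biperiodicD(2)[OF f(2)] by metis
  hence "Im (f u) = Im (cnj (f u))" by simp
  thus ?thesis by simp
 qed
 show "Re (f u) = Im (f u)" if "Re u = Im u"
 proof -
  have "\<i> * cnj u = u" using that by (simp add: complex_eq_iff)
  hence "Re (f u) = Re (\<i> * cnj (f u))" using s(3) by simp
  thus ?thesis by simp
 qed
qed

text \<open>On a side, \<open>u\<close> and \<open>f u\<close> satisfy the same linear equation, so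
  the sum stays on the side line and misses the open triangle. This holds for every symmetric
  \<open>f\<close> and is the source of both the boundary condition and the continuity of the
  reflected right-hand side.\<close>

lemma boundary_to_lines:
 assumes "fsym 1 (-1) \<i> f" "biperiodic f" "u \<in> TC - TT"
 shows "u + f u \<notin> TT"
 using fsym_edges[OF assms(1,2), of u] assms(3) by (auto simp: TC_def TT_def)

lemma Triangle_iff_TT: "z \<in> Triangle \<longleftrightarrow> (1 + \<i>) * (z + 1) \<in> TT"
 by (auto simp: Triangle_def TT_def abs_if)

lemma compact_TC: "compact TC" and convex_TC: "convex TC" and closed_TC: "closed TC"
proof -
 have T: "TC = {u. 0 <= Re u} \<inter> {u. Complex 1 (-1) \<bullet> u <= 0} \<inter> {u. Im u <= 2}"
  by (auto simp: TC_def inner_complex_def)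
 show "convex TC"
  by (subst T) (intro convex_Int convex_halfspace_Re_ge convex_halfspace_Im_le convex_halfspace_le)
 show c: "closed TC" unfolding TC_def
  by (intro closed_Collect_conj closed_Collect_le continuous_intros)
 have "TC = QQ \<inter> TC" using TC_subset_QQ by auto
 thus "compact TC" using c compact_Int_closed[OF compact_QQ c] by simp
qed

lemma open_TT: "open TT"
 unfolding TT_def by (intro open_Collect_conj open_Collect_less continuous_intros)

lemma eventually_nonneg_line:
 fixes W X :: real
 assumes "0 <= W" "W = 0 ==> 0 <= X"
 shows "\<forall>\<^sub>F t in at_right 0. 0 <= W + t * X"
proof (cases "W = 0")
 case True
 thus ?thesis using assms(2) by (auto simp: eventually_at_right_field intro!: exI[of _ 1])
next
 case False
 have "((%t. W + t * X) \<longlongrightarrow> W + 0 * X) (at_right 0)" by (intro tendsto_intros)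
 hence "\<forall>\<^sub>F t in at_right 0. 0 < W + t * X"
  using False assms(1) by (intro order_tendstoD(1)[where y = "W + 0 * X"]) auto
 thus ?thesis by eventually_elim simp
qed

text \<open>Let \<open>d\<close> be the defect \<open>p - f h - h\<close>. If a side condition is
  active at \<open>h\<close>, then \<open>h + f h\<close> lies on that side line while
  \<open>p\<close> lies strictly inside, so a small step from \<open>h\<close> along
  \<open>d\<close> stays in \<open>TC\<close>. The variational inequality for the closest point then
  gives \<open>d \<bullet> d <= 0\<close>.\<close>

lemma closest_point_hits_target:
 assumes f: "fsym 1 (-1) \<i> f" "biperiodic f" and p: "p \<in> TT" and h: "h = closest_point TC (p - f h)"
 shows "h + f h = p"
proof -
 have ne: "TC ~= {}" using p TT_subset by auto
 have \<tau>C: "h \<in> TC" using h closest_point_in_set[OF closed_TC ne] by metis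
 define d where "d = p - f h - h"
 note ed = fsym_edges[OF f, of h]
 have "\<forall>\<^sub>F t in at_right 0. 0 <= Re h + t * Re d"
  by (rule eventually_nonneg_line) (use \<tau>C p ed in "auto simp: TC_def TT_def d_def")
 moreover have "\<forall>\<^sub>F t in at_right 0. 0 <= (Im h - Re h) + t * (Im d - Re d)"
  by (rule eventually_nonneg_line) (use \<tau>C p ed in "auto simp: TC_def TT_def d_def")
 moreover have "\<forall>\<^sub>F t in at_right 0. 0 <= (2 - Im h) + t * (- Im d)"
  by (rule eventually_nonneg_line) (use \<tau>C p ed in "auto simp: TC_def TT_def d_def")
 moreover have "\<forall>\<^sub>F t in at_right 0. 0 < (t::real)" by (rule eventually_at_right_less)
 ultimately have "\<forall>\<^sub>F t in at_right 0. 0 < t & h + of_real t * d \<in> TC"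
  by eventually_elim (auto simp: TC_def algebra_simps)
 then obtain t where t: "0 < t" "h + of_real t * d \<in> TC"
  using eventually_happens'[OF trivial_limit_at_right_real] by blast
 have "(p - f h - closest_point TC (p - f h)) \<bullet> (h + of_real t * d - closest_point TC (p - f h)) <= 0"
  by (rule closest_point_dot[OF convex_TC closed_TC t(2)])
 hence "d \<bullet> (of_real t * d) <= 0" unfolding h[symmetric] d_def by simp
 hence "t * (d \<bullet> d) <= 0" by (simp add: scaleR_conv_of_real[symmetric])
 hence "d \<bullet> d <= 0" using t(1) by (simp add: mult_le_0_iff)
 hence "d = 0" by (metis inner_gt_zero_iff not_le)
 thus ?thesis unfolding d_def by (simp add: algebra_simps)
qed

lemma continuous_vtp_param:
 assumes "!!j k. k \<in> BX N ==> continuous_on S (%p. d p j k)" "continuous_on S g"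
 shows "continuous_on S (%p. vtp N (d p) (g p) :: complex^'n)"
 unfolding vtp_def tp_def using assms
 by (intro continuous_on_vec_lambda continuous_intros) auto

text \<open>The averaging projection onto the coefficients with \<open>csym 1 1 (-1)\<close>: the
  mean over the two commuting reflections, then over the third. It lets the fixed-point unknowns
  range over a full cube.\<close>

definition symC :: "(int * int => complex) => int * int => complex" where
 "symC c = (%(k, l). let q = (%(k, l). (c (k, l) + cnj (c (-k, l)) + cnj (c (k, -l)) + c (-k, -l)) / 4)
   in (q (k, l) - cnj (q (-l, -k))) / 2)"

lemma csym_symC: "csym 1 1 (-1) (symC c)"
 unfolding csym_def symC_def Let_def by (auto simp: field_simps)

lemma symC_id: "csym 1 1 (-1) c ==> symC c = c"
proof
 fix kl :: "int * int" assume c: "csym 1 1 (-1) c"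
 obtain k l where kl: "kl = (k, l)" by force
 have 1: "c (-k, l) = cnj (c (k, l))" "c (k, -l) = cnj (c (k, l))" "c (-k, -l) = c (k, l)" for k l
  using csymD(1)[OF c, where k = k and l = l] csymD(2)[OF c, where k = k and l = l]
   csymD(1)[OF c, where k = k and l = "-l"] by auto
 have 2: "c (-l, -k) = - cnj (c (k, l))"
  using csymD(3)[OF c, where k = k and l = l] by simp
 have "c (l, k) = - cnj (c (k, l))" using 2 1(3)[of l k] by simp
 thus "symC c kl = c kl"
  unfolding kl symC_def Let_def prod.case minus_minus 1 2 by simp
qed

locale cylinder_eq =
 fixes A :: "complex^'n => complex^'n^'n" and k :: 'n and a :: real
 assumes contA: "continuous_on UNIV A"
  and A0: "!!Z. Z \<notin> Cylinder k ==> A Z = 0"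
  and a: "0 < a" "a < 1"
  and Aa: "!!Z v. norm (A Z *v v) <= a * norm v"
begin

definition e0 :: "complex^'n" where "e0 = axis k 1"

text \<open>The map \<open>Z\<close> built from the correction \<open>F\<close>. It sends \<open>h\<close> to \<open>P\<close> as soon as its \<open>k\<close>-th
 coordinate does.\<close>

definition Zmap :: "complex^'n => (complex => complex^'n) => complex => complex => complex^'n" where
 "Zmap P F h u = (\<chi> j. if j = k then (u + F u $ k) / (1 + \<i>) - 1 else (F u $ j - F h $ j) / (1 + \<i>) + P $ j)"

lemma onei_ne: "1 + \<i> ~= 0" by (simp add: complex_eq_iff)

lemma Zmap_in_Cylinder: "Zmap P F h u \<in> Cylinder k \<longleftrightarrow> u + F u $ k \<in> TT"
 unfolding Cylinder_def Zmap_def using onei_ne by (simp add: Triangle_iff_TT)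

definition admissible :: "(complex => complex^'n) => bool" where
 "admissible F \<longleftrightarrow> continuous_on UNIV F & (ALL j. fsym 1 (-1) \<i> (%u. F u $ j)) & biperiodic F"

lemma admissible_vtp:
 assumes "!!j. csym 1 1 (-1) (c j)"
 shows "admissible (vtp N (%j. Fmul (c j)))"
 using fsym_tp[OF csym_Fmul[OF assms]] biperiodic_tp
 unfolding admissible_def vtp_def biperiodic_def
 by (auto simp: vec_eq_iff intro!: continuous_on_vec_lambda continuous_intros)

lemma continuous_Zmap: "continuous_on UNIV F ==> continuous_on S (Zmap P F h)"
 unfolding Zmap_def
proof (rule continuous_on_vec_lambda)
 fix i assume F: "continuous_on UNIV F"
 have Fc: "continuous_on S F" using F continuous_on_subset by blast
 show "continuous_on S (%u. if i = k then (u + F u $ k) / (1 + \<i>) - 1 else (F u $ i - F h $ i) / (1 + \<i>) + P $ i)"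
  by (cases "i = k") (auto intro!: continuous_intros Fc simp: onei_ne)
qed

text \<open>Boundary points of the triangle are mapped outside the open cylinder by the symmetry of
  \<open>F\<close>, and there \<open>A\<close> is 0.\<close>

lemma good_Zmap:
 assumes "admissible F"
 shows "good_coeff a (%e. A (Zmap P F h e))"
proof -
 have "A (Zmap P F h e) = 0" if "e \<in> TC - TT" for e
  using boundary_to_lines[of "%u. F u $ k" e] that assms
  by (intro A0) (auto simp: Zmap_in_Cylinder admissible_def biperiodic_def)
 moreover have "continuous_on TC (%e. A (Zmap P F h e))"
  by (rule continuous_on_compose2[OF contA continuous_Zmap]) (use assms in "auto simp: admissible_def")
 ultimately show ?thesis unfolding good_coeff_def using a Aa by auto
qed

lemma cnj_e0: "cnj (e0 $ j) = e0 $ j" by (simp add: e0_def axis_def)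

lemma norm_e0: "norm e0 = 1" by (simp add: e0_def)

definition RHS :: "complex^'n => (complex => complex^'n) => complex => (complex => complex^'n) => complex => complex^'n" where
 "RHS P F h w = TW (%e. A (Zmap P F h e)) w"

definition Sop :: "nat => ('n => int * int => complex) => complex => complex^'n" where
 "Sop N c = vtp N (%j. Smul (c j))"
definition Fop :: "nat => ('n => int * int => complex) => complex => complex^'n" where
 "Fop N c = vtp N (%j. Fmul (c j))"

lemma ssym_Sop: "(!!j. csym 1 1 (-1) (c j)) ==> ssym (Sop N c)"
 unfolding Sop_def by (intro ssym_vtp csym_Smul)

lemma integral_Sop_sq: "integral QQ (%u. (norm (e0 + Sop N c u))^2) <= 16 + csq N c"
 using Parseval_const_add[of "%j. Smul (c j)" e0 N] csq_Smul[of N c] by (simp add: Sop_def norm_e0)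

lemma continuous_Sop [continuous_intros]: "continuous_on S g ==> continuous_on S (%x. Sop N c (g x))"
 and continuous_Fop [continuous_intros]: "continuous_on S g ==> continuous_on S (%x. Fop N c (g x))"
 unfolding Sop_def Fop_def by (intro continuous_intros; assumption)+

text \<open>The fixed point of r |-> a^2 (16 + r): the squared radius of the L^2 ball that the
  truncated right-hand side maps into itself, where 16 is the squared norm of the constant field
  \<open>e0\<close>.\<close>

definition rho2 :: real where "rho2 = 16 * a^2 / (1 - a^2)"

lemma rho2: "0 < rho2" "a^2 * (16 + rho2) = rho2"
proof -
 have "a^2 < 1" using a by (simp add: abs_square_less_1)
 thus "0 < rho2" "a^2 * (16 + rho2) = rho2"
  using a by (auto simp: rho2_def field_simps)
qed

lemma csq_RHS_le:
 assumes "!!j. csym 1 1 (-1) (c j)" "admissible F"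
 shows "csq N (vfc (RHS P F h (%u. e0 + Sop M c u))) <= a^2 * (16 + csq M c)"
proof -
 have "csq N (vfc (RHS P F h (%u. e0 + Sop M c u))) <= integral QQ (%u. (norm (RHS P F h (%u. e0 + Sop M c u) u))^2)"
  unfolding RHS_def by (intro csq_vfc_le continuous_TW[OF good_Zmap[OF assms(2)]] continuous_intros)
 also have "... <= a^2 * integral QQ (%u. (norm (e0 + Sop M c u))^2)"
  unfolding RHS_def
  by (intro integral_TW_le[OF good_Zmap[OF assms(2)] ssym_Sop[OF assms(1)]] cnj_e0 continuous_intros)
 also have "... <= a^2 * (16 + csq M c)"
  by (intro mult_left_mono integral_Sop_sq) simp
 finally show ?thesis .
qed

text \<open>The equation projected to the frequencies of \<open>BX N\<close>, together with the
  unknown parameter \<open>h\<close> that is mapped to \<open>P\<close>. The right-hand side is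
  evaluated at the same \<open>c\<close> and \<open>h\<close>, so this is the full nonlinear
  coupling.\<close>

definition Galerkin :: "complex^'n => nat => ('n => int * int => complex) => complex => bool" where
 "Galerkin P N c h \<longleftrightarrow> (ALL j. csym 1 1 (-1) (c j)) & csq N c <= rho2 & h \<in> TC & (ALL j. c j 0 = 0) &
   Zmap P (Fop N c) h h = P &
   (ALL j. ALL l:BX N. c j l = vfc (RHS P (Fop N c) h (%u. e0 + Sop N c u)) j l)"

lemma csym_00:
 assumes "csym 1 1 (-1) c" shows "c 0 = 0"
 using csymD[OF assms, where k = 0 and l = 0] by (simp add: zero_prod_def complex_eq_iff)

text \<open>Real and imaginary parts of the coefficients and of \<open>h\<close> form one finite
  vector. Its components are made unconstrained by symmetrising, retracting to a ball and projecting
  to the triangle; all three turn out to be harmless at the fixed point.\<close>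

lemma Galerkin_exists:
 assumes P: "P \<in> Cylinder k"
 shows "EX c h. Galerkin P N c h"
proof -
 define p where "p = (1 + \<i>) * (P $ k + 1)"
 have p: "p \<in> TT" using P unfolding p_def Cylinder_def by (simp add: Triangle_iff_TT)
 have TCne: "TC ~= {}" using p TT_subset by auto
 define dec :: "(('n \<times> (int * int) \<times> bool) + bool => real) => 'n => int * int => complex"
  where "dec x j l = (if l \<in> BX N then Complex (x (Inl (j, l, False))) (x (Inl (j, l, True))) else 0)" for x j l
 define Y where "Y x j = symC (dec x j)" for x j
 \<comment> \<open>Radial retraction onto the ball of squared radius \<open>rho2\<close>, so that
   the bound for the right-hand side holds at every point of the cube.\<close>
 define lam where "lam x = sqrt rho2 / max (sqrt rho2) (sqrt (csq N (Y x)))" for x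
 define C where "C x j l = of_real (lam x) * Y x j l" for x j l
 define T where "T x = Complex (x (Inr False)) (x (Inr True))" for x :: "('n \<times> (int * int) \<times> bool) + bool => real"
 define H where "H x = RHS P (Fop N (C x)) (T x) (%u. e0 + Sop N (C x) u)" for x
 \<comment> \<open>The condition \<open>T x = T' x\<close> is a fixed-point form of the requirement
   that the point \<open>T x\<close> be mapped to \<open>P\<close>; see
   \<open>closest_point_hits_target\<close>.\<close>
 define T' where "T' x = closest_point TC (p - Fop N (C x) (T x) $ k)" for x
 define f where "f x i = (case i of Inl (j, l, b) => (if b then Im (vfc (H x) j l) else Re (vfc (H x) j l))
   | Inr b => (if b then Im (T' x) else Re (T' x)))" for x i
 define I where "I = (Inl ` (UNIV \<times> BX N \<times> UNIV) \<union> range Inr :: (('n \<times> (int * int) \<times> bool) + bool) set)"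
 have r: "0 < sqrt rho2" using rho2(1) by simp
 have csymY: "csym 1 1 (-1) (Y x j)" for x j unfolding Y_def by (rule csym_symC)
 have csymC: "csym 1 1 (-1) (C x j)" for x j
  unfolding csym_def
 proof (intro allI conjI)
  fix l m
  note c = csymD[OF csymY[of x j], where k = l and l = m]
  show "C x j (-l, m) = 1 * cnj (C x j (l, m))" "C x j (l, -m) = 1 * cnj (C x j (l, m))" "C x j (-m, -l) = -1 * cnj (C x j (l, m))"
   unfolding C_def c by simp_all
 qed
 have csqC: "csq N (C x) = (lam x)^2 * csq N (Y x)" for x
  unfolding csq_def C_def by (simp add: norm_mult power_mult_distrib sum_distrib_left mult_ac)
 have csqC_le: "csq N (C x) <= rho2" for x
 proof -
  have "lam x * sqrt (csq N (Y x)) <= sqrt rho2"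
   using r unfolding lam_def by (auto simp: max_def field_simps intro: mult_left_mono)
  moreover have "0 <= lam x * sqrt (csq N (Y x))"
   unfolding lam_def using r csq_nonneg[of N "Y x"] by (intro mult_nonneg_nonneg divide_nonneg_nonneg) (auto simp: max_def)
  ultimately have "(lam x * sqrt (csq N (Y x)))^2 <= (sqrt rho2)^2" by (intro power_mono)
  thus ?thesis unfolding csqC using csq_nonneg[of N "Y x"] rho2(1) by (simp add: power_mult_distrib)
 qed
 have adm: "admissible (Fop N (C x))" for x unfolding Fop_def by (intro admissible_vtp csymC)
 have csqH: "csq N (vfc (H x)) <= rho2" for x
 proof -
  have "csq N (vfc (H x)) <= a^2 * (16 + csq N (C x))" unfolding H_def by (intro csq_RHS_le csymC adm)
  also have "... <= a^2 * (16 + rho2)" by (intro mult_left_mono add_left_mono csqC_le) simp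
  finally show ?thesis by (simp add: rho2(2))
 qed
 have cdec: "continuous_on UNIV (%x. dec x j l)" for j l
  unfolding dec_def Complex_eq by (cases "l \<in> BX N") (auto intro!: continuous_intros)
 have cY: "continuous_on UNIV (%x. Y x j l)" for j l
  unfolding Y_def symC_def Let_def case_prod_beta by (intro continuous_intros cdec) auto
 have clam: "continuous_on UNIV lam"
  unfolding lam_def csq_def
  by (intro continuous_intros continuous_on_max cY) (use r in "auto simp: max_def split: if_splits")
 have cC: "continuous_on UNIV (%x. C x j l)" for j l
  unfolding C_def by (intro continuous_intros cY clam)
 have cC2: "continuous_on S (%q. C (fst q) j l)" for S :: "(_ \<times> complex) set" and j l
 proof (rule continuous_on_compose2[OF cC, where f = fst])
  show "continuous_on S fst" using continuous_on_fst[OF continuous_on_id, of S] by simp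
 qed auto
 have cT: "continuous_on UNIV T" unfolding T_def Complex_eq by (intro continuous_intros) auto
 have cF: "continuous_on S (%q. Fop N (C (fst q)) (g q))" if "continuous_on S g" for S :: "(_ \<times> complex) set" and g
  unfolding Fop_def Fmul_def
  by (intro continuous_vtp_param continuous_intros that cC2)
 have cS: "continuous_on S (%q. Sop N (C (fst q)) (snd q))" for S :: "(_ \<times> complex) set"
  unfolding Sop_def Smul_def
  by (intro continuous_vtp_param continuous_intros cC2)
 have cZ: "continuous_on S (%q. Zmap P (Fop N (C (fst q))) (T (fst q)) (snd q))" for S
  unfolding Zmap_def
 proof (rule continuous_on_vec_lambda)
  fix j
  have "continuous_on S (%q. T (fst q))" by (rule continuous_on_compose2[OF cT]) (auto intro: continuous_on_fst continuous_on_id simp del: continuous_on_coordinatewise_iff)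
  thus "continuous_on S (%q. if j = k then (snd q + Fop N (C (fst q)) (snd q) $ k) / (1 + \<i>) - 1
     else (Fop N (C (fst q)) (snd q) $ j - Fop N (C (fst q)) (T (fst q)) $ j) / (1 + \<i>) + P $ j)"
   by (cases "j = k") (auto intro!: continuous_intros cF simp: onei_ne)
 qed
 have cH: "continuous_on UNIV (%x. vfc (H x) j l)" for j l
 proof -
  have h0: "\<i> * (A (Zmap P (Fop N (C x)) (T x) e) *v cnj_vec (e0 + Sop N (C x) e)) $ j = 0" if "e \<in> TC - TT" for x e
   using good_coeffD(3)[OF good_Zmap[OF adm[of x], of P "T x"] that] by simp
  have "continuous_on (UNIV \<times> QQ) (%(x, u). H x u $ j)"
   unfolding H_def RHS_def TW_def vec_lambda_beta
  proof (rule continuous_tw)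
   show "continuous_on (UNIV \<times> TC) (%(x, e). \<i> * (A (Zmap P (Fop N (C x)) (T x) e) *v cnj_vec (e0 + Sop N (C x) e)) $ j)"
    unfolding case_prod_beta
    by (intro continuous_intros continuous_on_compose2[OF contA cZ] cS) auto
  qed (use h0 in auto)
  hence "continuous_on (UNIV \<times> cbox (Complex (-2) (-2)) (Complex 2 2)) (%(x, u). H x u $ j * ek (- l) u)"
   unfolding case_prod_beta QQ_def
   by (rule continuous_on_mult) (intro continuous_intros)
  hence "continuous_on UNIV (%x. integral (cbox (Complex (-2) (-2)) (Complex 2 2)) (%u. H x u $ j * ek (- l) u))"
   by (rule integral_continuous_on_param)
  thus ?thesis unfolding vfc_def fc_def QQ_def by (intro continuous_intros) auto
 qed
 have cT': "continuous_on UNIV T'"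
 proof -
  have "continuous_on UNIV (%x. (x, T x))" by (intro continuous_intros cT)
  hence "continuous_on UNIV (%x. Fop N (C (fst (x, T x))) (snd (x, T x)))"
   by (rule continuous_on_compose2[OF cF[OF continuous_on_snd[OF continuous_on_id], of UNIV]]) auto
  thus ?thesis unfolding T'_def
   by (intro continuous_on_compose2[OF continuous_on_closest_point[OF convex_TC closed_TC TCne, of UNIV]] continuous_intros) auto
 qed
 have "EX x. ALL i:I. f x i = x i"
 proof (rule Brouwer_finite_cube)
  show "finite I" unfolding I_def by auto
  \<comment> \<open>Coefficients of the right-hand side are at most \<open>sqrt rho2\<close>,
    coordinates of a point of \<open>TC\<close> at most 2.\<close>
  show "0 < sqrt rho2 + 2" using r by linarith
  show "continuous_on UNIV (%x. f x i)" for i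
  proof (cases i)
   case (Inl q)
   obtain j l b where "q = (j, l, b)" by (cases q)
   thus ?thesis unfolding f_def Inl by (cases b) (auto intro!: continuous_on_Re continuous_on_Im cH)
  next
   case (Inr b)
   thus ?thesis unfolding f_def Inr by (cases b) (auto intro!: continuous_on_Re continuous_on_Im cT')
  qed
  fix x i assume "i \<in> I"
  have vb: "cmod (vfc (H x) j l) <= sqrt rho2" if "l \<in> BX N" for j l
  proof -
   have "(cmod (vfc (H x) j l))^2 <= (SUM l:BX N. (cmod (vfc (H x) j l))^2)"
    by (rule member_le_sum) (use that in auto)
   also have "... <= (SUM j:UNIV. SUM l:BX N. (cmod (vfc (H x) j l))^2)"
    by (rule member_le_sum[of j]) (auto intro: sum_nonneg)
   also have "... <= csq N (vfc (H x))" unfolding csq_def by (simp add: sum_nonneg)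
   also have "... <= rho2" by (rule csqH)
   finally show ?thesis by (rule real_le_rsqrt)
  qed
  have "T' x \<in> TC" unfolding T'_def by (rule closest_point_in_set[OF closed_TC TCne])
  hence tb: "\<bar>Re (T' x)\<bar> <= 2" "\<bar>Im (T' x)\<bar> <= 2" by (auto simp: TC_def)
  show "\<bar>f x i\<bar> <= sqrt rho2 + 2"
  proof (cases i)
   case (Inl q)
   obtain j l b where q: "q = (j, l, b)" by (cases q)
   hence "l \<in> BX N" using \<open>i \<in> I\<close> unfolding Inl I_def by auto
   from vb[OF this, of j] show ?thesis unfolding f_def Inl q
    using abs_Re_le_cmod[of "vfc (H x) j l"] abs_Im_le_cmod[of "vfc (H x) j l"] by (auto split: if_splits)
  next
   case (Inr b)
   show ?thesis unfolding f_def Inr using tb r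
    by (cases b; simp only: sum.case if_True if_False simp_thms; linarith)
  qed
 qed
 then obtain x where x: "!!i. i \<in> I ==> f x i = x i" by blast
 have I: "Inr b \<in> I" "l \<in> BX N ==> Inl (j, l, b) \<in> I" for b j l
  unfolding I_def by auto
 have TT': "T x = T' x"
 proof (rule complex_eqI)
  show "Re (T x) = Re (T' x)" using x[OF I(1)[of False]] by (simp add: f_def T_def)
  show "Im (T x) = Im (T' x)" using x[OF I(1)[of True]] by (simp add: f_def T_def)
 qed
 have goodM: "good_coeff a (%e. A (Zmap P (Fop N (C x)) (T x) e))" by (intro good_Zmap adm)
 have csymH: "csym 1 1 (-1) (vfc (H x) j)" for j
  unfolding vfc_def H_def RHS_def
 proof (rule csym_fc)
  show "continuous_on QQ (%u. TW (%e. A (Zmap P (Fop N (C x)) (T x) e)) (%u. e0 + Sop N (C x) u) u $ j)"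
   by (rule continuous_on_component[OF continuous_TW[OF goodM]])
    (rule continuous_on_add[OF continuous_on_const continuous_Sop[OF continuous_on_id]])
 qed (rule fsym_TW)
 have decx: "dec x j l = (if l \<in> BX N then vfc (H x) j l else 0)" for j l
 proof (cases "l \<in> BX N")
  case True
  show ?thesis
  proof (rule complex_eqI)
   show "Re (dec x j l) = Re (if l \<in> BX N then vfc (H x) j l else 0)"
    using x[OF I(2)[OF True, of j False]] True by (simp add: f_def dec_def)
   show "Im (dec x j l) = Im (if l \<in> BX N then vfc (H x) j l else 0)"
    using x[OF I(2)[OF True, of j True]] True by (simp add: f_def dec_def)
  qed
 qed (simp add: dec_def)
 \<comment> \<open>The projected right-hand side is symmetric already, so at the fixed point
   \<open>symC\<close> changes nothing.\<close>
 have "csym 1 1 (-1) (dec x j)" for j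
  unfolding csym_def
 proof (intro allI conjI)
  fix l m
  note c = csymD[OF csymH[of j], where k = l and l = m]
  have B: "(-l, m) \<in> BX N \<longleftrightarrow> (l, m) \<in> BX N" "(l, -m) \<in> BX N \<longleftrightarrow> (l, m) \<in> BX N" "(-m, -l) \<in> BX N \<longleftrightarrow> (l, m) \<in> BX N"
   by (auto simp: BX_def)
  show "dec x j (-l, m) = 1 * cnj (dec x j (l, m))" "dec x j (l, -m) = 1 * cnj (dec x j (l, m))" "dec x j (-m, -l) = -1 * cnj (dec x j (l, m))"
   unfolding decx B c by simp_all
 qed
 hence "Y x j = dec x j" for j unfolding Y_def by (rule symC_id)
 hence Yx: "Y x = dec x" by (rule ext)
 have "csq N (Y x) = csq N (vfc (H x))"
  unfolding Yx csq_def by (intro arg_cong2[where f = "(*)"] refl sum.cong) (simp only: decx if_True)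
 \<comment> \<open>The bound for the right-hand side puts the fixed point inside the ball, so the
   retraction is the identity there.\<close>
 hence "csq N (Y x) <= rho2" using csqH[of x] by simp
 hence "max (sqrt rho2) (sqrt (csq N (Y x))) = sqrt rho2" by (simp add: max_absorb1)
 hence "lam x = 1" unfolding lam_def using r by simp
 hence Cx: "C x = dec x" unfolding C_def Yx by (simp add: fun_eq_iff)
 have "Galerkin P N (C x) (T x)"
  unfolding Galerkin_def
 proof (intro conjI allI ballI)
  show "csym 1 1 (-1) (C x j)" "C x j 0 = 0" for j by (rule csymC, rule csym_00[OF csymC])
  show "csq N (C x) <= rho2" by (rule csqC_le)
  have "T' x \<in> TC" unfolding T'_def by (rule closest_point_in_set[OF closed_TC TCne])
  thus "T x \<in> TC" by (subst TT')
  show "C x j l = vfc (RHS P (Fop N (C x)) (T x) (%u. e0 + Sop N (C x) u)) j l" if "l \<in> BX N" for j l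
   by (simp only: decx[of j l, unfolded Cx[symmetric] H_def] that if_True)
  have "T x + Fop N (C x) (T x) $ k = p"
  proof (rule closest_point_hits_target)
   show "fsym 1 (-1) \<i> (%u. Fop N (C x) u $ k)" "biperiodic (%u. Fop N (C x) u $ k)"
    using adm[of x] by (auto simp: admissible_def biperiodic_def)
   show "T x = closest_point TC (p - Fop N (C x) (T x) $ k)" using TT' unfolding T'_def .
  qed (rule p)
  thus "Zmap P (Fop N (C x)) (T x) (T x) = P"
   unfolding Zmap_def p_def using onei_ne by (simp add: vec_eq_iff)
 qed
 thus ?thesis by blast
qed

end

section \<open>\<open>L^p\<close> bounds for some \<open>p > 2\<close>\<close>

text \<open>Split at the level \<open>l\<close>: below it the square dominates, above it the fourth
  power. The free level is what allows a different balance for each term of a series.\<close>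

lemma powr_interpolate:
 fixes s l p :: real
 assumes "0 <= s" "0 < l" "2 < p" "p < 4"
 shows "s powr p <= l powr (p - 2) * s^2 + l powr (p - 4) * s ^ 4"
proof (cases "s = 0")
 case False
 hence s: "0 < s" using assms(1) by simp
 have e2: "s powr p = s powr (p - 2) * s^2" and e4: "s powr p = s powr (p - 4) * s ^ 4"
  using s by (simp_all add: powr_diff field_simps)
 show ?thesis
 proof (cases "s <= l")
  case True
  hence "s powr (p - 2) <= l powr (p - 2)" using assms s by (intro powr_mono2) auto
  hence "s powr p <= l powr (p - 2) * s^2" unfolding e2 by (intro mult_right_mono) auto
  thus ?thesis by (rule order_trans) simp
 next
  case False
  hence "s powr (p - 4) <= l powr (p - 4)" using assms s by (intro powr_mono2') auto
  hence "s powr p <= l powr (p - 4) * s ^ 4" unfolding e4 by (intro mult_right_mono) auto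
  thus ?thesis by (rule order_trans) simp
 qed
qed (use assms in auto)

text \<open>With S the sum on the right, each \<open>norm (v m)\<close> is at most
  \<open>S powr (1 / p) * y ^ m\<close>, and these majorants form a geometric series. The bound does
  not depend on the number of terms.\<close>

lemma norm_sum_powr_le:
 fixes v :: "nat => 'a::real_normed_vector"
 assumes y: "0 < y" "y < 1" and p: "1 <= p"
 shows "norm (\<Sum>m<L. v m) powr p <= (1 - y) powr (- p) * (\<Sum>m<L. (norm (v m) / y ^ m) powr p)"
proof -
 define S where "S = (\<Sum>m<L. (norm (v m) / y ^ m) powr p)"
 have S0: "0 <= S" unfolding S_def by (intro sum_nonneg) simp
 have v: "norm (v m) <= S powr (1 / p) * y ^ m" if "m < L" for m
 proof -
  have "(norm (v m) / y ^ m) powr p <= S" unfolding S_def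
   by (rule member_le_sum[of m "{..<L}" "%m. (norm (v m) / y ^ m) powr p"]) (use that in auto)
  hence "((norm (v m) / y ^ m) powr p) powr (1 / p) <= S powr (1 / p)"
   using p by (intro powr_mono2) auto
  hence "norm (v m) / y ^ m <= S powr (1 / p)"
   using p y by (simp add: powr_powr)
  thus ?thesis using y by (simp add: field_simps)
 qed
 have "norm (\<Sum>m<L. v m) <= (\<Sum>m<L. S powr (1 / p) * y ^ m)"
  by (rule order_trans[OF norm_sum sum_mono]) (use v in auto)
 also have "... = S powr (1 / p) * ((1 - y ^ L) / (1 - y))"
  using y by (simp add: sum_distrib_left[symmetric] sum_gp_strict)
 also have "... <= S powr (1 / p) * (1 / (1 - y))"
  using y by (intro mult_left_mono divide_right_mono) auto
 finally have "norm (\<Sum>m<L. v m) powr p <= (S powr (1 / p) * (1 / (1 - y))) powr p"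
  using p by (intro powr_mono2) auto
 also have "... = S * (1 - y) powr (- p)"
 proof -
  have "(1 / (1 - y)) powr p = (1 - y) powr (- p)"
   using y by (simp add: powr_divide powr_minus_divide)
  thus ?thesis using p S0 y by (subst powr_mult) (auto simp: powr_powr)
 qed
 finally show ?thesis unfolding S_def by (simp add: mult.commute)
qed

lemma continuous_on_norm_powr [continuous_intros]:
 fixes f :: "'a::topological_space => 'b::real_normed_vector"
 assumes "continuous_on S f" "0 < p"
 shows "continuous_on S (%x. norm (f x) powr p)"
 using assms by (intro continuous_on_powr' continuous_intros) auto

lemma vtp_cong: "(!!j l. l \<in> BX N ==> c j l = d j l) ==> vtp N c = vtp N d"
 unfolding vtp_def tp_def fun_eq_iff by (auto simp: vec_eq_iff intro!: sum.cong)

lemma vtp_add: "vtp N (%j l. c j l + d j l) z = vtp N c z + vtp N d z"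
 by (auto simp: vec_eq_iff tp_def sum.distrib distrib_right)

lemma vtp_sum: "vtp N (%j l. \<Sum>m<L::nat. t m j l) z = (\<Sum>m<L. vtp N (t m) z)"
 by (induction L) (simp_all add: vtp_add vec_eq_iff)

lemma norm_vtp_le: "norm (vtp N c z :: complex^'n) <= real CARD('n) * real (card (BX N)) * sqrt (csq N c)"
proof -
 have b: "cmod (c j l) <= sqrt (csq N c)" if "l \<in> BX N" for j l
 proof -
  have "(cmod (c j l))^2 <= (SUM l:BX N. (cmod (c j l))^2)"
   by (rule member_le_sum) (use that in auto)
  also have "... <= (SUM j:UNIV. SUM l:BX N. (cmod (c j l))^2)"
   by (rule member_le_sum[of j]) (auto intro: sum_nonneg)
  also have "... <= csq N c" unfolding csq_def by (simp add: sum_nonneg)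
  finally show ?thesis by (rule real_le_rsqrt)
 qed
 have "norm (vtp N c z :: complex^'n) <= (SUM j:UNIV. cmod (tp N (c j) z))"
  unfolding norm_vec_def using L2_set_le_sum[of UNIV "%j. cmod (tp N (c j) z)"] by simp
 also have "... <= (SUM j:(UNIV::'n set). SUM l:BX N. sqrt (csq N c))"
  unfolding tp_def by (intro sum_mono order_trans[OF norm_sum] sum_mono) (simp add: norm_mult b)
 also have "... = real CARD('n) * real (card (BX N)) * sqrt (csq N c)" by simp
 finally show ?thesis .
qed

lemma csym_diff:
 assumes "csym a1 a2 a3 c" "csym a1 a2 a3 d" shows "csym a1 a2 a3 (%l. c l - d l)"
 unfolding csym_def
proof (intro allI conjI)
 fix k l
 note c = csymD[OF assms(1), where k = k and l = l] and d = csymD[OF assms(2), where k = k and l = l]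
 show "c (-k, l) - d (-k, l) = a1 * cnj (c (k, l) - d (k, l))" "c (k, -l) - d (k, -l) = a2 * cnj (c (k, l) - d (k, l))"
  "c (-l, -k) - d (-l, -k) = a3 * cnj (c (k, l) - d (k, l))"
  unfolding c d by (simp_all add: right_diff_distrib)
qed

lemma csym_vfc_TW:
 assumes "good_coeff a M" "continuous_on TC w"
 shows "csym 1 1 (-1) (vfc (TW M w) j)"
 unfolding vfc_def
 by (rule csym_fc[OF continuous_on_component[OF continuous_TW[OF assms]] fsym_TW])

lemma Smul_diff: "Smul (%l. c l - d l) = (%l. Smul c l - Smul d l)"
 unfolding Smul_def fun_eq_iff right_diff_distrib by simp

lemma vtp_diff: "vtp N (%j l. c j l - d j l) z = vtp N c z - vtp N d z"
 by (auto simp: vec_eq_iff tp_def sum_subtractf left_diff_distrib)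

lemma vfc_add:
 assumes "continuous_on QQ f" "continuous_on QQ g"
 shows "vfc (%z. f z + g z) j l = vfc f j l + vfc g j l"
 unfolding vfc_def by (simp add: fc_add continuous_intros assms)

lemma vfc_diff:
 assumes "continuous_on QQ f" "continuous_on QQ g"
 shows "vfc (%z. f z - g z) j l = vfc f j l - vfc g j l"
 unfolding vfc_def by (simp add: fc_diff continuous_intros assms)

context cylinder_eq begin

section \<open>Neumann series for frozen coefficients\<close>

definition K1 :: real where "K1 = (real CARD('n))^2 * 300 ^ 4"
definition K2 :: real where "K2 = (real CARD('n))^2 * (300 * pi ^ 4)^2"

lemma K_ge1: "1 <= K1" "1 <= K2"
proof -
 have n: "1 <= (real CARD('n))^2" by (simp add: Suc_leI)
 have "1 <= pi ^ 4" using pi_gt3 by (intro one_le_power) simp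
 hence "1 <= (300 * pi ^ 4)^2" by (intro one_le_power) simp
 hence "1 * 1 <= (real CARD('n))^2 * (300 * pi ^ 4)^2" using n by (intro mult_mono) auto
 moreover have "1 * 1 <= (real CARD('n))^2 * 300 ^ 4" using n by (intro mult_mono) auto
 ultimately show "1 <= K1" "1 <= K2" unfolding K1_def K2_def by simp_all
qed

text \<open>The terms of the Neumann series of \<open>u = \<Pi> A(Z) cnj(e0 + S u)\<close>.\<close>

fun nterm :: "(complex => complex^'n^'n) => nat => nat => 'n => int * int => complex" where
 "nterm M N 0 = vfc (TW M (%_. e0))"
| "nterm M N (Suc m) = vfc (TW M (Sop N (nterm M N m)))"

context
 fixes M :: "complex => complex^'n^'n" assumes M: "good_coeff a M"
begin

lemma csym_nterm: "csym 1 1 (-1) (nterm M N m j)"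
 by (cases m) (auto intro!: csym_vfc_TW[OF M] continuous_Sop[OF continuous_on_id] continuous_on_const)

lemma cont_TW_Sop: "continuous_on S (TW M (Sop N c))" "continuous_on S (TW M (%_. e0))" "continuous_on S (TW M (%z. e0 + Sop N c z))"
 by (intro continuous_TW[OF M] continuous_Sop[OF continuous_on_id] continuous_on_const continuous_on_add)+

lemma csq_step:
 assumes "!!j. csym 1 1 (-1) (c j)"
 shows "csq N (vfc (TW M (Sop N c))) <= a^2 * csq N c"
proof -
 have "csq N (vfc (TW M (Sop N c))) <= integral QQ (%z. (norm (TW M (Sop N c) z))^2)"
  by (intro csq_vfc_le cont_TW_Sop)
 also have "... <= a^2 * integral QQ (%z. (norm (Sop N c z))^2)"
  using integral_TW_le[OF M ssym_Sop[OF assms] continuous_Sop[OF continuous_on_id], where e = 0 and m = 2] by simp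
 also have "... <= a^2 * csq N c"
  unfolding Sop_def Parseval_vtp by (intro mult_left_mono csq_Smul) simp
 finally show ?thesis .
qed

lemma L4_step:
 assumes "!!j. csym 1 1 (-1) (c j)"
 shows "integral QQ (%z. (norm (vtp N (vfc (TW M (Sop N c))) z)) ^ 4) <= K1 * integral QQ (%z. (norm (Sop N c z)) ^ 4)"
proof -
 have "integral QQ (%z. (norm (vtp N (vfc (TW M (Sop N c))) z)) ^ 4) <= K1 * integral QQ (%z. (norm (TW M (Sop N c) z)) ^ 4)"
  unfolding K1_def by (intro vtp_vfc_L4 cont_TW_Sop biperiodic_TW)
 also have "... <= K1 * (a ^ 4 * integral QQ (%z. (norm (Sop N c z)) ^ 4))"
  using integral_TW_le[OF M ssym_Sop[OF assms] continuous_Sop[OF continuous_on_id], where e = 0 and m = 4] K_ge1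
  by (intro mult_left_mono) auto
 also have "... <= K1 * (1 * integral QQ (%z. (norm (Sop N c z)) ^ 4))"
  using K_ge1 a by (intro mult_left_mono mult_right_mono power_le_one integral_nonneg integrable_QQ continuous_intros) auto
 finally show ?thesis by simp
qed

lemma csq_nterm: "csq N (nterm M N m) <= 16 * (a^2) ^ m"
proof (induction m)
 case 0
 have "csq N (nterm M N 0) <= integral QQ (%z. (norm (TW M (%_. e0) z))^2)"
  unfolding nterm.simps by (intro csq_vfc_le cont_TW_Sop)
 also have "... <= integral QQ (%_::complex. 1)"
 proof (intro integral_le integrable_QQ continuous_intros cont_TW_Sop)
  fix z
  have "norm (TW M (%_. e0) z) <= a" using norm_TW_le[OF M, of "%_. e0" z] by (simp add: norm_e0)
  thus "(norm (TW M (%_. e0) z))^2 <= 1" using a by (intro power_le_one) auto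
 qed
 also have "... = 16" using content_QQ by (simp add: QQ_def)
 finally show ?case by simp
next
 case (Suc m)
 have "csq N (nterm M N (Suc m)) <= a^2 * csq N (nterm M N m)"
  unfolding nterm.simps by (rule csq_step[OF csym_nterm])
 also have "... <= a^2 * (16 * (a^2) ^ m)" by (intro mult_left_mono Suc) simp
 finally show ?case by simp
qed

lemma L4_Sop: "integral QQ (%z. (norm (Sop N c z)) ^ 4) <= K2 * integral QQ (%z. (norm (vtp N c z)) ^ 4)"
 unfolding Sop_def K2_def by (rule vtp_Smul_L4)

text \<open>Each step costs at most \<open>K2\<close> for the Beurling transform and
  \<open>K1\<close> for the truncation; the factor \<open>a ^ 4\<close> is simply bounded by 1,
  since growth here will be beaten by the L^2 decay.\<close>

lemma L4_nterm: "integral QQ (%z. (norm (vtp N (nterm M N m) z)) ^ 4) <= 16 * K1 * (K1 * K2) ^ m"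
proof (induction m)
 case 0
 have "integral QQ (%z. (norm (vtp N (nterm M N 0) z)) ^ 4) <= K1 * integral QQ (%z. (norm (TW M (%_. e0) z)) ^ 4)"
  unfolding nterm.simps K1_def by (intro vtp_vfc_L4 cont_TW_Sop biperiodic_TW)
 also have "... <= K1 * integral QQ (%_::complex. 1)"
 proof (intro mult_left_mono integral_le integrable_QQ continuous_intros cont_TW_Sop)
  fix z
  have "norm (TW M (%_. e0) z) <= a" using norm_TW_le[OF M, of "%_. e0" z] by (simp add: norm_e0)
  thus "(norm (TW M (%_. e0) z)) ^ 4 <= 1" using a by (intro power_le_one) auto
 qed (use K_ge1 in auto)
 also have "... = 16 * K1" using content_QQ by (simp add: QQ_def)
 finally show ?case by simp
next
 case (Suc m)
 have "integral QQ (%z. (norm (vtp N (nterm M N (Suc m)) z)) ^ 4) <= K1 * integral QQ (%z. (norm (Sop N (nterm M N m) z)) ^ 4)"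
  unfolding nterm.simps by (rule L4_step[OF csym_nterm])
 also have "... <= K1 * (K2 * integral QQ (%z. (norm (vtp N (nterm M N m) z)) ^ 4))"
  by (intro mult_left_mono L4_Sop) (use K_ge1 in auto)
 also have "... <= K1 * (K2 * (16 * K1 * (K1 * K2) ^ m))"
  by (intro mult_left_mono Suc) (use K_ge1 in auto)
 finally show ?case by (simp add: mult_ac)
qed

end

definition KK :: real where "KK = K1 * K2"
text \<open>The exponent is close enough to 2 that \<open>(2 * KK) powr (ex - 2)\<close> is at most
  \<open>1 / a\<close>, half of the L^2 decay rate \<open>a^2\<close>. The cap 1/2 keeps
  \<open>ex\<close> below 3, which makes the L^4 part decay as well.\<close>

definition ex :: real where "ex = 2 + min (1/2) (ln (1 / a) / ln (2 * KK))"

lemma KK: "1 <= KK" "K1 <= KK"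
 using K_ge1 mult_mono[of 1 K1 1 K2] mult_left_mono[of 1 K2 K1] by (auto simp: KK_def)

lemma ex: "2 < ex" "ex < 3" "(2 * KK) powr (ex - 2) * a^2 <= a"
proof -
 have l: "0 < ln (1 / a)" "0 < ln (2 * KK)" using a KK by auto
 thus "2 < ex" "ex < 3" unfolding ex_def by auto
 have "(2 * KK) powr (ex - 2) <= (2 * KK) powr (ln (1 / a) / ln (2 * KK))"
  using KK by (intro powr_mono) (auto simp: ex_def)
 also have "... = 1 / a" using l KK a by (simp add: powr_def exp_minus inverse_eq_divide ln_div)
 finally have "(2 * KK) powr (ex - 2) * a^2 <= 1 / a * a^2" by (intro mult_right_mono) auto
 thus "(2 * KK) powr (ex - 2) * a^2 <= a" using a by (simp add: power2_eq_square)
qed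

text \<open>A common ratio for the two parts of the interpolation: \<open>a\<close> for the L^2
  part, 1/2 for the L^4 part.\<close>

definition sg :: real where "sg = max a (1/2)"

lemma sg: "0 < sg" "sg < 1" "a <= sg" "1/2 <= sg" using a by (auto simp: sg_def)

text \<open>Interpolation at the level \<open>(2 * KK) ^ m\<close>. The L^2 part carries the factor
  \<open>((2 * KK) powr (ex - 2) * a^2) ^ m\<close>, at most \<open>a ^ m\<close>; the L^4 part
  carries \<open>((2 * KK) powr (ex - 4) * KK) ^ m\<close>, at most 2^(-m) because
  \<open>ex - 4 < -1\<close>.\<close>

lemma integral_powr_term:
 fixes v :: "complex => complex^'n"
 assumes v: "continuous_on QQ v" and 2: "integral QQ (%z. (norm (v z))^2) <= 16 * (a^2) ^ m"
  and 4: "integral QQ (%z. (norm (v z)) ^ 4) <= 16 * KK ^ 2 * KK ^ m"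
 shows "integral QQ (%z. norm (v z) powr ex) <= 32 * KK^2 * sg ^ m"
proof -
 define l where "l = (2 * KK) ^ m"
 have KK0: "0 < KK" using KK by linarith
 have l: "0 < l" unfolding l_def using KK0 by simp
 have lp: "l powr b = ((2 * KK) powr b) ^ m" for b
 proof -
  have "0 < 2 * KK" using KK0 by simp
  hence "l powr b = ((2 * KK) powr real m) powr b" unfolding l_def by (simp only: powr_realpow)
  also have "... = (2 * KK) powr (real m * b)" by (rule powr_powr)
  also have "... = ((2 * KK) powr b) ^ m" using KK0 by (subst powr_power) auto
  finally show ?thesis .
 qed
 have "integral QQ (%z. norm (v z) powr ex) <=
   integral QQ (%z. l powr (ex - 2) * (norm (v z))^2 + l powr (ex - 4) * (norm (v z)) ^ 4)"
  using ex l by (intro integral_le integrable_QQ continuous_intros v powr_interpolate) auto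
 also have "... = l powr (ex - 2) * integral QQ (%z. (norm (v z))^2) + l powr (ex - 4) * integral QQ (%z. (norm (v z)) ^ 4)"
  by (subst integral_add) (auto intro!: integrable_QQ continuous_intros v)
 also have "... <= l powr (ex - 2) * (16 * (a^2) ^ m) + l powr (ex - 4) * (16 * KK ^ 2 * KK ^ m)"
  using 2 4 by (intro add_mono mult_left_mono) auto
 also have "l powr (ex - 2) * (16 * (a^2) ^ m) <= 16 * sg ^ m"
 proof -
  have "l powr (ex - 2) * (a^2) ^ m = ((2 * KK) powr (ex - 2) * a^2) ^ m"
   unfolding lp by (simp add: power_mult_distrib)
  also have "... <= sg ^ m" using ex(3) sg by (intro power_mono) auto
  finally show ?thesis by simp
 qed
 also have "l powr (ex - 4) * (16 * KK ^ 2 * KK ^ m) <= 16 * KK^2 * sg ^ m"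
 proof -
  have "(2 * KK) powr (ex - 4) <= (2 * KK) powr (- 1)"
   using ex KK by (intro powr_mono) auto
  also have "... = 1 / (2 * KK)" using KK0 by (simp add: powr_minus_divide)
  finally have "(2 * KK) powr (ex - 4) * KK <= 1 / (2 * KK) * KK" using KK0 by (intro mult_right_mono) auto
  hence "(2 * KK) powr (ex - 4) * KK <= sg" using KK0 sg(4) by simp
  hence "((2 * KK) powr (ex - 4) * KK) ^ m <= sg ^ m" using KK0 by (intro power_mono) auto
  hence "l powr (ex - 4) * KK ^ m <= sg ^ m" unfolding lp by (simp add: power_mult_distrib)
  hence "16 * KK^2 * (l powr (ex - 4) * KK ^ m) <= 16 * KK^2 * sg ^ m" by (intro mult_left_mono) auto
  thus ?thesis by (simp add: mult_ac)
 qed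
 also have "16 * sg ^ m + 16 * KK^2 * sg ^ m <= 32 * KK^2 * sg ^ m"
 proof -
  have "1 <= KK^2" using KK by (intro one_le_power) auto
  hence "sg ^ m * 1 <= sg ^ m * KK^2" using sg by (intro mult_left_mono) auto
  thus ?thesis by (simp add: mult_ac)
 qed
 finally show ?thesis by simp
qed

definition Cp :: real where
 "Cp = 2 powr ex * ((1 - root 6 sg) powr (- ex) * (32 * KK^2 / (1 - sqrt sg)) + 16)"

lemma integral_powr_series:
 fixes v :: "nat => complex => complex^'n"
 assumes v: "!!m. continuous_on QQ (v m)" "continuous_on QQ r"
  and t: "!!m. integral QQ (%z. norm (v m z) powr ex) <= 32 * KK^2 * sg ^ m"
  and r: "!!z. norm (r z) <= 1"
 shows "integral QQ (%z. norm ((\<Sum>m<L. v m z) + r z) powr ex) <= Cp"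
proof -
 \<comment> \<open>The sixth root: since \<open>ex < 3\<close>, the weights \<open>y ^ m\<close>
   cost at most \<open>y ^ (-3 m)\<close>, which is \<open>q ^ (-m)\<close> with \<open>q\<close>
   the square root of \<open>sg\<close>. Of the decay \<open>sg ^ m\<close> a factor
   \<open>q ^ m\<close> survives.\<close>
 define y where "y = root 6 sg"
 have y: "0 < y" "y < 1" "y ^ 6 = sg" using sg by (auto simp: y_def real_root_pow_pos2)
 define q where "q = sqrt sg"
 have q: "0 < q" "q < 1" using sg by (auto simp: q_def)
 have qr: "y ^ 3 = q"
 proof -
  have "(y ^ 3)^2 = sg" using y(3) by (simp add: power_mult[symmetric])
  thus ?thesis unfolding q_def using y by (metis real_sqrt_unique zero_le_power less_imp_le)
 qed
 have cv: "continuous_on QQ (%z. (norm (v m z) / y ^ m) powr ex)" for m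
 proof -
  have "continuous_on QQ (%z. norm (v m z) powr ex / (y ^ m) powr ex)"
   using ex y by (intro continuous_intros v) auto
  thus ?thesis using y by (simp add: powr_divide)
 qed
 have term_le: "integral QQ (%z. (norm (v m z) / y ^ m) powr ex) <= 32 * KK^2 * q ^ m" for m
 proof -
  have "(norm (v m z) / y ^ m) powr ex <= (1 / q ^ m) * norm (v m z) powr ex" for z
  proof -
   have "(1 / y ^ m) powr ex <= (1 / y ^ m) powr 3"
    using ex y by (intro powr_mono) (auto simp: power_le_one)
   also have "... = (1 / y ^ m) ^ 3" using y by (subst powr_numeral) auto
   also have "... = 1 / q ^ m" unfolding qr[symmetric] by (simp add: power_mult[symmetric] power_divide mult.commute)
   finally have "(1 / y ^ m) powr ex * norm (v m z) powr ex <= (1 / q ^ m) * norm (v m z) powr ex"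
    by (intro mult_right_mono) auto
   thus ?thesis using y by (simp add: powr_mult[symmetric])
  qed
  hence "integral QQ (%z. (norm (v m z) / y ^ m) powr ex) <= integral QQ (%z. (1 / q ^ m) * norm (v m z) powr ex)"
   using ex by (intro integral_le integrable_QQ cv continuous_intros v) auto
  also have "... = (1 / q ^ m) * integral QQ (%z. norm (v m z) powr ex)" by (rule integral_mult_right)
  also have "... <= (1 / q ^ m) * (32 * KK^2 * sg ^ m)" using q by (intro mult_left_mono t) auto
  also have "sg ^ m = q ^ m * q ^ m" using sg unfolding q_def by (simp add: power_mult_distrib[symmetric])
  also have "(1 / q ^ m) * (32 * KK^2 * (q ^ m * q ^ m)) = 32 * KK^2 * q ^ m" using q by simp
  finally show ?thesis .
 qed
 have pw: "norm ((\<Sum>m<L. v m z) + r z) powr ex <=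
   2 powr ex * ((1 - y) powr (- ex) * (\<Sum>m<L. (norm (v m z) / y ^ m) powr ex) + 1)" for z
 proof -
  let ?x = "norm (\<Sum>m<L. v m z)"
  have "norm ((\<Sum>m<L. v m z) + r z) <= 2 * max ?x 1"
   using norm_triangle_ineq[of "\<Sum>m<L. v m z" "r z"] r[of z] by (auto simp: max_def)
  hence "norm ((\<Sum>m<L. v m z) + r z) powr ex <= (2 * max ?x 1) powr ex"
   using ex by (intro powr_mono2) auto
  also have "... = 2 powr ex * (max ?x 1) powr ex" by (rule powr_mult)
  also have "(max ?x 1) powr ex <= ?x powr ex + 1" by (auto simp: max_def)
  also have "?x powr ex <= (1 - y) powr (- ex) * (\<Sum>m<L. (norm (v m z) / y ^ m) powr ex)"
   by (rule norm_sum_powr_le) (use y ex in auto)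
  finally show ?thesis by (auto intro: mult_left_mono)
 qed
 have "integral QQ (%z. norm ((\<Sum>m<L. v m z) + r z) powr ex) <=
   integral QQ (%z. 2 powr ex * ((1 - y) powr (- ex) * (\<Sum>m<L. (norm (v m z) / y ^ m) powr ex) + 1))"
  using ex by (intro integral_le integrable_QQ continuous_on_norm_powr continuous_on_add continuous_on_sum continuous_on_mult continuous_on_const v cv pw) simp_all
 also have "... = 2 powr ex * ((1 - y) powr (- ex) * (\<Sum>m<L. integral QQ (%z. (norm (v m z) / y ^ m) powr ex)) + 16)"
 proof -
  have c: "continuous_on QQ (%z. (1 - y) powr (- ex) * (\<Sum>m<L. (norm (v m z) / y ^ m) powr ex))"
   by (intro continuous_on_mult continuous_on_const continuous_on_sum cv)
  have "integral QQ (%z. (1 - y) powr (- ex) * (\<Sum>m<L. (norm (v m z) / y ^ m) powr ex) + 1) =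
   (1 - y) powr (- ex) * (\<Sum>m<L. integral QQ (%z. (norm (v m z) / y ^ m) powr ex)) + integral QQ (%_::complex. 1)"
   by (subst integral_add[OF integrable_QQ[OF c] integrable_QQ[OF continuous_on_const]], subst integral_mult_right,
     subst integral_sum) (auto intro!: integrable_QQ cv)
  thus ?thesis using content_QQ by (simp add: QQ_def)
 qed
 also have "... <= 2 powr ex * ((1 - y) powr (- ex) * (\<Sum>m<L. 32 * KK^2 * q ^ m) + 16)"
  by (intro mult_left_mono add_mono sum_mono term_le) auto
 also have "... <= 2 powr ex * ((1 - y) powr (- ex) * (32 * KK^2 / (1 - q)) + 16)"
 proof (intro mult_left_mono add_mono)
  have "(\<Sum>m<L. 32 * KK^2 * q ^ m) = 32 * KK^2 * ((1 - q ^ L) / (1 - q))"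
   using q by (simp add: sum_distrib_left[symmetric] sum_gp_strict)
  also have "... <= 32 * KK^2 * (1 / (1 - q))" using q by (intro mult_left_mono divide_right_mono) auto
  finally show "(\<Sum>m<L. 32 * KK^2 * q ^ m) <= 32 * KK^2 / (1 - q)" by simp
 qed auto
 finally show ?thesis unfolding Cp_def y_def q_def .
qed

text \<open>With the coefficient \<open>M\<close> frozen the equation is real-affine in
  \<open>c\<close>, so the solution is a partial Neumann sum plus a remainder. All fields lie in the
  finite-dimensional space of frequencies \<open>BX N\<close>, so enough steps make the remainder at
  most 1 in the sup norm. The number of steps depends on \<open>N\<close>, the resulting bound
  \<open>Cp\<close> does not.\<close>

lemma Galerkin_Lp:
 assumes G: "Galerkin P N c h"
 shows "integral QQ (%z. norm (vtp N c z) powr ex) <= Cp" "integral QQ (%z. norm (Sop N c z) powr ex) <= Cp"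
proof -
 define M where "M = (%W. A (Zmap P (Fop N c) h W))"
 have cs: "csym 1 1 (-1) (c j)" for j using G unfolding Galerkin_def by blast
 have M: "good_coeff a M" unfolding M_def Fop_def by (intro good_Zmap admissible_vtp cs)
 have fix_eq: "c j l = vfc (TW M (%z. e0 + Sop N c z)) j l" if "l \<in> BX N" for j l
  using G that unfolding Galerkin_def RHS_def M_def by blast
 define rem where "rem L j l = c j l - (\<Sum>m<L. nterm M N m j l)" for L j l
 \<comment> \<open>The remainders satisfy the homogeneous recursion, which contracts
   \<open>csq\<close> by \<open>a^2\<close> per step.\<close>
 have rem_Suc: "rem (Suc L) j l = vfc (TW M (Sop N (rem L))) j l" if "l \<in> BX N" for L j l
  using that
 proof (induction L arbitrary: j l)
  case 0
  have r0: "rem 0 = c" by (simp add: rem_def fun_eq_iff)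
  have "c j l = vfc (%z. TW M (%_. e0) z + TW M (Sop N c) z) j l"
   unfolding fix_eq[OF 0] TW_add ..
  also have "... = nterm M N 0 j l + vfc (TW M (Sop N c)) j l"
   by (simp add: vfc_add cont_TW_Sop[OF M])
  finally show ?case unfolding r0 by (simp add: rem_def)
 next
  case (Suc L)
  have e: "Sop N (rem (Suc L)) z = Sop N (rem L) z - Sop N (nterm M N L) z" for z
   unfolding Sop_def rem_def vtp_diff[symmetric] Smul_diff[symmetric] by (simp add: algebra_simps)
  have "vfc (TW M (Sop N (rem (Suc L)))) j l = vfc (%z. TW M (Sop N (rem L)) z - TW M (Sop N (nterm M N L)) z) j l"
   unfolding TW_diff[symmetric] e[symmetric] by simp
  also have "... = rem (Suc L) j l - nterm M N (Suc L) j l"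
   unfolding Suc.IH[OF Suc.prems] by (simp add: vfc_diff cont_TW_Sop[OF M])
  also have "... = rem (Suc (Suc L)) j l" by (simp add: rem_def)
  finally show ?case by simp
 qed
 have cs_rem: "csym 1 1 (-1) (rem L j)" for L j
 proof (induction L)
  case 0
  thus ?case using cs by (simp add: rem_def[abs_def])
 next
  case (Suc L)
  have "rem (Suc L) j = (%l. rem L j l - nterm M N L j l)" by (simp add: rem_def fun_eq_iff)
  thus ?case using csym_diff[OF Suc csym_nterm[OF M]] by simp
 qed
 have csq_rem: "csq N (rem L) <= rho2 * (a^2) ^ L" for L
 proof (induction L)
  case 0
  have "rem 0 = c" by (simp add: rem_def fun_eq_iff)
  thus ?case using G by (simp add: Galerkin_def)
 next
  case (Suc L)
  have "csq N (rem (Suc L)) = csq N (vfc (TW M (Sop N (rem L))))"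
   unfolding csq_def using rem_Suc by simp
  also have "... <= a^2 * csq N (rem L)" by (rule csq_step[OF M cs_rem])
  also have "... <= a^2 * (rho2 * (a^2) ^ L)" by (intro mult_left_mono Suc) simp
  finally show ?case by (simp add: mult_ac)
 qed
 \<comment> \<open>The constant comparing sup norm and L^2 norm on the frequencies
   \<open>BX N\<close>; it depends on \<open>N\<close>, but the factor \<open>(a^2) ^ L\<close>
   beats it for large \<open>L\<close>.\<close>
 define B where "B = real CARD('n) * real (card (BX N))"
 have "(%L. B * sqrt (rho2 * (a^2) ^ L)) \<longlonglongrightarrow> B * sqrt (rho2 * 0)"
  using a by (intro tendsto_intros LIMSEQ_power_zero) (auto simp: abs_square_less_1)
 hence "\<forall>\<^sub>F L in sequentially. B * sqrt (rho2 * (a^2) ^ L) < 1"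
  by (rule order_tendstoD(2)) simp
 then obtain L where L: "B * sqrt (rho2 * (a^2) ^ L) < 1"
  by (meson eventually_happens' sequentially_bot)
 have B0: "0 <= B" by (simp add: B_def)
 have small: "norm (vtp N d z :: complex^'n) <= 1" if "csq N d <= rho2 * (a^2) ^ L" for d z
 proof -
  have "norm (vtp N d z :: complex^'n) <= B * sqrt (csq N d)" unfolding B_def by (rule norm_vtp_le)
  also have "... <= B * sqrt (rho2 * (a^2) ^ L)" using that B0 by (intro mult_left_mono) auto
  finally show ?thesis using L by simp
 qed
 have u: "vtp N c z = (\<Sum>m<L. vtp N (nterm M N m) z) + vtp N (rem L) z" for z
  unfolding vtp_sum[symmetric] vtp_add[symmetric] rem_def by simp
 have s: "Sop N c z = (\<Sum>m<L. Sop N (nterm M N m) z) + Sop N (rem L) z" for z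
  unfolding Sop_def vtp_sum[symmetric] vtp_add[symmetric] rem_def Smul_def
  by (intro arg_cong2[where f = "vtp N"]) (auto simp: fun_eq_iff sum_distrib_left right_diff_distrib)
 have KKm: "(K1 * K2) ^ m = KK ^ m" for m by (simp add: KK_def)
 have K2KK: "K2 * K1 <= KK^2" "K1 <= KK^2"
  using KK mult_left_mono[of 1 KK KK] by (auto simp: KK_def power2_eq_square mult.commute)
 have l4: "integral QQ (%z. (norm (vtp N (nterm M N m) z)) ^ 4) <= 16 * KK^2 * KK ^ m" for m
 proof (rule order_trans[OF L4_nterm[OF M]])
  have "K1 * KK ^ m <= KK^2 * KK ^ m" using K2KK KK by (intro mult_right_mono) auto
  thus "16 * K1 * (K1 * K2) ^ m <= 16 * KK^2 * KK ^ m" unfolding KKm by simp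
 qed
 have l4s: "integral QQ (%z. (norm (Sop N (nterm M N m) z)) ^ 4) <= 16 * KK^2 * KK ^ m" for m
 proof (rule order_trans[OF L4_Sop[OF M]])
  have "K2 * integral QQ (%z. (norm (vtp N (nterm M N m) z)) ^ 4) <= K2 * (16 * K1 * (K1 * K2) ^ m)"
   using K_ge1 by (intro mult_left_mono L4_nterm[OF M]) auto
  also have "... <= 16 * KK^2 * KK ^ m"
  proof -
   have "K2 * K1 * KK ^ m <= KK^2 * KK ^ m" using K2KK KK by (intro mult_right_mono) auto
   thus ?thesis unfolding KKm by (simp add: mult_ac)
  qed
  finally show "K2 * integral QQ (%z. (norm (vtp N (nterm M N m) z)) ^ 4) <= 16 * KK^2 * KK ^ m" .
 qed
 show "integral QQ (%z. norm (vtp N c z) powr ex) <= Cp"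
  unfolding u
 proof (rule integral_powr_series)
  show "integral QQ (%z. norm (vtp N (nterm M N m) z) powr ex) <= 32 * KK^2 * sg ^ m" for m
   using csq_nterm[OF M, of N m] l4 by (intro integral_powr_term) (auto simp: Parseval_vtp intro!: continuous_vtp[OF continuous_on_id])
  show "norm (vtp N (rem L) z) <= 1" for z by (rule small[OF csq_rem])
 qed (rule continuous_vtp[OF continuous_on_id])+
 show "integral QQ (%z. norm (Sop N c z) powr ex) <= Cp"
  unfolding s
 proof (rule integral_powr_series)
  have "integral QQ (%z. (norm (Sop N (nterm M N m) z))^2) <= 16 * (a^2) ^ m" for m
   unfolding Sop_def Parseval_vtp by (rule order_trans[OF csq_Smul csq_nterm[OF M]])
  thus "integral QQ (%z. norm (Sop N (nterm M N m) z) powr ex) <= 32 * KK^2 * sg ^ m" for m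
   using l4s by (intro integral_powr_term) (auto intro!: continuous_Sop[OF continuous_on_id])
  show "norm (Sop N (rem L) z) <= 1" for z
   unfolding Sop_def by (rule small[OF order_trans[OF csq_Smul csq_rem]])
 qed (rule continuous_Sop[OF continuous_on_id])+
qed

end

section \<open>Equicontinuity\<close>

lemma has_derivative_ek:
 "(ek k has_derivative (%h. (\<i> * pi / 4) * (cnj (kap k) * h + kap k * cnj h) * ek k u)) (at u within S)"
proof -
 let ?l = "%h. pi / 2 * (of_int (fst k) * Re h + of_int (snd k) * Im h)"
 have "(?l has_derivative ?l) (at u within S)"
  by (intro has_derivative_mult_right has_derivative_add has_derivative_Re has_derivative_Im has_derivative_ident)
 hence "((%u. cis (?l u)) has_derivative (%h. ?l h *\<^sub>R (\<i> * cis (?l u)))) (at u within S)"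
  by (rule has_derivative_cis)
 moreover have eq: "?l h *\<^sub>R (\<i> * cis (?l u)) = (\<i> * pi / 4) * (cnj (kap k) * h + kap k * cnj h) * ek k u" for h
 proof -
  have "cnj (kap k) * h + kap k * cnj h = of_real (2 * (of_int (fst k) * Re h + of_int (snd k) * Im h))"
   by (simp add: complex_eq_iff kap_def)
  thus ?thesis by (simp add: ek_def scaleR_conv_of_real field_simps)
 qed
 moreover have "(%u. cis (?l u)) = ek k" by (simp add: ek_def fun_eq_iff)
 ultimately show ?thesis by (simp only:)
qed

text \<open>\<open>Fmul c k\<close> times the symbols of the two derivatives is
  \<open>Smul c k\<close> and \<open>c k\<close>, except at frequency 0, where \<open>Fmul\<close>
  is 0 by the convention for division. The hypothesis says that \<open>c\<close> has mean zero, as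
  any derivative of a periodic function has.\<close>

lemma has_derivative_tp_Fmul:
 assumes "c 0 = 0"
 shows "(tp N (Fmul c) has_derivative (%h. h * tp N (Smul c) u + cnj h * tp N c u)) (at u within S)"
proof -
 have "((%u. SUM k:BX N. Fmul c k * ek k u) has_derivative
   (%h. SUM k:BX N. Fmul c k * ((\<i> * pi / 4) * (cnj (kap k) * h + kap k * cnj h) * ek k u))) (at u within S)"
  by (intro has_derivative_sum has_derivative_mult_right has_derivative_ek)
 moreover have "(SUM k:BX N. Fmul c k * ((\<i> * pi / 4) * (cnj (kap k) * h + kap k * cnj h) * ek k u)) =
   h * tp N (Smul c) u + cnj h * tp N c u" for h
  unfolding tp_def sum_distrib_left sum.distrib[symmetric]
 proof (intro sum.cong refl)
  fix k
  show "Fmul c k * ((\<i> * pi / 4) * (cnj (kap k) * h + kap k * cnj h) * ek k u) =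
   h * (Smul c k * ek k u) + cnj h * (c k * ek k u)"
   using assms by (cases "k = 0") (auto simp: Fmul_def Smul_def field_simps)
 qed
 ultimately show ?thesis by (simp add: tp_def[abs_def])
qed

lemma has_derivative_chi:
 fixes f :: "'a::real_normed_vector => 'n::finite => complex"
 assumes "!!j. ((%x. f x j) has_derivative f' j) F"
 shows "((%x. \<chi> j. f x j) has_derivative (%h. \<chi> j. f' j h)) F"
proof -
 have e: "(\<chi> j. v j) = (SUM j:UNIV. axis j (v j))" for v :: "'n => complex"
  by (simp add: vec_eq_iff axis_def)
 have "linear (axis j :: complex => complex^'n)" for j
  by (auto intro!: linearI simp: vec_eq_iff axis_def)
 hence bl: "bounded_linear (axis j :: complex => complex^'n)" for j
  by (simp add: linear_conv_bounded_linear)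
 show ?thesis unfolding e
  by (rule has_derivative_sum, rule bounded_linear.has_derivative[OF bl assms])
qed

lemma has_derivative_vtp_Fmul:
 assumes "!!j. c j 0 = 0"
 shows "(vtp N (%j. Fmul (c j)) has_derivative (%h. h *s vtp N (%j. Smul (c j)) u + cnj h *s vtp N c u)) (at u within S)"
proof -
 have "((%u. \<chi> j. tp N (Fmul (c j)) u) has_derivative (%h. \<chi> j. h * tp N (Smul (c j)) u + cnj h * tp N (c j) u)) (at u within S)"
  by (intro has_derivative_chi has_derivative_tp_Fmul assms)
 moreover have "(\<chi> j. h * tp N (Smul (c j)) u + cnj h * tp N (c j) u) = h *s vtp N (%j. Smul (c j)) u + cnj h *s vtp N c u" for h
  by (simp add: vec_eq_iff)
 ultimately show ?thesis by (simp add: vtp_def[abs_def])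
qed

section \<open>Morrey's estimate along slices\<close>

lemma slice_exists:
 fixes Z :: "real => real"
 assumes "x1 < x2" "continuous_on {x1..x2} Z"
 shows "EX x:{x1..x2}. Z x <= integral {x1..x2} Z / (x2 - x1)"
proof -
 obtain x where x: "x \<in> {x1..x2}" "!!y. y \<in> {x1..x2} ==> Z x <= Z y"
  using continuous_attains_inf[OF compact_Icc _ assms(2)] assms(1) by auto
 have "integral {x1..x2} (%_. Z x) <= integral {x1..x2} Z"
  by (rule integral_le) (use assms x in "auto intro: integrable_continuous_real")
 hence "Z x * (x2 - x1) <= integral {x1..x2} Z" using assms(1) by (simp add: mult.commute)
 thus ?thesis using x(1) assms(1) by (auto simp: field_simps)
qed

definition box2 :: "real => real => real => real => complex set" where
 "box2 x1 x2 y1 y2 = cbox (Complex x1 y1) (Complex x2 y2)"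

lemma slices:
 fixes g :: "complex => real"
 assumes g: "continuous_on (box2 x1 x2 y1 y2) g" and l: "x1 < x2" "y1 < y2"
 shows "EX x:{x1..x2}. integral {y1..y2} (%y. g (Complex x y)) <= integral (box2 x1 x2 y1 y2) g / (x2 - x1)"
  and "EX y:{y1..y2}. integral {x1..x2} (%x. g (Complex x y)) <= integral (box2 x1 x2 y1 y2) g / (y2 - y1)"
proof -
 have c: "continuous_on (S \<times> T) (%(x, y). g (Complex x y))" if "S \<subseteq> {x1..x2}" "T \<subseteq> {y1..y2}" for S T
  unfolding case_prod_beta
 proof (rule continuous_on_compose2[OF g])
  show "continuous_on (S \<times> T) (%p. Complex (fst p) (snd p))"
   unfolding Complex_eq by (intro continuous_intros)
 qed (use that in "force simp: box2_def cbox_Complex_iff")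
 have c': "continuous_on (T \<times> S) (%(y, x). g (Complex x y))" if "S \<subseteq> {x1..x2}" "T \<subseteq> {y1..y2}" for S T
  unfolding case_prod_beta
 proof (rule continuous_on_compose2[OF g])
  show "continuous_on (T \<times> S) (%p. Complex (snd p) (fst p))"
   unfolding Complex_eq by (intro continuous_intros)
 qed (use that in "force simp: box2_def cbox_Complex_iff")
 have i1: "integral (box2 x1 x2 y1 y2) g = integral {x1..x2} (%x. integral {y1..y2} (%y. g (Complex x y)))"
  unfolding box2_def by (rule integral_complex_iterated) (use g in "simp add: box2_def")
 also have "... = integral {y1..y2} (%y. integral {x1..x2} (%x. g (Complex x y)))"
  using integral_swap_continuous[of x1 y1 x2 y2 "%x y. g (Complex x y)"] c[of "{x1..x2}" "{y1..y2}"]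
  by (simp add: cbox_Pair_eq)
 finally have i2: "integral (box2 x1 x2 y1 y2) g = integral {y1..y2} (%y. integral {x1..x2} (%x. g (Complex x y)))" .
 have "continuous_on {x1..x2} (%x. integral (cbox y1 y2) (%y. g (Complex x y)))"
  by (rule integral_continuous_on_param) (use c in auto)
 from slice_exists[OF l(1) this]
 show "EX x:{x1..x2}. integral {y1..y2} (%y. g (Complex x y)) <= integral (box2 x1 x2 y1 y2) g / (x2 - x1)"
  unfolding i1 by simp
 have "continuous_on {y1..y2} (%y. integral (cbox x1 x2) (%x. g (Complex x y)))"
  by (rule integral_continuous_on_param) (use c' in auto)
 from slice_exists[OF l(2) this]
 show "EX y:{y1..y2}. integral {x1..x2} (%x. g (Complex x y)) <= integral (box2 x1 x2 y1 y2) g / (y2 - y1)"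
  unfolding i2 by simp
qed

text \<open>Morrey's Dirichlet growth criterion. A point is reached along a zigzag of vertical and
 horizontal segments of geometrically decreasing length on which \<open>g\<close> has small integral.\<close>

locale Morrey =
 fixes f :: "complex => 'b::euclidean_space" and g :: "complex => real" and C z :: real
 assumes f: "continuous_on QQ f" and g: "continuous_on QQ g" and g0: "!!u. 0 <= g u" and z: "0 < z" and C: "0 <= C"
  and V: "!!x y1 y2. y1 <= y2 ==> Complex x y1 \<in> QQ ==> Complex x y2 \<in> QQ ==>
    norm (f (Complex x y2) - f (Complex x y1)) <= integral {y1..y2} (%y. g (Complex x y))"
  and H: "!!y x1 x2. x1 <= x2 ==> Complex x1 y \<in> QQ ==> Complex x2 y \<in> QQ ==>
    norm (f (Complex x2 y) - f (Complex x1 y)) <= integral {x1..x2} (%x. g (Complex x y))"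
  and G: "!!x1 x2 y1 y2 h. box2 x1 x2 y1 y2 \<subseteq> QQ ==> x1 <= x2 ==> y1 <= y2 ==> x2 - x1 <= h ==> y2 - y1 <= h ==> 0 < h ==>
    integral (box2 x1 x2 y1 y2) g <= C * h powr (1 + z)"
begin

text \<open>Some slice is no worse than the mean over a strip of width h/2, which gives the factor
  2. The strip is the half next to the corner, so the line also crosses the square of half the side
  at that corner.\<close>

lemma good_slices:
 assumes h: "0 < h" and p: "Complex x0 y0 \<in> QQ" "-2 <= x0 - h" "-2 <= y0 - h"
 shows "EX x:{x0 - h/2..x0}. ALL y:{y0 - h..y0}. ALL y':{y0 - h..y0}. norm (f (Complex x y) - f (Complex x y')) <= 2 * C * h powr z"
  and "EX y:{y0 - h/2..y0}. ALL x:{x0 - h..x0}. ALL x':{x0 - h..x0}. norm (f (Complex x y) - f (Complex x' y)) <= 2 * C * h powr z"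
proof -
 have sub: "box2 (x0 - h/2) x0 (y0 - h) y0 \<subseteq> QQ" "box2 (x0 - h) x0 (y0 - h/2) y0 \<subseteq> QQ"
  using p h by (auto simp: box2_def cbox_Complex_iff QQ_iff)
 have e: "C * h powr (1 + z) / (h / 2) = 2 * C * h powr z"
  using h by (simp add: powr_add)
 have c: "continuous_on {s..t} (%y. g (Complex x y))" if "-2 <= x" "x <= 2" "-2 <= s" "t <= 2" for x s t
 proof (rule continuous_on_compose2[OF g])
  show "continuous_on {s..t} (Complex x)" unfolding Complex_eq[abs_def] by (intro continuous_intros)
 qed (use that in "auto simp: QQ_iff")
 have c': "continuous_on {s..t} (%x. g (Complex x y))" if "-2 <= y" "y <= 2" "-2 <= s" "t <= 2" for y s t
 proof (rule continuous_on_compose2[OF g])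
  show "continuous_on {s..t} (%x. Complex x y)" unfolding Complex_eq[abs_def] by (intro continuous_intros)
 qed (use that in "auto simp: QQ_iff")
 obtain x where x: "x \<in> {x0 - h/2..x0}" and xi0: "integral {y0 - h..y0} (%y. g (Complex x y)) <= integral (box2 (x0 - h/2) x0 (y0 - h) y0) g / (h/2)"
  using slices(1)[OF continuous_on_subset[OF g sub(1)]] h by auto
 note xi0
 also have "integral (box2 (x0 - h/2) x0 (y0 - h) y0) g / (h/2) <= C * h powr (1 + z) / (h / 2)"
  using h by (intro divide_right_mono G[OF sub(1)]) auto
 finally have xi: "integral {y0 - h..y0} (%y. g (Complex x y)) <= 2 * C * h powr z" unfolding e .
 have le: "norm (f (Complex x y) - f (Complex x y')) <= 2 * C * h powr z" if "y \<in> {y0 - h..y0}" "y' \<in> {y0 - h..y0}" "y' <= y" for y y'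
 proof -
  have "norm (f (Complex x y) - f (Complex x y')) <= integral {y'..y} (%y. g (Complex x y))"
   by (rule V) (use that p h x in "auto simp: QQ_iff")
  also have "... <= integral {y0 - h..y0} (%y. g (Complex x y))"
   by (rule integral_subset_le) (use that p h x g0 in "auto simp: QQ_iff intro!: integrable_continuous_real c")
  finally show ?thesis using xi by simp
 qed
 have "norm (f (Complex x y) - f (Complex x y')) <= 2 * C * h powr z" if "y \<in> {y0 - h..y0}" "y' \<in> {y0 - h..y0}" for y y'
  using le[OF that] le[OF that(2,1)] norm_minus_commute[of "f (Complex x y)"] by (metis linear)
 thus "EX x:{x0 - h/2..x0}. ALL y:{y0 - h..y0}. ALL y':{y0 - h..y0}. norm (f (Complex x y) - f (Complex x y')) <= 2 * C * h powr z"
  using x by blast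
 obtain y where y: "y \<in> {y0 - h/2..y0}" and yi0: "integral {x0 - h..x0} (%x. g (Complex x y)) <= integral (box2 (x0 - h) x0 (y0 - h/2) y0) g / (h/2)"
  using slices(2)[OF continuous_on_subset[OF g sub(2)]] h by auto
 note yi0
 also have "integral (box2 (x0 - h) x0 (y0 - h/2) y0) g / (h/2) <= C * h powr (1 + z) / (h / 2)"
  using h by (intro divide_right_mono G[OF sub(2)]) auto
 finally have yi: "integral {x0 - h..x0} (%x. g (Complex x y)) <= 2 * C * h powr z" unfolding e .
 have le: "norm (f (Complex x y) - f (Complex x' y)) <= 2 * C * h powr z" if "x \<in> {x0 - h..x0}" "x' \<in> {x0 - h..x0}" "x' <= x" for x x'
 proof -
  have "norm (f (Complex x y) - f (Complex x' y)) <= integral {x'..x} (%x. g (Complex x y))"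
   by (rule H) (use that p h y in "auto simp: QQ_iff")
  also have "... <= integral {x0 - h..x0} (%x. g (Complex x y))"
   by (rule integral_subset_le) (use that p h y g0 in "auto simp: QQ_iff intro!: integrable_continuous_real c'")
  finally show ?thesis using yi by simp
 qed
 have "norm (f (Complex x y) - f (Complex x' y)) <= 2 * C * h powr z" if "x \<in> {x0 - h..x0}" "x' \<in> {x0 - h..x0}" for x x'
  using le[OF that] le[OF that(2,1)] norm_minus_commute[of "f (Complex x y)"] by (metis linear)
 thus "EX y:{y0 - h/2..y0}. ALL x:{x0 - h..x0}. ALL x':{x0 - h..x0}. norm (f (Complex x y) - f (Complex x' y)) <= 2 * C * h powr z"
  using y by blast
qed

definition rr :: real where "rr = (1/2) powr z"

lemma rr: "0 < rr" "rr < 1"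
 using z powr_less_mono2[of z "1/2" 1] by (auto simp: rr_def)

text \<open>\<open>2 * C\<close> for the first vertical segment, and the sum of the geometric series
  of zigzag steps with ratio \<open>rr^2\<close>: one step halves the side twice.\<close>

definition CM :: real where "CM = 2 * C + 4 * C / (1 - rr^2)"

lemma good_vertical_line:
 assumes h: "0 < h" and p: "Complex x0 y0 \<in> QQ" "-2 <= x0 - h" "-2 <= y0 - h"
 shows "EX x:{x0 - h/2..x0}. ALL y:{y0 - h..y0}. norm (f (Complex x y) - f (Complex x0 y0)) <= CM * h powr z"
proof -
 define H where "H m = h / 2 ^ m" for m :: nat
 have Hpos: "0 < H m" and Hle: "H m <= h" and HSuc: "H (Suc m) = H m / 2" for m
  using h by (auto simp: H_def field_simps)
 have Hpow: "H m powr z = h powr z * rr ^ m" for m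
 proof -
  have "H m powr z = (h * (1/2) ^ m) powr z" by (simp add: H_def power_divide)
  also have "... = h powr z * ((1/2) ^ m) powr z" by (rule powr_mult)
  also have "((1/2::real) ^ m) powr z = rr ^ m"
  proof -
   have "((1/2::real) ^ m) powr z = ((1/2) powr real m) powr z" by (subst powr_realpow) auto
   also have "... = (1/2) powr (real m * z)" by (rule powr_powr)
   also have "... = rr ^ m" unfolding rr_def by (subst powr_power) auto
   finally show ?thesis .
  qed
  finally show ?thesis .
 qed
 \<comment> \<open>Squares of side \<open>H (2*i)\<close> supply vertical lines, those of side
   \<open>H (2*i+1)\<close> horizontal ones. The half-width strips make the horizontal line
   \<open>w i\<close> meet both \<open>v i\<close> and \<open>v (Suc i)\<close> where its bound is
   valid, so the corners \<open>P i\<close> are joined by two controlled segments.\<close>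
 define GV where "GV i x \<longleftrightarrow> x \<in> {x0 - H (2*i)/2..x0} & (ALL y:{y0 - H (2*i)..y0}. ALL y':{y0 - H (2*i)..y0}.
   norm (f (Complex x y) - f (Complex x y')) <= 2 * C * H (2*i) powr z)" for i x
 define GH where "GH i y \<longleftrightarrow> y \<in> {y0 - H (2*i+1)/2..y0} & (ALL x:{x0 - H (2*i+1)..x0}. ALL x':{x0 - H (2*i+1)..x0}.
   norm (f (Complex x y) - f (Complex x' y)) <= 2 * C * H (2*i+1) powr z)" for i y
 have "EX x. GV i x" for i
  using good_slices(1)[OF Hpos[of "2*i"] p(1)] p Hle[of "2*i"] unfolding GV_def by fastforce
 then obtain v where GV: "!!i. GV i (v i)" by metis
 have "EX y. GH i y" for i
  using good_slices(2)[OF Hpos[of "2*i+1"] p(1)] p Hle[of "2*i+1"] unfolding GH_def by fastforce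
 then obtain w where GH: "!!i. GH i (w i)" by metis
 have v: "v i \<in> {x0 - H (2*i)/2..x0}" and w: "w i \<in> {y0 - H (2*i+1)/2..y0}" for i
  using GV[of i] GH[of i] unfolding GV_def GH_def by blast+
 have vf: "norm (f (Complex (v i) y) - f (Complex (v i) y')) <= 2 * C * H (2*i) powr z"
  if "y \<in> {y0 - H (2*i)..y0}" "y' \<in> {y0 - H (2*i)..y0}" for i y y'
  using GV[of i] that unfolding GV_def by blast
 have wf: "norm (f (Complex x (w i)) - f (Complex x' (w i))) <= 2 * C * H (2*i+1) powr z"
  if "x \<in> {x0 - H (2*i+1)..x0}" "x' \<in> {x0 - H (2*i+1)..x0}" for i x x'
  using GH[of i] that unfolding GH_def by blast
 define P where "P i = Complex (v i) (w i)" for i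
 have step: "norm (f (P (Suc i)) - f (P i)) <= 4 * C * h powr z * (rr^2) ^ i" for i
 proof -
  have H1: "H (2 * i + 1) = H (2 * i) / 2" "H (2 * Suc i) = H (2 * i) / 4" "H (2 * Suc i + 1) = H (2*i) / 8"
   using HSuc[of "2*i"] HSuc[of "2*i+1"] HSuc[of "2*i+2"] by auto
  have a: "norm (f (Complex (v (Suc i)) (w (Suc i))) - f (Complex (v (Suc i)) (w i))) <= 2 * C * H (2 * Suc i) powr z"
   by (rule vf) (use w[of i] w[of "Suc i"] Hpos[of "2*i"] H1 in auto)
  have b: "norm (f (Complex (v (Suc i)) (w i)) - f (Complex (v i) (w i))) <= 2 * C * H (2 * i + 1) powr z"
   by (rule wf) (use v[of i] v[of "Suc i"] Hpos[of "2*i"] H1 in auto)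
  have "H (2 * Suc i) powr z <= H (2 * i) powr z" "H (2 * i + 1) powr z <= H (2 * i) powr z"
   using z H1 Hpos[of "2*i"] by (auto intro!: powr_mono2)
  hence "2 * C * H (2 * Suc i) powr z + 2 * C * H (2 * i + 1) powr z <= 2 * C * H (2 * i) powr z + 2 * C * H (2 * i) powr z"
   using C by (intro add_mono mult_left_mono) auto
  also have "... = 4 * C * h powr z * (rr^2) ^ i" unfolding Hpow by (simp add: power_mult)
  finally show ?thesis
   using a b norm_triangle_ineq[of "f (Complex (v (Suc i)) (w (Suc i))) - f (Complex (v (Suc i)) (w i))" "f (Complex (v (Suc i)) (w i)) - f (Complex (v i) (w i))"]
   unfolding P_def by simp
 qed
 have r2: "0 < rr^2" "rr^2 < 1" using rr by (auto simp: abs_square_less_1)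
 have tele: "norm (f (P n) - f (P 0)) <= 4 * C * h powr z / (1 - rr^2)" for n
 proof -
  have "norm (f (P n) - f (P 0)) = norm (\<Sum>i<n. f (P (Suc i)) - f (P i))"
   by (subst sum_lessThan_telescope) simp
  also have "... <= (\<Sum>i<n. 4 * C * h powr z * (rr^2) ^ i)"
   by (rule order_trans[OF norm_sum sum_mono]) (rule step)
  also have "... = 4 * C * h powr z * ((1 - (rr^2) ^ n) / (1 - rr^2))"
   using r2 unfolding sum_distrib_left[symmetric] by (simp add: sum_gp_strict)
  also have "... <= 4 * C * h powr z * (1 / (1 - rr^2))"
   using r2 C by (intro mult_left_mono divide_right_mono) auto
  finally show ?thesis by simp
 qed
 have "(%n. H n) \<longlonglongrightarrow> 0"
 proof -
  have "(%n. h * (1/2) ^ n) \<longlonglongrightarrow> h * 0" by (intro tendsto_intros LIMSEQ_power_zero) auto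
  thus ?thesis by (simp add: H_def[abs_def] power_divide)
 qed
 hence H0: "(%i. H (2 * i)) \<longlonglongrightarrow> 0"
  using LIMSEQ_subseq_LIMSEQ[of H 0 "%i. 2 * i"] by (simp add: o_def strict_mono_def)
 have bnd: "x0 - H (2*i) <= v i & v i <= x0 & y0 - H (2*i) <= w i & w i <= y0" for i
  using v[of i] w[of i] HSuc[of "2*i"] Hpos[of "2*i"] by auto
 have X: "(%i. x0 - H (2*i)) \<longlonglongrightarrow> x0" and Y: "(%i. y0 - H (2*i)) \<longlonglongrightarrow> y0"
  using tendsto_diff[OF tendsto_const H0] by auto
 have "v \<longlonglongrightarrow> x0"
  by (rule tendsto_sandwich[OF _ _ X tendsto_const]) (use bnd in "auto intro: always_eventually")
 moreover have "w \<longlonglongrightarrow> y0"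
  by (rule tendsto_sandwich[OF _ _ Y tendsto_const]) (use bnd in "auto intro: always_eventually")
 ultimately have "P \<longlonglongrightarrow> Complex x0 y0" unfolding P_def[abs_def] by (rule tendsto_Complex)
 moreover have PQ: "P i \<in> QQ" for i
  using bnd[of i] p Hle[of "2*i"] by (auto simp: P_def QQ_iff)
 ultimately have "(%i. f (P i)) \<longlonglongrightarrow> f (Complex x0 y0)"
  by (intro continuous_on_tendsto_compose[OF f _ p(1)]) auto
 hence "(%i. norm (f (P i) - f (P 0))) \<longlonglongrightarrow> norm (f (Complex x0 y0) - f (P 0))"
  by (intro tendsto_intros)
 hence lim: "norm (f (Complex x0 y0) - f (P 0)) <= 4 * C * h powr z / (1 - rr^2)"
  by (rule LIMSEQ_le_const2) (use tele in auto)
 show ?thesis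
 proof (intro bexI[of _ "v 0"] ballI)
  show "v 0 \<in> {x0 - h/2..x0}" using v[of 0] by (simp add: H_def)
  fix y assume y: "y \<in> {y0 - h..y0}"
  have "norm (f (Complex (v 0) y) - f (P 0)) <= 2 * C * h powr z"
   using vf[of y 0 "w 0"] y w[of 0] h by (simp add: P_def H_def)
  hence "norm (f (Complex (v 0) y) - f (Complex x0 y0)) <= 2 * C * h powr z + 4 * C * h powr z / (1 - rr^2)"
   using lim norm_triangle_ineq[of "f (Complex (v 0) y) - f (P 0)" "f (P 0) - f (Complex x0 y0)"]
   by (simp add: norm_minus_commute)
  also have "... = CM * h powr z" by (simp add: CM_def algebra_simps add_divide_distrib)
  finally show "norm (f (Complex (v 0) y) - f (Complex x0 y0)) <= CM * h powr z" .
 qed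
qed

text \<open>Both points are left along good vertical lines of squares of side 2h, and one good
  horizontal line joins these. The strips have width h, which absorbs the offset of at most h
  between the points. Points of \<open>TC\<close> have nonnegative coordinates, so with
  \<open>h <= 1/2\<close> all squares stay in \<open>QQ\<close>.\<close>

lemma Holder_TC:
 assumes "p \<in> TC" "q \<in> TC" and h: "0 < h" "h <= 1/2" and d: "cmod (p - q) <= h"
 shows "norm (f p - f q) <= (2 * CM + 2 * C) * (2 * h) powr z"
proof -
 have dx: "\<bar>Re p - Re q\<bar> <= h" "\<bar>Im p - Im q\<bar> <= h"
  using abs_Re_le_cmod[of "p - q"] abs_Im_le_cmod[of "p - q"] d by auto
 have r: "0 <= Re p" "Re p <= 2" "0 <= Im p" "Im p <= 2" "0 <= Re q" "Re q <= 2" "0 <= Im q" "Im q <= 2"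
  using assms(1,2) by (auto simp: TC_def)
 obtain x where x: "x \<in> {Re p - 2*h/2..Re p}" "!!y. y \<in> {Im p - 2*h..Im p} ==> norm (f (Complex x y) - f p) <= CM * (2*h) powr z"
  using good_vertical_line[of "2*h" "Re p" "Im p"] r h by (auto simp: QQ_iff)
 obtain x' where x': "x' \<in> {Re q - 2*h/2..Re q}" "!!y. y \<in> {Im q - 2*h..Im q} ==> norm (f (Complex x' y) - f q) <= CM * (2*h) powr z"
  using good_vertical_line[of "2*h" "Re q" "Im q"] r h by (auto simp: QQ_iff)
 define X Y where "X = max (Re p) (Re q)" and "Y = min (Im p) (Im q)"
 have XY: "Complex X Y \<in> QQ" "-2 <= X - 2*h" "-2 <= Y - 2*h" using r h by (auto simp: X_def Y_def QQ_iff)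
 obtain y where y: "y \<in> {Y - 2*h/2..Y}" "!!s t. s \<in> {X - 2*h..X} ==> t \<in> {X - 2*h..X} ==> norm (f (Complex s y) - f (Complex t y)) <= 2 * C * (2*h) powr z"
  using good_slices(2)[of "2*h", OF _ XY] h by auto
 have "norm (f (Complex x y) - f p) <= CM * (2*h) powr z"
  by (rule x(2)) (use y(1) dx in "auto simp: Y_def")
 moreover have "norm (f (Complex x' y) - f q) <= CM * (2*h) powr z"
  by (rule x'(2)) (use y(1) dx in "auto simp: Y_def")
 moreover have "norm (f (Complex x y) - f (Complex x' y)) <= 2 * C * (2*h) powr z"
  by (rule y(2)) (use x(1) x'(1) dx in "auto simp: X_def")
 moreover have "f p - f q = (f (Complex x y) - f (Complex x' y)) + (f (Complex x' y) - f q) - (f (Complex x y) - f p)" by simp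
 ultimately have "norm (f p - f q) <= 2 * C * (2*h) powr z + CM * (2*h) powr z + CM * (2*h) powr z"
  by (smt (verit) norm_triangle_ineq norm_triangle_ineq4)
 thus ?thesis by (simp add: algebra_simps)
qed

end

section \<open>The L^2 norm over a period cell\<close>

definition N2 :: "(complex => complex^'n) => real" where
 "N2 f = sqrt (integral QQ (%u. (norm (f u))^2))"

lemma int_norm2_nonneg: "continuous_on QQ f ==> 0 <= integral QQ (%u. (norm (f u :: complex^'n))^2)"
 by (intro integral_nonneg integrable_QQ continuous_intros) auto

lemma N2_sq: "continuous_on QQ f ==> (N2 f)^2 = integral QQ (%u. (norm (f u))^2)"
 unfolding N2_def by (simp add: int_norm2_nonneg)

lemma N2_nonneg: "continuous_on QQ f ==> 0 <= N2 f"
 unfolding N2_def by (simp add: int_norm2_nonneg)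

lemma N2_minus_commute: "N2 (%u. f u - g u) = N2 (%u. g u - f u)"
 unfolding N2_def by (simp add: norm_minus_commute)

lemma N2_le:
 assumes "continuous_on QQ f" "integral QQ (%u. (norm (f u))^2) <= b^2 * integral QQ (%u. (norm (g u))^2)" "0 <= b"
 shows "N2 f <= b * N2 g"
 unfolding N2_def using real_sqrt_le_mono[OF assms(2)] assms(3) by (simp add: real_sqrt_mult)

text \<open>The pointwise Young inequality with weights y/x and x/y integrates to the square of x +
  y. The small \<open>e\<close> keeps both positive when a norm is 0.\<close>

lemma N2_triangle:
 fixes f g :: "complex => complex^'n"
 assumes f: "continuous_on QQ f" and g: "continuous_on QQ g"
 shows "N2 (%u. f u + g u) <= N2 f + N2 g"
proof (rule field_le_epsilon)
 fix e :: real assume e: "0 < e"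
 define x y where "x = N2 f + e/2" and "y = N2 g + e/2"
 have xy: "0 < x" "0 < y" using N2_nonneg[OF f] N2_nonneg[OF g] e by (simp_all add: x_def y_def add_nonneg_pos)
 have ptw: "(norm (v + w))^2 <= (1 + y/x) * (norm v)^2 + (1 + x/y) * (norm w)^2" for v w :: "complex^'n"
 proof -
  have "0 <= (y * norm v - x * norm w)^2 / (x * y)" using xy by simp
  also have "... = y/x * (norm v)^2 + x/y * (norm w)^2 - 2 * norm v * norm w"
   using xy by (simp add: power2_eq_square field_simps)
  finally have 1: "2 * norm v * norm w <= y/x * (norm v)^2 + x/y * (norm w)^2" by simp
  have "(norm (v + w))^2 <= (norm v + norm w)^2" by (intro power_mono norm_triangle_ineq) simp
  also have "... = (norm v)^2 + (norm w)^2 + 2 * norm v * norm w" by (simp add: power2_sum)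
  finally show ?thesis using 1 by (simp add: algebra_simps)
 qed
 have "integral QQ (%u. (norm (f u + g u))^2) <= integral QQ (%u. (1 + y/x) * (norm (f u))^2 + (1 + x/y) * (norm (g u))^2)"
  by (intro integral_le integrable_QQ continuous_intros f g ptw)
 also have "... = (1 + y/x) * (N2 f)^2 + (1 + x/y) * (N2 g)^2"
  unfolding N2_sq[OF f] N2_sq[OF g] by (subst integral_add) (auto intro!: integrable_QQ continuous_intros f g)
 also have "... <= (1 + y/x) * x^2 + (1 + x/y) * y^2"
  using xy e N2_nonneg[OF f] N2_nonneg[OF g]
  by (intro add_mono mult_left_mono power_mono) (auto simp: x_def y_def)
 also have "... = (x + y)^2" using xy by (simp add: power2_eq_square field_simps)
 finally have "N2 (%u. f u + g u) <= x + y"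
  unfolding N2_def using xy by (intro real_le_lsqrt) auto
 thus "N2 (%u. f u + g u) <= N2 f + N2 g + e" by (simp add: x_def y_def)
qed

lemma N2_triangle3:
 fixes f g h :: "complex => complex^'n"
 assumes "continuous_on QQ f" "continuous_on QQ g" "continuous_on QQ h"
 shows "N2 (%u. f u - h u) <= N2 (%u. f u - g u) + N2 (%u. g u - h u)"
 using N2_triangle[of "%u. f u - g u" "%u. g u - h u"] assms by (simp add: continuous_intros)

text \<open>Finitely supported coefficients: they give the same field for every larger truncation,
  so fields of different degrees can be compared at a common one.\<close>

definition bsupp :: "nat => ('n => int * int => complex) => bool" where
 "bsupp J d \<longleftrightarrow> (ALL j l. l \<notin> BX J --> d j l = 0)"

lemma vtp_bsupp:
 assumes "bsupp J d" "J <= N" shows "vtp N d = vtp J d"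
proof -
 have B: "BX J \<subseteq> BX N" using assms(2) by (auto simp: BX_def)
 have "tp N (d j) u = tp J (d j) u" for j u
  unfolding tp_def using assms(1) B by (intro sum.mono_neutral_right) (auto simp: bsupp_def)
 thus ?thesis by (simp add: vtp_def fun_eq_iff)
qed

lemma bsupp_Smul: "bsupp J d ==> bsupp J (%j. Smul (d j))"
 by (auto simp: bsupp_def Smul_def)

text \<open>A uniform approximation by some trigonometric polynomial exists, and the Fourier
  truncation is at least as good in L^2.\<close>

lemma vtp_dense:
 fixes h :: "complex => complex^'n"
 assumes h: "continuous_on UNIV h" "!!j. biperiodic (%u. h u $ j)" and e: "0 < e"
 shows "EX J0. ALL J>=J0. N2 (%u. vtp J (vfc h) u - h u) <= e"
proof -
 have hc: "continuous_on QQ h" using h(1) continuous_on_subset by blast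
 \<comment> \<open>Then \<open>real CARD('n) * (16 * e'^2)\<close> equals \<open>e^2\<close>: n
   components over a cell of area 16.\<close>
 define e' where "e' = e / (4 * sqrt (real CARD('n)))"
 have e': "0 < e'" using e by (simp add: e'_def)
 have "EX M c. ALL u:QQ. cmod (h u $ j - tp M c u) < e'" for j
  using trig_poly_dense[of "%u. h u $ j" e'] h e' by (metis continuous_on_component)
 then obtain M c where Mc: "!!j u. u \<in> QQ ==> cmod (h u $ j - tp (M j) (c j) u) < e'" by metis
 define d where "d j l = (if l \<in> BX (M j) then c j l else 0)" for j l
 have le: "N2 (%u. vtp J (vfc h) u - h u) <= e" if J: "Max (range M) <= J" for J
 proof -
  have MJ: "M j <= J" for j using J Max_ge[of "range M" "M j"] by simp
  have td: "tp J (d j) u = tp (M j) (c j) u" for j u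
  proof -
   have "tp J (d j) u = (SUM l:BX (M j). d j l * ek l u)"
    unfolding tp_def using MJ[of j] by (intro sum.mono_neutral_right) (auto simp: BX_def d_def)
   thus ?thesis unfolding tp_def d_def by simp
  qed
  have "integral QQ (%u. (norm (vtp J (vfc h) u - h u))^2) = (SUM j:UNIV. integral QQ (%u. (cmod (h u $ j - tp J (fc (%u. h u $ j)) u))^2))"
   unfolding norm_minus_commute[of "vtp J (vfc h) _"]
   by (subst integral_QQ_norm_sq) (auto intro!: continuous_intros hc simp: vfc_def)
  also have "... <= (SUM j:UNIV. integral QQ (%u. (cmod (h u $ j - tp J (d j) u))^2))"
   by (intro sum_mono) (simp add: integral_diff_tp continuous_intros hc sum_nonneg)
  also have "... <= (SUM j:(UNIV::'n set). integral QQ (%_::complex. e'^2))"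
  proof (intro sum_mono integral_le integrable_QQ continuous_intros hc power_mono)
   fix j u assume "u \<in> QQ"
   thus "cmod (h u $ j - tp J (d j) u) <= e'" unfolding td using Mc by (simp add: less_imp_le)
  qed auto
  also have "... = real CARD('n) * (16 * e'^2)" using content_QQ by (simp add: QQ_def)
  also have "... = e^2" unfolding e'_def by (simp add: power_divide power_mult_distrib)
  finally show ?thesis unfolding N2_def using e by (intro real_le_lsqrt) auto
 qed
 thus ?thesis by blast
qed

lemma norm_matrix_vector_le: "norm (M *v v :: complex^'n) <= (real CARD('n))^2 * norm (M :: complex^'n^'n) * norm v"
proof -
 have "norm (M *v v) <= (SUM j:UNIV. cmod ((M *v v) $ j))"
  unfolding norm_vec_def by (rule L2_set_le_sum) simp
 also have "... <= (SUM j:(UNIV::'n set). SUM i:(UNIV::'n set). norm M * norm v)"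
 proof (intro sum_mono)
  fix j
  show "cmod ((M *v v) $ j) <= (SUM i:(UNIV::'n set). norm M * norm v)"
   unfolding matrix_vector_mult_def vec_lambda_beta
  proof (intro order_trans[OF norm_sum] sum_mono)
   fix i
   have "norm (M $ j $ i) <= norm M" by (metis Finite_Cartesian_Product.norm_nth_le order_trans)
   thus "norm (M $ j $ i * v $ i) <= norm M * norm v"
    unfolding norm_mult by (intro mult_mono Finite_Cartesian_Product.norm_nth_le) auto
  qed
 qed
 also have "... = (real CARD('n))^2 * norm M * norm v" by (simp add: power2_eq_square)
 finally show ?thesis .
qed

lemma good_coeff_diff:
 assumes "good_coeff a M" "good_coeff a' M'" "0 <= e" "!!W. W \<in> TC ==> norm (M W - M' W) <= e"
 shows "good_coeff ((real CARD('n))^2 * e) (%W. M W - M' W :: complex^'n^'n)"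
proof -
 have "norm ((M W - M' W) *v v) <= (real CARD('n))^2 * e * norm v" if "W \<in> TC" for W v
  by (rule order_trans[OF norm_matrix_vector_le]) (intro mult_right_mono mult_left_mono assms(4) that norm_ge_zero; simp)
 thus ?thesis
  using assms unfolding good_coeff_def by (auto intro!: continuous_intros)
qed

lemma young_powr:
 fixes t s p :: real
 assumes "0 <= t" "0 < s" "1 < p"
 shows "t <= s + s powr (1 - p) * t powr p"
proof (cases "t <= s")
 case False
 hence "1 <= (t / s) powr (p - 1)" using assms by (intro ge_one_powr_ge_zero) auto
 hence "t * 1 <= t * (t / s) powr (p - 1)" using assms by (intro mult_left_mono) auto
 also have "... = s powr (1 - p) * t powr p"
  using assms False by (simp add: powr_divide powr_diff field_simps)
 finally show ?thesis using assms by simp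
qed (use assms in "simp add: add_increasing2")

text \<open>Hoelder's inequality in additive form. The level \<open>s = h powr (- 2 / p)\<close>
  balances the contribution of the area, \<open>s * h^2\<close>, against that of the L^p norm; both
  become \<open>h powr (2 - 2 / p)\<close>, whose excess over 1 is the Hoelder exponent.\<close>

lemma integral_box_le:
 fixes v :: "complex => complex^'n"
 assumes v: "continuous_on QQ v" and p: "2 < p" and K: "integral QQ (%u. norm (v u) powr p) <= K"
  and b: "box2 x1 x2 y1 y2 \<subseteq> QQ" "x1 <= x2" "y1 <= y2" "x2 - x1 <= h" "y2 - y1 <= h" "0 < h"
 shows "integral (box2 x1 x2 y1 y2) (%u. norm (v u)) <= (1 + K) * h powr (1 + (1 - 2 / p))"
proof -
 define s where "s = h powr (- 2 / p)"
 have s: "0 < s" using b by (simp add: s_def)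
 have cb: "continuous_on (box2 x1 x2 y1 y2) v" using v b(1) continuous_on_subset by blast
 have intb: "f integrable_on box2 x1 x2 y1 y2" if "continuous_on (box2 x1 x2 y1 y2) f" for f :: "complex => real"
  using that unfolding box2_def by (rule integrable_continuous)
 have "integral (box2 x1 x2 y1 y2) (%u. norm (v u)) <= integral (box2 x1 x2 y1 y2) (%u. s + s powr (1 - p) * norm (v u) powr p)"
  using p s by (intro integral_le intb continuous_intros cb young_powr) auto
 also have "... = s * measure lborel (box2 x1 x2 y1 y2) + s powr (1 - p) * integral (box2 x1 x2 y1 y2) (%u. norm (v u) powr p)"
 proof -
  have "integral (box2 x1 x2 y1 y2) (%u. s + s powr (1 - p) * norm (v u) powr p) =
    integral (box2 x1 x2 y1 y2) (%_. s) + integral (box2 x1 x2 y1 y2) (%u. s powr (1 - p) * norm (v u) powr p)"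
   using p by (intro integral_add intb continuous_intros cb) auto
  thus ?thesis by (simp add: box2_def)
 qed
 also have "measure lborel (box2 x1 x2 y1 y2) <= h * h"
  unfolding box2_def content_complex_cbox[OF b(2,3)] using b by (intro mult_mono) auto
 also have "integral (box2 x1 x2 y1 y2) (%u. norm (v u) powr p) <= K"
  using p by (intro order_trans[OF integral_subset_le[OF b(1)] K] intb integrable_QQ continuous_intros cb v) auto
 finally have "integral (box2 x1 x2 y1 y2) (%u. norm (v u)) <= s * (h * h) + s powr (1 - p) * K"
  using s by (simp add: mult_left_mono add_mono)
 also have "s * (h * h) = h powr (1 + (1 - 2 / p))"
 proof -
  have "h * h = h powr 2" using b by (simp add: power2_eq_square)
  hence "s * (h * h) = h powr (- 2 / p + 2)" unfolding s_def powr_add by simp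
  moreover have "- 2 / p + 2 = 1 + (1 - 2 / p)" by simp
  ultimately show ?thesis by (simp only:)
 qed
 also have "s powr (1 - p) = h powr (1 + (1 - 2 / p))"
  unfolding s_def powr_powr using p by (intro arg_cong[where f = "%x. h powr x"]) (simp add: field_simps)
 finally show ?thesis by (simp add: algebra_simps)
qed

context cylinder_eq begin

definition be :: real where "be = 1 - 2 / ex"

lemma be: "0 < be" using ex by (simp add: be_def)

lemma Galerkin_c0: "Galerkin P N c Z ==> c j 0 = 0" and Galerkin_csym: "Galerkin P N c Z ==> csym 1 1 (-1) (c j)"
 unfolding Galerkin_def by auto

lemma Fop_has_derivative:
 assumes "!!j. c j 0 = 0"
 shows "(Fop N c has_derivative (%h. h *s Sop N c u + cnj h *s vtp N c u)) (at u within S)"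
 unfolding Fop_def Sop_def by (rule has_derivative_vtp_Fmul) (rule assms)

text \<open>The directional derivative of \<open>F\<close> along a unit vector is at most the sum of
  the norms of \<open>S u\<close> and \<open>u\<close>, and the uniform L^p bounds control their
  integrals over squares independently of \<open>N\<close> and \<open>P\<close>.\<close>

lemma Fop_Morrey:
 assumes G: "Galerkin P N c Z"
 shows "Morrey (Fop N c) (%u. norm (Sop N c u) + norm (vtp N c u)) (2 * (1 + Cp)) be"
proof -
 let ?g = "%u. norm (Sop N c u) + norm (vtp N c u)"
 note Lp = Galerkin_Lp[OF G]
 have Cp0: "0 <= Cp"
  using ex by (intro order_trans[OF integral_nonneg Lp(1)] integrable_QQ continuous_intros) auto
 have c: "continuous_on S (Sop N c)" "continuous_on S (vtp N c)" for S
  by (intro continuous_intros)+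
 have line: "norm (Fop N c (r t2) - Fop N c (r t1)) <= integral {t1..t2} (%t. ?g (r t))"
  if t: "t1 <= t2" and r: "!!t. (r has_derivative (%h. of_real h * d)) (at t within {t1..t2})" and d: "cmod d = 1" for r :: "real => complex" and d t1 t2
 proof -
  define D where "D t = d *s Sop N c (r t) + cnj d *s vtp N c (r t)" for t
  have "((%t. Fop N c (r t)) has_vector_derivative D t) (at t within {t1..t2})" if "t \<in> {t1..t2}" for t
  proof -
   have "((%t. Fop N c (r t)) has_derivative (%h. (of_real h * d) *s Sop N c (r t) + cnj (of_real h * d) *s vtp N c (r t))) (at t within {t1..t2})"
    by (rule has_derivative_compose[OF r Fop_has_derivative]) (rule Galerkin_c0[OF G])
   moreover have "(of_real h * d) *s Sop N c (r t) + cnj (of_real h * d) *s vtp N c (r t) = h *\<^sub>R D t" for h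
    by (simp add: D_def vec_eq_iff complex_eq_iff algebra_simps)
   ultimately show ?thesis by (simp add: has_vector_derivative_def)
  qed
  hence I: "(D has_integral (Fop N c (r t2) - Fop N c (r t1))) {t1..t2}"
   by (intro fundamental_theorem_of_calculus t) auto
  have "continuous_on {t1..t2} r"
   using has_derivative_continuous[OF r] by (simp add: continuous_on_eq_continuous_within)
  hence gc: "continuous_on {t1..t2} (%t. ?g (r t))" by (intro continuous_intros)
  have "norm (integral {t1..t2} D) <= integral {t1..t2} (%t. ?g (r t))"
  proof (rule integral_norm_bound_integral)
   show "norm (D t) <= ?g (r t)" for t
    unfolding D_def by (rule order_trans[OF norm_triangle_ineq]) (simp add: norm_svec d)
  qed (use I gc in "auto intro: integrable_continuous_real has_integral_integrable")
  thus ?thesis using I by (simp add: integral_unique)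
 qed
 show ?thesis
 proof (unfold_locales)
  show "continuous_on QQ (Fop N c)" "continuous_on QQ ?g" by (intro continuous_intros)+
  show "0 < be" "0 <= 2 * (1 + Cp)" using be Cp0 by auto
  show "norm (Fop N c (Complex x y2) - Fop N c (Complex x y1)) <= integral {y1..y2} (%y. ?g (Complex x y))" if "y1 <= y2" for x y1 y2
  proof (rule line[OF that, of "Complex x" \<i>])
   have "((%y. of_real x + \<i> * of_real y) has_derivative (%h. 0 + \<i> * of_real h)) (at t within {y1..y2})" for t
    by (intro has_derivative_add has_derivative_const has_derivative_mult_right has_derivative_of_real has_derivative_ident)
   thus "(Complex x has_derivative (%h. of_real h * \<i>)) (at t within {y1..y2})" for t
    by (simp add: Complex_eq[abs_def] mult.commute)
  qed simp
  show "norm (Fop N c (Complex x2 y) - Fop N c (Complex x1 y)) <= integral {x1..x2} (%x. ?g (Complex x y))" if "x1 <= x2" for y x1 x2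
  proof (rule line[OF that, of "%x. Complex x y" 1])
   have "((%x. of_real x + \<i> * of_real y) has_derivative (%h. of_real h + 0)) (at t within {x1..x2})" for t
    by (intro has_derivative_add has_derivative_const has_derivative_of_real has_derivative_ident)
   thus "((%x. Complex x y) has_derivative (%h. of_real h * 1)) (at t within {x1..x2})" for t
    by (simp add: Complex_eq[abs_def])
  qed simp
  show "integral (box2 x1 x2 y1 y2) ?g <= 2 * (1 + Cp) * h powr (1 + be)"
   if b: "box2 x1 x2 y1 y2 \<subseteq> QQ" "x1 <= x2" "y1 <= y2" "x2 - x1 <= h" "y2 - y1 <= h" "0 < h" for x1 x2 y1 y2 h
  proof -
   have "integral (box2 x1 x2 y1 y2) ?g = integral (box2 x1 x2 y1 y2) (%u. norm (Sop N c u)) + integral (box2 x1 x2 y1 y2) (%u. norm (vtp N c u))"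
    unfolding box2_def by (intro integral_add integrable_continuous continuous_intros)
   also have "... <= (1 + Cp) * h powr (1 + be) + (1 + Cp) * h powr (1 + be)"
    unfolding be_def by (intro add_mono integral_box_le c ex Lp b)
   finally show ?thesis by (simp add: algebra_simps)
  qed
 qed auto
qed

lemma Galerkin_equicont:
 shows "EX K. ALL P N c Z. Galerkin P N c Z -->
  (ALL p:TC. ALL q:TC. ALL h. 0 < h --> h <= 1/2 --> cmod (p - q) <= h --> norm (Fop N c p - Fop N c q) <= K * (2 * h) powr be)"
proof -
 define K where "K = 2 * (2 * (2 * (1 + Cp)) + 4 * (2 * (1 + Cp)) / (1 - ((1/2) powr be)^2)) + 2 * (2 * (1 + Cp))"
 have "norm (Fop N c p - Fop N c q) <= K * (2 * h) powr be"
  if "Galerkin P N c Z" "p \<in> TC" "q \<in> TC" "0 < h" "h <= 1/2" "cmod (p - q) <= h" for P N c Z p q h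
 proof -
  interpret Morrey "Fop N c" "%u. norm (Sop N c u) + norm (vtp N c u)" "2 * (1 + Cp)" be
   by (rule Fop_Morrey[OF that(1)])
  show ?thesis using Holder_TC[OF that(2-6)] unfolding CM_def rr_def K_def .
 qed
 thus ?thesis by blast
qed

lemma vertex_zero:
 assumes "admissible F" shows "F 0 = 0"
proof -
 have "F 0 $ j = 0" for j
 proof -
  have f: "fsym 1 (-1) \<i> (%u. F u $ j)" "biperiodic (%u. F u $ j)"
   using assms by (auto simp: admissible_def biperiodic_def)
  show ?thesis using fsym_edges[OF f, of 0] by (simp add: complex_eq_iff)
 qed
 thus ?thesis by (simp add: vec_eq_iff)
qed

text \<open>\<open>F\<close> vanishes at the vertex 0, where two of the side conditions meet. Any
  point of \<open>TC\<close> has modulus at most 4, so eight steps of length at most 1/2 lead to it,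
  and at \<open>h = 1/2\<close> the Hoelder bound of each step is \<open>K\<close>.\<close>

lemma Galerkin_bounded:
 shows "EX B. ALL P N c Z. Galerkin P N c Z --> (ALL p:TC. norm (Fop N c p) <= B)"
proof -
 obtain K where K: "!!P N c Z p q h. Galerkin P N c Z ==> p \<in> TC ==> q \<in> TC ==> 0 < h ==> h <= 1/2 ==> cmod (p - q) <= h ==> norm (Fop N c p - Fop N c q) <= K * (2 * h) powr be"
  using Galerkin_equicont by blast
 have "norm (Fop N c p) <= 8 * K" if G: "Galerkin P N c Z" and p: "p \<in> TC" for P N c Z p
 proof -
  define q where "q i = of_real (real i / 8) * p" for i :: nat
  have z: "0 \<in> TC" by (simp add: TC_def)
  have qT: "q i \<in> TC" if "i <= 8" for i
  proof -
   have "(1 - real i / 8) *\<^sub>R 0 + (real i / 8) *\<^sub>R p \<in> TC"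
    by (rule convexD[OF convex_TC z p]) (use that in auto)
   thus ?thesis by (simp add: q_def scaleR_conv_of_real)
  qed
  have "cmod p <= \<bar>Re p\<bar> + \<bar>Im p\<bar>" by (rule cmod_le)
  hence np: "cmod p <= 4" using p by (auto simp: TC_def)
  have "norm (Fop N c (q (Suc i)) - Fop N c (q i)) <= K" if "i < 8" for i
  proof -
   have "q (Suc i) - q i = of_real (1/8) * p" by (simp add: q_def field_simps)
   hence "cmod (q (Suc i) - q i) = cmod (of_real (1/8)) * cmod p" by (simp only: norm_mult)
   thus ?thesis using K[OF G qT[of "Suc i"] qT[of i], of "1/2"] that np by simp
  qed
  hence s: "(\<Sum>i<8. norm (Fop N c (q (Suc i)) - Fop N c (q i))) <= (\<Sum>i<8::nat. K)"
   by (intro sum_mono) auto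
  have "Fop N c (q 8) - Fop N c (q 0) = (\<Sum>i<8. Fop N c (q (Suc i)) - Fop N c (q i))"
   by (rule sum_lessThan_telescope[symmetric])
  also have "norm ... <= (\<Sum>i<8. norm (Fop N c (q (Suc i)) - Fop N c (q i)))" by (rule norm_sum)
  finally have "norm (Fop N c (q 8) - Fop N c (q 0)) <= 8 * K" using s by simp
  moreover have "Fop N c (q 0) = 0"
   using vertex_zero[OF admissible_vtp[OF Galerkin_csym[OF G]]] by (simp add: q_def Fop_def)
  ultimately show ?thesis by (simp add: q_def)
 qed
 thus ?thesis by blast
qed

text \<open>All admissible fields transform by the same reflections of values, so the norm of a
  difference is invariant. Uniform convergence on the triangle is thereby uniform convergence on the
  plane.\<close>

lemma norm_fold_admissible:
 assumes "admissible F" "admissible F'"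
 shows "norm (F (fold_TC u) - F' (fold_TC u)) = norm (F u - F' u)"
proof (rule fold_invariant)
 show "biperiodic (%u. norm (F u - F' u))" using assms by (auto simp: admissible_def biperiodic_def)
 have n: "norm v = norm w" if "!!j. cmod (v $ j) = cmod (w $ j)" for v w :: "complex^'n"
  using that by (simp add: norm_vec_def)
 have s: "F (cnj u) $ j = cnj (F u $ j)" "F (- cnj u) $ j = - cnj (F u $ j)" "F (\<i> * cnj u) $ j = \<i> * cnj (F u $ j)"
  if "admissible F" for F j u using that by (auto simp: admissible_def fsym_def)
 have m: "cmod (- cnj x - - cnj y) = cmod (x - y)" "cmod (cnj x - cnj y) = cmod (x - y)" "cmod (\<i> * cnj x - \<i> * cnj y) = cmod (x - y)" for x y
 proof -
  show 2: "cmod (cnj x - cnj y) = cmod (x - y)" by (metis complex_cnj_diff complex_mod_cnj)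
  show "cmod (- cnj x - - cnj y) = cmod (x - y)" using 2 by (simp add: norm_minus_commute)
  show "cmod (\<i> * cnj x - \<i> * cnj y) = cmod (x - y)" unfolding right_diff_distrib[symmetric] norm_mult using 2 by simp
 qed
 show "norm (F (cnj u) - F' (cnj u)) = norm (F u - F' u)" "norm (F (- cnj u) - F' (- cnj u)) = norm (F u - F' u)"
  "norm (F (\<i> * cnj u) - F' (\<i> * cnj u)) = norm (F u - F' u)" for u
  by (rule n, simp only: vector_minus_component s[OF assms(1)] s[OF assms(2)] m)+
qed

end

section \<open>Strong convergence of the Galerkin solutions\<close>

lemma csym_restrict:
 assumes "csym a1 a2 a3 c" shows "csym a1 a2 a3 (%l. if l \<in> BX N then c l else 0)"
 unfolding csym_def
proof (intro allI conjI)
 fix l m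
 note c = csymD[OF assms, where k = l and l = m]
 have B: "(-l, m) \<in> BX N \<longleftrightarrow> (l, m) \<in> BX N" "(l, -m) \<in> BX N \<longleftrightarrow> (l, m) \<in> BX N" "(-m, -l) \<in> BX N \<longleftrightarrow> (l, m) \<in> BX N"
  by (auto simp: BX_def)
 show "(if (-l, m) \<in> BX N then c (-l, m) else 0) = a1 * cnj (if (l, m) \<in> BX N then c (l, m) else 0)"
  "(if (l, -m) \<in> BX N then c (l, -m) else 0) = a2 * cnj (if (l, m) \<in> BX N then c (l, m) else 0)"
  "(if (-m, -l) \<in> BX N then c (-m, -l) else 0) = a3 * cnj (if (l, m) \<in> BX N then c (l, m) else 0)"
  unfolding B c by simp_all
qed

context cylinder_eq begin

lemma Sop_diff: "Sop N (%j l. c j l - d j l) y = Sop N c y - Sop N d y"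
 unfolding Sop_def Smul_diff vtp_diff ..

lemma Sop_bsupp: "bsupp J d ==> J <= N ==> Sop N d = Sop J d"
 unfolding Sop_def by (rule vtp_bsupp[OF bsupp_Smul])

lemma N2_Sop_le: "N2 (%y. Sop N c y - Sop N d y) <= N2 (%y. vtp N c y - vtp N d y)"
proof -
 have "csq N (%j. Smul (%l. c j l - d j l)) <= csq N (%j l. c j l - d j l)" by (rule csq_Smul)
 thus ?thesis
  unfolding N2_def Sop_diff[symmetric] vtp_diff[symmetric] unfolding Sop_def Parseval_vtp by simp
qed

lemma cont_TW_e0_Sop: "good_coeff b M ==> continuous_on S (TW M (%y. e0 + Sop N c y))"
 by (intro continuous_TW continuous_on_add continuous_on_const continuous_Sop continuous_on_id)

lemma N2_TW_contr:
 assumes M: "good_coeff b M" and c: "!!j. csym 1 1 (-1) (c j)" and d: "!!j. csym 1 1 (-1) (d j)"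
 shows "N2 (%y. TW M (%y. e0 + Sop N c y) y - TW M (%y. e0 + Sop N d y) y) <= b * N2 (%y. vtp N c y - vtp N d y)"
proof -
 have b: "0 <= b" using good_coeffD(1)[OF M] .
 have e: "TW M (%y. e0 + Sop N c y) y - TW M (%y. e0 + Sop N d y) y = TW M (%y. 0 + Sop N (%j l. c j l - d j l) y) y" for y
  unfolding TW_diff[symmetric] Sop_diff by simp
 have "N2 (%y. TW M (%y. 0 + Sop N (%j l. c j l - d j l) y) y) <= b * N2 (%y. 0 + Sop N (%j l. c j l - d j l) y)"
 proof (rule N2_le)
  show "continuous_on QQ (TW M (%y. 0 + Sop N (%j l. c j l - d j l) y))"
   by (intro continuous_TW[OF M] continuous_on_add continuous_on_const continuous_Sop continuous_on_id)
  show "integral QQ (%y. (norm (TW M (%y. 0 + Sop N (%j l. c j l - d j l) y) y))^2) <= b^2 * integral QQ (%y. (norm (0 + Sop N (%j l. c j l - d j l) y))^2)"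
   by (rule integral_TW_le[OF M]) (auto intro!: ssym_Sop csym_diff c d continuous_Sop[OF continuous_on_id])
 qed (rule b)
 also have "... <= b * N2 (%y. vtp N c y - vtp N d y)"
  using N2_Sop_le[of N c d] by (intro mult_left_mono b) (simp add: Sop_diff)
 finally show ?thesis unfolding e .
qed

lemma N2_TW_change:
 assumes M: "good_coeff b (%Z. M Z - M' Z)" and c: "!!j. csym 1 1 (-1) (c j)"
 shows "N2 (%y. TW M (%y. e0 + Sop N c y) y - TW M' (%y. e0 + Sop N c y) y) <= b * N2 (%y. e0 + Sop N c y)"
 unfolding TW_diff_left
proof (rule N2_le)
 show "continuous_on QQ (TW (%Z. M Z - M' Z) (%y. e0 + Sop N c y))" by (rule cont_TW_e0_Sop[OF M])
 show "integral QQ (%y. (norm (TW (%Z. M Z - M' Z) (%y. e0 + Sop N c y) y))^2) <= b^2 * integral QQ (%y. (norm (e0 + Sop N c y))^2)"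
  by (rule integral_TW_le[OF M]) (auto intro!: ssym_Sop c cnj_e0 continuous_Sop[OF continuous_on_id])
qed (rule good_coeffD(1)[OF M])

text \<open>For a frozen coefficient the equation is a contraction with factor \<open>a\<close>. Its
  exact solution need not have finitely many frequencies, so the iteration is truncated after each
  step; a truncation error \<open>x\<close> per step turns a residual R into at most
  \<open>x + a * (x + R)\<close>.\<close>

lemma approx_solution:
 assumes M: "good_coeff a M" and t: "0 < t"
 shows "EX J d. (ALL j. csym 1 1 (-1) (d j)) & bsupp J d & N2 (%y. vtp J d y - TW M (%y. e0 + Sop J d y) y) <= t"
proof -
 \<comment> \<open>With this choice the accumulated truncation error \<open>2 * x / (1 - a)\<close>
   is \<open>t / 2\<close>; the other half is left for the decaying initial residual.\<close>
 define x where "x = t * (1 - a) / 4"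
 have x: "0 < x" using t a by (simp add: x_def)
 have iter: "EX J d. (ALL j. csym 1 1 (-1) (d j)) & bsupp J d &
   N2 (%y. vtp J d y - TW M (%y. e0 + Sop J d y) y) <= 4 * a ^ i + 2 * x / (1 - a)" for i
 proof (induction i)
  case 0
  define d where "d = (%(j::'n) (l::int * int). 0::complex)"
  have z: "vtp 0 d y = 0" "Sop 0 d y = 0" for y by (auto simp: d_def Sop_def vec_eq_iff Smul_def tp_def)
  have "N2 (%y. vtp 0 d y - TW M (%y. e0 + Sop 0 d y) y) <= 4"
   unfolding N2_def z
  proof (rule real_le_lsqrt)
   have "integral QQ (%y. (norm (0 - TW M (%y. e0 + 0) y))^2) <= integral QQ (%_::complex. 1)"
   proof (intro integral_le integrable_QQ continuous_intros continuous_TW[OF M])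
    fix y
    have "norm (TW M (%_. e0 + 0) y) <= a" using norm_TW_le[OF M, of "%_. e0 + 0" y] by (simp add: norm_e0)
    thus "(norm (0 - TW M (%_. e0 + 0) y))^2 <= 1" using a by (intro power_le_one) auto
   qed
   thus "integral QQ (%y. (norm (0 - TW M (%y. e0 + 0) y))^2) <= 4^2"
    using content_QQ by (simp add: QQ_def)
  qed simp
  moreover have "0 <= 2 * x / (1 - a)" using x a by simp
  ultimately have "N2 (%y. vtp 0 d y - TW M (%y. e0 + Sop 0 d y) y) <= 4 * a ^ 0 + 2 * x / (1 - a)" by simp
  moreover have "csym 1 1 (-1) (d j)" "bsupp 0 d" for j by (auto simp: d_def csym_def bsupp_def)
  ultimately show ?case by blast
 next
  case (Suc i)
  then obtain J d where d: "!!j. csym 1 1 (-1) (d j)" "bsupp J d"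
   and r: "N2 (%y. vtp J d y - TW M (%y. e0 + Sop J d y) y) <= 4 * a ^ i + 2 * x / (1 - a)" by blast
  define h where "h = TW M (%y. e0 + Sop J d y)"
  have hc: "continuous_on S h" for S unfolding h_def by (rule cont_TW_e0_Sop[OF M])
  obtain J0 where J0: "!!K. J0 <= K ==> N2 (%y. vtp K (vfc h) y - h y) <= x"
   using vtp_dense[OF hc _ x] biperiodic_TW unfolding h_def by blast
  define K where "K = max J J0"
  define d' where "d' j l = (if l \<in> BX K then vfc h j l else 0)" for j l
  have d'c: "csym 1 1 (-1) (d' j)" for j
   unfolding d'_def h_def
   by (intro csym_restrict csym_vfc_TW[OF M] continuous_on_add continuous_on_const continuous_Sop continuous_on_id)
  have vd': "vtp K d' = vtp K (vfc h)" by (rule vtp_cong) (simp add: d'_def)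
  have vd: "vtp J d = vtp K d" "Sop J d = Sop K d"
   using vtp_bsupp[OF d(2), of K] Sop_bsupp[OF d(2), of K] by (simp_all add: K_def)
  have n1: "N2 (%y. vtp K d' y - h y) <= x" unfolding vd' by (rule J0) (simp add: K_def)
  have "N2 (%y. vtp K d' y - vtp K d y) <= N2 (%y. vtp K d' y - h y) + N2 (%y. h y - vtp K d y)"
   by (rule N2_triangle3) (intro hc continuous_intros)+
  also have "... <= x + (4 * a ^ i + 2 * x / (1 - a))"
   using n1 r N2_minus_commute[of h "vtp K d"] unfolding h_def vd by simp
  finally have n2: "N2 (%y. vtp K d y - vtp K d' y) <= x + (4 * a ^ i + 2 * x / (1 - a))"
   by (subst N2_minus_commute)
  have "N2 (%y. vtp K d' y - TW M (%y. e0 + Sop K d' y) y) <= N2 (%y. vtp K d' y - h y) + N2 (%y. h y - TW M (%y. e0 + Sop K d' y) y)"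
   by (rule N2_triangle3) (intro hc cont_TW_e0_Sop[OF M] continuous_intros)+
  also have "N2 (%y. h y - TW M (%y. e0 + Sop K d' y) y) <= a * N2 (%y. vtp K d y - vtp K d' y)"
   unfolding h_def vd by (rule N2_TW_contr[OF M d(1) d'c])
  also have "... <= a * (x + (4 * a ^ i + 2 * x / (1 - a)))" using a n2 by (intro mult_left_mono) auto
  finally have "N2 (%y. vtp K d' y - TW M (%y. e0 + Sop K d' y) y) <= x + a * (x + (4 * a ^ i + 2 * x / (1 - a)))"
   using n1 by simp
  also have "... <= 4 * a ^ Suc i + 2 * x / (1 - a)"
  proof -
   have "x + a * x + a * (2 * x / (1 - a)) <= 2 * x / (1 - a)"
   proof -
    define q where "q = 2 * x / (1 - a)"
    have "q * (1 - a) = 2 * x" using a by (simp add: q_def)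
    moreover have "a * x <= 1 * x" using a x by (intro mult_right_mono) auto
    ultimately have "x + a * x + a * q <= q" by (simp add: algebra_simps)
    thus ?thesis by (simp add: q_def)
   qed
   thus ?thesis by (simp add: algebra_simps)
  qed
  finally have "N2 (%y. vtp K d' y - TW M (%y. e0 + Sop K d' y) y) <= 4 * a ^ Suc i + 2 * x / (1 - a)" .
  moreover have "bsupp K d'" by (simp add: bsupp_def d'_def)
  ultimately show ?case using d'c by blast
 qed
 have "(%i. 4 * a ^ i) \<longlonglongrightarrow> 4 * 0" using a by (intro tendsto_intros LIMSEQ_power_zero) auto
 hence L: "(%i. 4 * a ^ i) \<longlonglongrightarrow> 0" by (simp only: mult_zero_right)
 have "\<forall>\<^sub>F i in sequentially. 4 * a ^ i < t / 2" by (rule order_tendstoD(2)[OF L]) (use t in simp)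
 then obtain i where i: "4 * a ^ i < t / 2" by (meson eventually_happens' sequentially_bot)
 have "2 * x / (1 - a) = t / 2" using a by (simp add: x_def field_simps)
 hence "4 * a ^ i + 2 * x / (1 - a) <= t" using i by linarith
 thus ?thesis using iter[of i] order_trans by blast
qed

text \<open>The projected equation is compared with the reference field \<open>d\<close>: the
  difference of the right-hand sides is a contraction part with factor \<open>a\<close>, a part from
  replacing the coefficient by \<open>M\<close>, and the residual of \<open>d\<close>. The first is
  absorbed on the left, whence the division by \<open>1 - a\<close>. The projection itself costs
  nothing.\<close>

lemma Galerkin_close:
 assumes G: "Galerkin P N c g" and M: "good_coeff a M" and d: "!!j. csym 1 1 (-1) (d j)" "bsupp J d" "J <= N"
  and r: "N2 (%y. vtp J d y - TW M (%y. e0 + Sop J d y) y) <= t"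
  and x: "0 <= x" "!!Z. Z \<in> TC ==> norm (A (Zmap P (Fop N c) g Z) - M Z) <= x"
 defines "D \<equiv> ((real CARD('n))^2 * x * N2 (%y. e0 + Sop J d y) + t) / (1 - a)"
 shows "N2 (%y. vtp N c y - vtp J d y) <= D" "N2 (%y. Sop N c y - Sop J d y) <= D"
  "N2 (%y. vtp N c y - TW M (%y. e0 + Sop N c y) y) <= 2 * D + t"
proof -
 let ?MN = "%Z. A (Zmap P (Fop N c) g Z)"
 let ?h = "TW ?MN (%y. e0 + Sop N c y)"
 have cs: "csym 1 1 (-1) (c j)" for j by (rule Galerkin_csym[OF G])
 have MN: "good_coeff a ?MN" unfolding Fop_def by (intro good_Zmap admissible_vtp cs)
 have MD: "good_coeff ((real CARD('n))^2 * x) (%Z. ?MN Z - M Z)"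
  by (rule good_coeff_diff[OF MN M x])
 have v: "vtp J d = vtp N d" "Sop J d = Sop N d"
  using vtp_bsupp[OF d(2,3)] Sop_bsupp[OF d(2,3)] by simp_all
 have cont: "continuous_on QQ ?h" "continuous_on QQ (TW ?MN (%y. e0 + Sop N d y))" "continuous_on QQ (TW M (%y. e0 + Sop N d y))"
   "continuous_on QQ (TW M (%y. e0 + Sop N c y))"
  "continuous_on QQ (vtp N d)" "continuous_on QQ (vtp N c)"
  by (intro cont_TW_e0_Sop[OF MN] cont_TW_e0_Sop[OF M] continuous_vtp continuous_on_id)+
 have fix_eq: "c j l = vfc ?h j l" if "l \<in> BX N" for j l
  using G that unfolding Galerkin_def RHS_def by blast
 have "csq N (%j l. c j l - d j l) = csq N (%j l. vfc ?h j l - d j l)"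
  unfolding csq_def using fix_eq by simp
 also have "... <= integral QQ (%y. (norm (?h y - vtp N d y))^2)" by (rule csq_vfc_diff_le[OF cont(1)])
 finally have "N2 (%y. vtp N c y - vtp N d y) <= N2 (%y. ?h y - vtp N d y)"
  unfolding N2_def vtp_diff[symmetric] Parseval_vtp by simp
 also have "... <= N2 (%y. ?h y - TW ?MN (%y. e0 + Sop N d y) y) + N2 (%y. TW ?MN (%y. e0 + Sop N d y) y - vtp N d y)"
  by (rule N2_triangle3[OF cont(1,2,5)])
 also have "N2 (%y. TW ?MN (%y. e0 + Sop N d y) y - vtp N d y) <=
   N2 (%y. TW ?MN (%y. e0 + Sop N d y) y - TW M (%y. e0 + Sop N d y) y) + N2 (%y. TW M (%y. e0 + Sop N d y) y - vtp N d y)"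
  by (rule N2_triangle3[OF cont(2,3,5)])
 also have "N2 (%y. ?h y - TW ?MN (%y. e0 + Sop N d y) y) <= a * N2 (%y. vtp N c y - vtp N d y)"
  by (rule N2_TW_contr[OF MN cs d(1)])
 also have "N2 (%y. TW ?MN (%y. e0 + Sop N d y) y - TW M (%y. e0 + Sop N d y) y) <= (real CARD('n))^2 * x * N2 (%y. e0 + Sop N d y)"
  by (rule N2_TW_change[OF MD d(1)])
 also have "N2 (%y. TW M (%y. e0 + Sop N d y) y - vtp N d y) <= t"
  using r unfolding v by (subst N2_minus_commute)
 finally have "N2 (%y. vtp N c y - vtp N d y) <= a * N2 (%y. vtp N c y - vtp N d y) + ((real CARD('n))^2 * x * N2 (%y. e0 + Sop N d y) + t)"
  by simp
 hence "(1 - a) * N2 (%y. vtp N c y - vtp N d y) <= (real CARD('n))^2 * x * N2 (%y. e0 + Sop N d y) + t"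
  by (simp add: algebra_simps)
 thus uD: "N2 (%y. vtp N c y - vtp J d y) <= D"
  unfolding D_def v using a by (simp add: pos_le_divide_eq mult.commute)
 thus "N2 (%y. Sop N c y - Sop J d y) <= D"
  unfolding v using N2_Sop_le[of N c d] by simp
 have D0: "0 <= D" using uD N2_nonneg[of "%y. vtp N c y - vtp N d y"] cont unfolding v by (simp add: continuous_on_diff)
 have "N2 (%y. vtp N c y - TW M (%y. e0 + Sop N c y) y) <= N2 (%y. vtp N c y - vtp N d y) + N2 (%y. vtp N d y - TW M (%y. e0 + Sop N c y) y)"
  by (rule N2_triangle3[OF cont(6,5,4)])
 also have "N2 (%y. vtp N d y - TW M (%y. e0 + Sop N c y) y) <= N2 (%y. vtp N d y - TW M (%y. e0 + Sop N d y) y) +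
   N2 (%y. TW M (%y. e0 + Sop N d y) y - TW M (%y. e0 + Sop N c y) y)"
  by (rule N2_triangle3[OF cont(5,3,4)])
 also have "N2 (%y. TW M (%y. e0 + Sop N d y) y - TW M (%y. e0 + Sop N c y) y) <= a * N2 (%y. vtp N d y - vtp N c y)"
  by (rule N2_TW_contr[OF M d(1) cs])
 also have "N2 (%y. vtp N d y - vtp N c y) <= D"
  using uD unfolding v by (subst N2_minus_commute)
 also have "a * D <= D" using a D0 by (simp add: mult_left_le_one_le)
 finally show "N2 (%y. vtp N c y - TW M (%y. e0 + Sop N c y) y) <= 2 * D + t"
  using uD r a unfolding v by (simp add: mult_left_mono)
qed

lemma norm_Zmap_diff: "norm (Zmap P F g y - Zmap P F' \<tau>' y) <= norm (F y - F' y) + norm (F g - F' \<tau>')"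
proof -
 define w where "w = (\<chi> j. if j = k then 0 else (F g - F' \<tau>') $ j)"
 have e: "Zmap P F g y - Zmap P F' \<tau>' y = (1 / (1 + \<i>)) *s ((F y - F' y) - w)"
  unfolding Zmap_def w_def vec_eq_iff by (simp add: diff_divide_distrib add_divide_distrib)
 have "norm w <= norm (F g - F' \<tau>')"
  unfolding norm_vec_def w_def by (intro L2_set_mono) auto
 moreover have "cmod (1 / (1 + \<i>)) <= 1" using abs_Re_le_cmod[of "1 + \<i>"] by (auto simp: norm_divide divide_le_eq_1)
 ultimately have "norm (Zmap P F g y - Zmap P F' \<tau>' y) <= 1 * norm ((F y - F' y) - w)"
  unfolding e norm_svec by (intro mult_right_mono) auto
 also have "... <= norm (F y - F' y) + norm w" by (simp add: norm_triangle_ineq4)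
 finally show ?thesis using \<open>norm w <= _\<close> by simp
qed

lemma admissible_limit:
 assumes F: "!!i. admissible (f i)" and u: "uniform_limit UNIV f F sequentially"
 shows "admissible F"
proof -
 have lim: "(%i. f i y) \<longlonglongrightarrow> F y" for y using tendsto_uniform_limitI[OF u] by simp
 have limj: "(%i. f i y $ j) \<longlonglongrightarrow> F y $ j" for y j by (intro tendsto_intros lim)
 have "continuous_on UNIV F"
  using F by (intro uniform_limit_theorem[OF _ u]) (auto simp: admissible_def)
 moreover have "fsym 1 (-1) \<i> (%y. F y $ j)" for j
 proof -
  have s: "f i (cnj y) $ j = 1 * cnj (f i y $ j)" "f i (- cnj y) $ j = -1 * cnj (f i y $ j)" "f i (\<i> * cnj y) $ j = \<i> * cnj (f i y $ j)" for i y
   using F[of i] by (auto simp: admissible_def fsym_def)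
  have L: "F (m y) $ j = b * cnj (F y $ j)" if "!!i. f i (m y) $ j = b * cnj (f i y $ j)" for m b y
  proof (rule LIMSEQ_unique[OF limj])
   show "(%i. f i (m y) $ j) \<longlonglongrightarrow> b * cnj (F y $ j)"
    unfolding that by (intro tendsto_intros limj)
  qed
  show ?thesis unfolding fsym_def
   by (intro allI conjI) (rule L[where m = cnj], rule s(1), rule L[where m = "%y. - cnj y"], rule s(2), rule L[where m = "%y. \<i> * cnj y"], rule s(3))
 qed
 moreover have "biperiodic F"
  unfolding biperiodic_def
 proof (intro allI conjI)
  fix y
  have p: "f i (y + 4) = f i y" "f i (y + 4 * \<i>) = f i y" for i
   using F[of i] by (auto simp: admissible_def biperiodic_def)
  show "F (y + 4) = F y" using LIMSEQ_unique[OF lim[of "y + 4"]] lim[of y] unfolding p by blast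
  show "F (y + 4 * \<i>) = F y" using LIMSEQ_unique[OF lim[of "y + 4 * \<i>"]] lim[of y] unfolding p by blast
 qed
 ultimately show ?thesis unfolding admissible_def by blast
qed

end

context cylinder_eq begin

lemma compact_uniform_compose:
 fixes f :: "'x => complex^'n" and F :: "nat => 'x => complex^'n"
 assumes g: "continuous_on UNIV (g :: complex^'n => 'b::real_normed_vector)" and b: "bounded (f ` S)"
  and u: "uniform_limit S F f sequentially" and e: "0 < e"
 shows "\<forall>\<^sub>F i in sequentially. ALL x:S. norm (g (F i x) - g (f x)) <= e"
proof -
 obtain R where R: "!!x. x \<in> S ==> norm (f x) <= R" using b by (auto simp: bounded_iff)
 have "uniformly_continuous_on (cball 0 (R + 1)) g"
  by (intro compact_uniformly_continuous continuous_on_subset[OF g]) auto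
 then obtain l where l: "0 < l" "!!x y. x \<in> cball 0 (R + 1) ==> y \<in> cball 0 (R + 1) ==> dist y x < l ==> dist (g y) (g x) < e"
  unfolding uniformly_continuous_on_def using e by metis
 have "\<forall>\<^sub>F i in sequentially. ALL x:S. dist (F i x) (f x) < min l 1"
  using uniform_limitD[OF u, of "min l 1"] l by simp
 thus ?thesis
 proof eventually_elim
  case (elim i)
  show ?case
  proof
   fix x assume x: "x \<in> S"
   have "norm (F i x) <= R + 1"
    using elim x R[OF x] norm_triangle_ineq[of "f x" "F i x - f x"] by (force simp: dist_norm)
   thus "norm (g (F i x) - g (f x)) <= e"
    using l(2)[of "f x" "F i x"] elim x R[OF x] by (force simp: dist_norm)
  qed
 qed
qed

text \<open>Compactness is needed only for \<open>F\<close> and for the point \<open>h\<close>.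
  Their convergence makes the coefficients \<open>A(Z)\<close> converge uniformly, and
  \<open>Galerkin_close\<close> then forces the derivatives to converge strongly, so the nonlinear
  equation survives the limit.\<close>

lemma Galerkin_limit:
 assumes P: "P \<in> Cylinder k"
 shows "EX F s N c. admissible F & s \<in> TC & Zmap P F s s = P & (ALL i. \<exists>\<tau>'. Galerkin P (N i) (c i) \<tau>') &
  uniform_limit UNIV (%i. Fop (N i) (c i)) F sequentially &
  (ALL e>0. EX i0. ALL i>=i0. ALL i'>=i0. N2 (%z. vtp (N i) (c i) z - vtp (N i') (c i') z) <= e &
    N2 (%z. Sop (N i) (c i) z - Sop (N i') (c i') z) <= e) &
  (ALL e>0. EX i0. ALL i>=i0. N2 (%z. vtp (N i) (c i) z - RHS P F s (%z. e0 + Sop (N i) (c i) z) z) <= e)"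
proof -
 obtain C T where G: "!!N. Galerkin P N (C N) (T N)" using Galerkin_exists[OF P] by metis
 from Galerkin_bounded obtain B where B0: "ALL P N c s. Galerkin P N c s --> (ALL p:TC. norm (Fop N c p) <= B)" ..
 have B: "norm (Fop N (C N) p) <= B" if "p \<in> TC" for N p by (rule B0[rule_format, OF G that])
 from Galerkin_equicont obtain K where K0: "ALL P N c s. Galerkin P N c s -->
  (ALL p:TC. ALL q:TC. ALL h. 0 < h --> h <= 1/2 --> cmod (p - q) <= h --> norm (Fop N c p - Fop N c q) <= K * (2 * h) powr be)" ..
 have K: "norm (Fop N (C N) p - Fop N (C N) q) <= K * (2 * h) powr be"
  if "p \<in> TC" "q \<in> TC" "0 < h" "h <= 1/2" "cmod (p - q) <= h" for N p q h
  by (rule K0[rule_format, OF G that])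
 have eq: "EX d>0. ALL N y. y \<in> TC & norm (x - y) < d --> norm (Fop N (C N) x - Fop N (C N) y) < e" if "x \<in> TC" "0 < e" for x e
 proof -
  have "((%h. K * (2 * h) powr be) \<longlongrightarrow> K * (2 * 0) powr be) (at_right 0)"
   using be by (intro tendsto_intros tendsto_powr') (auto simp: eventually_at_right_field intro!: exI[of _ 1])
  hence "\<forall>\<^sub>F h in at_right 0. K * (2 * h) powr be < e"
   using that(2) be by (intro order_tendstoD(2)) auto
  moreover have "\<forall>\<^sub>F h in at_right 0. h \<in> {0<..<1/2::real}" by (rule eventually_at_right_real) simp
  ultimately have "\<forall>\<^sub>F h in at_right 0. K * (2 * h) powr be < e & h \<in> {0<..<1/2::real}" by (rule eventually_conj)
  then obtain h where h: "K * (2 * h) powr be < e" "0 < h" "h < 1/2"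
   using eventually_happens'[OF trivial_limit_at_right_real] by force
  have "norm (Fop N (C N) x - Fop N (C N) y) < e" if "y \<in> TC" "norm (x - y) < h" for N y
   using K[of x y h N] that h \<open>x \<in> TC\<close> by simp
  thus ?thesis using h(2) by blast
 qed
 obtain g r where "continuous_on TC g" and r: "strict_mono (r :: nat => nat)"
  and gl: "!!e. 0 < e ==> EX N. ALL n x. n \<ge> N & x \<in> TC --> norm (Fop (r n) (C (r n)) x - g x) < e"
  by (rule Arzela_Ascoli[OF compact_TC, of "%N. Fop N (C N)" B]) (use B eq in blast)+
 have "ALL n. (T \<circ> r) n \<in> TC" using G unfolding Galerkin_def by simp
 then obtain s q where s: "s \<in> TC" and q: "strict_mono (q :: nat => nat)" and Tl: "((T \<circ> r) \<circ> q) \<longlonglongrightarrow> s"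
  by (rule seq_compactE[OF compact_imp_seq_compact[OF compact_TC]])
 define N where "N = r \<circ> q"
 define c where "c i = C (N i)" for i
 define f where "f i = Fop (N i) (c i)" for i
 define t where "t i = T (N i)" for i
 have GN: "Galerkin P (N i) (c i) (t i)" for i unfolding c_def t_def by (rule G)
 have Nge: "i <= N i" for i unfolding N_def using strict_mono_o[OF r q] by (rule seq_suble)
 have tl: "t \<longlonglongrightarrow> s" using Tl by (simp add: t_def[abs_def] N_def o_def)
 have adm: "admissible (f i)" for i
  unfolding f_def Fop_def by (intro admissible_vtp Galerkin_csym[OF GN])
 \<comment> \<open>Arzela-Ascoli acts on the triangle; folding transfers the Cauchy property to the
   plane.\<close>
 have cauchy: "ALL e>0. EX M. ALL m n x. M <= m & M <= n & x \<in> UNIV --> dist (f m x) (f n x) < e"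
 proof (intro allI impI)
  fix e :: real assume "0 < e"
  then obtain M where M: "!!n x. M <= n ==> x \<in> TC ==> norm (Fop (r n) (C (r n)) x - g x) < e/2"
   using gl[of "e/2"] by auto
  have M': "norm (f n x - g x) < e/2" if "M <= n" "x \<in> TC" for n x
   using M[of "q n" x] that seq_suble[OF q, of n] by (simp add: f_def c_def N_def)
  have "dist (f m x) (f n x) < e" if "M <= m" "M <= n" for m n x
  proof -
   have "norm (f m (fold_TC x) - f n (fold_TC x)) <= norm (f m (fold_TC x) - g (fold_TC x)) + norm (f n (fold_TC x) - g (fold_TC x))"
    using norm_triangle_ineq4[of "f m (fold_TC x) - g (fold_TC x)" "f n (fold_TC x) - g (fold_TC x)"] by simp
   thus ?thesis
    using M'[OF that(1) fold_in_TC, of x] M'[OF that(2) fold_in_TC, of x] norm_fold_admissible[OF adm adm, of m x n]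
    by (simp add: dist_norm)
  qed
  thus "EX M. ALL m n x. M <= m & M <= n & x \<in> UNIV --> dist (f m x) (f n x) < e" by blast
 qed
 then obtain F where "ALL e>0. EX M. ALL n x. M <= n & x \<in> UNIV --> dist (f n x) (F x) < e"
  using uniformly_convergent_eq_cauchy[of "%x. x \<in> UNIV" f] by blast
 hence u: "uniform_limit UNIV f F sequentially"
  unfolding uniform_limit_sequentially_iff by simp
 have F: "admissible F" by (rule admissible_limit[OF adm u])
 have Fc: "continuous_on UNIV F" using F by (simp add: admissible_def)
 have ft: "(%i. f i (t i)) \<longlonglongrightarrow> F s"
 proof -
  have 1: "(%i. F (t i)) \<longlonglongrightarrow> F s" by (rule continuous_on_tendsto_compose[OF Fc tl]) auto
  have "(%i. f i (t i) - F (t i)) \<longlonglongrightarrow> 0"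
  proof (rule LIMSEQ_I)
   fix e :: real assume "0 < e"
   from uniform_limitD[OF u this] obtain M where "ALL n>=M. ALL x. dist (f n x) (F x) < e"
    by (auto simp: eventually_sequentially)
   thus "EX no. ALL n>=no. norm (f n (t n) - F (t n) - 0) < e" by (auto simp: dist_norm)
  qed
  from tendsto_add[OF this 1] show ?thesis by simp
 qed
 have Zeq: "Zmap P F s s = P"
 proof -
  have "Zmap P (f i) (t i) (t i) = P" for i using GN unfolding Galerkin_def f_def by blast
  from arg_cong[OF this, of "%v. v $ k"] have "(t i + f i (t i) $ k) / (1 + \<i>) - 1 = P $ k" for i
   by (simp add: Zmap_def)
  moreover have "(%i. (t i + f i (t i) $ k) / (1 + \<i>) - 1) \<longlonglongrightarrow> (s + F s $ k) / (1 + \<i>) - 1"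
   by (intro tendsto_intros tl ft onei_ne)
  ultimately have "(s + F s $ k) / (1 + \<i>) - 1 = P $ k" by (simp add: LIMSEQ_const_iff)
  thus ?thesis unfolding Zmap_def vec_eq_iff by simp
 qed
 have uZ: "uniform_limit TC (%i. Zmap P (f i) (t i)) (Zmap P F s) sequentially"
 proof (rule uniform_limitI)
  fix e :: real assume e: "0 < e"
  have "\<forall>\<^sub>F i in sequentially. ALL x:UNIV. dist (f i x) (F x) < e/2" using uniform_limitD[OF u, of "e/2"] e by simp
  moreover have "\<forall>\<^sub>F i in sequentially. dist (f i (t i)) (F s) < e/2" using tendstoD[OF ft, of "e/2"] e by simp
  ultimately show "\<forall>\<^sub>F i in sequentially. ALL x:TC. dist (Zmap P (f i) (t i) x) (Zmap P F s x) < e"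
  proof eventually_elim
   case (elim i)
   show ?case
   proof
    fix x
    have "dist (f i x) (F x) < e/2" using elim(1) by simp
    thus "dist (Zmap P (f i) (t i) x) (Zmap P F s x) < e"
     using norm_Zmap_diff[of P "f i" "t i" x F s] elim(2) unfolding dist_norm by linarith
   qed
  qed
 qed
 define M where "M = (%W. A (Zmap P F s W))"
 have M: "good_coeff a M" unfolding M_def by (rule good_Zmap[OF F])
 have bZ: "bounded (Zmap P F s ` TC)"
  by (intro compact_imp_bounded compact_continuous_image continuous_Zmap[OF Fc] compact_TC)
 have Aconv: "\<forall>\<^sub>F i in sequentially. ALL x:TC. norm (A (Zmap P (f i) (t i) x) - M x) <= e" if "0 < e" for e
  unfolding M_def by (rule compact_uniform_compose[OF contA bZ uZ that])
 have close: "EX v w i0. (ALL i>=i0. N2 (%z. vtp (N i) (c i) z - v z) <= e & N2 (%z. Sop (N i) (c i) z - w z) <= e &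
   N2 (%z. vtp (N i) (c i) z - TW M (%z. e0 + Sop (N i) (c i) z) z) <= 3 * e) & continuous_on QQ v & continuous_on QQ w" if e: "0 < e" for e
 proof -
  define l where "l = e * (1 - a) / 2"
  have l: "0 < l" "l <= e" using e a by (auto simp: l_def field_simps)
  obtain J d where d: "!!j. csym 1 1 (-1) (d j)" "bsupp J d" "N2 (%z. vtp J d z - TW M (%z. e0 + Sop J d z) z) <= l"
   using approx_solution[OF M l(1)] by blast
  define L where "L = (real CARD('n))^2 * N2 (%z. e0 + Sop J d z) + 1"
  have "0 <= N2 (%z. e0 + Sop J d z)"
   by (intro N2_nonneg continuous_on_add continuous_on_const continuous_Sop continuous_on_id)
  hence L: "0 < L" unfolding L_def by (simp add: add_nonneg_pos)
  \<comment> \<open>The reference field is fixed before this bound on the coefficient error, so the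
    weight \<open>L\<close>, which depends on that field, can be divided out.\<close>
  define Z where "Z = l / L"
  have Z: "0 < Z" using l L by (simp add: Z_def)
  obtain i1 where i1: "!!i x. i1 <= i ==> x \<in> TC ==> norm (A (Zmap P (f i) (t i) x) - M x) <= Z"
   using Aconv[OF Z] unfolding eventually_sequentially by blast
  have D: "((real CARD('n))^2 * Z * N2 (%z. e0 + Sop J d z) + l) / (1 - a) <= e"
  proof -
   have "(real CARD('n))^2 * Z * N2 (%z. e0 + Sop J d z) = Z * (L - 1)" by (simp add: L_def)
   also have "... <= Z * L" using Z by simp
   also have "... = l" using L by (simp add: Z_def)
   finally have "(real CARD('n))^2 * Z * N2 (%z. e0 + Sop J d z) + l <= 2 * l" by simp
   also have "... = e * (1 - a)" by (simp add: l_def)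
   finally show ?thesis using a by (simp add: pos_divide_le_eq)
  qed
  have "N2 (%z. vtp (N i) (c i) z - vtp J d z) <= e & N2 (%z. Sop (N i) (c i) z - Sop J d z) <= e &
   N2 (%z. vtp (N i) (c i) z - TW M (%z. e0 + Sop (N i) (c i) z) z) <= 3 * e" if "max i1 J <= i" for i
  proof -
   have JN: "J <= N i" using that Nge[of i] by simp
   have "norm (A (Zmap P (Fop (N i) (c i)) (t i) W) - M W) <= Z" if "W \<in> TC" for W
    using i1[of i W] \<open>max i1 J <= i\<close> that by (simp add: f_def)
   note cl = Galerkin_close[OF GN M d(1,2) JN d(3) less_imp_le[OF Z] this]
   show ?thesis using cl D l by linarith
  qed
  moreover have "continuous_on QQ (vtp J d)" "continuous_on QQ (Sop J d)" by (intro continuous_intros)+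
  ultimately show ?thesis by blast
 qed
 have part1: "EX i0. ALL i>=i0. ALL i'>=i0. N2 (%z. vtp (N i) (c i) z - vtp (N i') (c i') z) <= e &
    N2 (%z. Sop (N i) (c i) z - Sop (N i') (c i') z) <= e" if "0 < e" for e
 proof -
  have e2: "0 < e/2" using that by simp
  obtain v w i0 where vw: "!!i. i0 <= i ==> N2 (%z. vtp (N i) (c i) z - v z) <= e/2"
   "!!i. i0 <= i ==> N2 (%z. Sop (N i) (c i) z - w z) <= e/2" "continuous_on QQ v" "continuous_on QQ w"
   using close[OF e2] by blast
  have cc: "continuous_on QQ (vtp (N i) (c i))" "continuous_on QQ (Sop (N i) (c i))" for i by (intro continuous_intros)+
  have "N2 (%z. vtp (N i) (c i) z - vtp (N i') (c i') z) <= e" "N2 (%z. Sop (N i) (c i) z - Sop (N i') (c i') z) <= e"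
   if "i0 <= i" "i0 <= i'" for i i'
   using N2_triangle3[OF cc(1) vw(3) cc(1), of i i'] N2_triangle3[OF cc(2) vw(4) cc(2), of i i'] vw(1)[OF that(1)] vw(1)[OF that(2)]
    vw(2)[OF that(1)] vw(2)[OF that(2)] N2_minus_commute[of v] N2_minus_commute[of w] by simp_all
  thus ?thesis by blast
 qed
 have part2: "EX i0. ALL i>=i0. N2 (%z. vtp (N i) (c i) z - RHS P F s (%z. e0 + Sop (N i) (c i) z) z) <= e" if "0 < e" for e
  using close[of "e/3"] that unfolding RHS_def M_def by auto
 show ?thesis
  using F s Zeq GN u part1 part2 unfolding f_def
  by (intro exI[of _ F] exI[of _ s] exI[of _ N] exI[of _ c]) blast
qed

end

section \<open>The maximum principle\<close>

lemma wrap_QQ: "EX m n. Z + 4 * of_int m + 4 * of_int n * \<i> \<in> QQ"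
proof -
 have "EX m. -2 <= x + 4 * of_int m & x + 4 * of_int m <= 2" for x :: real
  using floor_correct[of "(x + 2) / 4"] by (intro exI[of _ "- \<lfloor>(x + 2) / 4\<rfloor>"]) (simp add: field_simps)
 from this[of "Re Z"] this[of "Im Z"] show ?thesis by (auto simp: QQ_iff)
qed

text \<open>A shift multiplies each character by a constant, and all but the trivial one have mean
  zero; uniform approximation does the rest.\<close>

lemma integral_QQ_shift:
 fixes g :: "complex => complex"
 assumes g: "continuous_on UNIV g" "biperiodic g"
 shows "integral QQ (%Z. g (Z + s)) = integral QQ g"
proof -
 have c: "continuous_on QQ (%Z. g (Z + s))" "continuous_on QQ g"
  using g(1) by (auto intro!: continuous_intros continuous_on_compose2[OF g(1)] intro: continuous_on_subset)
 have "cmod (integral QQ (%Z. g (Z + s)) - integral QQ g) <= 32 * e" if e: "0 < e" for e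
 proof -
  obtain M d where d: "!!Z. Z \<in> QQ ==> cmod (g Z - tp M d Z) < e" using trig_poly_dense[OF g e] by blast
  have d': "cmod (g Z - tp M d Z) < e" for Z
  proof -
   obtain m n where mn: "Z + 4 * of_int m + 4 * of_int n * \<i> \<in> QQ" using wrap_QQ by blast
   show ?thesis using d[OF mn] by (simp only: biperiodic_int[OF g(2)] biperiodic_int[OF biperiodic_tp])
  qed
  have "integral QQ (%Z. tp M d (Z + s)) = integral QQ (tp M d)"
  proof -
   have "integral QQ (%Z. tp M d (Z + s)) = (SUM l:BX M. integral QQ (%Z. (d l * ek l s) * ek l Z))"
    unfolding tp_def ek_plus by (subst integral_sum) (auto intro!: continuous_intros integrable_QQ simp: mult_ac)
   also have "... = (SUM l:BX M. integral QQ (%Z. d l * ek l Z))"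
    by (intro sum.cong refl) (simp add: integral_ek)
   also have "... = integral QQ (tp M d)"
    unfolding tp_def[abs_def] by (subst integral_sum) (auto intro!: continuous_intros integrable_QQ)
   finally show ?thesis .
  qed
  hence "integral QQ (%Z. g (Z + s)) - integral QQ g =
    integral QQ (%Z. g (Z + s) - tp M d (Z + s)) - integral QQ (%Z. g Z - tp M d Z)"
   using c by (subst (1 2) integral_diff) (auto intro!: continuous_intros integrable_QQ)
  also have "cmod ... <= 16 * e + 16 * e"
   by (rule order_trans[OF norm_triangle_ineq4], rule add_mono; rule norm_integral_QQ_le)
    (use c d' in "auto intro!: continuous_intros less_imp_le")
  finally show ?thesis by simp
 qed
 hence "cmod (integral QQ (%Z. g (Z + s)) - integral QQ g) <= e" if "0 < e" for e
  using that by (metis div_by_0 divide_pos_pos mult.commute nonzero_divide_eq_eq zero_less_numeral zero_neq_numeral)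
 hence "cmod (integral QQ (%Z. g (Z + s)) - integral QQ g) <= 0" by (rule field_le_epsilon[where y = 0, simplified])
 thus ?thesis by simp
qed

text \<open>The square over which fields are averaged: averaging turns L^2 convergence of
  derivatives into uniform convergence.\<close>

definition BB :: "real => complex set" where "BB W = cbox 0 (Complex W W)"

lemma BB_iff: "s \<in> BB W \<longleftrightarrow> 0 <= Re s & Re s <= W & 0 <= Im s & Im s <= W"
 unfolding BB_def using cbox_Complex_iff[of s 0 0 W W] by (simp add: zero_complex.code)

lemma content_BB: "0 <= W ==> measure lborel (BB W) = W^2"
 unfolding BB_def using content_complex_cbox[of 0 W 0 W] by (simp add: zero_complex.code power2_eq_square)

lemma norm_BB: "s \<in> BB W ==> cmod s <= 2 * W"
 using cmod_le[of s] by (auto simp: BB_iff)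

lemma BB_QQ: "W <= 2 ==> BB W \<subseteq> QQ" by (auto simp: BB_iff QQ_iff)

lemma integrable_BB:
 "continuous_on UNIV (f :: complex => 'b::euclidean_space) ==> (%s. f (Z + s)) integrable_on BB W"
 unfolding BB_def by (rule integrable_continuous, rule continuous_on_compose2[of UNIV f]) (auto intro!: continuous_intros)

lemma integral_BB_tp: "integral (BB W) (%s. tp N c (Z + s)) = tp N (%l. c l * integral (BB W) (ek l)) Z"
 unfolding tp_def ek_plus
proof (subst integral_sum)
 show "(%s. c l * (ek l Z * ek l s)) integrable_on BB W" for l
  unfolding BB_def by (rule integrable_continuous) (intro continuous_intros)
 show "(SUM l:BX N. integral (BB W) (%s. c l * (ek l Z * ek l s))) = (SUM l:BX N. c l * integral (BB W) (ek l) * ek l Z)"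
  by (simp, simp add: mult.commute mult.left_commute)
qed simp

lemma norm_integral_BB_const:
 fixes g :: "complex => complex"
 assumes "continuous_on UNIV g" "!!s. s \<in> BB W ==> cmod (g (Z + s)) <= B" "0 <= W"
 shows "cmod (integral (BB W) (%s. g (Z + s))) <= W^2 * B"
proof -
 have "cmod (integral (BB W) (%s. g (Z + s))) <= integral (BB W) (%s. B)"
  by (rule integral_norm_bound_integral) (use assms integrable_BB[of g Z W] in "auto simp: BB_def")
 also have "... = W^2 * B" using content_BB[OF assms(3)] by (simp add: BB_def)
 finally show ?thesis .
qed

text \<open>Young's inequality at the level \<open>e\<close> bounds the integrand by its square, and
  the integral of the square over a shifted small square is at most that over a full period. The
  constant 9 is generous: the estimate gives 2e + e/2.\<close>

lemma norm_integral_BB_le: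
 fixes g :: "complex => complex^'n"
 assumes g: "continuous_on UNIV g" "biperiodic g" and e: "N2 g <= e" "0 < e" and W: "0 <= W" "W <= 2"
 shows "cmod (integral (BB W) (%s. g (Z + s) $ j)) <= 9 * e"
proof -
 have c: "continuous_on UNIV (%s. g (Z + s))" by (intro continuous_on_compose2[OF g(1)] continuous_intros) auto
 have cs: "continuous_on UNIV (%s. (norm (g s))^2)" using g(1) by (intro continuous_intros)
 let ?q = "%s. e / 2 + (norm (g (Z + s)))^2 / (2 * e)"
 have i2: "(%s. (norm (g (Z + s)))^2) integrable_on BB W" by (rule integrable_BB[OF cs])
 have "integral (BB W) (%s. (norm (g (Z + s)))^2) <= integral QQ (%s. (norm (g (Z + s)))^2)"
  by (rule integral_subset_le[OF BB_QQ[OF W(2)] i2 integrable_QQ]) (auto intro!: continuous_intros continuous_on_subset[OF c])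
 also have "... = integral QQ (%s. (norm (g s))^2)"
 proof -
  have "integral QQ (%s. complex_of_real ((norm (g (s + Z)))^2)) = integral QQ (%s. complex_of_real ((norm (g s))^2))"
   by (rule integral_QQ_shift[of "%s. complex_of_real ((norm (g s))^2)"])
    (use g in "auto simp: biperiodic_def intro!: continuous_intros")
  hence "Re (integral QQ (%s. complex_of_real ((norm (g (s + Z)))^2))) = Re (integral QQ (%s. complex_of_real ((norm (g s))^2)))"
   by (rule arg_cong)
  thus ?thesis
   by (subst (asm) (1 2) integral_QQ_Re[symmetric])
    (auto intro!: continuous_intros continuous_on_subset[OF c] continuous_on_subset[OF g(1)] simp: add.commute[of _ Z])
 qed
 also have "... = (N2 g)^2" by (rule N2_sq[symmetric]) (use g(1) in "rule continuous_on_subset, auto")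
 also have "... <= e^2" using e N2_nonneg[OF continuous_on_subset[OF g(1)]] by (intro power_mono) auto
 finally have le: "integral (BB W) (%s. (norm (g (Z + s)))^2) <= e^2" .
 have "cmod (integral (BB W) (%s. g (Z + s) $ j)) <= integral (BB W) ?q"
 proof (rule integral_norm_bound_integral)
  show "(%s. g (Z + s) $ j) integrable_on BB W" by (rule integrable_BB[of "%s. g s $ j"]) (use g(1) in "intro continuous_intros")
  show "?q integrable_on BB W" using e(2)
   by (intro integrable_BB[of "%s. e / 2 + (norm (g s))^2 / (2 * e)"] continuous_intros g(1)) auto
  fix s
  have "cmod (g (Z + s) $ j) <= norm (g (Z + s))" by (rule Finite_Cartesian_Product.norm_nth_le)
  also have "... <= ?q s"
  proof -
   have "0 <= (norm (g (Z + s)) - e)^2 / (2 * e)" using e(2) by simp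
   thus ?thesis using e(2) by (simp add: power2_diff field_simps power2_eq_square)
  qed
  finally show "cmod (g (Z + s) $ j) <= ?q s" .
 qed
 also have "... = e / 2 * W^2 + integral (BB W) (%s. (norm (g (Z + s)))^2) / (2 * e)"
 proof (subst integral_add)
  show "(%x. (norm (g (Z + x)))^2 / (2 * e)) integrable_on BB W"
   using e(2) by (intro integrable_BB[of "%s. (norm (g s))^2 / (2 * e)"] continuous_intros g(1)) auto
  show "(%x. e / 2) integrable_on BB W" unfolding BB_def by (rule integrable_continuous) auto
 qed (use content_BB[OF W(1)] in "simp add: BB_def")
 also have "... <= e / 2 * 2^2 + e^2 / (2 * e)"
  using e(2) W by (intro add_mono mult_left_mono power_mono divide_right_mono le) auto
 also have "... <= 9 * e" using e(2) by (simp add: power2_eq_square)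
 finally show ?thesis .
qed

context cylinder_eq begin

lemma integral_BB_Fop_derivative:
 assumes "!!j. c j 0 = 0"
 shows "((%Z. integral (BB W) (%s. Fop N c (Z + s) $ j)) has_derivative
  (%h. h * integral (BB W) (%s. Sop N c (Z + s) $ j) + cnj h * integral (BB W) (%s. vtp N c (Z + s) $ j))) (at Z within S)"
proof -
 let ?c = "%l. c j l * integral (BB W) (ek l)"
 have F: "tp N (%l. Fmul (c j) l * integral (BB W) (ek l)) = tp N (Fmul ?c)"
  by (simp add: tp_def[abs_def] Fmul_def mult.assoc)
 have S: "tp N (%l. Smul (c j) l * integral (BB W) (ek l)) = tp N (Smul ?c)"
  by (simp add: tp_def[abs_def] Smul_def mult.assoc)
 show ?thesis
  unfolding Fop_def Sop_def vtp_nth integral_BB_tp F S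
  by (rule has_derivative_tp_Fmul) (simp add: assms)
qed

text \<open>Weyl's lemma by averaging. The derivatives of the averaged Galerkin fields are averages
  of \<open>S u\<close> and \<open>u\<close>; the former converge uniformly, the latter tend to 0
  where the limiting right-hand side vanishes. The limit then has a complex-linear derivative.
  Points of the square have modulus at most \<open>2 * W\<close>, hence at most r/2, so averages
  centred in the half ball see only the ball.\<close>

lemma holomorphic_square_average:
 assumes F: "admissible F" and c0: "!!i j. c i j 0 = 0"
  and u: "uniform_limit UNIV (%i. Fop (N i) (c i)) F sequentially"
  and C: "!!e. e > 0 ==> EX i0. ALL i>=i0. ALL i'>=i0. N2 (%Z. Sop (N i) (c i) Z - Sop (N i') (c i') Z) <= e"
  and R: "!!e. e > 0 ==> EX i0. ALL i>=i0. N2 (%Z. vtp (N i) (c i) Z - RHS P F T (%Z. e0 + Sop (N i) (c i) Z) Z) <= e"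
  and zero: "!!w Z. Z \<in> ball x r ==> RHS P F T w Z = 0"
  and W: "0 < W" "W <= 2" "4 * W <= r"
 shows "(%Z. integral (BB W) (%s. F (Z + s) $ j)) holomorphic_on ball x (r / 2)"
proof -
 define f where "f i Z = integral (BB W) (%s. Fop (N i) (c i) (Z + s) $ j)" for i Z
 define S where "S i Z = integral (BB W) (%s. Sop (N i) (c i) (Z + s) $ j)" for i Z
 define V where "V i Z = integral (BB W) (%s. vtp (N i) (c i) (Z + s) $ j)" for i Z
 have bip: "biperiodic (vtp M d)" for M and d :: "'n => _"
  using biperiodic_tp unfolding biperiodic_def vtp_def by (simp add: vec_eq_iff)
 have cU: "continuous_on UNIV (vtp M d)" for M and d :: "'n => _" by (intro continuous_intros)
 have cF: "continuous_on UNIV F" using F by (simp add: admissible_def)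
 have comp: "continuous_on UNIV g ==> (%s. g (Z + s) $ j) integrable_on BB W" for g :: "complex => complex^'n" and Z
  by (rule integrable_BB[of "%s. g s $ j"]) (intro continuous_intros)
 have SC: "cmod (S i Z - S i' Z) <= 9 * e" if "N2 (%Z. Sop (N i) (c i) Z - Sop (N i') (c i') Z) <= e" "0 < e" for i i' Z e
 proof -
  have "cmod (integral (BB W) (%s. (Sop (N i) (c i) (Z + s) - Sop (N i') (c i') (Z + s)) $ j)) <= 9 * e"
   by (rule norm_integral_BB_le[of "%s. Sop (N i) (c i) s - Sop (N i') (c i') s"])
    (use that W bip in "auto simp: biperiodic_def Sop_def intro!: continuous_intros")
  also have "integral (BB W) (%s. (Sop (N i) (c i) (Z + s) - Sop (N i') (c i') (Z + s)) $ j) = S i Z - S i' Z"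
   unfolding S_def vector_minus_component by (rule integral_diff) (auto simp: Sop_def intro!: integrable_BB[of "tp _ _"] continuous_intros)
  finally show ?thesis .
 qed
 have VC: "cmod (V i Z) <= 9 * e"
  if "N2 (%Z. vtp (N i) (c i) Z - RHS P F T (%Z. e0 + Sop (N i) (c i) Z) Z) <= e" "0 < e" "Z \<in> ball x (r / 2)" for i Z e
 proof -
  define g where "g Z = RHS P F T (%Z. e0 + Sop (N i) (c i) Z) Z" for Z
  have g: "continuous_on UNIV g" "biperiodic g"
  proof -
   show "continuous_on UNIV g" unfolding g_def[abs_def] RHS_def
    by (rule continuous_TW[OF good_Zmap[OF F]]) (intro continuous_intros)
   show "biperiodic g" using biperiodic_TW unfolding g_def[abs_def] RHS_def biperiodic_def vec_eq_iff by blast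
  qed
  have "V i Z = integral (BB W) (%s. (vtp (N i) (c i) (Z + s) - g (Z + s)) $ j)"
   unfolding V_def
  proof (rule Henstock_Kurzweil_Integration.integral_cong)
   fix s assume "s \<in> BB W"
   hence "cmod s <= r / 2" using norm_BB[of s W] W by auto
   hence "dist x (Z + s) < r" using that(3) norm_triangle_ineq4[of "x - Z" s] by (simp add: dist_norm algebra_simps)
   thus "vtp (N i) (c i) (Z + s) $ j = (vtp (N i) (c i) (Z + s) - g (Z + s)) $ j"
    using zero[of "Z + s"] by (simp add: g_def)
  qed
  also have "cmod ... <= 9 * e"
   by (rule norm_integral_BB_le[of "%s. vtp (N i) (c i) s - g s"])
    (use that W bip g in "auto simp: biperiodic_def g_def[symmetric] intro!: continuous_intros")
  finally show ?thesis .
 qed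
 have "EX L. ALL Z. (%i. S i Z) \<longlonglongrightarrow> L Z"
 proof (intro choice allI)
  fix Z
  have "Cauchy (%i. S i Z)"
  proof (rule CauchyI)
   fix e :: real assume "0 < e"
   then obtain i0 where i0: "!!i i'. i\<ge>i0 ==> i'\<ge>i0 ==> N2 (%Z. Sop (N i) (c i) Z - Sop (N i') (c i') Z) <= e / 10"
    using C[of "e/10"] by auto
   have "cmod (S m Z - S n Z) < e" if "m \<ge> i0" "n \<ge> i0" for m n
    using SC[OF i0[OF that], of Z] \<open>0 < e\<close> by simp
   thus "EX M. ALL m>=M. ALL n>=M. cmod (S m Z - S n Z) < e" by (intro exI[of _ i0]) auto
  qed
  thus "EX y. (%i. S i Z) \<longlonglongrightarrow> y" by (simp add: Cauchy_convergent_iff convergent_def)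
 qed
 then obtain L where L: "!!Z. (%i. S i Z) \<longlonglongrightarrow> L Z" by blast
 have lim: "(%i. f i Z) \<longlonglongrightarrow> integral (BB W) (%s. F (Z + s) $ j)" for Z
 proof (rule LIMSEQ_I)
  fix e :: real assume "0 < e"
  hence "\<forall>\<^sub>F i in sequentially. ALL s:UNIV. dist (Fop (N i) (c i) s) (F s) < e / 5"
   using uniform_limitD[OF u, of "e/5"] by simp
  then obtain i0 where i0: "!!i s. i \<ge> i0 ==> dist (Fop (N i) (c i) s) (F s) < e / 5" by (auto simp: eventually_sequentially)
  have "cmod (f i Z - integral (BB W) (%s. F (Z + s) $ j)) < e" if i: "i \<ge> i0" for i
  proof -
   have "f i Z - integral (BB W) (%s. F (Z + s) $ j) = integral (BB W) (%s. Fop (N i) (c i) (Z + s) $ j - F (Z + s) $ j)"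
    unfolding f_def by (rule integral_diff[symmetric]) (auto simp: Fop_def cF intro!: comp integrable_BB[of "tp _ _"] continuous_intros)
   also have "cmod ... <= W^2 * (e / 5)"
   proof (rule norm_integral_BB_const)
    show "continuous_on UNIV (%s. Fop (N i) (c i) s $ j - F s $ j)" by (auto simp: Fop_def intro!: continuous_intros cF)
    show "cmod (Fop (N i) (c i) (Z + s) $ j - F (Z + s) $ j) <= e / 5" for s
     using i0[OF i, of "Z + s"] Finite_Cartesian_Product.norm_nth_le[of "Fop (N i) (c i) (Z + s) - F (Z + s)" j]
     unfolding dist_norm vector_minus_component by linarith
   qed (use W in auto)
   also have "... <= 2^2 * (e / 5)" using W \<open>0 < e\<close> by (intro mult_right_mono power_mono) auto
   also have "... < e" using \<open>0 < e\<close> by simp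
   finally show ?thesis .
  qed
  thus "EX no. ALL n>=no. cmod (f n Z - integral (BB W) (%s. F (Z + s) $ j)) < e" by blast
 qed
 show ?thesis
 proof (cases "0 < r")
  case True
  have "EX g. ALL Z:ball x (r/2). (%i. f i Z) \<longlonglongrightarrow> g Z & (g has_derivative (%h. h * L Z)) (at Z within ball x (r/2))"
  proof (rule has_derivative_sequence[where f' = "%i Z h. h * S i Z + cnj h * V i Z"])
   show "(f i has_derivative (%h. h * S i Z + cnj h * V i Z)) (at Z within ball x (r/2))" for i Z
    unfolding f_def S_def V_def by (rule integral_BB_Fop_derivative) (rule c0)
   show "x \<in> ball x (r/2)" using True by simp
   show "(%i. f i x) \<longlonglongrightarrow> integral (BB W) (%s. F (x + s) $ j)" by (rule lim)
   fix e :: real assume e: "0 < e"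
   obtain i1 where i1: "!!i i'. i\<ge>i1 ==> i'\<ge>i1 ==> N2 (%Z. Sop (N i) (c i) Z - Sop (N i') (c i') Z) <= e / 18" using C[of "e/18"] e by auto
   obtain i2 where i2: "!!i. i\<ge>i2 ==> N2 (%Z. vtp (N i) (c i) Z - RHS P F T (%Z. e0 + Sop (N i) (c i) Z) Z) <= e / 18" using R[of "e/18"] e by auto
   have "cmod (h * S i Z + cnj h * V i Z - h * L Z) <= e * cmod h" if i: "i \<ge> max i1 i2" and Z: "Z \<in> ball x (r/2)" for i Z h
   proof -
    have "cmod (S i Z - L Z) <= 9 * (e / 18)"
    proof (rule LIMSEQ_le_const2[OF tendsto_norm[OF tendsto_diff[OF tendsto_const L]]])
     show "EX m. ALL n>=m. cmod (S i Z - S n Z) <= 9 * (e / 18)"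
      using SC[OF i1] i e by (intro exI[of _ i1]) auto
    qed
    moreover have "cmod (V i Z) <= 9 * (e / 18)" using VC[OF i2 _ Z] i e by auto
    moreover have "h * S i Z + cnj h * V i Z - h * L Z = h * (S i Z - L Z) + cnj h * V i Z" by (simp add: algebra_simps)
    moreover have "cmod (h * (S i Z - L Z) + cnj h * V i Z) <= cmod h * cmod (S i Z - L Z) + cmod h * cmod (V i Z)"
     by (rule order_trans[OF norm_triangle_ineq]) (simp add: norm_mult)
    ultimately have "cmod (h * S i Z + cnj h * V i Z - h * L Z) <= cmod h * (9 * (e / 18)) + cmod h * (9 * (e / 18))"
     by (smt (verit) mult_left_mono norm_ge_zero)
    thus ?thesis by (simp add: field_simps)
   qed
   thus "\<forall>\<^sub>F i in sequentially. ALL Z:ball x (r/2). ALL h. cmod (h * S i Z + cnj h * V i Z - h * L Z) <= e * cmod h"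
    unfolding eventually_sequentially by blast
  qed simp
  then obtain g where g: "!!Z. Z\<in>ball x (r/2) ==> (%i. f i Z) \<longlonglongrightarrow> g Z"
   "!!Z. Z\<in>ball x (r/2) ==> (g has_derivative (%h. h * L Z)) (at Z within ball x (r/2))" by blast
  have "g holomorphic_on ball x (r/2)"
   unfolding holomorphic_on_def field_differentiable_def has_field_derivative_def
   using g(2) by (auto simp: mult.commute[of _ "L _"] intro!: exI)
  moreover have "g Z = integral (BB W) (%s. F (Z + s) $ j)" if "Z \<in> ball x (r/2)" for Z
   using LIMSEQ_unique[OF g(1)[OF that] lim] .
  ultimately show ?thesis by (rule holomorphic_transform)
 next
  case False
  thus ?thesis using W by auto
 qed
qed

text \<open>As the squares shrink, the normalised averages tend to the continuous \<open>F\<close>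
  locally uniformly, and locally uniform limits of holomorphic functions are holomorphic.\<close>

lemma holomorphic_where_RHS_vanishes:
 assumes F: "admissible F" and c0: "!!i j. c i j 0 = 0"
  and u: "uniform_limit UNIV (%i. Fop (N i) (c i)) F sequentially"
  and C: "!!e. e > 0 ==> EX i0. ALL i>=i0. ALL i'>=i0. N2 (%Z. Sop (N i) (c i) Z - Sop (N i') (c i') Z) <= e"
  and R: "!!e. e > 0 ==> EX i0. ALL i>=i0. N2 (%Z. vtp (N i) (c i) Z - RHS P F T (%Z. e0 + Sop (N i) (c i) Z) Z) <= e"
  and zero: "!!w Z. Z \<in> ball x r ==> RHS P F T w Z = 0"
 shows "(%Z. F Z $ j) holomorphic_on ball x (r / 2)"
proof (cases "0 < r")
 case True
 define d where "d n = min (1/2) (r/4) / (Suc n)" for n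
 have d: "0 < d n" "d n <= 2" "4 * d n <= r" for n
 proof -
  have "d n <= min (1/2) (r/4) / 1" unfolding d_def using True by (intro divide_left_mono) auto
  thus "d n <= 2" "4 * d n <= r" by linarith+
  show "0 < d n" using True by (simp add: d_def)
 qed
 have d0: "d \<longlonglongrightarrow> 0" unfolding d_def by (rule LIMSEQ_Suc[OF lim_const_over_n])
 have cF: "continuous_on UNIV F" using F by (simp add: admissible_def)
 define f where "f n Z = integral (BB (d n)) (%s. F (Z + s) $ j) / of_real ((d n)^2)" for n Z
 show ?thesis
 proof (rule holomorphic_uniform_sequence[of _ f])
  show "f n holomorphic_on ball x (r/2)" for n
   unfolding f_def
   by (intro holomorphic_intros holomorphic_square_average[OF F c0 u C R zero] d) (use d[of n] in auto)
  fix y assume "y \<in> ball x (r/2)"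
  then obtain e where e: "0 < e" "cball y e \<subseteq> ball x (r/2)" using open_contains_cball open_ball by metis
  have "uniform_limit (cball y e) f (%Z. F Z $ j) sequentially"
  proof (rule uniform_limitI)
   fix X :: real assume X: "0 < X"
   have "uniformly_continuous_on (cball y (e + 1)) F"
    by (rule compact_uniformly_continuous[OF continuous_on_subset[OF cF]]) auto
   then obtain U where U: "0 < U" "!!p q. p \<in> cball y (e+1) ==> q \<in> cball y (e+1) ==> dist q p < U ==> dist (F q) (F p) < X / 2"
    unfolding uniformly_continuous_on_def using half_gt_zero[OF X] by metis
   have "\<forall>\<^sub>F n in sequentially. d n < min (1/2) (U/2)" using d0 U(1) by (intro order_tendstoD(2)) auto
   thus "\<forall>\<^sub>F n in sequentially. ALL Z:cball y e. dist (f n Z) (F Z $ j) < X"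
   proof eventually_elim
    case (elim n)
    show ?case
    proof
     fix Z assume Z: "Z \<in> cball y e"
     have "cmod (integral (BB (d n)) (%s. F (Z + s) $ j - F Z $ j)) <= (d n)^2 * (X / 2)"
     proof (rule norm_integral_BB_const[of "%s. F s $ j - F Z $ j"])
      fix s assume "s \<in> BB (d n)"
      hence s: "cmod s < U" "cmod s <= 1" using norm_BB[of s "d n"] elim by auto
      have "dist y (Z + s) <= e + 1" using norm_triangle_ineq4[of "y - Z" s] s(2) Z by (simp add: dist_norm algebra_simps)
      hence "dist (F (Z + s)) (F Z) < X / 2" using U(2)[of Z "Z + s"] s(1) Z by (simp add: dist_norm)
      thus "cmod (F (Z + s) $ j - F Z $ j) <= X / 2"
       using Finite_Cartesian_Product.norm_nth_le[of "F (Z + s) - F Z" j] by (simp add: dist_norm)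
     qed (use d[of n] cF in "auto intro!: continuous_intros")
     also have "integral (BB (d n)) (%s. F (Z + s) $ j - F Z $ j) = integral (BB (d n)) (%s. F (Z + s) $ j) - of_real ((d n)^2) * F Z $ j"
      using content_BB[of "d n"] d[of n]
      by (subst integral_diff[OF integrable_BB[of "%s. F s $ j"]])
       (auto intro!: continuous_intros cF simp: BB_def scaleR_conv_of_real)
     also have "... = of_real ((d n)^2) * (f n Z - F Z $ j)"
      unfolding f_def using d(1)[of n] by (simp add: field_simps)
     finally have "(d n)^2 * cmod (f n Z - F Z $ j) <= (d n)^2 * (X / 2)" by (simp add: norm_mult norm_power)
     hence "cmod (f n Z - F Z $ j) <= X / 2" using d(1)[of n] by simp
     thus "dist (f n Z) (F Z $ j) < X" using X by (simp add: dist_norm)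
    qed
   qed
  qed
  thus "EX e. 0 < e & cball y e \<subseteq> ball x (r/2) & uniform_limit (cball y e) f (%Z. F Z $ j) sequentially"
   using e by blast
 qed simp
qed (simp add: ball_empty holomorphic_on_def)

end

text \<open>\<open>TC\<close> is the sublevel set \<open>fm <= 0\<close> of this maximum of five affine functions.\<close>

definition fm :: "complex => real" where
 "fm z = Max {Re z - 2, - Re z, Im z - 2, - Im z, (Re z - Im z) / 2}"

lemma fm_le: "fm z <= t \<longleftrightarrow> Re z - 2 <= t & - Re z <= t & Im z - 2 <= t & - Im z <= t & (Re z - Im z) / 2 <= t"
 by (simp add: fm_def)

lemma fm_ge: "Re z - 2 <= fm z" "- Re z <= fm z" "Im z - 2 <= fm z" "- Im z <= fm z" "(Re z - Im z) / 2 <= fm z"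
 using fm_le[of z "fm z"] by auto

lemma fm_in: "fm z \<in> {Re z - 2, - Re z, Im z - 2, - Im z, (Re z - Im z) / 2}"
 unfolding fm_def by (rule Max_in) auto

lemma continuous_fm: "continuous_on S g ==> continuous_on S (%x. fm (g x))"
 unfolding fm_def by (simp add: continuous_intros)

lemma fm_TC: "fm z <= 0 \<longleftrightarrow> z \<in> TC" by (auto simp: fm_le TC_def)

text \<open>The modulus of \<open>exp (b * f z)\<close> is the exponential of the affine function,
  so the maximum modulus principle applies to it.\<close>

lemma affine_max_constant:
 assumes f: "f holomorphic_on ball x r" "0 < r" and le: "!!z. z \<in> ball x r ==> Re (b * f z) <= Re (b * f x)"
  and z: "z \<in> ball x r"
 shows "Re (b * f z) = Re (b * f x)"
proof -
 have "(%z. exp (b * f z)) constant_on ball x r"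
  by (rule maximum_modulus_principle[of _ _ "ball x r" x]) (use f le in "auto intro!: holomorphic_intros")
 hence "exp (b * f z) = exp (b * f x)" using z f(2) unfolding constant_on_def by auto
 hence "cmod (exp (b * f z)) = cmod (exp (b * f x))" by simp
 thus ?thesis by simp
qed

text \<open>A reflection \<open>R\<close> that fixes \<open>x\<close> extends the estimate across an edge of \<open>TC\<close> through \<open>x\<close>,
 provided the affine function is invariant under \<open>R\<close>.\<close>

lemma fm_locally_constant:
 assumes f: "f holomorphic_on ball x r" "0 < r" and m: "!!z. z \<in> TC ==> fm (f z) <= m" "fm (f x) = m"
  and l: "!!w. Re (b * w) + c <= fm w" "Re (b * f x) + c = m"
  and R: "!!z. z \<in> ball x r ==> z \<in> TC \<or> (R z \<in> TC & Re (b * f (R z)) = Re (b * f z))"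
  and z: "z \<in> ball x r" "z \<in> TC"
 shows "fm (f z) = m"
proof -
 have "Re (b * f y) <= Re (b * f x)" if "y \<in> ball x r" for y
  using R[OF that] l(2) order_trans[OF l(1) m(1), of y] order_trans[OF l(1) m(1), of "R y"] by auto
 hence "Re (b * f z) = Re (b * f x)" by (rule affine_max_constant[OF f _ z(1)])
 thus ?thesis using l(1)[of "f z"] l(2) m(1)[OF z(2)] by simp
qed

text \<open>If the map left the triangle, \<open>fm\<close> would have a positive maximum. The set
  where it is attained is closed, and also open by holomorphy near such points and reflection across
  the sides, so it is all of \<open>TC\<close>. But the vertex 0 is fixed by the map.\<close>

lemma max_principle:
 assumes adm: "fsym 1 (-1) \<i> g" "biperiodic g" and cont: "continuous_on UNIV g"
  and hol: "!!x. x \<in> TC ==> x + g x \<notin> TC ==> EX r>0. g holomorphic_on ball x r"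
  and z: "z \<in> TC"
 shows "z + g z \<in> TC"
proof (rule ccontr)
 assume bad: "z + g z \<notin> TC"
 define f where "f Z = Z + g Z" for Z
 have cf: "continuous_on S (%Z. fm (f Z))" for S
  unfolding f_def by (intro continuous_fm continuous_intros continuous_on_subset[OF cont]) auto
 obtain x0 where x0: "x0 \<in> TC" "!!y. y \<in> TC ==> fm (f y) <= fm (f x0)"
  using continuous_attains_sup[OF compact_TC _ cf] z by blast
 define m where "m = fm (f x0)"
 have mle: "!!y. y \<in> TC ==> fm (f y) <= m" using x0 by (simp add: m_def)
 have m: "0 < m" using mle[OF z] bad fm_TC[of "f z"] by (auto simp: f_def)
 note e = fsym_edges[OF adm]
 have s: "g (cnj Z) = cnj (g Z)" "g (- cnj Z) = - cnj (g Z)" "g (\<i> * cnj Z) = \<i> * cnj (g Z)" for Z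
  using adm(1) by (auto simp: fsym_def)
 have s2: "g (cnj Z + 4 * \<i>) = cnj (g Z)" for Z using s(1) biperiodicD(2)[OF adm(2)] by simp
 have loc: "EX r>0. ALL y:ball x r. y \<in> TC --> fm (f y) = m" if x: "x \<in> TC" "fm (f x) = m" for x
 proof -
  have "f x \<notin> TC" using x(2) m fm_TC[of "f x"] by simp
  then obtain r where r: "0 < r" "g holomorphic_on ball x r" using hol[OF x(1)] by (auto simp: f_def)
  have hf: "f holomorphic_on ball x t" if "t <= r" for t
   unfolding f_def by (intro holomorphic_intros holomorphic_on_subset[OF r(2)]) (use that in auto)
  have fin: "EX r>0. ALL y:ball x r. y \<in> TC --> fm (f y) = m"
   if l: "!!w. Re (b * w) + c <= fm w" "Re (b * f x) + c = m" and t: "0 < t" and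
    R: "!!z. z \<in> ball x t ==> z \<in> TC \<or> (R z \<in> TC & Re (b * f (R z)) = Re (b * f z))" for b c t R
  proof (intro exI[of _ "min r t"] conjI ballI impI)
   fix y assume y: "y \<in> ball x (min r t)" "y \<in> TC"
   show "fm (f y) = m"
    by (rule fm_locally_constant[OF hf[of "min r t"] _ mle x(2) l _ y, of R]) (use r t R in auto)
  qed (use r t in auto)
  have near: "Re y < Re x + t" "Re x < Re y + t" "Im y < Im x + t" "Im x < Im y + t" if "y \<in> ball x t" for y t
   using that abs_Re_le_cmod[of "x - y"] abs_Im_le_cmod[of "x - y"] by (auto simp: dist_norm)
  consider (int) "x \<in> TT" | (v) "Re x = 0" "Im x = 0" | (v1) "Re x = 0" "Im x = 2" | (v2) "Re x = 2" "Im x = 2" |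
   (e1) "Re x = 0" "0 < Im x" "Im x < 2" | (e2) "Im x = 2" "0 < Re x" "Re x < 2" | (e3) "Re x = Im x" "0 < Re x" "Re x < 2"
   using x(1) unfolding TC_def TT_def by force
  thus ?thesis
  proof cases
   case int
   then obtain t where t: "0 < t" "ball x t \<subseteq> TT" using open_TT openE by blast
   hence tt: "z \<in> ball x t ==> z \<in> TC" for z using TT_subset by blast
   have "EX b c. (ALL w. Re (b * w) + c <= fm w) & Re (b * f x) + c = m"
   proof -
    consider "Re (f x) - 2 = m" | "- Re (f x) = m" | "Im (f x) - 2 = m" | "- Im (f x) = m" | "(Re (f x) - Im (f x)) / 2 = m"
     using fm_in[of "f x"] x(2) by auto
    thus ?thesis
    proof cases
     case 1 thus ?thesis using fm_ge(1) by (intro exI[of _ 1] exI[of _ "-2"]) auto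
    next
     case 2 thus ?thesis using fm_ge(2) by (intro exI[of _ "-1"] exI[of _ 0]) auto
    next
     case 3 thus ?thesis using fm_ge(3) by (intro exI[of _ "-\<i>"] exI[of _ "-2"]) auto
    next
     case 4 thus ?thesis using fm_ge(4) by (intro exI[of _ "\<i>"] exI[of _ 0]) auto
    next
     case 5 thus ?thesis using fm_ge(5) by (intro exI[of _ "(1 + \<i>) / 2"] exI[of _ 0]) (auto simp: field_simps)
    qed
   qed
   then obtain b c where "!!w. Re (b * w) + c <= fm w" "Re (b * f x) + c = m" by blast
   thus ?thesis using t(1) tt by (intro fin[of b c t "%z. z"]) auto
  next
   case v
   hence "f x = 0" using e[of x] by (simp add: f_def complex_eq_iff)
   thus ?thesis using x(2) m fm_TC[of 0] by (simp add: TC_def)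
  next
   case v1
   hence "f x = 2 * \<i>" using e[of x] by (simp add: f_def complex_eq_iff)
   thus ?thesis using x(2) m fm_TC[of "2 * \<i>"] by (simp add: TC_def)
  next
   case v2
   hence "f x = 2 + 2 * \<i>" using e[of x] by (simp add: f_def complex_eq_iff)
   thus ?thesis using x(2) m fm_TC[of "2 + 2 * \<i>"] by (simp add: TC_def)
  next
   case e1
   hence "Re (f x) = 0" using e[of x] by (simp add: f_def)
   \<comment> \<open>Near a side the active affine function must be invariant under reflection in
     that side. On the line \<open>Re = 0\<close> the value \<open>(Re - Im) / 2\<close> cannot be
     the positive maximum, since then \<open>- Im\<close> would be twice as large; the halved
     coefficient in \<open>fm\<close> serves this purpose.\<close>
   hence c: "Im (f x) - 2 = m \<or> - Im (f x) = m" using fm_in[of "f x"] fm_ge(4)[of "f x"] x(2) m by auto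
   define t where "t = min (Im x) (2 - Im x) / 2"
   have t2: "2 * t <= Im x" "2 * t <= 2 - Im x" by (auto simp: t_def)
   have t: "0 < t" using e1 by (simp add: t_def)
   have R: "z \<in> TC \<or> - cnj z \<in> TC" "f (- cnj z) = - cnj (f z)" if "z \<in> ball x t" for z
    using near[OF that] e1 t2 by (auto simp: TC_def f_def s)
   from c show ?thesis
   proof
    assume "Im (f x) - 2 = m" thus ?thesis
     using fm_ge(3) t R by (intro fin[of "-\<i>" "-2" t "%z. - cnj z"]) force+
   next
    assume "- Im (f x) = m" thus ?thesis
     using fm_ge(4) t R by (intro fin[of "\<i>" "0" t "%z. - cnj z"]) force+
   qed
  next
   case e2
   hence "Im (f x) = 2" using e[of x] by (simp add: f_def)
   hence c: "Re (f x) - 2 = m \<or> - Re (f x) = m" using fm_in[of "f x"] fm_ge(1)[of "f x"] x(2) m by auto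
   define t where "t = min (Re x) (2 - Re x) / 2"
   have t2: "2 * t <= Re x" "2 * t <= 2 - Re x" by (auto simp: t_def)
   have t: "0 < t" using e2 by (simp add: t_def)
   have R: "z \<in> TC \<or> cnj z + 4 * \<i> \<in> TC" "f (cnj z + 4 * \<i>) = cnj (f z) + 4 * \<i>" if "z \<in> ball x t" for z
    using near[OF that] e2 t2 by (auto simp: TC_def f_def s2)
   from c show ?thesis
   proof
    assume "Re (f x) - 2 = m" thus ?thesis
     using fm_ge(1) t R by (intro fin[of 1 "-2" t "%z. cnj z + 4 * \<i>"]) force+
   next
    assume "- Re (f x) = m" thus ?thesis
     using fm_ge(2) t R by (intro fin[of "-1" "0" t "%z. cnj z + 4 * \<i>"]) force+
   qed
  next
   case e3
   hence d: "Re (f x) = Im (f x)" using e[of x] by (simp add: f_def)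
   hence c: "Re (f x) - 2 = m \<or> - Re (f x) = m" using fm_in[of "f x"] x(2) m by auto
   define t where "t = min (Re x) (2 - Re x) / 2"
   have t2: "2 * t <= Re x" "2 * t <= 2 - Re x" by (auto simp: t_def)
   have t: "0 < t" using e3 by (simp add: t_def)
   have R: "z \<in> TC \<or> \<i> * cnj z \<in> TC" "f (\<i> * cnj z) = \<i> * cnj (f z)" if "z \<in> ball x t" for z
    using near[OF that] e3 t2 by (auto simp: TC_def f_def s algebra_simps)
   \<comment> \<open>On the diagonal the active function itself is not symmetric; it is replaced by
     its mean with its mirror image, which is still below \<open>fm\<close> and has the same value
     at \<open>f x\<close>.\<close>
   have av: "(Re w + Im w - 4) / 2 <= fm w" "- (Re w + Im w) / 2 <= fm w" for w using fm_ge[of w] by auto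
   from c show ?thesis
   proof
    assume "Re (f x) - 2 = m" thus ?thesis
     using av(1) t R d by (intro fin[of "(1 - \<i>) / 2" "-2" t "%z. \<i> * cnj z"]) (force simp: field_simps)+
   next
    assume "- Re (f x) = m" thus ?thesis
     using av(2) t R d by (intro fin[of "- (1 - \<i>) / 2" "0" t "%z. \<i> * cnj z"]) (force simp: field_simps)+
   qed
  qed
 qed
 define S where "S = {x \<in> TC. fm (f x) = m}"
 have "closedin (top_of_set TC) S"
  unfolding S_def by (rule continuous_closedin_preimage_constant[OF cf])
 moreover have "openin (top_of_set TC) S"
  unfolding openin_contains_ball
 proof (intro conjI ballI)
  fix x assume "x \<in> S"
  then obtain r where "r > 0" "ALL y:ball x r. y \<in> TC --> fm (f y) = m" using loc[of x] unfolding S_def by blast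
  thus "EX e>0. ball x e \<inter> TC \<subseteq> S" unfolding S_def by blast
 qed (simp add: S_def)
 ultimately have "S = TC"
  using convex_connected[OF convex_TC] x0(1) m_def by (auto simp: connected_clopen S_def)
 moreover have "0 \<in> TC" by (simp add: TC_def)
 ultimately have "fm (f 0) = m" by (auto simp: S_def)
 moreover have "f 0 = 0" using e[of 0] by (simp add: f_def complex_eq_iff)
 ultimately show False using m fm_TC[of 0] by (simp add: TC_def)
qed

context cylinder_eq begin

text \<open>Outside the closed triangle the coefficient \<open>A(Z)\<close> vanishes near the point,
  so the \<open>k\<close>-th component is holomorphic there, as \<open>max_principle\<close>
  asks.\<close>

lemma Galerkin_limit_in_TC:
 assumes F: "admissible F" and c0: "!!i j. c i j 0 = 0"
  and u: "uniform_limit UNIV (%i. Fop (N i) (c i)) F sequentially"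
  and C: "!!e. e > 0 ==> EX i0. ALL i>=i0. ALL i'>=i0. N2 (%Z. Sop (N i) (c i) Z - Sop (N i') (c i') Z) <= e"
  and R: "!!e. e > 0 ==> EX i0. ALL i>=i0. N2 (%Z. vtp (N i) (c i) Z - RHS P F T (%Z. e0 + Sop (N i) (c i) Z) Z) <= e"
  and z: "z \<in> TC"
 shows "z + F z $ k \<in> TC"
proof (rule max_principle[OF _ _ _ _ z])
 have cF: "continuous_on UNIV F" using F by (simp add: admissible_def)
 thus "continuous_on UNIV (%Z. F Z $ k)" by (intro continuous_intros)
 show "fsym 1 (-1) \<i> (%Z. F Z $ k)" "biperiodic (%Z. F Z $ k)"
  using F by (auto simp: admissible_def biperiodic_def)
 fix x assume x: "x \<in> TC" "x + F x $ k \<notin> TC"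
 \<comment> \<open>The right-hand side at a point of the plane is read off at its folded point, so
   the neighbourhood has to be taken for the folded map.\<close>
 have "open ((%Z. fold_TC Z + F (fold_TC Z) $ k) -` (- TC))"
  using closed_TC by (intro open_vimage continuous_intros continuous_on_compose2[OF cF]) auto
 moreover have "x \<in> (%Z. fold_TC Z + F (fold_TC Z) $ k) -` (- TC)" using x by (simp add: fold_id)
 ultimately obtain r where r: "0 < r" "ball x r \<subseteq> (%Z. fold_TC Z + F (fold_TC Z) $ k) -` (- TC)"
  using openE by blast
 have "(%Z. F Z $ k) holomorphic_on ball x (r / 2)"
 proof (rule holomorphic_where_RHS_vanishes[OF F c0 u C R])
  fix w Z assume "Z \<in> ball x r"
  hence "fold_TC Z + F (fold_TC Z) $ k \<notin> TT" using r(2) TT_subset by auto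
  hence "A (Zmap P F T (fold_TC Z)) = 0" by (intro A0) (simp add: Zmap_in_Cylinder)
  thus "RHS P F T w Z = 0"
   unfolding RHS_def using norm_TW_le0[of "%H. A (Zmap P F T H)" w Z] by simp
 qed
 thus "EX r>0. (%Z. F Z $ k) holomorphic_on ball x r" using r(1) by (intro exI[of _ "r/2"]) simp
qed

end

section \<open>The Riemann map of the triangle\<close>

lemma Schwarz_scaled:
 assumes h: "h holomorphic_on ball x R" "0 < R" "h x = 0" "!!z. z \<in> ball x R ==> cmod (h z) < 1"
  and d: "(h has_field_derivative d) (at x)"
 shows "cmod d * R <= 1"
proof -
 define f where "f z = h (x + of_real R * z)" for z
 have b: "x + of_real R * z \<in> ball x R" if "cmod z < 1" for z using that h(2) by (simp add: dist_norm norm_mult)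
 have "(h \<circ> (%z. x + of_real R * z)) holomorphic_on ball 0 1"
  by (rule holomorphic_on_compose_gen[OF _ h(1)]) (use b in "auto intro!: holomorphic_intros")
 hence "f holomorphic_on ball 0 1" by (simp add: f_def[abs_def] o_def)
 hence "cmod (deriv f 0) <= 1"
  by (rule Schwarz_Lemma(2)[of f 0]) (use h(3,4) b in "auto simp: f_def")
 moreover have "(f has_field_derivative d * of_real R) (at 0)"
  unfolding f_def by (rule DERIV_chain'[where g = h and f = "%z. x + of_real R * z"]) (use d in "auto intro!: derivative_eq_intros")
 hence "deriv f 0 = d * of_real R" by (rule DERIV_imp_deriv)
 ultimately show ?thesis using h(2) by (simp add: norm_mult)
qed

text \<open>The Cayley transform centred at \<open>h x\<close> carries the half-plane to the disc
  and reduces this to the Schwarz lemma.\<close>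

lemma Schwarz_half_plane:
 assumes h: "h holomorphic_on ball x R" "0 < R" "!!z. z \<in> ball x R ==> 0 < Re (h z)"
  and d: "(h has_field_derivative d) (at x)"
 shows "cmod d * R <= 2 * Re (h x)"
proof -
 define w where "w = h x"
 have w: "0 < Re w" using h by (simp add: w_def)
 define f where "f z = (h z - w) / (h z + cnj w)" for z
 have nz: "v + cnj w ~= 0" if "0 < Re v" for v
 proof
  assume "v + cnj w = 0" hence "Re (v + cnj w) = 0" by simp thus False using that w by simp
 qed
 have "cmod (f z) < 1" if "z \<in> ball x R" for z
 proof -
  have "(cmod (h z - w))^2 < (cmod (h z + cnj w))^2"
  proof -
   have "0 < Re (h z) * Re w" using h(3)[OF that] w by simp
   thus ?thesis unfolding cmod_power2 by (simp add: power2_eq_square algebra_simps)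
  qed
  hence "cmod (h z - w) < cmod (h z + cnj w)" by (simp add: power2_less_imp_less)
  thus ?thesis using nz[OF h(3)[OF that]] by (simp add: f_def norm_divide)
 qed
 moreover have "f holomorphic_on ball x R" unfolding f_def
  by (intro holomorphic_intros h(1)) (use nz h(3) in auto)
 moreover have "(f has_field_derivative d / (w + cnj w)) (at x)"
 proof -
  have "(f has_field_derivative ((d - 0) * (h x + cnj w) - (h x - w) * (d + 0)) / ((h x + cnj w) * (h x + cnj w))) (at x)"
   unfolding f_def by (intro DERIV_divide DERIV_diff DERIV_add DERIV_const d) (use nz h in auto)
  thus ?thesis using nz[OF w] by (simp add: w_def)
 qed
 ultimately have "cmod (d / (w + cnj w)) * R <= 1"
  by (intro Schwarz_scaled[of f x R]) (use h(2) in "auto simp: f_def w_def")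
 moreover have "w + cnj w = of_real (2 * Re w)" by (simp add: complex_eq_iff)
 ultimately show ?thesis using w by (simp add: norm_divide w_def field_simps)
qed

text \<open>Schwarz-Pick: a Moebius map moves \<open>h x\<close> to 0.\<close>

lemma Schwarz_disc:
 assumes h: "h holomorphic_on ball x R" "0 < R" "!!z. z \<in> ball x R ==> cmod (h z) < 1"
  and d: "(h has_field_derivative d) (at x)"
 shows "cmod d * R <= 1 - (cmod (h x))^2"
proof -
 define w where "w = h x"
 have w: "cmod w < 1" using h by (simp add: w_def)
 define f where "f z = (h z - w) / (1 - cnj w * h z)" for z
 have nz: "1 - cnj w * v ~= 0" if "cmod v < 1" for v
 proof -
  have "cmod (cnj w * v) < 1 * 1" unfolding norm_mult using that w by (intro mult_strict_mono') auto
  thus ?thesis by auto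
 qed
 have w2: "w * cnj w = of_real ((cmod w)^2)" by (rule complex_norm_square[symmetric])
 have "cmod (f z) < 1" if "z \<in> ball x R" for z
  using Moebius_function_norm_lt_1[of w "h z" 0] h(3)[OF that] w by (simp add: f_def Moebius_function_simple)
 moreover have "f holomorphic_on ball x R" unfolding f_def
  by (intro holomorphic_intros h(1)) (use nz h(3) in auto)
 moreover have "(f has_field_derivative d / of_real (1 - (cmod w)^2)) (at x)"
 proof -
  have "(f has_field_derivative ((d - 0) * (1 - cnj w * h x) - (h x - w) * (0 - cnj w * d)) / ((1 - cnj w * h x) * (1 - cnj w * h x))) (at x)"
   unfolding f_def by (intro DERIV_divide DERIV_diff DERIV_add DERIV_cmult DERIV_const d) (use nz h in auto)
  thus ?thesis using nz[OF w] w2 by (simp add: w_def mult.commute)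
 qed
 ultimately have "cmod (d / of_real (1 - (cmod w)^2)) * R <= 1"
  by (intro Schwarz_scaled[of f x R]) (use h(2) in "auto simp: f_def w_def")
 moreover have "0 < 1 - (cmod w)^2" using w by (simp add: abs_square_less_1)
 ultimately show ?thesis by (simp only: norm_divide norm_of_real abs_of_pos w_def) (simp add: field_simps)
qed

section \<open>Boundary behaviour of the Riemann map\<close>

definition bd :: "complex => real" where "bd l = min (Re l) (min (2 - Im l) (Im l - Re l))"

lemma bd_TT: "l \<in> TT \<longleftrightarrow> 0 < bd l" by (auto simp: bd_def TT_def)

lemma continuous_bd [continuous_intros]: "continuous_on S g ==> continuous_on S (%x. bd (g x))"
 unfolding bd_def by (intro continuous_intros)

lemma bd_ge: "bd l <= Re l" "bd l <= 2 - Im l" "bd l <= Im l - Re l" by (auto simp: bd_def)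

text \<open>The three affine functions in \<open>bd\<close> add up to 2 and all equal 2/3 at the
  centroid. A lower bound for each of them is therefore also an upper bound for the others.\<close>

lemma bd_dist: "cmod (l - Complex (2/3) (4/3)) <= 4 * (2 / 3 - bd l)"
proof -
 have "\<bar>Re l - 2/3\<bar> <= 2 * (2 / 3 - bd l)" unfolding abs_le_iff using bd_ge[of l] by (intro conjI) argo+
 moreover have "\<bar>Im l - 4/3\<bar> <= 2 * (2 / 3 - bd l)" unfolding abs_le_iff using bd_ge[of l] by (intro conjI) argo+
 ultimately show "cmod (l - Complex (2/3) (4/3)) <= 4 * (2 / 3 - bd l)" using cmod_le[of "l - Complex (2/3) (4/3)"] by simp
qed

lemma ball_bd: "ball l (bd l / 2) \<subseteq> TT"
proof
 fix z assume "z \<in> ball l (bd l / 2)"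
 hence "\<bar>Re l - Re z\<bar> < bd l / 2" "\<bar>Im l - Im z\<bar> < bd l / 2"
  using abs_Re_le_cmod[of "l - z"] abs_Im_le_cmod[of "l - z"] by (auto simp: dist_norm)
 thus "z \<in> TT" using bd_ge[of l] unfolding TT_def mem_Collect_eq by linarith
qed

lemma Riemann_TT:
 obtains Phi Psi where "Phi holomorphic_on ball 0 1" "Psi holomorphic_on TT"
  "!!u. u \<in> ball 0 1 ==> Phi u \<in> TT & Psi (Phi u) = u" "!!l. l \<in> TT ==> Psi l \<in> ball 0 1 & Phi (Psi l) = l"
proof -
 have "convex TT"
 proof -
  have T: "TT = {l. 0 < Re l} \<inter> {l. Complex 1 (-1) \<bullet> l < 0} \<inter> {l. Im l < 2}"
   by (auto simp: TT_def inner_complex_def)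
  show ?thesis by (subst T) (intro convex_Int convex_halfspace_Re_gt convex_halfspace_Im_lt convex_halfspace_lt)
 qed
 hence "open TT & simply_connected TT" using open_TT convex_imp_simply_connected by blast
 moreover have "Complex (2/3) (4/3) \<in> TT" "0 \<notin> TT" by (auto simp: TT_def)
 hence "TT ~= {}" "TT ~= UNIV" by auto
 ultimately show ?thesis using Riemann_mapping_theorem[of TT] that by metis
qed

locale Riemann_map =
 fixes Phi Psi :: "complex => complex"
 assumes hPhi: "Phi holomorphic_on ball 0 1" and hPsi: "Psi holomorphic_on TT"
  and Phi: "!!u. u \<in> ball 0 1 ==> Phi u \<in> TT & Psi (Phi u) = u"
  and Psi: "!!l. l \<in> TT ==> Psi l \<in> ball 0 1 & Phi (Psi l) = l"
begin

lemma Phi_deriv: "u \<in> ball 0 1 ==> (Phi has_field_derivative deriv Phi u) (at u)"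
 using hPhi by (rule holomorphic_derivI[OF _ open_ball])

text \<open>Each side of the triangle gives a half-plane containing the image, and
  \<open>Schwarz_half_plane\<close> is used for each on the ball of radius \<open>1 - cmod u\<close>
  about \<open>u\<close>.\<close>

lemma deriv_le_bd: assumes u: "u \<in> ball 0 1" shows "cmod (deriv Phi u) * (1 - cmod u) <= 2 * bd (Phi u)"
proof -
 have sub: "ball u (1 - cmod u) \<subseteq> ball 0 1" by (simp add: ball_subset_ball_iff)
 have key: "cmod (b * deriv Phi u) * (1 - cmod u) <= 2 * Re (b * Phi u + c)" if "!!l. l \<in> TT ==> 0 < Re (b * l + c)" for b c
  by (rule Schwarz_half_plane)
   (use u that Phi sub in "auto intro!: holomorphic_intros holomorphic_on_subset[OF hPhi sub] DERIV_add[where E = 0, simplified] DERIV_cmult Phi_deriv")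
 have 1: "cmod (deriv Phi u) * (1 - cmod u) <= 2 * Re (Phi u)" using key[of 1 0] by (simp add: TT_def)
 have 2: "cmod (deriv Phi u) * (1 - cmod u) <= 2 * (2 - Im (Phi u))" using key[of \<i> 2] by (simp add: TT_def norm_mult)
 have 3: "cmod (deriv Phi u) * (1 - cmod u) <= 2 * (Im (Phi u) - Re (Phi u))"
 proof -
  have "cmod (- 1 - \<i>) * cmod (deriv Phi u) * (1 - cmod u) <= 2 * (Im (Phi u) - Re (Phi u))"
   using key[of "- 1 - \<i>" 0] unfolding norm_mult by (simp add: TT_def)
  moreover have "1 * (cmod (deriv Phi u) * (1 - cmod u)) <= cmod (- 1 - \<i>) * (cmod (deriv Phi u) * (1 - cmod u))"
   using abs_Re_le_cmod[of "- 1 - \<i>"] u by (intro mult_right_mono mult_nonneg_nonneg) auto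
  ultimately show ?thesis by (simp add: mult.assoc)
 qed
 show ?thesis using 1 2 3 by (auto simp: bd_def min_def)
qed

text \<open>Along the segment from the incentre to \<open>l\<close>, the quantity \<open>1 - |Psi|^2\<close> can decrease only as
 fast as the 16th power of the (concave) function \<open>bd\<close>.\<close>

lemma bd_power_le: "EX c>0. ALL l:TT. c * bd l ^ 16 <= 1 - cmod (Psi l)"
proof -
 let ?e = "Complex (2/3) (4/3)"
 have e: "?e \<in> TT" by (simp add: TT_def)
 define c where "c = (1 - (cmod (Psi ?e))^2) / (2/3) ^ 16"
 have lt: "cmod (Psi l) < 1" if "l \<in> TT" for l using Psi[OF that] by simp
 have c: "0 < c" using lt[OF e] by (simp add: c_def abs_square_less_1)
 have "c / 2 * bd l ^ 16 <= 1 - cmod (Psi l)" if l: "l \<in> TT" for l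
 proof -
  define p where "p t = ?e + of_real t * (l - ?e)" for t :: real
  define D where "D t = (1 - t) * (2/3) + t * bd l" for t :: real
  define f where "f t = 1 - (cmod (Psi (p t)))^2" for t
  have b0: "0 < bd l" using l by (simp add: bd_TT)
  have D: "0 < D t" if "0 <= t" "t <= 1" for t
   using that b0 by (cases "t = 0") (auto simp: D_def intro!: add_nonneg_pos)
  have Dp: "D t <= bd (p t)" if "0 <= t" "t <= 1" for t
  proof -
   have "t * bd l <= t * Re l" "t * bd l <= t * (2 - Im l)" "t * bd l <= t * (Im l - Re l)"
    using that by (auto simp: bd_def intro!: mult_left_mono)
   moreover have "Re (p t) = (1 - t) * (2/3) + t * Re l" "Im (p t) = (1 - t) * (4/3) + t * Im l"
    by (auto simp: p_def field_simps)
   ultimately show ?thesis unfolding bd_def[of "p t"] D_def min.bounded_iff by (simp add: field_simps)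
  qed
  have pT: "p t \<in> TT" if "0 <= t" "t <= 1" for t using D[OF that] Dp[OF that] by (simp add: bd_TT)
  \<comment> \<open>The exponent is 2 * 2 * 4: the derivative of the squared modulus, the radius
    \<open>bd / 2\<close> in the Schwarz-Pick estimate, and the constant of \<open>bd_dist\<close>.
    \<open>D\<close> interpolates \<open>bd\<close> linearly along the segment and lies below it by
    concavity.\<close>
  have "f 0 / D 0 ^ 16 <= f 1 / D 1 ^ 16"
  proof (rule DERIV_nonneg_imp_nondecreasing[of 0 1])
   fix t :: real assume t: "0 <= t" "t <= 1"
   define d where "d = deriv Psi (p t) * (l - ?e)"
   define f' where "f' = - (2 * (Psi (p t) \<bullet> d))"
   have dPsi: "(Psi has_field_derivative deriv Psi (p t)) (at (p t))"
    by (rule holomorphic_derivI[OF hPsi open_TT pT[OF t]])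
   have "((%t. p t) has_vector_derivative (l - ?e)) (at t)"
    unfolding p_def scaleR_conv_of_real[symmetric]
    by (rule has_vector_derivative_eq_rhs[OF has_vector_derivative_add[OF has_vector_derivative_const
      has_vector_derivative_scaleR[OF DERIV_ident has_vector_derivative_const]]]) simp
   hence "((Psi \<circ> p) has_vector_derivative (l - ?e) * deriv Psi (p t)) (at t)"
    by (rule field_vector_diff_chain_at) (rule dPsi)
   hence "((%t. Psi (p t)) has_vector_derivative d) (at t)"
    by (simp add: o_def d_def mult.commute)
   note d' = this[unfolded has_vector_derivative_def]
   have "((%t. (norm (Psi (p t)))^2) has_derivative (%h. 2 * (Psi (p t) \<bullet> (h *\<^sub>R d)))) (at t)"
    unfolding power2_norm_eq_inner
    by (rule has_derivative_eq_rhs[OF has_derivative_inner[OF d' d']]) (auto simp: inner_commute)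
   hence "((%t. (norm (Psi (p t)))^2) has_field_derivative - f') (at t)"
    unfolding has_field_derivative_def by (rule has_derivative_eq_rhs) (simp add: f'_def fun_eq_iff)
   hence f: "(f has_field_derivative f') (at t)"
    unfolding f_def using DERIV_diff[OF DERIV_const] by fastforce
   have DD: "(D has_field_derivative (bd l - 2/3)) (at t)"
    unfolding D_def by (rule DERIV_cong[OF DERIV_add[OF DERIV_cmult_right[OF DERIV_diff[OF DERIV_const DERIV_ident]] DERIV_cmult_right[OF DERIV_ident]]]) simp
   have Dt: "0 < D t" by (rule D[OF t])
   have "\<bar>Psi (p t) \<bullet> d\<bar> <= cmod (Psi (p t)) * cmod d" by (rule Cauchy_Schwarz_ineq2)
   also have "... <= 1 * cmod d" using lt[OF pT[OF t]] by (intro mult_right_mono) auto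
   finally have "\<bar>f'\<bar> <= 2 * (cmod (deriv Psi (p t)) * cmod (l - ?e))" by (simp add: f'_def d_def norm_mult)
   hence "\<bar>f'\<bar> * D t <= 2 * (cmod (deriv Psi (p t)) * cmod (l - ?e)) * bd (p t)"
    using Dp[OF t] Dt by (intro mult_mono) auto
   also have "... = 4 * ((cmod (deriv Psi (p t)) * (bd (p t) / 2)) * cmod (l - ?e))" by simp
   also have "... <= 4 * (f t * (4 * (2/3 - bd l)))"
   proof (intro mult_left_mono mult_mono bd_dist)
    show "cmod (deriv Psi (p t)) * (bd (p t) / 2) <= f t" unfolding f_def
     by (rule Schwarz_disc[OF holomorphic_on_subset[OF hPsi ball_bd] _ _ dPsi])
      (use pT[OF t] bd_TT in simp, use lt ball_bd in blast)
    show "0 <= f t" using lt[OF pT[OF t]] by (simp add: f_def abs_square_le_1)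
   qed auto
   finally have le: "\<bar>f'\<bar> * D t <= 16 * f t * (2/3 - bd l)" by (simp add: algebra_simps)
   hence ge: "0 <= f' * D t - 16 * f t * (bd l - 2/3)"
    using Dt abs_ge_minus_self[of f'] mult_right_mono[of "- f'" "\<bar>f'\<bar>" "D t"] by (simp add: algebra_simps)
   have "((%t. f t / D t ^ 16) has_field_derivative
     (f' * D t ^ 16 - f t * (16 * (D t ^ 15 * (bd l - 2/3)))) / (D t ^ 16 * D t ^ 16)) (at t)"
    using DERIV_power[OF DD, of 16] Dt by (intro DERIV_divide f) (auto simp: mult.commute)
   moreover have "0 <= (f' * D t ^ 16 - f t * (16 * (D t ^ 15 * (bd l - 2/3)))) / (D t ^ 16 * D t ^ 16)"
   proof (rule divide_nonneg_nonneg)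
    have "f' * D t ^ 16 - f t * (16 * (D t ^ 15 * (bd l - 2/3))) = D t ^ 15 * (f' * D t - 16 * f t * (bd l - 2/3))"
     using power_Suc[of "D t" 15] by (simp add: algebra_simps)
    thus "0 <= f' * D t ^ 16 - f t * (16 * (D t ^ 15 * (bd l - 2/3)))" using ge Dt by simp
   qed (use Dt in simp)
   ultimately show "EX y. ((%t. f t / D t ^ 16) has_field_derivative y) (at t) & 0 <= y" by blast
  qed simp
  hence "c <= f 1 / bd l ^ 16" by (simp add: c_def f_def D_def p_def)
  hence "c * bd l ^ 16 <= f 1" using b0 by (simp add: field_simps)
  also have "f 1 = (1 - cmod (Psi l)) * (1 + cmod (Psi l))" by (simp add: f_def p_def power2_eq_square algebra_simps)
  also have "... <= (1 - cmod (Psi l)) * 2" using lt[OF l] by (intro mult_left_mono) auto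
  finally show ?thesis by simp
 qed
 thus ?thesis using c by (intro exI[of _ "c/2"]) auto
qed

text \<open>The power bound for \<open>Psi\<close>, read at \<open>Phi u\<close>, says that
  \<open>bd (Phi u) ^ 16\<close> is at most a multiple of \<open>1 - cmod u\<close>. Its 16th root
  is the first estimate; inserted into \<open>deriv_le_bd\<close> it gives the second, one power of
  \<open>bd\<close> cancelling.\<close>

lemma bd_Phi: "EX C>0. ALL u:ball 0 1. bd (Phi u) <= C * (1 - cmod u) powr (1/16) & cmod (deriv Phi u) <= C / bd (Phi u) ^ 15"
proof -
 obtain c where c: "0 < c" "!!l. l \<in> TT ==> c * bd l ^ 16 <= 1 - cmod (Psi l)" using bd_power_le by blast
 define C where "C = max (2 / c) ((1 / c) powr (1/16))"
 have "bd (Phi u) <= C * (1 - cmod u) powr (1/16) & cmod (deriv Phi u) <= C / bd (Phi u) ^ 15" if u: "u \<in> ball 0 1" for u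
 proof
  define b where "b = bd (Phi u)"
  have b: "0 < b" "c * b ^ 16 <= 1 - cmod u" using Phi[OF u] c(2)[of "Phi u"] by (auto simp: bd_TT b_def)
  have p: "0 < 1 - cmod u" using u by simp
  have "b = b powr (16 * (1/16))" using b(1) by simp
  also have "... = (b powr 16) powr (1/16)" by (rule powr_powr[symmetric])
  also have "... <= (1 / c * (1 - cmod u)) powr (1/16)"
   using b c(1) by (intro powr_mono2) (auto simp: field_simps)
  also have "... = (1 / c) powr (1/16) * (1 - cmod u) powr (1/16)" using c(1) p by (simp only: powr_mult)
  also have "... <= C * (1 - cmod u) powr (1/16)" by (intro mult_right_mono) (auto simp: C_def)
  finally show "bd (Phi u) <= C * (1 - cmod u) powr (1/16)" by (simp add: b_def)
  have "cmod (deriv Phi u) * (c * b ^ 16) <= cmod (deriv Phi u) * (1 - cmod u)" by (intro mult_left_mono b) auto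
  also have "... <= 2 * b" unfolding b_def by (rule deriv_le_bd[OF u])
  finally have "(cmod (deriv Phi u) * (c * b ^ 15)) * b <= 2 * b" using power_Suc[of b 15] by (simp add: mult_ac)
  hence "cmod (deriv Phi u) * (c * b ^ 15) <= 2" using b(1) by simp
  hence "cmod (deriv Phi u) <= (2 / c) / b ^ 15" using b(1) c(1) by (simp add: field_simps)
  also have "... <= C / b ^ 15" using b(1) by (intro divide_right_mono) (auto simp: C_def)
  finally show "cmod (deriv Phi u) <= C / bd (Phi u) ^ 15" by (simp add: b_def)
 qed
 moreover have "0 < C" using c(1) by (simp add: C_def less_max_iff_disj)
 ultimately show ?thesis by blast
qed

text \<open>Along radii the derivative is at most a multiple of
  \<open>(1 - t) powr (1/16 - 1)\<close>, which is integrable up to 1. The dilated maps hence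
  converge uniformly on the closed disc, and \<open>bd\<close> tends to 0 towards the
  circle.\<close>

lemma radial_limit:
 "EX g. continuous_on (cball 0 1) g & (ALL u:ball 0 1. g u = Phi u) & (ALL u:sphere 0 1. g u \<in> TC - TT)"
proof -
 obtain C where C: "0 < C" "!!u. u \<in> ball 0 1 ==> bd (Phi u) <= C * (1 - cmod u) powr (1/16)" using bd_Phi by blast
 \<comment> \<open>An antiderivative of the bound for the radial derivative, normalised to be 0 at
   \<open>t = 1\<close>.\<close>
 define H where "H t = - (2 * C * 16 * (1 - t) powr (1/16))" for t :: real
 have in1: "of_real t * u \<in> ball 0 1" if "0 <= t" "t < 1" "u \<in> cball 0 1" for t and u :: complex
  using that mult_left_le[of "cmod u" t] by (auto simp: norm_mult intro!: le_less_trans[of "t * cmod u" t])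
 have key: "cmod (Phi (of_real t * u) - Phi (of_real s * u)) <= H t - H s" if st: "0 <= s" "s < t" "t < 1" and u: "u \<in> cball 0 1" for s t u
 proof (rule differentiable_bound_general[OF st(2), of "%x. Phi (of_real x * u)" H])
  have D: "((%x. Phi (of_real x * u)) has_vector_derivative (u * deriv Phi (of_real x * u))) (at x)" if "0 <= x" "x < 1" for x
  proof -
   have "((%x. of_real x * u) has_vector_derivative u) (at x)"
    unfolding scaleR_conv_of_real[symmetric]
    by (rule has_vector_derivative_eq_rhs[OF has_vector_derivative_scaleR[OF DERIV_ident has_vector_derivative_const]]) simp
   from field_vector_diff_chain_at[OF this Phi_deriv[OF in1[OF that u]]] show ?thesis by (simp add: o_def)
  qed
  have DH: "(H has_vector_derivative (2 * C * (1 - x) powr (1/16 - 1))) (at x)" if "x < 1" for x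
  proof -
   have "((%t. (1 - t) powr (1/16)) has_field_derivative ((1/16) * (1 - x) powr (1/16 - 1) * (- 1))) (at x)"
    by (rule DERIV_fun_powr[THEN DERIV_cong, OF DERIV_diff[OF DERIV_const DERIV_ident]]) (use that in auto)
   from DERIV_minus[OF DERIV_cmult[OF this, of "2 * C * 16"]] show ?thesis
    unfolding has_real_derivative_iff_has_vector_derivative[symmetric] H_def by (simp add: mult_ac)
  qed
  show "continuous_on {s..t} (%x. Phi (of_real x * u))"
   by (rule continuous_on_vector_derivative[OF has_vector_derivative_at_within[OF D]]) (use st in auto)
  show "continuous_on {s..t} H"
   by (rule continuous_on_vector_derivative[OF has_vector_derivative_at_within[OF DH]]) (use st in auto)
  fix x assume x: "s < x" "x < t"
  show "((%x. Phi (of_real x * u)) has_vector_derivative (u * deriv Phi (of_real x * u))) (at x)" using D x st by simp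
  show "(H has_vector_derivative (2 * C * (1 - x) powr (1/16 - 1))) (at x)" using DH x st by simp
  let ?z = "of_real x * u"
  have z: "?z \<in> ball 0 1" using in1[of x u] x st u by simp
  have q: "0 < 1 - cmod ?z" using z by simp
  have xz: "1 - x <= 1 - cmod ?z" using u x st mult_left_le[of "cmod u" x] by (simp add: norm_mult)
  have "cmod (deriv Phi ?z) * (1 - cmod ?z) <= 2 * (C * (1 - cmod ?z) powr (1/16))"
   using deriv_le_bd[OF z] C(2)[OF z] by simp
  hence "cmod (deriv Phi ?z) <= 2 * C * (1 - cmod ?z) powr (1/16) / (1 - cmod ?z)" using q by (simp add: field_simps)
  also have "... = 2 * C * (1 - cmod ?z) powr (1/16 - 1)" using q unfolding powr_diff by simp
  also have "... <= 2 * C * (1 - x) powr (1/16 - 1)"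
   using xz x st C(1) by (intro mult_left_mono powr_mono2') auto
  finally have d: "cmod (deriv Phi ?z) <= 2 * C * (1 - x) powr (1/16 - 1)" .
  have "cmod u * cmod (deriv Phi ?z) <= 1 * (2 * C * (1 - x) powr (1/16 - 1))" using u by (intro mult_mono d) auto
  thus "norm (u * deriv Phi ?z) <= 2 * C * (1 - x) powr (1/16 - 1)" by (simp add: norm_mult)
 qed
 define r where "r n = 1 - 1 / (real n + 2)" for n
 have r: "0 <= r n" "r n < 1" for n by (auto simp: r_def)
 have rm: "r m < r n" if "m < n" for m n using that by (auto simp: r_def intro!: divide_strict_left_mono)
 have r1: "r \<longlonglongrightarrow> 1"
 proof -
  have "(%n. 1 / (real n + 2)) \<longlonglongrightarrow> 0" using LIMSEQ_ignore_initial_segment[OF lim_const_over_n[of "1::real"], of 2] by (simp add: add.commute)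
  from tendsto_diff[OF tendsto_const this, of 1] show ?thesis by (simp add: r_def[abs_def])
 qed
 have H0: "(%n. - H (r n)) \<longlonglongrightarrow> 0"
 proof -
  have "(%n. 2 * C * 16 * (1 - r n) powr (1/16)) \<longlonglongrightarrow> 2 * C * 16 * (1 - 1) powr (1/16)"
   by (intro tendsto_intros tendsto_powr' r1) (use r(2) in "auto simp: less_imp_le")
  thus ?thesis by (simp add: H_def)
 qed
 have Hneg: "H t <= 0" for t using C(1) by (simp add: H_def)
 have "uniformly_Cauchy_on (cball 0 1) (%n u. Phi (of_real (r n) * u))"
 proof (rule uniformly_Cauchy_onI')
  fix e :: real assume e: "0 < e"
  hence "\<forall>\<^sub>F n in sequentially. - H (r n) < e" using H0 by (intro order_tendstoD(2)) auto
  then obtain M where M: "!!n. n \<ge> M ==> - H (r n) < e" by (auto simp: eventually_sequentially)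
  show "EX M. ALL x:cball 0 1. ALL m>=M. ALL n>m. dist (Phi (of_real (r m) * x)) (Phi (of_real (r n) * x)) < e"
  proof (intro exI[of _ M] ballI allI impI)
   fix x :: complex and m n assume x: "x \<in> cball 0 1" "m \<ge> M" "n > m"
   have "cmod (Phi (of_real (r n) * x) - Phi (of_real (r m) * x)) <= H (r n) - H (r m)" using x by (intro key r rm)
   also have "... < e" using M[OF x(2)] Hneg[of "r n"] by simp
   finally show "dist (Phi (of_real (r m) * x)) (Phi (of_real (r n) * x)) < e" by (simp add: dist_norm norm_minus_commute)
  qed
 qed
 then obtain g where g: "uniform_limit (cball 0 1) (%n u. Phi (of_real (r n) * u)) g sequentially"
  using Cauchy_uniformly_convergent unfolding uniformly_convergent_on_def by blast
 have cPhi: "continuous_on (ball 0 1) Phi" by (rule holomorphic_on_imp_continuous_on[OF hPhi])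
 have "continuous_on (cball 0 1) g"
 proof (rule uniform_limit_theorem[OF _ g])
  show "\<forall>\<^sub>F n in sequentially. continuous_on (cball 0 1) (%u. Phi (of_real (r n) * u))"
  proof (intro always_eventually allI)
   fix n
   have "(%u. complex_of_real (r n) * u) ` cball 0 1 \<subseteq> ball 0 1" using in1[OF r] by blast
   thus "continuous_on (cball 0 1) (%u. Phi (of_real (r n) * u))"
    by (intro continuous_on_compose2[OF cPhi] continuous_intros)
  qed
 qed simp
 moreover have "g u = Phi u" if u: "u \<in> ball 0 1" for u
 proof (rule LIMSEQ_unique[OF tendsto_uniform_limitI[OF g]])
  have "isCont Phi u" using cPhi u by (simp add: continuous_on_eq_continuous_at)
  moreover have "(%n. of_real (r n) * u) \<longlonglongrightarrow> of_real 1 * u" by (intro tendsto_intros r1)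
  ultimately show "(%n. Phi (of_real (r n) * u)) \<longlonglongrightarrow> Phi u" using isCont_tendsto_compose[of u Phi] by simp
 qed (use u in auto)
 moreover have "g u \<in> TC - TT" if u: "u \<in> sphere 0 1" for u
 proof -
  have lim: "(%n. Phi (of_real (r n) * u)) \<longlonglongrightarrow> g u" using tendsto_uniform_limitI[OF g, of u] u by auto
  have inb: "of_real (r n) * u \<in> ball 0 1" for n using u r by (intro in1) auto
  have "g u \<in> TC"
   by (rule closed_sequentially[OF closed_TC _ lim]) (use Phi inb TT_subset in blast)
  moreover have "bd (g u) <= 0"
  proof (rule LIMSEQ_le)
   have "isCont bd (g u)" using continuous_bd[of UNIV "%x. x"] by (simp add: continuous_on_eq_continuous_at)
   thus "(%n. bd (Phi (of_real (r n) * u))) \<longlonglongrightarrow> bd (g u)" using lim by (rule isCont_tendsto_compose)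
   have "(%n. C * (1 - r n) powr (1/16)) \<longlonglongrightarrow> C * (1 - 1) powr (1/16)"
    by (intro tendsto_intros tendsto_powr' r1) (use r(2) in "auto simp: less_imp_le")
   thus "(%n. C * (1 - r n) powr (1/16)) \<longlonglongrightarrow> 0" by simp
   show "EX N. ALL n>=N. bd (Phi (of_real (r n) * u)) <= C * (1 - r n) powr (1/16)"
    using C(2)[OF inb] u r by (auto simp: norm_mult)
  qed
  ultimately show ?thesis by (simp add: bd_TT not_less)
 qed
 ultimately show ?thesis by blast
qed

end

section \<open>Change of variables\<close>

text \<open>Identifies R^2 with the complex plane, because the change of variables formula speaks of
  vectors in \<open>real^2\<close>.\<close>

definition c2 :: "real^2 => complex" where "c2 v = Complex (v $ 1) (v $ 2)"
definition r2 :: "complex => real^2" where "r2 z = vector [Re z, Im z]"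

lemma c2_r2 [simp]: "c2 (r2 z) = z" and r2_c2 [simp]: "r2 (c2 v) = v"
 by (simp_all add: c2_def r2_def vec_eq_iff forall_2)

lemma linear_c2: "linear c2" and linear_r2: "linear r2"
 by (rule linearI; simp add: c2_def r2_def vec_eq_iff forall_2 complex_eq_iff)+

lemma borel_c2 [measurable]: "c2 \<in> borel_measurable borel"
 by (intro borel_measurable_continuous_onI linear_continuous_on) (simp add: linear_c2 linear_conv_bounded_linear[symmetric])

lemma lborel_c2: "distr lborel borel c2 = lborel"
proof (rule lborel_eqI[symmetric])
 fix l u :: complex assume le: "!!b. b \<in> Basis ==> l \<bullet> b <= u \<bullet> b"
 have le2: "r2 l \<bullet> b <= r2 u \<bullet> b" if "b \<in> Basis" for b
  using that le[of 1] le[of \<i>] by (auto simp: Basis_vec_def UNIV_2 inner_axis r2_def)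
 have "c2 -` box l u = box (r2 l) (r2 u)"
  by (auto simp: c2_def r2_def mem_box_cart forall_2 in_box_complex_iff)
 hence "emeasure (distr lborel borel c2) (box l u) = emeasure lborel (box (r2 l) (r2 u))"
  by (subst emeasure_distr) auto
 also have "... = (\<Prod>b\<in>Basis. (r2 u - r2 l) \<bullet> b)" using le2 by simp
 also have "(\<Prod>b\<in>Basis. (r2 u - r2 l) \<bullet> b) = (\<Prod>b\<in>Basis. (u - l) \<bullet> b)"
  by (simp add: Basis_vec_def UNIV_2 Basis_complex_def inner_axis r2_def axis_eq_axis)
 finally show "emeasure (distr lborel borel c2) (box l u) = (\<Prod>b\<in>Basis. (u - l) \<bullet> b)" .
qed simp

lemma integral_c2:
 fixes f :: "complex => 'b::euclidean_space"
 assumes "f \<in> borel_measurable borel"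
 shows "integrable lborel (%v. f (c2 v)) \<longleftrightarrow> integrable lborel f" "(LINT v|lborel. f (c2 v)) = (LINT z|lborel. f z)"
 using integrable_distr_eq[of c2 lborel borel f] integral_distr[of c2 lborel borel f] assms by (simp_all add: lborel_c2)

lemma set_integrable_lebesgue:
 fixes f :: "'a::euclidean_space => 'b::euclidean_space"
 assumes "open S" "continuous_on S f"
 shows "(%x. indicator S x *\<^sub>R f x) \<in> borel_measurable borel"
  "set_integrable lebesgue S f \<longleftrightarrow> set_integrable lborel S f"
  "set_lebesgue_integral lebesgue S f = set_lebesgue_integral lborel S f"
proof -
 show m: "(%x. indicator S x *\<^sub>R f x) \<in> borel_measurable borel"
  by (rule borel_measurable_continuous_on_indicator) (use assms in auto)
 show "set_integrable lebesgue S f \<longleftrightarrow> set_integrable lborel S f"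
  "set_lebesgue_integral lebesgue S f = set_lebesgue_integral lborel S f"
  unfolding set_integrable_def set_lebesgue_integral_def using m
  by (subst integrable_completion integral_completion; simp)+
qed

lemma set_integral_c2:
 fixes f :: "complex => 'b::euclidean_space"
 assumes "open S" "continuous_on S f"
 shows "(%v. f (c2 v)) absolutely_integrable_on (c2 -` S) \<longleftrightarrow> set_integrable lborel S f"
  "set_integrable lborel S f ==> integral (c2 -` S) (%v. f (c2 v)) = set_lebesgue_integral lborel S f"
proof -
 have c: "continuous_on A c2" for A by (intro linear_continuous_on) (simp add: linear_c2 linear_conv_bounded_linear[symmetric])
 have o: "open (c2 -` S)" by (rule open_vimage[OF assms(1) c])
 have cf: "continuous_on (c2 -` S) (%v. f (c2 v))" by (rule continuous_on_compose2[OF assms(2) c]) auto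
 note m = set_integrable_lebesgue(1)[OF assms] and L = set_integrable_lebesgue(2,3)[OF o cf]
 have i: "indicator (c2 -` S) v *\<^sub>R f (c2 v) = indicator S (c2 v) *\<^sub>R f (c2 v)" for v by (simp add: indicator_def)
 show 1: "(%v. f (c2 v)) absolutely_integrable_on (c2 -` S) \<longleftrightarrow> set_integrable lborel S f"
  unfolding L(1) unfolding set_integrable_def i by (rule integral_c2(1)[OF m])
 show "integral (c2 -` S) (%v. f (c2 v)) = set_lebesgue_integral lborel S f" if "set_integrable lborel S f"
 proof -
  have "integral (c2 -` S) (%v. f (c2 v)) = set_lebesgue_integral lebesgue (c2 -` S) (%v. f (c2 v))"
   by (rule set_lebesgue_integral_eq_integral(2)[symmetric]) (use 1 that in auto)
  also have "... = set_lebesgue_integral lborel S f"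
   unfolding L(2) unfolding set_lebesgue_integral_def i by (rule integral_c2(2)[OF m])
  finally show ?thesis .
 qed
qed

text \<open>By the Cauchy-Riemann equations the Jacobian determinant is the squared modulus of the
  complex derivative. The scalar integrand is wrapped into \<open>real^1\<close> for the sake of the
  general formula.\<close>

lemma holomorphic_change_of_variables:
 fixes f :: "complex => real"
 assumes S: "open S" "Phi holomorphic_on S" "inj_on Phi S" and U: "Phi ` S = U" "open U"
  and f: "continuous_on U f" "set_integrable lborel U f"
 shows "set_integrable lborel S (%Y. (cmod (deriv Phi Y))^2 * f (Phi Y)) &
  set_lebesgue_integral lborel S (%Y. (cmod (deriv Phi Y))^2 * f (Phi Y)) = set_lebesgue_integral lborel U f"
proof -
 let ?g = "%v. r2 (Phi (c2 v))" and ?g' = "%v h. r2 (deriv Phi (c2 v) * c2 h)"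
 define F where "F v = (vec (f (c2 v)) :: real^1)" for v
 have c: "continuous_on A c2" for A by (intro linear_continuous_on) (simp add: linear_c2 linear_conv_bounded_linear[symmetric])
 have d: "(?g has_derivative ?g' v) (at v within c2 -` S)" if "v \<in> c2 -` S" for v
 proof -
  have "(c2 has_derivative c2) (at v within c2 -` S)" by (rule linear_imp_has_derivative[OF linear_c2])
  moreover have "(Phi has_derivative (%h. deriv Phi (c2 v) * h)) (at (c2 v))"
   using holomorphic_derivI[OF S(2,1)] that by (simp add: has_field_derivative_def)
  ultimately have "((%v. Phi (c2 v)) has_derivative (%h. deriv Phi (c2 v) * c2 h)) (at v within c2 -` S)"
   by (rule has_derivative_compose)
  thus ?thesis by (rule bounded_linear.has_derivative[OF linear_conv_bounded_linear[THEN iffD1, OF linear_r2]])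
 qed
 have det: "det (matrix (?g' v)) = (cmod (deriv Phi (c2 v)))^2" for v
  unfolding cmod_power2 by (simp add: det_2 matrix_def r2_def c2_def axis_def power2_eq_square)
 have inj: "inj_on ?g (c2 -` S)"
 proof (rule inj_onI)
  fix x y assume xy: "x \<in> c2 -` S" "y \<in> c2 -` S" "?g x = ?g y"
  have "Phi (c2 x) = Phi (c2 y)" using arg_cong[OF xy(3), of c2] by (simp only: c2_r2)
  from inj_onD[OF S(3) this] have "c2 x = c2 y" using xy(1,2) by simp
  hence "r2 (c2 x) = r2 (c2 y)" by simp
  thus "x = y" by simp
 qed
 have img: "?g ` (c2 -` S) = c2 -` U"
 proof (intro set_eqI iffI)
  fix w assume "w \<in> c2 -` U"
  then obtain z where "z \<in> S" "c2 w = Phi z" using U(1) by auto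
  hence "r2 z \<in> c2 -` S" "w = ?g (r2 z)" by (simp_all, metis r2_c2)
  thus "w \<in> ?g ` (c2 -` S)" by blast
 qed (use U(1) in auto)
 have o: "open (c2 -` S)" by (rule open_vimage[OF S(1) c])
 have bl: "bounded_linear (vec :: real => real^1)" "bounded_linear (%v :: real^1. v $ 1)"
  by (simp add: linear_conv_bounded_linear[symmetric] linear_vec, rule bounded_linear_vec_nth)
 have fa: "(%v. f (c2 v)) absolutely_integrable_on c2 -` U" using set_integral_c2(1)[OF U(2) f(1)] f(2) by simp
 hence "F absolutely_integrable_on c2 -` U"
  unfolding F_def using absolutely_integrable_linear[OF _ bl(1)] by (simp add: o_def)
 hence cv: "(%v. \<bar>det (matrix (?g' v))\<bar> *\<^sub>R F (?g v)) absolutely_integrable_on (c2 -` S)"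
  "integral (c2 -` S) (%v. \<bar>det (matrix (?g' v))\<bar> *\<^sub>R F (?g v)) = integral (c2 -` U) F"
  using has_absolute_integral_change_of_variables[OF _ d inj, of F "integral (c2 -` U) F"] o by (auto simp: img lmeasurable_iff_integrable)
 define H where "H Y = (cmod (deriv Phi Y))^2 * f (Phi Y)" for Y
 have HF: "(%v. (\<bar>det (matrix (?g' v))\<bar> *\<^sub>R F (?g v)) $ 1) = (%v. H (c2 v))"
  by (simp add: F_def H_def det)
 have 1: "(%v. H (c2 v)) absolutely_integrable_on (c2 -` S)"
  using absolutely_integrable_linear[OF cv(1) bl(2)] HF by (simp add: o_def)
 have "integral (c2 -` S) (%v. H (c2 v)) = integral (c2 -` S) (%v. \<bar>det (matrix (?g' v))\<bar> *\<^sub>R F (?g v)) $ 1"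
  using integral_linear[OF set_lebesgue_integral_eq_integral(1)[OF cv(1)] bl(2)] HF by (simp add: o_def)
 also have "... = integral (c2 -` U) F $ 1" by (simp add: cv(2))
 also have "... = integral (c2 -` U) (%v. f (c2 v))"
  using integral_linear[OF set_lebesgue_integral_eq_integral(1)[OF fa] bl(1)] by (simp add: o_def F_def[abs_def])
 finally have 2: "integral (c2 -` S) (%v. H (c2 v)) = set_lebesgue_integral lborel U f"
  using set_integral_c2(2)[OF U(2) f] by simp
 have cH: "continuous_on S H" unfolding H_def
 proof (intro continuous_intros)
  show "continuous_on S (deriv Phi)" by (intro holomorphic_on_imp_continuous_on holomorphic_deriv S)
  show "continuous_on S (%Y. f (Phi Y))"
   by (rule continuous_on_compose2[OF f(1) holomorphic_on_imp_continuous_on[OF S(2)]]) (use U in auto)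
 qed
 have "set_integrable lborel S H" using set_integral_c2(1)[OF S(1) cH] 1 by simp
 moreover from this have "set_lebesgue_integral lborel S H = set_lebesgue_integral lborel U f"
  using set_integral_c2(2)[OF S(1) cH] 2 by simp
 ultimately show ?thesis unfolding H_def by blast
qed

lemma lborel_reflections:
 "distr lborel borel cnj = (lborel :: complex measure)" "distr lborel borel (%z. - cnj z) = lborel"
 "distr lborel borel (%z. \<i> * cnj z) = lborel"
proof -
 have key: "distr lborel borel R = lborel"
  if m: "R \<in> borel_measurable borel" and pre: "!!l u. R -` box l u = box (L l u) (U l u)"
   and q: "!!l u. Re l <= Re u ==> Im l <= Im u ==> Re (L l u) <= Re (U l u) & Im (L l u) <= Im (U l u) &
    (Re (U l u) - Re (L l u)) * (Im (U l u) - Im (L l u)) = (Re u - Re l) * (Im u - Im l)"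
  for R :: "complex => complex" and L U
 proof (rule lborel_eqI[symmetric])
  fix l u :: complex assume le: "!!b. b \<in> Basis ==> l \<bullet> b <= u \<bullet> b"
  have le': "Re l <= Re u" "Im l <= Im u" using le[of 1] le[of \<i>] by (auto simp: Basis_complex_def)
  have "emeasure (distr lborel borel R) (box l u) = emeasure lborel (box (L l u) (U l u))"
   using m by (subst emeasure_distr) (auto simp: pre)
  also have "... = (\<Prod>b\<in>Basis. (u - l) \<bullet> b)"
   unfolding emeasure_lborel_box_eq using q[OF le'] by (auto simp: Basis_complex_def)
  finally show "emeasure (distr lborel borel R) (box l u) = (\<Prod>b\<in>Basis. (u - l) \<bullet> b)" .
 qed simp
 have m: "cnj \<in> borel_measurable borel" "(%z. - cnj z) \<in> borel_measurable borel" "(%z. \<i> * cnj z) \<in> borel_measurable borel"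
  by (intro borel_measurable_continuous_onI continuous_intros)+
 show "distr lborel borel cnj = (lborel :: complex measure)"
  by (rule key[OF m(1), of "%l u. Complex (Re l) (- Im u)" "%l u. Complex (Re u) (- Im l)"]) (auto simp: in_box_complex_iff)
 show "distr lborel borel (%z. - cnj z) = lborel"
  by (rule key[OF m(2), of "%l u. Complex (- Re u) (Im l)" "%l u. Complex (- Re l) (Im u)"]) (auto simp: in_box_complex_iff)
 show "distr lborel borel (%z. \<i> * cnj z) = lborel"
  by (rule key[OF m(3), of "%l u. Complex (Im l) (Re l)" "%l u. Complex (Im u) (Re u)"]) (auto simp: in_box_complex_iff)
qed

text \<open>Off the mirror line, a null set, \<open>S\<close> is the disjoint union of
  \<open>H\<close> and its mirror image, and the two halves contribute equally.\<close>

lemma integral_reflection_double: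
 fixes G :: "complex => real"
 assumes R: "distr lborel borel R = (lborel :: complex measure)" "R \<in> borel_measurable borel" and G: "!!z. G (R z) = G z"
  and [measurable]: "G \<in> borel_measurable borel" "H \<in> sets borel" "S \<in> sets borel" and H: "set_integrable lborel H G"
  and N: "w ~= 0" "!!z. w \<bullet> z ~= 0 ==> indicat_real S z = indicator H z + indicator H (R z)"
 shows "set_integrable lborel S G & set_lebesgue_integral lborel S G = 2 * set_lebesgue_integral lborel H G"
proof -
 note [measurable] = R(2)
 have i: "integrable lborel (%z. indicator H z * G z)" using H by (simp add: set_integrable_def)
 have i2: "integrable lborel (%z. indicator H (R z) * G z)" "(LINT z|lborel. indicator H (R z) * G z) = (LINT z|lborel. indicator H z * G z)"
  using integrable_distr_eq[of R lborel borel "%z. indicator H z * G z"] integral_distr[of R lborel borel "%z. indicator H z * G z"]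
   i R by (simp_all add: G)
 have ae: "AE z in lborel. indicator S z * G z = indicator H z * G z + indicator H (R z) * G z"
 proof -
  have "negligible {z. w \<bullet> z = 0}" by (rule negligible_hyperplane) (use N in auto)
  moreover have "closed {z. w \<bullet> z = 0}" by (rule closed_hyperplane)
  ultimately have "{z. w \<bullet> z = 0} \<in> null_sets lborel"
   by (simp add: negligible_iff_null_sets null_sets_completion_iff)
  from AE_not_in[OF this] show ?thesis by eventually_elim (simp add: N(2) distrib_right)
 qed
 have s: "integrable lborel (%z. indicator H z * G z + indicator H (R z) * G z)"
  using i i2(1) by (rule Bochner_Integration.integrable_add)
 have "integrable lborel (%z. indicator S z * G z)"
  by (rule integrable_cong_AE_imp[OF s]) (use ae in "auto simp: eq_commute")
 moreover have "(LINT z|lborel. indicator S z * G z) = (LINT z|lborel. indicator H z * G z + indicator H (R z) * G z)"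
  by (rule integral_cong_AE[OF _ _ ae]) simp_all
 ultimately show ?thesis
  using i i2 by (simp add: set_integrable_def set_lebesgue_integral_def)
qed

text \<open>Three successive doublings, across the diagonal, the real axis and the imaginary
  axis.\<close>

lemma integral_QQ_eq_TT:
 fixes G :: "complex => real"
 assumes c: "continuous_on UNIV G" and G: "!!z. G (cnj z) = G z" "!!z. G (- cnj z) = G z" "!!z. G (\<i> * cnj z) = G z"
 shows "integral QQ G = 8 * set_lebesgue_integral lborel TT G"
proof -
 define S1 where "S1 = {z. 0 < Re z & Re z < 2 & 0 < Im z & Im z < 2}"
 define S2 where "S2 = {z. 0 < Re z & Re z < 2 & - 2 < Im z & Im z < 2}"
 define S3 where "S3 = box (Complex (-2) (-2)) (Complex 2 2)"
 have o: "open S1" "open S2" "open S3" unfolding S1_def S2_def S3_def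
  by (intro open_Collect_conj open_Collect_less continuous_intros open_box)+
 have Gm: "G \<in> borel_measurable borel" using c by (rule borel_measurable_continuous_onI)
 have m: "cnj \<in> borel_measurable borel" "(%z. - cnj z) \<in> borel_measurable borel" "(%z. \<i> * cnj z) \<in> borel_measurable borel"
  by (intro borel_measurable_continuous_onI continuous_intros)+
 have "set_integrable lborel QQ G"
  unfolding set_integrable_def by (rule borel_integrable_compact[OF compact_QQ continuous_on_subset[OF c]]) auto
 hence "set_integrable lborel TT G"
  by (rule set_integrable_subset) (use open_TT TT_subset TC_subset_QQ in auto)
 hence 1: "set_integrable lborel S1 G & set_lebesgue_integral lborel S1 G = 2 * set_lebesgue_integral lborel TT G"
  using o open_TT
  by (intro integral_reflection_double[OF lborel_reflections(3) m(3) G(3) Gm, where w = "Complex 1 (-1)"])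
   (auto simp: S1_def TT_def inner_complex_def complex_eq_iff indicator_def)
 hence 2: "set_integrable lborel S2 G & set_lebesgue_integral lborel S2 G = 2 * set_lebesgue_integral lborel S1 G"
  using o by (intro integral_reflection_double[OF lborel_reflections(1) m(1) G(1) Gm, where w = "\<i>"])
   (auto simp: S1_def S2_def inner_complex_def complex_eq_iff indicator_def)
 hence 3: "set_integrable lborel S3 G & set_lebesgue_integral lborel S3 G = 2 * set_lebesgue_integral lborel S2 G"
  using o by (intro integral_reflection_double[OF lborel_reflections(2) m(2) G(2) Gm, where w = "1"])
   (auto simp: S2_def S3_def in_box_complex_iff inner_complex_def complex_eq_iff indicator_def)
 have c3: "continuous_on S3 G" by (rule continuous_on_subset[OF c]) simp
 have "integral QQ G = integral S3 G" by (simp add: QQ_def S3_def integral_open_interval)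
 also have "... = set_lebesgue_integral lebesgue S3 G"
  by (rule set_lebesgue_integral_eq_integral(2)[symmetric]) (use 3 set_integrable_lebesgue(2)[OF o(3) c3] in simp)
 also have "... = set_lebesgue_integral lborel S3 G" by (rule set_integrable_lebesgue(3)[OF o(3) c3])
 finally show ?thesis using 1 2 3 by simp
qed

lemma set_integral_TT_le_QQ:
 fixes G :: "complex => real"
 assumes c: "continuous_on UNIV G" and nn: "!!z. 0 <= G z"
 shows "set_integrable lborel TT G" "set_lebesgue_integral lborel TT G <= integral QQ G"
proof -
 have cT: "continuous_on TT G" by (rule continuous_on_subset[OF c]) simp
 have q: "set_integrable lborel QQ G"
  unfolding set_integrable_def by (rule borel_integrable_compact[OF compact_QQ continuous_on_subset[OF c]]) auto
 thus i: "set_integrable lborel TT G"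
  by (rule set_integrable_subset) (use open_TT TT_subset TC_subset_QQ in auto)
 hence a: "G absolutely_integrable_on TT" using set_integrable_lebesgue(2)[OF open_TT cT] by simp
 have "set_lebesgue_integral lborel TT G = integral TT G"
  using set_lebesgue_integral_eq_integral(2)[OF a] set_integrable_lebesgue(3)[OF open_TT cT] by simp
 also have "... <= integral QQ G"
  by (rule integral_subset_le[OF _ set_lebesgue_integral_eq_integral(1)[OF a] integrable_QQ])
   (use TT_subset TC_subset_QQ nn in "auto intro: continuous_on_subset[OF c]")
 finally show "set_lebesgue_integral lborel TT G <= integral QQ G" .
qed

section \<open>Integrability of the boundary singularity\<close>

lemma integral_sqrt_singular_le:
 fixes c W :: real
 assumes "\<bar>c\<bar> <= 2" "0 < W" "W <= 1"
 shows "integral {-2..2} (%t. 1 / sqrt (\<bar>t - c\<bar> + W)) <= 16"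
proof -
 have s: "sqrt u <= 4" if "u <= 16" for u :: real using real_sqrt_le_mono[OF that] by simp
 have cont: "continuous_on A (%t. 1 / sqrt (\<bar>t - c\<bar> + W))" for A
  using assms by (intro continuous_intros) (auto simp: add_nonneg_eq_0_iff)
 have l: "((%t. 1 / sqrt (\<bar>t - c\<bar> + W)) has_integral (- 2 * sqrt (c - c + W) - - 2 * sqrt (c - (-2) + W))) {-2..c}"
 proof (rule fundamental_theorem_of_calculus)
  fix t assume t: "t \<in> {-2..c}"
  hence "((%t. - 2 * sqrt (c - t + W)) has_field_derivative 1 / sqrt (\<bar>t - c\<bar> + W)) (at t)"
   using assms by (auto intro!: derivative_eq_intros simp: field_simps)
  thus "((%t. - 2 * sqrt (c - t + W)) has_vector_derivative 1 / sqrt (\<bar>t - c\<bar> + W)) (at t within {-2..c})"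
   by (simp add: has_real_derivative_iff_has_vector_derivative has_vector_derivative_at_within)
 qed (use assms in auto)
 have r: "((%t. 1 / sqrt (\<bar>t - c\<bar> + W)) has_integral (2 * sqrt (2 - c + W) - 2 * sqrt (c - c + W))) {c..2}"
 proof (rule fundamental_theorem_of_calculus)
  fix t assume t: "t \<in> {c..2}"
  hence "((%t. 2 * sqrt (t - c + W)) has_field_derivative 1 / sqrt (\<bar>t - c\<bar> + W)) (at t)"
   using assms by (auto intro!: derivative_eq_intros simp: field_simps)
  thus "((%t. 2 * sqrt (t - c + W)) has_vector_derivative 1 / sqrt (\<bar>t - c\<bar> + W)) (at t within {c..2})"
   by (simp add: has_real_derivative_iff_has_vector_derivative has_vector_derivative_at_within)
 qed (use assms in auto)
 have "integral {-2..2} (%t. 1 / sqrt (\<bar>t - c\<bar> + W)) = 2 * sqrt (c + 2 + W) + 2 * sqrt (2 - c + W) - 4 * sqrt W"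
  using integral_unique[OF has_integral_combine[OF _ _ l r]] assms by simp
 also have "... <= 16" using s[of "c + 2 + W"] s[of "2 - c + W"] assms real_sqrt_ge_zero[of W] by linarith
 finally show ?thesis .
qed

lemma integral_QQ_singular_le:
 fixes c :: "real => real"
 assumes c: "continuous_on UNIV c" "!!x. x \<in> {-2..2} ==> \<bar>c x\<bar> <= 2" and e: "0 < W" "W <= 1"
 shows "integral QQ (%Z. 1 / sqrt (\<bar>Im Z - c (Re Z)\<bar> + W)) <= 64"
proof -
 have "\<bar>u\<bar> + W ~= 0" for u using e by linarith
 hence cont: "continuous_on A (%Z. 1 / sqrt (\<bar>Im Z - c (Re Z)\<bar> + W))" for A
  by (intro continuous_intros continuous_on_compose2[OF c(1)]) auto
 have "integral QQ (%Z. 1 / sqrt (\<bar>Im Z - c (Re Z)\<bar> + W)) = integral {-2..2} (%x. integral {-2..2} (%y. 1 / sqrt (\<bar>y - c x\<bar> + W)))"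
  unfolding QQ_def by (subst integral_complex_iterated[OF cont]) simp
 also have "... <= integral {-2..2::real} (%x. 16 :: real)"
 proof (rule integral_le)
  have "continuous_on (cbox (-2, -2) (2, 2)) (%p. 1 / sqrt (\<bar>snd p - c (fst p)\<bar> + W))"
   using \<open>!!u. \<bar>u\<bar> + W ~= 0\<close> by (intro continuous_intros continuous_on_compose2[OF c(1)]) auto
  hence "continuous_on ({-2..2} \<times> cbox (-2) 2) (%(x, y). 1 / sqrt (\<bar>y - c x\<bar> + W))"
   by (simp add: cbox_Pair_eq case_prod_beta)
  from integral_continuous_on_param[OF this]
  show "(%x. integral {-2..2} (%y. 1 / sqrt (\<bar>y - c x\<bar> + W))) integrable_on {-2..2}"
   by (intro integrable_continuous_real) simp
 qed (use integral_sqrt_singular_le c e in auto)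
 finally show ?thesis by simp
qed

text \<open>Near each side the function behaves like an inverse square root of one variable.
  Shifting the three singularities by \<open>e n\<close> gives continuous functions with integrals
  at most 3 * 64 over \<open>QQ\<close>, and Fatou's lemma removes the shift.\<close>

lemma bd_singular_integrable:
 shows "set_integrable lborel TT (%Z. 1 / sqrt (bd Z))"
proof -
 define c :: "nat => real => real" where "c i x = (if i = 0 then x else if i = 1 then 2 else 0)" for i x
 define e where "e n = 1 / real (Suc n)" for n
 have e: "0 < e n" "e n <= 1" for n by (auto simp: e_def)
 have e0: "e \<longlonglongrightarrow> 0" unfolding e_def by (rule LIMSEQ_Suc[OF lim_const_over_n])
 define f where "f n Z = 1 / sqrt (\<bar>Im Z - Re Z\<bar> + e n) + 1 / sqrt (\<bar>Im Z - 2\<bar> + e n) + 1 / sqrt (\<bar>Re Z\<bar> + e n)" for n Z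
 have nz: "\<bar>u\<bar> + e n ~= 0" for u n using e[of n] by linarith
 have cn: "continuous_on A (%Z. 1 / sqrt (\<bar>h Z\<bar> + e n))" if "continuous_on A h" for A n and h :: "complex => real"
  using that nz by (intro continuous_intros) auto
 have cf: "continuous_on A (f n)" for A n unfolding f_def by (intro continuous_intros cn)
 have nn: "0 <= f n Z" for n Z using e[of n] by (auto simp: f_def)
 have swap: "integral QQ (%Z. 1 / sqrt (\<bar>Re Z\<bar> + e n)) = integral QQ (%Z. 1 / sqrt (\<bar>Im Z\<bar> + e n))" for n
 proof -
  have "integral QQ (%Z. complex_of_real (1 / sqrt (\<bar>Im (\<i> * cnj Z)\<bar> + e n))) = integral QQ (%Z. complex_of_real (1 / sqrt (\<bar>Im Z\<bar> + e n)))"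
   by (rule integral_QQ_cnj(3)[of "%Z. complex_of_real (1 / sqrt (\<bar>Im Z\<bar> + e n))"]) (intro continuous_intros cn)
  hence "Re (integral QQ (%Z. complex_of_real (1 / sqrt (\<bar>Re Z\<bar> + e n)))) = Re (integral QQ (%Z. complex_of_real (1 / sqrt (\<bar>Im Z\<bar> + e n))))"
   by simp
  thus ?thesis
   using integral_QQ_Re[of "%Z. complex_of_real (1 / sqrt (\<bar>Re Z\<bar> + e n))"]
    integral_QQ_Re[of "%Z. complex_of_real (1 / sqrt (\<bar>Im Z\<bar> + e n))"]
   by (simp add: cn continuous_on_of_real continuous_on_Re continuous_on_Im continuous_on_id del: of_real_divide)
 qed
 have If: "integral QQ (f n) <= 192" for n
 proof -
  have "integral QQ (f n) = integral QQ (%Z. 1 / sqrt (\<bar>Im Z - Re Z\<bar> + e n)) + integral QQ (%Z. 1 / sqrt (\<bar>Im Z - 2\<bar> + e n)) + integral QQ (%Z. 1 / sqrt (\<bar>Re Z\<bar> + e n))"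
   unfolding f_def by (subst integral_add integral_add; (intro integrable_QQ continuous_intros cn)?)+ simp
  also have "... <= 64 + 64 + 64" unfolding swap
   using integral_QQ_singular_le[of "%x. x" "e n"] integral_QQ_singular_le[of "%x. 2" "e n"] integral_QQ_singular_le[of "%x. 0" "e n"] e[of n]
   by (intro add_mono) (auto simp: continuous_intros abs_le_iff)
  finally show ?thesis by simp
 qed
 define g where "g Z = 1 / sqrt (Im Z - Re Z) + 1 / sqrt (2 - Im Z) + 1 / sqrt (Re Z)" for Z
 have lim: "(%n. indicator TT Z * f n Z) \<longlonglongrightarrow> indicator TT Z * g Z" for Z
 proof (cases "Z \<in> TT")
  case True
  hence "(%n. f n Z) \<longlonglongrightarrow> 1 / sqrt (\<bar>Im Z - Re Z\<bar> + 0) + 1 / sqrt (\<bar>Im Z - 2\<bar> + 0) + 1 / sqrt (\<bar>Re Z\<bar> + 0)"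
   unfolding f_def by (intro tendsto_intros e0) (auto simp: TT_def)
  thus ?thesis using True by (simp add: g_def TT_def)
 qed simp
 have [measurable]: "TT \<in> sets borel" "Re \<in> borel_measurable borel" "Im \<in> borel_measurable borel"
  by (auto intro!: borel_open open_TT borel_measurable_continuous_onI continuous_intros)
 have gm: "(%Z. indicator TT Z * g Z) \<in> borel_measurable borel" unfolding g_def by measurable
 have fm: "f n \<in> borel_measurable borel" for n using cf by (rule borel_measurable_continuous_onI)
 have "integrable lborel (%Z. indicator TT Z * g Z)"
 proof (rule integrableI_bounded)
  have "(\<integral>\<^sup>+Z. ennreal (norm (indicator TT Z * g Z)) \<partial>lborel) = (\<integral>\<^sup>+Z. liminf (%n. ennreal (indicator TT Z * f n Z)) \<partial>lborel)"
  proof (rule nn_integral_cong)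
   fix Z
   have "0 <= indicator TT Z * g Z" by (auto simp: g_def TT_def indicator_def)
   hence "(%n. ennreal (indicator TT Z * f n Z)) \<longlonglongrightarrow> ennreal (norm (indicator TT Z * g Z))"
    using tendsto_ennrealI[OF lim] by simp
   thus "ennreal (norm (indicator TT Z * g Z)) = liminf (%n. ennreal (indicator TT Z * f n Z))"
    by (simp add: lim_imp_Liminf)
  qed
  also have "... <= liminf (%n. \<integral>\<^sup>+Z. ennreal (indicator TT Z * f n Z) \<partial>lborel)"
   by (rule nn_integral_liminf) (use fm in measurable)
  also have "... <= liminf (%n. ennreal 192)"
  proof (intro Liminf_mono always_eventually allI)
   fix n
   have "(\<integral>\<^sup>+Z. ennreal (indicator TT Z * f n Z) \<partial>lborel) = ennreal (set_lebesgue_integral lborel TT (f n))"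
    unfolding set_lebesgue_integral_def real_scaleR_def
    using set_integral_TT_le_QQ(1)[OF cf nn, of n] nn by (intro nn_integral_eq_integral) (auto simp: set_integrable_def)
   also have "... <= ennreal 192" using set_integral_TT_le_QQ(2)[OF cf nn, of n] If[of n] by (intro ennreal_leI) simp
   finally show "(\<integral>\<^sup>+Z. ennreal (indicator TT Z * f n Z) \<partial>lborel) <= ennreal 192" .
  qed
  finally show "(\<integral>\<^sup>+Z. ennreal (norm (indicator TT Z * g Z)) \<partial>lborel) < \<infinity>" by (simp add: Liminf_const le_less_trans)
 qed (use gm in simp)
 hence "set_integrable lborel TT g" by (simp add: set_integrable_def)
 thus ?thesis
 proof (rule set_integrable_bound)
  show "set_borel_measurable lborel TT (%Z. 1 / sqrt (bd Z))"
   unfolding set_borel_measurable_def bd_def by measurable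
  have "1 / sqrt (bd Z) <= g Z" if "Z \<in> TT" for Z using that by (auto simp: bd_def min_def g_def TT_def)
  thus "AE Z in lborel. Z \<in> TT --> norm (1 / sqrt (bd Z)) <= norm (g Z)"
   by (auto simp: bd_TT intro!: AE_I2 order_trans[OF _ abs_ge_self])
 qed
qed

section \<open>Weak derivatives\<close>

lemma Ck_Suc_imp: "Ck (Suc n) f ==> Ck n f"
proof (induction n arbitrary: f)
 case 0
 thus ?case by (simp add: continuous_on_eq_continuous_at differentiable_imp_continuous_within)
next
 case (Suc n)
 thus ?case by (metis Ck.simps(2))
qed

lemma Ck_const: "Ck n (%_. c)"
 by (induction n arbitrary: c) auto

lemma Ck_add: "Ck n f ==> Ck n g ==> Ck n (%x. f x + g x)"
proof (induction n arbitrary: f g)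
 case (Suc n)
 have "frechet_derivative (%x. f x + g x) (at x) b = frechet_derivative f (at x) b + frechet_derivative g (at x) b" for x b
 proof -
  have "(f has_derivative frechet_derivative f (at x)) (at x)" "(g has_derivative frechet_derivative g (at x)) (at x)"
   using Suc.prems by (auto simp: frechet_derivative_works)
  from frechet_derivative_at[OF has_derivative_add[OF this]] show ?thesis by metis
 qed
 thus ?case using Suc by (auto intro: differentiable_add)
qed (simp add: continuous_intros)

lemma Ck_mult: "Ck n f ==> Ck n g ==> Ck n (%x. f x * g x)"
proof (induction n arbitrary: f g)
 case (Suc n)
 have "frechet_derivative (%x. f x * g x) (at x) b = f x * frechet_derivative g (at x) b + frechet_derivative f (at x) b * g x" for x b
 proof -
  have "(f has_derivative frechet_derivative f (at x)) (at x)" "(g has_derivative frechet_derivative g (at x)) (at x)"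
   using Suc.prems by (auto simp: frechet_derivative_works)
  from has_derivative_mult[OF this] have "frechet_derivative (%x. f x * g x) (at x) = (%h. f x * frechet_derivative g (at x) h + frechet_derivative f (at x) h * g x)"
   by (rule frechet_derivative_at[symmetric])
  thus ?thesis by simp
 qed
 moreover have "Ck n f" "Ck n g" using Suc.prems Ck_Suc_imp by blast+
 ultimately show ?case using Suc by (auto intro!: differentiable_mult Ck_add)
qed (simp add: continuous_intros)

text \<open>The family of products of a polynomial in 1/x with \<open>exp (- 1 / x)\<close>,
  extended by 0. It is closed under differentiation, which makes smoothness an induction over all
  \<open>q\<close> at once.\<close>

definition bump :: "real poly => real => real" where
 "bump q x = (if 0 < x then poly q (1 / x) * exp (- 1 / x) else 0)"

lemma poly_div_exp_tendsto_0: "((%t. t ^ n * poly (q :: real poly) t / exp t) \<longlongrightarrow> 0) at_top"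
proof (induction q arbitrary: n)
 case (pCons a q)
 have "((%t. a * (t ^ n / exp t) + t ^ Suc n * poly q t / exp t) \<longlongrightarrow> a * 0 + 0) at_top"
  by (intro tendsto_add tendsto_mult tendsto_const tendsto_power_div_exp_0 pCons)
 thus ?case by (simp add: algebra_simps add_divide_distrib)
qed simp

text \<open>In terms of t = 1/x the derivative replaces \<open>q\<close> by t^2 (q - q'). At 0 the
  exponential beats every polynomial in t.\<close>

lemma has_derivative_bump: "(bump q has_field_derivative bump (monom 1 2 * (q - pderiv q)) x) (at x)"
proof -
 consider "x < 0" | "x = 0" | "0 < x" by linarith
 thus ?thesis
 proof cases
  case 1
  have "((%_. 0) has_field_derivative 0) (at x)" by simp
  hence "(bump q has_field_derivative 0) (at x)"
   by (rule has_field_derivative_transform_within_open[of _ _ _ "{..<0}"]) (use 1 in "auto simp: bump_def")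
  thus ?thesis using 1 by (simp add: bump_def)
 next
  case 2
  have "((%h. bump q h / h) \<longlongrightarrow> 0) (at 0)"
   proof (rule filterlim_split_at)
   show "((%h. bump q h / h) \<longlongrightarrow> 0) (at_left 0)"
    by (rule tendsto_eventually) (auto simp: eventually_at_left_field bump_def intro!: exI[of _ "-1"])
   have "((%h. inverse h ^ 1 * poly q (inverse h) / exp (inverse h)) \<longlongrightarrow> 0) (at_right 0)"
    by (rule filterlim_compose[OF poly_div_exp_tendsto_0 filterlim_inverse_at_top_right])
   thus "((%h. bump q h / h) \<longlongrightarrow> 0) (at_right 0)"
    by (rule Lim_transform_eventually)
     (auto simp: eventually_at_right_field bump_def exp_minus field_simps intro!: exI[of _ 1])
  qed
  thus ?thesis using 2 by (simp add: has_field_derivative_iff bump_def)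
 next
  case 3
  have "((%x. poly q (1 / x) * exp (- 1 / x)) has_field_derivative
    (poly q (1 / x) * (exp (- 1 / x) * (1 / x^2)) + poly (pderiv q) (1 / x) * (- 1 / x^2) * exp (- 1 / x))) (at x)"
  proof (rule DERIV_cong[OF DERIV_mult'])
   have i: "((%x. 1 / x) has_field_derivative (- 1 / x^2)) (at x)"
    using 3 by (auto intro!: derivative_eq_intros simp: power2_eq_square)
   show "((%x. poly q (1 / x)) has_field_derivative (poly (pderiv q) (1 / x) * (- 1 / x^2))) (at x)"
    by (rule DERIV_chain'[OF i poly_DERIV, THEN DERIV_cong]) simp
   have j: "((%x. - 1 / x) has_field_derivative (1 / x^2)) (at x)" using DERIV_minus[OF i] by simp
   show "((%x. exp (- 1 / x)) has_field_derivative (exp (- 1 / x) * (1 / x^2))) (at x)"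
    by (rule DERIV_chain'[OF j DERIV_exp, THEN DERIV_cong]) simp
  qed simp
  hence "(bump q has_field_derivative
    (poly q (1 / x) * (exp (- 1 / x) * (1 / x^2)) + poly (pderiv q) (1 / x) * (- 1 / x^2) * exp (- 1 / x))) (at x)"
   by (rule has_field_derivative_transform_within_open[of _ _ _ "{0<..}"]) (use 3 in "auto simp: bump_def")
  thus ?thesis using 3 by (simp add: bump_def poly_monom algebra_simps power_divide)
 qed
qed

lemma Ck_bump: "Ck n (%x. bump q (a \<bullet> x + b))"
proof (induction n arbitrary: q)
 case 0
 have "isCont (bump q) t" for t using has_derivative_bump by (rule DERIV_isCont)
 hence "continuous_on UNIV (bump q)" by (simp add: continuous_at_imp_continuous_on)
 thus ?case by (auto intro!: continuous_on_compose2[of UNIV "bump q"] continuous_intros)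
next
 case (Suc n)
 have d: "((%x. bump q (a \<bullet> x + b)) has_derivative (%h. bump (monom 1 2 * (q - pderiv q)) (a \<bullet> x + b) * (a \<bullet> h))) (at x)" for x
  by (rule has_derivative_compose[OF _ has_derivative_bump[unfolded has_field_derivative_def]])
   (auto intro!: derivative_eq_intros)
 show ?case
  using d frechet_derivative_at[OF d, symmetric] Suc by (auto simp: differentiable_def intro!: Ck_mult Ck_const)
qed

text \<open>A product of four one-sided cutoffs, nonzero exactly on the open box; as
  \<open>n\<close> grows it tends to the indicator of the box.\<close>

definition box_bump :: "complex => complex => nat => complex => real" where
 "box_bump l u n z = (bump 1 (real (Suc n) * (Re z - Re l)) * bump 1 (real (Suc n) * (Re u - Re z))) *
  (bump 1 (real (Suc n) * (Im z - Im l)) * bump 1 (real (Suc n) * (Im u - Im z)))"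

lemma bump_1: "0 <= bump 1 x" "bump 1 x <= 1" "bump 1 x ~= 0 \<longleftrightarrow> 0 < x"
 by (auto simp: bump_def)

lemma bump_1_tendsto: "(%n. bump 1 (real (Suc n) * x)) \<longlonglongrightarrow> (if 0 < x then 1 else 0)"
proof (cases "0 < x")
 case True
 have "(%n. exp (- ((1 / real (Suc n)) / x))) \<longlonglongrightarrow> exp (- (0 / x))"
  by (intro tendsto_intros LIMSEQ_Suc[OF lim_const_over_n]) (use True in simp)
 moreover have "0 < real (Suc n) * x" for n using True by simp
 hence "bump 1 (real (Suc n) * x) = exp (- ((1 / real (Suc n)) / x))" for n
  unfolding bump_def using True by (simp del: of_nat_Suc)
 ultimately show ?thesis using True by simp
next
 case False
 hence "bump 1 (real (Suc n) * x) = 0" for n by (simp add: bump_def zero_less_mult_iff)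
 thus ?thesis using False by simp
qed

lemma box_bump_nz: "box_bump l u n z ~= 0 \<longleftrightarrow> z \<in> box l u"
 by (auto simp: box_bump_def bump_1(3) in_box_complex_iff zero_less_mult_iff)

lemma box_bump_le: "\<bar>box_bump l u n z\<bar> <= 1"
proof -
 have m: "\<bar>x * y\<bar> <= 1" if "\<bar>x\<bar> <= 1" "\<bar>y\<bar> <= 1" for x y :: real
  using mult_mono[OF that] by (simp add: abs_mult)
 show ?thesis unfolding box_bump_def by (intro m) (use bump_1 in auto)
qed

lemma box_bump_tendsto: "(%n. box_bump l u n z) \<longlonglongrightarrow> indicator (box l u) z"
proof -
 let ?c = "%t :: real. if 0 < t then 1 else 0 :: real"
 have "(%n. box_bump l u n z) \<longlonglongrightarrow> (?c (Re z - Re l) * ?c (Re u - Re z)) * (?c (Im z - Im l) * ?c (Im u - Im z))"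
  unfolding box_bump_def by (intro tendsto_mult bump_1_tendsto)
 also have "(?c (Re z - Re l) * ?c (Re u - Re z)) * (?c (Im z - Im l) * ?c (Im u - Im z)) = indicat_real (box l u) z"
  by (auto simp: in_box_complex_iff indicator_def)
 finally show ?thesis .
qed

lemma test_fun_box_bump:
 assumes "cbox l u \<subseteq> U" shows "test_fun_on U (box_bump l u n)"
 unfolding test_fun_on_def
proof (intro conjI allI)
 fix k
 let ?N = "real (Suc n)"
 have "Ck k (%z. bump 1 (?N * (Re z - Re l)))" "Ck k (%z. bump 1 (?N * (Re u - Re z)))"
  "Ck k (%z. bump 1 (?N * (Im z - Im l)))" "Ck k (%z. bump 1 (?N * (Im u - Im z)))"
  using Ck_bump[of k 1 "Complex ?N 0" "- ?N * Re l"] Ck_bump[of k 1 "Complex (- ?N) 0" "?N * Re u"]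
   Ck_bump[of k 1 "Complex 0 ?N" "- ?N * Im l"] Ck_bump[of k 1 "Complex 0 (- ?N)" "?N * Im u"]
  by (simp_all add: inner_complex_def right_diff_distrib del: of_nat_Suc)
 thus "Ck k (box_bump l u n)" unfolding box_bump_def[abs_def] by (intro Ck_mult)
next
 have "{x. box_bump l u n x ~= 0} = box l u" by (auto simp: box_bump_nz)
 moreover have c: "closure (box l u) \<subseteq> cbox l u" by (rule closure_minimal[OF box_subset_cbox closed_cbox])
 ultimately show "closure {x. box_bump l u n x ~= 0} \<subseteq> U" "compact (closure {x. box_bump l u n x ~= 0})"
  using assms by (auto simp: compact_closure bounded_box)
qed

text \<open>Boxes are closed under intersection and generate the Borel sets, so the vanishing
  extends to all Borel sets by the pi-lambda argument, then to Lebesgue sets, which differ from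
  Borel ones by null sets. A function with vanishing integrals is 0 almost everywhere.\<close>

lemma set_integral_boxes_zero_imp_AE:
 fixes g :: "complex => 'b::euclidean_space"
 assumes i: "set_integrable lebesgue (box l u) g"
  and z: "!!a b. box a b \<subseteq> box l u ==> set_lebesgue_integral lebesgue (box a b) g = 0"
 shows "AE x in lebesgue. x \<in> box l u --> g x = 0"
proof -
 define f where "f x = indicator (box l u) x *\<^sub>R g x" for x
 have fi: "integrable lebesgue f" using i by (simp add: f_def[abs_def] set_integrable_def)
 hence fs: "set_integrable lebesgue A f" if "A \<in> sets lebesgue" for A
  using that by (simp add: set_integrable_def integrable_mult_indicator)
 have borel: "set_lebesgue_integral lebesgue A f = 0" if "A \<in> sets borel" for A
 proof -
  have "Int_stable (range (%(a, b). box a b :: complex set))" "range (%(a, b). box a b :: complex set) \<subseteq> Pow UNIV"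
   "A \<in> sigma_sets UNIV (range (%(a, b). box a b))"
   using that by (auto simp: borel_eq_box Int_stable_def box_Int_box)
  thus ?thesis
  proof (induct rule: sigma_sets_induct_disjoint)
   case (basic A)
   then obtain a b where "A = box a b" by auto
   hence "set_lebesgue_integral lebesgue A f = set_lebesgue_integral lebesgue (box a b \<inter> box l u) g"
    by (simp add: set_lebesgue_integral_def f_def indicator_inter_arith)
   moreover obtain a' b' where "box a b \<inter> box l u = box a' b'" by (simp add: box_Int_box)
   ultimately show ?case using z[of a' b'] by (metis inf_le2)
  next
   case (compl A)
   hence A: "A \<in> sets lebesgue" by (simp add: borel_eq_box)
   have "(LINT x|lebesgue. f x) = set_lebesgue_integral lebesgue (box l u) g" by (simp add: f_def set_lebesgue_integral_def)
   also have "... = 0" using z by simp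
   finally have "set_lebesgue_integral lebesgue (A \<union> (UNIV - A)) f = 0" by (simp add: set_lebesgue_integral_def)
   moreover have "set_lebesgue_integral lebesgue (A \<union> (UNIV - A)) f =
     set_lebesgue_integral lebesgue A f + set_lebesgue_integral lebesgue (UNIV - A) f"
    using sets.compl_sets[OF A] by (intro set_integral_Un fs A) auto
   ultimately show ?case using compl by simp
  next
   case (union A)
   hence "A i \<in> sets (borel :: complex measure)" for i unfolding borel_eq_box by auto
   hence A: "A i \<in> sets lebesgue" for i by simp
   hence "set_lebesgue_integral lebesgue (\<Union>i. A i) f = (\<Sum>i. set_lebesgue_integral lebesgue (A i) f)"
    using union(1) by (intro lebesgue_integral_countable_add fs) (auto simp: disjoint_family_on_def)
   thus ?case using union by simp
  qed (simp add: set_lebesgue_integral_def)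
 qed
 interpret sigma_finite_measure "lebesgue :: complex measure"
 proof
  obtain A :: "complex set set" where "countable A" "A \<subseteq> sets lborel" "\<Union>A = space lborel" "ALL a:A. emeasure lborel a ~= \<infinity>"
   using lborel.sigma_finite_countable by blast
  thus "\<exists>A::complex set set. countable A & A \<subseteq> sets lebesgue & \<Union>A = space lebesgue & (ALL a:A. emeasure lebesgue a ~= \<infinity>)"
   by (intro exI[of _ A]) (auto simp: emeasure_completion subset_iff)
 qed
 have "AE x in lebesgue. f x = 0"
 proof (rule density_zero[OF fi])
  fix A :: "complex set" assume "A \<in> sets lebesgue"
  then obtain S N N' where A: "A = S \<union> N" "N \<subseteq> N'" "N' \<in> null_sets lborel" "S \<in> sets lborel"
   by (rule sets_completionE)
  have "AE x in lebesgue. x \<notin> N'" using A(3) by (intro AE_not_in null_sets_completionI)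
  hence ae: "AE x in lebesgue. indicator A x *\<^sub>R f x = indicator S x *\<^sub>R f x"
   by eventually_elim (use A in "auto simp: indicator_def")
  have "set_lebesgue_integral lebesgue A f = set_lebesgue_integral lebesgue S f"
   unfolding set_lebesgue_integral_def
   by (rule integral_cong_AE[OF _ _ ae]) (use fs[OF \<open>A \<in> sets lebesgue\<close>] fs[of S] A(4) in "auto simp: set_integrable_def")
  thus "set_lebesgue_integral lebesgue A f = 0" using borel A(4) by simp
 qed
 thus ?thesis by eventually_elim (auto simp: f_def)
qed

text \<open>On every line parallel to \<open>b\<close> the fundamental theorem leaves only the
  values at the ends of \<open>QQ\<close>, which lie outside the disc.\<close>

lemma integral_derivative_compact_support:
 fixes h :: "complex => 'b::euclidean_space"
 assumes d: "!!x. (h has_derivative D x) (at x)" and c: "continuous_on UNIV (%x. D x b)" and b: "b \<in> {1, \<i>}"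
  and h: "!!x. x \<notin> ball 0 1 ==> h x = 0"
 shows "integral QQ (%x. D x b) = 0"
proof -
 have cQ: "continuous_on QQ (%x. D x b)" by (rule continuous_on_subset[OF c]) simp
 have out: "h (Complex x y) = 0" if "\<bar>x\<bar> = 2 \<or> \<bar>y\<bar> = 2" for x y
  using that abs_Re_le_cmod[of "Complex x y"] abs_Im_le_cmod[of "Complex x y"] by (intro h) auto
 have line: "integral {-2..2} (%t. D (p + of_real t * v) v) = h (p + 2 * v) - h (p - 2 * v)" for p v
 proof (rule integral_unique, rule has_integral_eq_rhs, rule fundamental_theorem_of_calculus)
  fix t :: real
  have "((%t. h (p + of_real t * v)) has_derivative (%s. D (p + of_real t * v) (of_real s * v))) (at t within {-2..2})"
   by (rule has_derivative_compose[OF _ d]) (auto intro!: derivative_eq_intros)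
  moreover have "D (p + of_real t * v) (of_real s * v) = s *\<^sub>R D (p + of_real t * v) v" for s
   using linear_scale[OF has_derivative_linear[OF d[of "p + of_real t * v"]], of s v] by (simp add: scaleR_conv_of_real)
  ultimately show "((%t. h (p + of_real t * v)) has_vector_derivative D (p + of_real t * v) v) (at t within {-2..2})"
   by (simp add: has_vector_derivative_def)
 qed auto
 from b consider "b = 1" | "b = \<i>" by auto
 thus ?thesis
 proof cases
  case 1
  have "integral QQ (%x. D x b) = integral {-2..2} (%y. integral {-2..2} (%x. D (Complex x y) 1))"
   using integral_QQ_iterated_swap[OF cQ] 1 by simp
  also have "... = integral {-2..2} (%y::real. 0)"
  proof (rule Henstock_Kurzweil_Integration.integral_cong)
   fix y :: real
   have e: "Complex 0 y + of_real x * 1 = Complex x y" "Complex 0 y + 2 * 1 = Complex 2 y" "Complex 0 y - 2 * 1 = Complex (-2) y" for x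
    by (simp_all add: complex_eq_iff)
   show "integral {-2..2} (%x. D (Complex x y) 1) = 0"
    using line[of "Complex 0 y" 1] out[of 2 y] out[of "-2" y] unfolding e by simp
  qed
  finally show ?thesis by simp
 next
  case 2
  have "integral QQ (%x. D x b) = integral {-2..2} (%x. integral {-2..2} (%y. D (Complex x y) \<i>))"
   using integral_complex_iterated[of "-2" "-2" 2 2 "%x. D x b"] cQ 2 by (simp add: QQ_def)
  also have "... = integral {-2..2} (%x::real. 0)"
  proof (rule Henstock_Kurzweil_Integration.integral_cong)
   fix x :: real
   have e: "Complex x 0 + of_real y * \<i> = Complex x y" "Complex x 0 + 2 * \<i> = Complex x 2" "Complex x 0 - 2 * \<i> = Complex x (-2)" for y
    by (simp_all add: complex_eq_iff)
   show "integral {-2..2} (%y. D (Complex x y) \<i>) = 0"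
    using line[of "Complex x 0" \<i>] out[of x 2] out[of x "-2"] unfolding e by simp
  qed
  finally show ?thesis by simp
 qed
qed

lemma test_fun_derivative:
 assumes "test_fun_on U w" "b \<in> Basis"
 shows "(w has_derivative frechet_derivative w (at x)) (at x)" "continuous_on UNIV (%x. frechet_derivative w (at x) b)"
  "continuous_on UNIV w" "{x. frechet_derivative w (at x) b ~= 0} \<subseteq> closure {x. w x ~= 0}"
proof -
 have C: "Ck n w" for n using assms by (simp add: test_fun_on_def)
 show d: "(w has_derivative frechet_derivative w (at x)) (at x)" for x
  using C[of "Suc 0"] by (simp add: frechet_derivative_works)
 show "continuous_on UNIV (%x. frechet_derivative w (at x) b)" using C[of "Suc 0"] assms(2) by simp
 show "continuous_on UNIV w" using C[of 0] by simp
 show "{x. frechet_derivative w (at x) b ~= 0} \<subseteq> closure {x. w x ~= 0}"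
 proof
  fix x assume x: "x \<in> {x. frechet_derivative w (at x) b ~= 0}"
  show "x \<in> closure {x. w x ~= 0}"
  proof (rule ccontr)
   assume "x \<notin> closure {x. w x ~= 0}"
   hence "(w has_derivative (%_. 0)) (at x)"
    using closure_subset[of "{x. w x ~= 0}"]
    by (rule_tac has_derivative_transform_within_open[OF has_derivative_const[of 0] open_Compl[OF closed_closure]]) auto
   hence "frechet_derivative w (at x) = (%_. 0)" by (rule frechet_derivative_at[symmetric])
   thus False using x by simp
  qed
 qed
qed

lemma integrable_support:
 fixes f :: "'a::euclidean_space => 'b::euclidean_space"
 assumes f: "locally_integrable_on f U" and U: "open U" and p: "continuous_on UNIV p" and K: "compact K" "{x. p x ~= 0} \<subseteq> K" "K \<subseteq> U"
 shows "integrable (lebesgue_on U) (%x. p x *\<^sub>R f x)" "(!!x. \<bar>p x\<bar> <= B) ==> norm (LINT x|lebesgue_on U. p x *\<^sub>R f x) <= B * (LINT x|lebesgue_on K. norm (f x))"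
proof -
 have Us: "U \<in> sets lebesgue" "K \<in> sets lebesgue" using U compact_imp_closed[OF K(1)] by auto
 have fK: "integrable (lebesgue_on K) f" using f K unfolding locally_integrable_on_def by blast
 have cK: "continuous_on K p" by (rule continuous_on_subset[OF p]) simp
 obtain C where C: "!!x. x \<in> K ==> norm (p x) <= C"
  using compact_imp_bounded[OF compact_continuous_image[OF cK K(1)]] by (auto simp: bounded_iff)
 have pm: "p \<in> borel_measurable (lebesgue_on K)" using cK Us by (simp add: continuous_imp_measurable_on_sets_lebesgue)
 have iK: "integrable (lebesgue_on K) (%x. p x *\<^sub>R f x)"
 proof (rule Bochner_Integration.integrable_bound[of _ "%x. C *\<^sub>R f x"])
  show "(%x. p x *\<^sub>R f x) \<in> borel_measurable (lebesgue_on K)" using pm fK by simp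
  show "AE x in lebesgue_on K. norm (p x *\<^sub>R f x) <= norm (C *\<^sub>R f x)"
   by (rule AE_I2) (use C in "auto intro!: mult_right_mono order_trans[OF _ abs_ge_self]")
 qed (use fK in simp)
 have e: "indicator U x * p x = indicator K x * p x" for x using K by (auto simp: indicator_def)
 show "integrable (lebesgue_on U) (%x. p x *\<^sub>R f x)"
  using iK Us by (simp add: integrable_restrict_space e)
 assume B: "!!x. \<bar>p x\<bar> <= B"
 have "(LINT x|lebesgue_on U. p x *\<^sub>R f x) = (LINT x|lebesgue_on K. p x *\<^sub>R f x)"
  using Us by (simp add: integral_restrict_space e)
 also have "norm ... <= (LINT x|lebesgue_on K. B * norm (f x))"
  by (rule Bochner_Integration.integral_norm_bound_integral[OF iK]) (use fK B in "auto intro!: mult_right_mono")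
 finally show "norm (LINT x|lebesgue_on U. p x *\<^sub>R f x) <= B * (LINT x|lebesgue_on K. norm (f x))" by simp
qed

text \<open>The fundamental lemma of the calculus of variations. Dominated convergence with
  \<open>box_bump\<close> gives vanishing integrals over boxes, and countably many closed boxes
  cover \<open>U\<close>; their frontiers are null sets.\<close>

lemma AE_zero_from_test_functions:
 fixes g :: "complex => 'b::euclidean_space"
 assumes U: "open U" and g: "locally_integrable_on g U" and z: "!!w. test_fun_on U w ==> (LINT x|lebesgue_on U. w x *\<^sub>R g x) = 0"
 shows "AE x in lebesgue_on U. g x = 0"
proof -
 have Us: "U \<in> sets lebesgue" using U by auto
 have gK: "set_integrable lebesgue (cbox l u) g" if "cbox l u \<subseteq> U" for l u
 proof -
  have "integrable (lebesgue_on (cbox l u)) g" using g that compact_cbox unfolding locally_integrable_on_def by blast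
  thus ?thesis by (simp add: set_integrable_def integrable_restrict_space)
 qed
 have gB: "set_integrable lebesgue (box l u) g" if "cbox l u \<subseteq> U" for l u
  by (rule set_integrable_subset[OF gK[OF that]]) (auto simp: box_subset_cbox)
 have s: "norm (box_bump l u n x *\<^sub>R v) <= norm v" for l u n x and v :: 'b
  using mult_right_mono[OF box_bump_le[of l u n x] norm_ge_zero[of v]] by simp
 have box0: "set_lebesgue_integral lebesgue (box l u) g = 0" if "cbox l u \<subseteq> U" for l u
 proof (rule LIMSEQ_unique)
  show "(%n. LINT x|lebesgue. box_bump l u n x *\<^sub>R (indicator (box l u) x *\<^sub>R g x)) \<longlonglongrightarrow> set_lebesgue_integral lebesgue (box l u) g"
   unfolding set_lebesgue_integral_def
  proof (rule integral_dominated_convergence)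
   have i: "integrable lebesgue (%x. indicator (box l u) x *\<^sub>R g x)" using gB[OF that] by (simp add: set_integrable_def)
   thus m: "(%x. indicator (box l u) x *\<^sub>R g x) \<in> borel_measurable lebesgue" by simp
   show "integrable lebesgue (%x. norm (indicator (box l u) x *\<^sub>R g x))" using i by (rule integrable_norm)
   have "continuous_on UNIV (box_bump l u n)" for n using test_fun_derivative(3)[OF test_fun_box_bump[OF that]] by (metis nonempty_Basis all_not_in_conv)
   thus "(%x. box_bump l u n x *\<^sub>R (indicator (box l u) x *\<^sub>R g x)) \<in> borel_measurable lebesgue" for n
    by (intro borel_measurable_scaleR[OF _ m] measurable_completion) (simp add: borel_measurable_continuous_onI)
   show "AE x in lebesgue. (%n. box_bump l u n x *\<^sub>R (indicator (box l u) x *\<^sub>R g x)) \<longlonglongrightarrow> indicator (box l u) x *\<^sub>R g x"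
    by (rule AE_I2, rule tendsto_eq_rhs[OF tendsto_scaleR[OF box_bump_tendsto tendsto_const]]) (simp add: indicator_def)
   show "AE x in lebesgue. norm (box_bump l u n x *\<^sub>R (indicator (box l u) x *\<^sub>R g x)) <= norm (indicator (box l u) x *\<^sub>R g x)" for n
    by (rule AE_I2, rule s)
  qed
  have e: "indicator U x * box_bump l u n x = box_bump l u n x * indicator (box l u) x" for x n
   using box_bump_nz[of l u n x] that box_subset_cbox[of l u] by (auto simp: indicator_def)
  have "(LINT x|lebesgue. box_bump l u n x *\<^sub>R (indicator (box l u) x *\<^sub>R g x)) = (LINT x|lebesgue_on U. box_bump l u n x *\<^sub>R g x)" for n
   using Us by (simp add: integral_restrict_space e)
  hence "(LINT x|lebesgue. box_bump l u n x *\<^sub>R (indicator (box l u) x *\<^sub>R g x)) = 0" for n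
   using z[OF test_fun_box_bump[OF that]] by simp
  thus "(%n. LINT x|lebesgue. box_bump l u n x *\<^sub>R (indicator (box l u) x *\<^sub>R g x)) \<longlonglongrightarrow> 0" by simp
 qed
 obtain D where D: "countable D" "D \<subseteq> Pow U" "!!X. X \<in> D ==> EX a b. X = cbox a b" "\<Union>D = U"
  using open_countable_Union_open_cbox[OF U] by metis
 have "AE x in lebesgue. x \<in> X --> g x = 0" if X: "X \<in> D" for X
 proof -
  obtain a b where ab: "X = cbox a b" using D(3)[OF X] by blast
  have sub: "cbox a b \<subseteq> U" using X D(2) ab by auto
  have "AE x in lebesgue. x \<in> box a b --> g x = 0"
  proof (rule set_integral_boxes_zero_imp_AE[OF gB[OF sub]])
   fix l u assume "box l u \<subseteq> box a b"
   \<comment> \<open>An empty open box says nothing about the closed box with the same corners, so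
     it is treated apart.\<close>
   hence "box l u = {} \<or> cbox l u \<subseteq> cbox a b" using subset_box(4)[of l u a b] box_subset_cbox[of a b] by (metis box_eq_empty(1) closure_box closure_minimal closed_cbox order_trans)
   thus "set_lebesgue_integral lebesgue (box l u) g = 0" using box0[of l u] sub by (auto simp: set_lebesgue_integral_def)
  qed
  moreover have "AE x in lebesgue. x \<notin> cbox a b - box a b"
   by (rule AE_not_in) (use negligible_frontier_interval[of a b] in "simp add: negligible_iff_null_sets")
  ultimately show ?thesis unfolding ab by eventually_elim auto
 qed
 hence "AE x in lebesgue. ALL X:D. x \<in> X --> g x = 0" by (subst AE_ball_countable[OF D(1)]) blast
 hence "AE x in lebesgue. x \<in> U --> g x = 0" by eventually_elim (use D(4) in blast)
 thus ?thesis using Us by (simp add: AE_restrict_space_iff)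
qed

lemma continuous_imp_locally_integrable:
 assumes "continuous_on U f" shows "locally_integrable_on f U"
 unfolding locally_integrable_on_def
proof (intro allI impI)
 fix K assume K: "compact K & K \<subseteq> U"
 hence c: "continuous_on K f" using assms continuous_on_subset by blast
 have Kc: "closed K" using K compact_imp_closed by blast
 have "integrable lborel (%x. indicator K x *\<^sub>R f x)" using K c by (intro borel_integrable_compact) auto
 moreover have "(%x. indicator K x *\<^sub>R f x) \<in> borel_measurable lborel"
  using borel_measurable_continuous_on_indicator[OF _ c] Kc by simp
 ultimately have "integrable lebesgue (%x. indicator K x *\<^sub>R f x)" by (simp add: integrable_completion)
 thus "integrable (lebesgue_on K) f" using Kc by (simp add: integrable_restrict_space)
qed

lemma test_fun_support:
 assumes "test_fun_on U z" "b \<in> Basis"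
 obtains K where "compact K" "K \<subseteq> U" "{x. z x ~= 0} \<subseteq> K" "{x. frechet_derivative z (at x) b ~= 0} \<subseteq> K"
 using that[of "closure {x. z x ~= 0}"] assms test_fun_derivative(4)[OF assms] closure_subset
 unfolding test_fun_on_def by metis

lemma has_weak_deriv_bounded_linear:
 assumes w: "has_weak_deriv f g b U" and T: "bounded_linear T" and U: "open U" "b \<in> Basis"
 shows "has_weak_deriv (%x. T (f x)) (%x. T (g x)) b U"
proof -
 have loc: "locally_integrable_on f U" "locally_integrable_on g U"
  and eq: "!!z. test_fun_on U z ==> (LINT x|lebesgue_on U. frechet_derivative z (at x) b *\<^sub>R f x) = - (LINT x|lebesgue_on U. z x *\<^sub>R g x)"
  using w unfolding has_weak_deriv_def by auto
 interpret T: bounded_linear T by fact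
 have "locally_integrable_on (%x. T (f x)) U" "locally_integrable_on (%x. T (g x)) U"
  using loc integrable_bounded_linear[OF T] unfolding locally_integrable_on_def by auto
 moreover have "(LINT x|lebesgue_on U. frechet_derivative z (at x) b *\<^sub>R T (f x)) = - (LINT x|lebesgue_on U. z x *\<^sub>R T (g x))"
  if z: "test_fun_on U z" for z
 proof -
  obtain K where K: "compact K" "K \<subseteq> U" "{x. z x ~= 0} \<subseteq> K" "{x. frechet_derivative z (at x) b ~= 0} \<subseteq> K"
   by (rule test_fun_support[OF z U(2)])
  have "(LINT x|lebesgue_on U. T (frechet_derivative z (at x) b *\<^sub>R f x)) = T (LINT x|lebesgue_on U. frechet_derivative z (at x) b *\<^sub>R f x)"
   by (rule integral_bounded_linear[OF T integrable_support(1)[OF loc(1) U(1) test_fun_derivative(2)[OF z U(2)] K(1,4,2)]])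
  also have "... = - T (LINT x|lebesgue_on U. z x *\<^sub>R g x)" unfolding eq[OF z] by (rule linear_neg[OF bounded_linear.linear[OF T]])
  also have "T (LINT x|lebesgue_on U. z x *\<^sub>R g x) = (LINT x|lebesgue_on U. T (z x *\<^sub>R g x))"
   by (rule integral_bounded_linear[OF T integrable_support(1)[OF loc(2) U(1) test_fun_derivative(3)[OF z U(2)] K(1,3,2)], symmetric])
  finally show ?thesis by (simp add: T.scaleR)
 qed
 ultimately show ?thesis unfolding has_weak_deriv_def by blast
qed

text \<open>\<open>weak_deriv\<close> is a choice among weak derivatives, and any two differ by a
  function that annihilates all test functions.\<close>

lemma weak_deriv_AE:
 fixes f :: "complex => 'b::euclidean_space"
 assumes w: "has_weak_deriv f g b U" and U: "open U" "b \<in> Basis"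
 shows "AE x in lebesgue_on U. weak_deriv U b f x = g x"
proof -
 have w': "has_weak_deriv f (weak_deriv U b f) b U"
  unfolding weak_deriv_def by (rule someI[of "%g. has_weak_deriv f g b U", OF w])
 define d where "d x = weak_deriv U b f x - g x" for x
 have loc: "locally_integrable_on g U" "locally_integrable_on (weak_deriv U b f) U"
  using w w' by (auto simp: has_weak_deriv_def)
 hence ld: "locally_integrable_on d U"
  unfolding locally_integrable_on_def d_def by auto
 have "AE x in lebesgue_on U. d x = 0"
 proof (rule AE_zero_from_test_functions[OF U(1) ld])
  fix z assume z: "test_fun_on U z"
  obtain K where K: "compact K" "K \<subseteq> U" "{x. z x ~= 0} \<subseteq> K" "{x. frechet_derivative z (at x) b ~= 0} \<subseteq> K"
   by (rule test_fun_support[OF z U(2)])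
  note i = integrable_support(1)[OF _ U(1) test_fun_derivative(3)[OF z U(2)] K(1,3,2)]
  have "(LINT x|lebesgue_on U. z x *\<^sub>R weak_deriv U b f x) = (LINT x|lebesgue_on U. z x *\<^sub>R g x)"
   using w w' z unfolding has_weak_deriv_def by (metis neg_equal_iff_equal)
  thus "(LINT x|lebesgue_on U. z x *\<^sub>R d x) = 0"
   unfolding d_def scaleR_diff_right by (subst Bochner_Integration.integral_diff[OF i[OF loc(2)] i[OF loc(1)]]) simp
 qed
 thus ?thesis by eventually_elim (simp add: d_def)
qed

text \<open>The product with a test function, extended by 0, is differentiable on the whole plane
  with the derivative \<open>D\<close> supported in \<open>K\<close>. Its integral vanishes, which
  is integration by parts.\<close>

lemma has_weak_deriv_C1:
 fixes g :: "complex => 'b::euclidean_space"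
 assumes d: "!!x. x \<in> ball 0 1 ==> (g has_derivative g' x) (at x)" and c: "continuous_on (ball 0 1) (%x. g' x b)" and b: "b \<in> Basis"
 shows "has_weak_deriv g (%x. g' x b) b (ball 0 1)"
proof -
 have cg: "continuous_on (ball 0 1) g" using has_derivative_continuous[OF d] by (simp add: continuous_on_eq_continuous_at)
 have loc: "locally_integrable_on g (ball 0 1)" "locally_integrable_on (%x. g' x b) (ball 0 1)"
  by (intro continuous_imp_locally_integrable cg c)+
 have "(LINT x|lebesgue_on (ball 0 1). frechet_derivative z (at x) b *\<^sub>R g x) = - (LINT x|lebesgue_on (ball 0 1). z x *\<^sub>R g' x b)"
  if z: "test_fun_on (ball 0 1) z" for z
 proof -
  obtain K where K: "compact K" "K \<subseteq> ball 0 1" "{x. z x ~= 0} \<subseteq> K" "{x. frechet_derivative z (at x) b ~= 0} \<subseteq> K"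
   by (rule test_fun_support[OF z b])
  note t = test_fun_derivative[OF z b]
  note i1 = integrable_support(1)[OF loc(1) open_ball t(2) K(1,4,2)]
  note i2 = integrable_support(1)[OF loc(2) open_ball t(3) K(1,3,2)]
  define h where "h x = (if x \<in> ball 0 1 then z x *\<^sub>R g x else 0)" for x
  define D where "D x = (if x \<in> K then (%e. z x *\<^sub>R g' x e + frechet_derivative z (at x) e *\<^sub>R g x) else (%_. 0))" for x
  have oK: "open (- K)" using compact_imp_closed[OF K(1)] by auto
  have Db: "D x b = z x *\<^sub>R g' x b + frechet_derivative z (at x) b *\<^sub>R g x" if "x \<in> ball 0 1" for x
  proof -
   have "x \<notin> K ==> z x = 0 & frechet_derivative z (at x) b = 0" using K(3,4) by blast
   thus ?thesis by (auto simp: D_def)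
  qed
  have "integral QQ (%x. D x b) = 0"
  proof (rule integral_derivative_compact_support)
   show "b \<in> {1, \<i>}" using b by (auto simp: Basis_complex_def)
   show "h x = 0" if "x \<notin> ball 0 1" for x using that by (simp add: h_def)
   show "(h has_derivative D x) (at x)" for x
   proof (cases "x \<in> K")
    case True
    hence x: "x \<in> ball 0 1" using K(2) by blast
    have "((%x. z x *\<^sub>R g x) has_derivative D x) (at x)"
     unfolding D_def if_P[OF True] by (rule has_derivative_scaleR[OF t(1) d[OF x]])
    thus ?thesis
     by (rule has_derivative_transform_within_open[OF _ open_ball x]) (simp add: h_def)
   next
    case False
    have "((%_. 0) has_derivative D x) (at x)" unfolding D_def using False by simp
    thus ?thesis
     by (rule has_derivative_transform_within_open[OF _ oK]) (use False K(3) in "auto simp: h_def")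
   qed
   have "continuous_on (ball 0 1) (%x. D x b)"
    by (rule continuous_on_eq[of _ "%x. z x *\<^sub>R g' x b + frechet_derivative z (at x) b *\<^sub>R g x"])
     (intro continuous_intros c cg continuous_on_subset[OF t(2)] continuous_on_subset[OF t(3)], auto simp: Db simp del: mem_ball mem_ball_0)
   moreover have "continuous_on (- K) (%x. D x b)"
    by (rule continuous_on_eq[of _ "%_. 0"]) (auto simp: D_def)
   ultimately have "continuous_on (ball 0 1 \<union> - K) (%x. D x b)" using oK by (intro continuous_on_open_Un) auto
   moreover have "ball 0 1 \<union> - K = UNIV" using K(2) by auto
   ultimately show "continuous_on UNIV (%x. D x b)" by simp
  qed
  moreover have "integral QQ (%x. D x b) = (LINT x|lebesgue_on (ball 0 1). D x b)"
  proof -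
   have "(LINT x|lebesgue_on (ball 0 1). D x b) = (LINT x|lebesgue. indicator (ball 0 1) x *\<^sub>R D x b)"
    by (rule integral_restrict_space) simp
   also have "... = (LINT x|lebesgue_on K. D x b)"
   proof -
    have "indicator (ball 0 1) x *\<^sub>R D x b = indicator K x *\<^sub>R D x b" for x using K(2) by (auto simp: D_def indicator_def)
    hence "(LINT x|lebesgue. indicator (ball 0 1) x *\<^sub>R D x b) = (LINT x|lebesgue. indicator K x *\<^sub>R D x b)" by presburger
    thus ?thesis using compact_imp_closed[OF K(1)] by (simp only:) (subst integral_restrict_space, auto)
   qed
   also have "... = integral K (%x. D x b)"
   proof (rule lebesgue_integral_eq_integral)
    have "continuous_on K (%x. D x b)"
     by (rule continuous_on_eq[of _ "%x. z x *\<^sub>R g' x b + frechet_derivative z (at x) b *\<^sub>R g x"])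
      (intro continuous_intros continuous_on_subset[OF c K(2)] continuous_on_subset[OF cg K(2)] continuous_on_subset[OF t(2)] continuous_on_subset[OF t(3)], use Db K(2) in "auto simp del: mem_ball mem_ball_0")
    from continuous_imp_locally_integrable[OF this] show "integrable (lebesgue_on K) (%x. D x b)"
     unfolding locally_integrable_on_def using K(1) by blast
   qed (use compact_imp_closed[OF K(1)] in auto)
   also have "... = integral QQ (%x. D x b)"
   proof -
    have "K \<subseteq> QQ"
    proof
     fix x assume "x \<in> K"
     hence "cmod x < 1" using K(2) by auto
     thus "x \<in> QQ" using abs_Re_le_cmod[of x] abs_Im_le_cmod[of x] unfolding QQ_iff by linarith
    qed
    moreover have "(%x. if x \<in> K then D x b else 0) = (%x. D x b)" by (auto simp: D_def)
    ultimately show ?thesis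
     using Henstock_Kurzweil_Integration.integral_restrict_Int[of QQ K "%x. D x b"] by (simp add: Int_absorb2)
   qed
   finally show ?thesis by simp
  qed
  moreover have "(LINT x|lebesgue_on (ball 0 1). D x b) = (LINT x|lebesgue_on (ball 0 1). z x *\<^sub>R g' x b + frechet_derivative z (at x) b *\<^sub>R g x)"
   by (rule Bochner_Integration.integral_cong) (auto simp: Db)
  ultimately show ?thesis
   using Bochner_Integration.integral_add[OF i2 i1] by (simp add: add_eq_0_iff)
 qed
 thus ?thesis unfolding has_weak_deriv_def using loc by blast
qed

text \<open>A test function and its derivative are bounded with compact support, so L^1 convergence
  on compact sets passes through both sides of the defining identity.\<close>

lemma has_weak_deriv_limit:
 fixes f :: "complex => 'b::euclidean_space"
 assumes w: "!!i. has_weak_deriv (F i) (p i) b U" and U: "open U" "b \<in> Basis"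
  and loc: "locally_integrable_on f U" "locally_integrable_on q U"
  and F: "!!K. compact K ==> K \<subseteq> U ==> (%i. LINT x|lebesgue_on K. norm (F i x - f x)) \<longlonglongrightarrow> 0"
  and p: "!!K. compact K ==> K \<subseteq> U ==> (%i. LINT x|lebesgue_on K. norm (p i x - q x)) \<longlonglongrightarrow> 0"
 shows "has_weak_deriv f q b U"
proof -
 have conv: "(%i. LINT x|lebesgue_on U. v x *\<^sub>R G i x) \<longlonglongrightarrow> (LINT x|lebesgue_on U. v x *\<^sub>R g x)"
  if G: "!!i. locally_integrable_on (G i) U" "locally_integrable_on g U"
   and l: "!!K. compact K ==> K \<subseteq> U ==> (%i. LINT x|lebesgue_on K. norm (G i x - g x)) \<longlonglongrightarrow> 0"
   and v: "continuous_on UNIV v" and K: "compact K" "K \<subseteq> U" "{x. v x ~= 0} \<subseteq> K" for G g K and v :: "complex => real"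
 proof -
  obtain B where B: "!!x. x \<in> K ==> norm (v x) <= B"
   using compact_imp_bounded[OF compact_continuous_image[OF continuous_on_subset[OF v] K(1)]] by (auto simp: bounded_iff)
  have B': "\<bar>v x\<bar> <= max B 0" for x using B[of x] K(3) by (cases "v x = 0") auto
  have "(%i. (LINT x|lebesgue_on U. v x *\<^sub>R G i x) - (LINT x|lebesgue_on U. v x *\<^sub>R g x)) \<longlonglongrightarrow> 0"
  proof (rule Lim_null_comparison[OF _ tendsto_mult_right_zero[OF l[OF K(1,2)]]])
   have "norm ((LINT x|lebesgue_on U. v x *\<^sub>R G i x) - (LINT x|lebesgue_on U. v x *\<^sub>R g x)) <= max B 0 * (LINT x|lebesgue_on K. norm (G i x - g x))" for i
   proof -
    have ld: "locally_integrable_on (%x. G i x - g x) U" using G unfolding locally_integrable_on_def by auto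
    have "(LINT x|lebesgue_on U. v x *\<^sub>R (G i x - g x)) = (LINT x|lebesgue_on U. v x *\<^sub>R G i x) - (LINT x|lebesgue_on U. v x *\<^sub>R g x)"
     unfolding scaleR_diff_right
     by (rule Bochner_Integration.integral_diff[OF integrable_support(1)[OF G(1) U(1) v K(1,3,2)] integrable_support(1)[OF G(2) U(1) v K(1,3,2)]])
    thus ?thesis using integrable_support(2)[OF ld U(1) v K(1,3,2) B'] by simp
   qed
   thus "\<forall>\<^sub>F i in sequentially. norm ((LINT x|lebesgue_on U. v x *\<^sub>R G i x) - (LINT x|lebesgue_on U. v x *\<^sub>R g x)) <= max B 0 * (LINT x|lebesgue_on K. norm (G i x - g x))"
    by simp
  qed
  thus ?thesis by (simp add: LIM_zero_iff)
 qed
 have "(LINT x|lebesgue_on U. frechet_derivative z (at x) b *\<^sub>R f x) = - (LINT x|lebesgue_on U. z x *\<^sub>R q x)"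
  if z: "test_fun_on U z" for z
 proof (rule LIMSEQ_unique)
  obtain K where K: "compact K" "K \<subseteq> U" "{x. z x ~= 0} \<subseteq> K" "{x. frechet_derivative z (at x) b ~= 0} \<subseteq> K"
   by (rule test_fun_support[OF z U(2)])
  have wl: "locally_integrable_on (F i) U" "locally_integrable_on (p i) U" for i using w by (auto simp: has_weak_deriv_def)
  show "(%i. LINT x|lebesgue_on U. frechet_derivative z (at x) b *\<^sub>R F i x) \<longlonglongrightarrow> (LINT x|lebesgue_on U. frechet_derivative z (at x) b *\<^sub>R f x)"
   by (rule conv[OF wl(1) loc(1) F test_fun_derivative(2)[OF z U(2)] K(1,2,4)])
  have "(%i. - (LINT x|lebesgue_on U. z x *\<^sub>R p i x)) \<longlonglongrightarrow> - (LINT x|lebesgue_on U. z x *\<^sub>R q x)"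
   by (intro tendsto_minus conv[OF wl(2) loc(2) p test_fun_derivative(3)[OF z U(2)] K(1,2,3)])
  thus "(%i. LINT x|lebesgue_on U. frechet_derivative z (at x) b *\<^sub>R F i x) \<longlonglongrightarrow> - (LINT x|lebesgue_on U. z x *\<^sub>R q x)"
   using w z by (simp add: has_weak_deriv_def)
 qed
 thus ?thesis unfolding has_weak_deriv_def using loc by blast
qed

lemma norm_le_sq: "0 < e ==> t <= e / 2 + t^2 / (2 * e)" for t e :: real
proof -
 assume e: "0 < e"
 hence "0 <= (t - e)^2 / (2 * e)" by simp
 thus ?thesis using e by (simp add: power2_diff field_simps power2_eq_square)
qed

lemma L1_le_of_L2:
 fixes d :: "'a => 'b::euclidean_space"
 assumes M: "finite_measure M" and m: "d \<in> borel_measurable M" and i2: "integrable M (%x. (norm (d x))^2)"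
  and e: "(LINT x|M. (norm (d x))^2) <= e^2" "0 < e"
 shows "integrable M d" "(LINT x|M. norm (d x)) <= e / 2 * (measure M (space M) + 1)"
proof -
 interpret finite_measure M by (rule M)
 show i1: "integrable M d"
  by (rule Bochner_Integration.integrable_bound[of _ "%x. 1 / 2 + (norm (d x))^2 / (2 * 1)"])
   (use m i2 norm_le_sq[of 1] in "auto intro!: AE_I2 order_trans[OF _ abs_ge_self]")
 have "(LINT x|M. norm (d x)) <= (LINT x|M. e / 2 + (norm (d x))^2 / (2 * e))"
  by (rule integral_mono) (use i1 i2 norm_le_sq[OF e(2)] in auto)
 also have "... = e / 2 * measure M (space M) + (LINT x|M. (norm (d x))^2) / (2 * e)" using i2 by simp
 also have "... <= e / 2 * measure M (space M) + e^2 / (2 * e)"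
  using e by (intro add_left_mono divide_right_mono) auto
 also have "... = e / 2 * (measure M (space M) + 1)" using e by (simp add: field_simps power2_eq_square)
 finally show "(LINT x|M. norm (d x)) <= e / 2 * (measure M (space M) + 1)" .
qed

lemma norm_diff_sq_le: "(norm (x - y))^2 <= 2 * (norm x)^2 + 2 * (norm y)^2" for x y :: "'b::real_inner"
proof -
 have "0 <= (norm (x + y))^2" by simp
 thus ?thesis unfolding power2_norm_eq_inner by (simp add: inner_diff inner_add inner_commute)
qed

text \<open>On a finite measure space an L^2 Cauchy sequence is Cauchy in L^1 and has an almost
  everywhere convergent subsequence. Fatou's lemma turns its limit into the L^2 limit of the whole
  sequence. The subsequence is kept for pointwise arguments.\<close>

lemma L2_complete:
 fixes s :: "nat => 'a => 'b::euclidean_space"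
 assumes M: "finite_measure M" and m: "!!i. s i \<in> borel_measurable M" and i2: "!!i. integrable M (%x. (norm (s i x))^2)"
  and C: "!!e. 0 < e ==> EX N. ALL i>=N. ALL j>=N. (LINT x|M. (norm (s i x - s j x))^2) <= e"
 obtains p r where "p \<in> borel_measurable M" "strict_mono (r :: nat => nat)" "AE x in M. (%i. s (r i) x) \<longlonglongrightarrow> p x"
  "integrable M (%x. (norm (p x))^2)" "!!i. integrable M (%x. (norm (s i x - p x))^2)"
  "(%i. LINT x|M. (norm (s i x - p x))^2) \<longlonglongrightarrow> 0"
proof -
 interpret finite_measure M by (rule M)
 have d2: "integrable M (%x. (norm (s i x - s j x))^2)" for i j
  by (rule Bochner_Integration.integrable_bound[of _ "%x. 2 * (norm (s i x))^2 + 2 * (norm (s j x))^2"])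
   (use m i2 norm_diff_sq_le in "auto intro!: AE_I2")
 have i1: "integrable M (s i)" for i
 proof (rule L1_le_of_L2(1)[OF M m i2])
  define I where "I = (LINT x|M. (norm (s i x))^2)"
  have I: "0 <= I" unfolding I_def by simp
  thus "(LINT x|M. (norm (s i x))^2) <= (I + 1)^2" unfolding I_def[symmetric] by (simp add: power2_eq_square algebra_simps)
  show "0 < I + 1" using I by simp
 qed
 have L1: "EX N. ALL i>=N. ALL j>=N. (LINT x|M. norm (s i x - s j x)) < e" if e: "0 < e" for e
 proof -
  define d where "d = e / (measure M (space M) + 1)"
  have d: "0 < d" "d * (measure M (space M) + 1) = e"
   using e measure_nonneg[of M "space M"] by (simp_all add: d_def add_nonneg_pos add_nonneg_eq_0_iff del: measure_nonneg)
  obtain N where N: "!!i j. i \<ge> N ==> j \<ge> N ==> (LINT x|M. (norm (s i x - s j x))^2) <= d^2" using C[of "d^2"] d by auto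
  have "(LINT x|M. norm (s i x - s j x)) < e" if "i \<ge> N" "j \<ge> N" for i j
   using L1_le_of_L2(2)[OF M borel_measurable_diff[OF m m] d2 N[OF that] d(1)] d(2) e by simp
  thus ?thesis by blast
 qed
 obtain r where r: "strict_mono r" "AE x in M. Cauchy (%i. s (r i) x)"
  using cauchy_L1_AE_cauchy_subseq[OF i1 L1] by blast
 define p where "p x = lim (%i. s (r i) x)" for x
 have pm: "p \<in> borel_measurable M" unfolding p_def using m by measurable
 have lim: "AE x in M. (%i. s (r i) x) \<longlonglongrightarrow> p x"
  using r(2) by eventually_elim (simp add: p_def Cauchy_convergent_iff convergent_LIMSEQ_iff)
 have key: "(\<integral>\<^sup>+x. ennreal ((norm (s i x - p x))^2) \<partial>M) <= ennreal e" if N: "!!j. j \<ge> N ==> (LINT x|M. (norm (s i x - s j x))^2) <= e" for i e N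
 proof -
  have "(\<integral>\<^sup>+x. ennreal ((norm (s i x - p x))^2) \<partial>M) = (\<integral>\<^sup>+x. liminf (%j. ennreal ((norm (s i x - s (r j) x))^2)) \<partial>M)"
   using lim
  proof (intro nn_integral_cong_AE, eventually_elim)
   case (elim x)
   have "(%j. ennreal ((norm (s i x - s (r j) x))^2)) \<longlonglongrightarrow> ennreal ((norm (s i x - p x))^2)"
    by (intro tendsto_ennrealI tendsto_intros elim)
   from lim_imp_Liminf[OF sequentially_bot this] show ?case by simp
  qed
  also have "... <= liminf (%j. \<integral>\<^sup>+x. ennreal ((norm (s i x - s (r j) x))^2) \<partial>M)"
   by (rule nn_integral_liminf) (use m in measurable)
  also have "... <= liminf (%j. ennreal e)"
  proof (rule Liminf_mono)
   have "(\<integral>\<^sup>+x. ennreal ((norm (s i x - s (r j) x))^2) \<partial>M) <= ennreal e" if "j \<ge> N" for j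
    using N[of "r j"] that seq_suble[OF r(1), of j] d2 by (subst nn_integral_eq_integral) (auto intro: ennreal_leI)
   thus "\<forall>\<^sub>F j in sequentially. (\<integral>\<^sup>+x. ennreal ((norm (s i x - s (r j) x))^2) \<partial>M) <= ennreal e"
    by (auto simp: eventually_sequentially)
  qed
  finally show ?thesis by (simp add: Liminf_const)
 qed
 have d2p': "integrable M (%x. (norm (s i x - p x))^2)" if "!!j. j \<ge> N ==> (LINT x|M. (norm (s i x - s j x))^2) <= e" for i N e
 proof (rule integrableI_bounded)
  have "(\<integral>\<^sup>+x. ennreal ((norm (s i x - p x))^2) \<partial>M) <= ennreal e" by (rule key) (rule that)
  thus "(\<integral>\<^sup>+x. ennreal (norm ((norm (s i x - p x))^2)) \<partial>M) < \<infinity>" by (simp add: le_less_trans)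
 qed (use m pm in auto)
 obtain N1 where N1: "!!i j. i \<ge> N1 ==> j \<ge> N1 ==> (LINT x|M. (norm (s i x - s j x))^2) <= 1" using C[of 1] by auto
 have p2: "integrable M (%x. (norm (p x))^2)"
 proof (rule Bochner_Integration.integrable_bound[of _ "%x. 2 * (norm (s N1 x))^2 + 2 * (norm (s N1 x - p x))^2"])
  show "AE x in M. norm ((norm (p x))^2) <= norm (2 * (norm (s N1 x))^2 + 2 * (norm (s N1 x - p x))^2)"
  proof (rule AE_I2)
   fix x
   show "norm ((norm (p x))^2) <= norm (2 * (norm (s N1 x))^2 + 2 * (norm (s N1 x - p x))^2)"
    using norm_diff_sq_le[of "s N1 x" "s N1 x - p x"] by simp
  qed
 qed (use i2 d2p'[of N1 N1 1] N1 pm in auto)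
 have d2p: "integrable M (%x. (norm (s i x - p x))^2)" for i
  by (rule Bochner_Integration.integrable_bound[of _ "%x. 2 * (norm (s i x))^2 + 2 * (norm (p x))^2"])
   (use m i2 pm p2 norm_diff_sq_le in "auto intro!: AE_I2")
 have "(%i. LINT x|M. (norm (s i x - p x))^2) \<longlonglongrightarrow> 0"
 proof (rule LIMSEQ_I)
  fix e :: real assume e: "0 < e"
  obtain N where N: "!!i j. i \<ge> N ==> j \<ge> N ==> (LINT x|M. (norm (s i x - s j x))^2) <= e / 2" using C[of "e/2"] e by auto
  have "(LINT x|M. (norm (s i x - p x))^2) <= e / 2" if "i \<ge> N" for i
  proof -
   have "ennreal (LINT x|M. (norm (s i x - p x))^2) <= ennreal (e / 2)"
    using key[of N i "e/2"] N[OF that] d2p by (subst nn_integral_eq_integral[symmetric]) auto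
   thus ?thesis using e by (simp add: ennreal_le_iff)
  qed
  hence le: "norm ((LINT x|M. (norm (s i x - p x))^2) - 0) <= e / 2" if "i \<ge> N" for i
   using that by (simp only: diff_zero real_norm_def) (subst abs_of_nonneg, simp_all)
  have "norm ((LINT x|M. (norm (s i x - p x))^2) - 0) < e" if "i \<ge> N" for i
   by (rule le_less_trans[OF le[OF that]]) (use e in simp)
  thus "EX N. ALL i>=N. norm ((LINT x|M. (norm (s i x - p x))^2) - 0) < e" by blast
 qed
 thus ?thesis by (rule that[OF pm r(1) lim p2 d2p])
qed

section \<open>Transport to the disc\<close>

lemma bounded_linear_svec: "bounded_linear (%v :: complex^'n. z *s v)" "bounded_linear (%h. h *s (v :: complex^'n))"
proof -
 show "bounded_linear (%v :: complex^'n. z *s v)"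
  by (rule bounded_linear_intro[where K = "cmod z"]) (auto simp: vec_eq_iff algebra_simps norm_svec)
 show "bounded_linear (%h. h *s (v :: complex^'n))"
  by (rule bounded_linear_intro[where K = "norm v"]) (auto simp: vec_eq_iff algebra_simps norm_svec)
qed

lemma bounded_linear_cnj_vec: "bounded_linear (cnj_vec :: complex^'n => complex^'n)"
 by (rule bounded_linear_intro[where K = 1]) (auto simp: vec_eq_iff cnj_vec_def complex_eq_iff, simp add: norm_cnj_vec[unfolded cnj_vec_def])

lemma L2_imp_L1_tendsto:
 fixes d :: "nat => 'a::euclidean_space => 'b::euclidean_space"
 assumes U: "U \<in> lmeasurable" "K \<in> sets lebesgue" "K \<subseteq> U" and m: "!!i. d i \<in> borel_measurable (lebesgue_on U)"
  and i2: "!!i. integrable (lebesgue_on U) (%x. (norm (d i x))^2)" and l: "(%i. LINT x|lebesgue_on U. (norm (d i x))^2) \<longlonglongrightarrow> 0"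
 shows "(%i. LINT x|lebesgue_on K. norm (d i x)) \<longlonglongrightarrow> 0"
proof -
 have fm: "finite_measure (lebesgue_on U)" using U(1) by (rule finite_measure_lebesgue_on)
 define Z where "Z = measure (lebesgue_on U) (space (lebesgue_on U))"
 have le: "(LINT x|lebesgue_on K. norm (d i x)) <= (LINT x|lebesgue_on U. norm (d i x))" if "integrable (lebesgue_on U) (d i)" for i
 proof -
  have "(LINT x|lebesgue_on K. norm (d i x)) = (LINT x|lebesgue. indicator K x *\<^sub>R norm (d i x))"
   using U by (simp add: integral_restrict_space)
  also have "... <= (LINT x|lebesgue. indicator U x *\<^sub>R norm (d i x))"
  proof (rule integral_mono')
   have "integrable (lebesgue_on U) (%x. norm (d i x))" using that by (rule integrable_norm)
   thus "integrable lebesgue (%x. indicator U x *\<^sub>R norm (d i x))"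
    using U(1) by (simp add: integrable_restrict_space fmeasurableD)
  qed (use U(3) in "auto simp: indicator_def")
  also have "... = (LINT x|lebesgue_on U. norm (d i x))" using U(1) by (simp add: integral_restrict_space fmeasurableD)
  finally show ?thesis .
 qed
 show ?thesis
 proof (rule LIMSEQ_I)
  fix e :: real assume e: "0 < e"
  define t where "t = e / (Z + 1)"
  have Z: "0 <= Z" by (simp add: Z_def)
  have t: "0 < t" using e Z by (simp add: t_def add_nonneg_pos)
  have "\<forall>\<^sub>F i in sequentially. (LINT x|lebesgue_on U. (norm (d i x))^2) < t^2" using l t by (intro order_tendstoD(2)) auto
  then obtain N where N: "!!i. i \<ge> N ==> (LINT x|lebesgue_on U. (norm (d i x))^2) < t^2" by (auto simp: eventually_sequentially)
  have "norm ((LINT x|lebesgue_on K. norm (d i x)) - 0) < e" if "i \<ge> N" for i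
  proof -
   note L = L1_le_of_L2[OF fm m i2 less_imp_le[OF N[OF that]] t]
   have "(LINT x|lebesgue_on K. norm (d i x)) <= t / 2 * (Z + 1)" using le[OF L(1)] L(2) by (simp add: Z_def)
   also have "... = t * (Z + 1) / 2" by simp
   also have "t * (Z + 1) = e" using Z by (simp add: t_def add_nonneg_eq_0_iff)
   also have "e / 2 < e" using e by simp
   finally have "(LINT x|lebesgue_on K. norm (d i x)) < e" .
   moreover have "0 <= (LINT x|lebesgue_on K. norm (d i x))" by (rule Bochner_Integration.integral_nonneg) simp
   ultimately show ?thesis by simp
  qed
  thus "EX N. ALL i>=N. norm ((LINT x|lebesgue_on K. norm (d i x)) - 0) < e" by blast
 qed
qed

lemma L2_norm_tendsto:
 fixes s :: "nat => 'a => 'b::euclidean_space"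
 assumes i: "!!i. integrable M (%x. (norm (s i x))^2)" "integrable M (%x. (norm (p x))^2)" "!!i. integrable M (%x. (norm (s i x - p x))^2)"
  and l: "(%i. LINT x|M. (norm (s i x - p x))^2) \<longlonglongrightarrow> 0"
 shows "(%i. LINT x|M. (norm (s i x))^2) \<longlonglongrightarrow> (LINT x|M. (norm (p x))^2)"
proof -
 define I where "I = (LINT x|M. (norm (p x))^2)"
 have I: "0 <= I" by (simp add: I_def)
 have key: "\<bar>(LINT x|M. (norm (s i x))^2) - I\<bar> <= (1 + 1 / t) * (LINT x|M. (norm (s i x - p x))^2) + t * I" if t: "0 < t" for t i
 proof -
  have pt: "norm ((norm x)^2 - (norm y)^2) <= (1 + 1 / t) * (norm (x - y))^2 + t * (norm y)^2" for x y :: 'b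
  proof -
   have "\<bar>2 * (y \<bullet> (x - y))\<bar> <= 2 * (norm y * norm (x - y))" using Cauchy_Schwarz_ineq2[of y "x - y"] by simp
   also have "... <= t * (norm y)^2 + (norm (x - y))^2 / t"
   proof -
    have "0 <= (t * norm y - norm (x - y))^2 / t" using t by simp
    thus ?thesis using t by (simp add: power2_diff field_simps power2_eq_square)
   qed
   moreover have "(norm x)^2 - (norm y)^2 = (norm (x - y))^2 + 2 * (y \<bullet> (x - y))"
    unfolding power2_norm_eq_inner by (simp add: inner_diff inner_commute)
   ultimately have "\<bar>(norm x)^2 - (norm y)^2\<bar> <= (norm (x - y))^2 + (t * (norm y)^2 + (norm (x - y))^2 / t)"
    by (smt (verit) zero_le_power2)
   thus ?thesis by (simp add: algebra_simps)
  qed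
  have "\<bar>(LINT x|M. (norm (s i x))^2) - I\<bar> = norm (LINT x|M. (norm (s i x))^2 - (norm (p x))^2)"
   unfolding I_def using i by simp
  also have "... <= (LINT x|M. (1 + 1 / t) * (norm (s i x - p x))^2 + t * (norm (p x))^2)"
   by (rule order_trans[OF integral_norm_bound integral_mono]) (use i pt in auto)
  also have "... = (1 + 1 / t) * (LINT x|M. (norm (s i x - p x))^2) + t * I" unfolding I_def using i by simp
  finally show ?thesis .
 qed
 show ?thesis
 proof (rule LIMSEQ_I)
  fix e :: real assume e: "0 < e"
  define t where "t = e / (2 * (I + 1))"
  have t: "0 < t" using e I by (simp add: t_def add_nonneg_pos)
  have "I + 1 ~= 0" using I by simp
  hence "t * (I + 1) = e / 2" unfolding t_def by (simp add: field_simps)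
  hence tI: "t * I < e / 2" using t by (simp add: distrib_left)
  have "(%i. (1 + 1 / t) * (LINT x|M. (norm (s i x - p x))^2)) \<longlonglongrightarrow> 0" by (rule tendsto_mult_right_zero[OF l])
  hence "\<forall>\<^sub>F i in sequentially. (1 + 1 / t) * (LINT x|M. (norm (s i x - p x))^2) < e / 2" using e by (intro order_tendstoD(2)) auto
  then obtain N where N: "!!i. i \<ge> N ==> (1 + 1 / t) * (LINT x|M. (norm (s i x - p x))^2) < e / 2" by (auto simp: eventually_sequentially)
  have "norm ((LINT x|M. (norm (s i x))^2) - I) < e" if "i \<ge> N" for i
   using key[OF t, of i] tI N[OF that] unfolding real_norm_def by linarith
  thus "EX N. ALL i>=N. norm ((LINT x|M. (norm (s i x))^2) - (LINT x|M. (norm (p x))^2)) < e" unfolding I_def by blast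
 qed
qed

lemma closure_TT: "TC \<subseteq> closure TT"
proof
 fix g assume g: "g \<in> TC"
 define t where "t n = 1 / real (Suc n)" for n
 have t: "0 < t n" "t n <= 1" for n by (auto simp: t_def)
 have "t \<longlonglongrightarrow> 0" unfolding t_def by (rule LIMSEQ_Suc[OF lim_const_over_n])
 hence "(%n. g + of_real (t n) * (Complex (2/3) (4/3) - g)) \<longlonglongrightarrow> g + of_real 0 * (Complex (2/3) (4/3) - g)" by (intro tendsto_intros)
 moreover have "g + of_real (t n) * (Complex (2/3) (4/3) - g) \<in> TT" for n
 proof -
  have c: "0 < (1 - s) * u + s * (2/3)" if "0 <= u" "0 < s" "s <= 1" for s u :: real using that by (intro add_nonneg_pos) auto
  have "0 < (1 - t n) * Re g + t n * (2/3)" "0 < (1 - t n) * (2 - Im g) + t n * (2/3)" "0 < (1 - t n) * (Im g - Re g) + t n * (2/3)"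
   by (rule c; use g t[of n] in "simp add: TC_def")+
  thus ?thesis by (simp add: TT_def algebra_simps)
 qed
 ultimately show "g \<in> closure TT" unfolding closure_sequential by (intro exI[of _ "%n. g + of_real (t n) * (Complex (2/3) (4/3) - g)"]) auto
qed

lemma closure_Triangle: "g \<in> TC ==> g / (1 + \<i>) - 1 \<in> closure Triangle"
proof -
 assume "g \<in> TC"
 hence "(%g. g / (1 + \<i>) - 1) g \<in> (%g. g / (1 + \<i>) - 1) ` closure TT" using closure_TT by blast
 also have "... \<subseteq> closure Triangle"
 proof (rule image_closure_subset)
  have ne: "1 + \<i> ~= 0" by (simp add: complex_eq_iff)
  show "continuous_on (closure TT) (%g. g / (1 + \<i>) - 1)" using ne by (intro continuous_intros) auto
  have "(%g. g / (1 + \<i>) - 1) ` TT \<subseteq> Triangle" using ne by (auto simp: Triangle_iff_TT)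
  thus "(%g. g / (1 + \<i>) - 1) ` TT \<subseteq> closure Triangle" using closure_subset by blast
 qed simp
 finally show ?thesis .
qed

lemma open_Triangle: "open Triangle"
 unfolding Triangle_def by (intro open_Collect_conj open_Collect_less continuous_intros)

lemma closure_Cylinder: "closure (Cylinder k) = {W. W $ k \<in> closure Triangle}"
 and frontier_Cylinder: "frontier (Cylinder k) = {W. W $ k \<in> frontier Triangle}"
proof -
 have eq: "{W :: complex^'a. W $ k \<in> B} = (%W. W $ k) -` B" for B by auto
 show c: "closure (Cylinder k) = {W. W $ k \<in> closure Triangle}"
 proof
  show "closure (Cylinder k) \<subseteq> {W. W $ k \<in> closure Triangle}"
  proof (rule closure_minimal)
   show "Cylinder k \<subseteq> {W. W $ k \<in> closure Triangle}" using closure_subset by (auto simp: Cylinder_def)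
   show "closed {W. W $ k \<in> closure Triangle}" unfolding eq by (intro closed_vimage continuous_intros) auto
  qed
  show "{W. W $ k \<in> closure Triangle} \<subseteq> closure (Cylinder k)"
  proof
   fix W :: "complex^'a" assume "W \<in> {W. W $ k \<in> closure Triangle}"
   then obtain t where t: "!!n. t n \<in> Triangle" "t \<longlonglongrightarrow> W $ k" by (auto simp: closure_sequential)
   have "(%n. \<chi> j. if j = k then t n else W $ j) \<longlonglongrightarrow> (\<chi> j. if j = k then W $ k else W $ j)"
    by (rule tendsto_vec_lambda) (use t(2) in auto)
   moreover have "(\<chi> j. if j = k then W $ k else W $ j) = W" by (simp add: vec_eq_iff)
   moreover have "(\<chi> j. if j = k then t n else W $ j) \<in> Cylinder k" for n using t(1) by (simp add: Cylinder_def)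
   ultimately show "W \<in> closure (Cylinder k)" unfolding closure_sequential by (intro exI[of _ "%n. \<chi> j. if j = k then t n else W $ j"]) auto
  qed
 qed
 have "open (Cylinder k)" unfolding Cylinder_def eq by (intro open_vimage open_Triangle continuous_intros)
 thus "frontier (Cylinder k) = {W. W $ k \<in> frontier Triangle}"
  using c open_Triangle by (auto simp: frontier_def interior_open Cylinder_def)
qed

text \<open>Young's inequality with constant 1, by comparing \<open>m\<close> with
  \<open>t powr (q - p)\<close>.\<close>

lemma powr_Young: "0 <= t ==> 0 <= m ==> 0 < p ==> p < q ==> t powr p * m <= t powr q + m powr (q / (q - p))" for t m p q :: real
proof -
 assume a: "0 <= t" "0 <= m" "0 < p" "p < q"
 show ?thesis
 proof (cases "m <= t powr (q - p)")
  case True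
  hence "t powr p * m <= t powr p * t powr (q - p)" by (intro mult_left_mono) auto
  also have "... = t powr q" by (simp add: powr_add[symmetric])
  finally show ?thesis by (simp add: add_increasing2)
 next
  case False
  hence m: "0 < m" using a by (smt (verit) powr_ge_zero)
  have "t = (t powr (q - p)) powr (1 / (q - p))" using a by (simp add: powr_powr)
  also have "... <= m powr (1 / (q - p))" using False a by (intro powr_mono2) auto
  finally have "t powr p <= (m powr (1 / (q - p))) powr p" using a by (intro powr_mono2) auto
  hence "t powr p * m <= m powr (p / (q - p)) * m" using a by (intro mult_right_mono) (auto simp: powr_powr)
  also have "... = m powr (p / (q - p) + 1)" using m by (simp add: powr_add)
  also have "p / (q - p) + 1 = q / (q - p)" using a by (simp add: field_simps)
  finally show ?thesis by (simp add: add_increasing)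
 qed
qed

locale disc_solution = cylinder_eq A k a + Riemann_map Phi Psi
 for A :: "complex^'n => complex^'n^'n" and k a Phi Psi
begin

abbreviation M where "M \<equiv> lebesgue_on (ball 0 (1::real) :: complex set)"

lemma continuous_Phi: "continuous_on (ball 0 1) Phi" "continuous_on (ball 0 1) (deriv Phi)"
 using hPhi by (auto intro!: holomorphic_on_imp_continuous_on holomorphic_deriv)

lemma disc_integral:
 fixes f :: "complex => real"
 assumes f: "continuous_on TT f" "set_integrable lborel TT f"
 shows "integrable M (%r. (cmod (deriv Phi r))^2 * f (Phi r))"
  "(LINT r|M. (cmod (deriv Phi r))^2 * f (Phi r)) = set_lebesgue_integral lborel TT f"
proof -
 define H where "H r = (cmod (deriv Phi r))^2 * f (Phi r)" for r
 have img: "Phi ` ball 0 1 = TT"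
 proof
  show "TT \<subseteq> Phi ` ball 0 1" using Psi by (metis image_eqI subsetI)
 qed (use Phi in blast)
 have inj: "inj_on Phi (ball 0 1)" using Phi by (metis inj_onI)
 have cH: "continuous_on (ball 0 1) H" unfolding H_def
  by (intro continuous_intros continuous_Phi continuous_on_compose2[OF f(1)]) (use img in auto)
 note cv = holomorphic_change_of_variables[OF open_ball hPhi inj img open_TT f, folded H_def]
 show "integrable M (%r. (cmod (deriv Phi r))^2 * f (Phi r))"
  using cv set_integrable_lebesgue(2)[OF open_ball cH]
  unfolding H_def[symmetric] by (simp add: integrable_restrict_space set_integrable_def)
 show "(LINT r|M. (cmod (deriv Phi r))^2 * f (Phi r)) = set_lebesgue_integral lborel TT f"
  using cv set_integrable_lebesgue(3)[OF open_ball cH]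
  unfolding H_def[symmetric] by (simp add: integral_restrict_space set_lebesgue_integral_def)
qed

lemma disc_L2:
 assumes w: "continuous_on UNIV w"
 shows "integrable M (%r. (cmod (deriv Phi r))^2 * (norm (w (Phi r) :: complex^'n))^2)"
  "(LINT r|M. (cmod (deriv Phi r))^2 * (norm (w (Phi r)))^2) <= (N2 w)^2"
proof -
 have c: "continuous_on S (%g. (norm (w g))^2)" for S by (intro continuous_intros continuous_on_subset[OF w]) auto
 note t = set_integral_TT_le_QQ[OF c] and d = disc_integral[OF c]
 show "integrable M (%r. (cmod (deriv Phi r))^2 * (norm (w (Phi r) :: complex^'n))^2)" by (rule d(1)[OF t(1)]) simp
 have "(N2 w)^2 = integral QQ (%g. (norm (w g))^2)" by (rule N2_sq) (rule continuous_on_subset[OF w], simp)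
 thus "(LINT r|M. (cmod (deriv Phi r))^2 * (norm (w (Phi r)))^2) <= (N2 w)^2"
  using d(2)[OF t(1)] t(2) by simp
qed

text \<open>The exponent makes the singular factor that Young's inequality produces integrable:
 it satisfies \<open>15 (pp - 2) ex / (ex - pp) = 1/2\<close>.\<close>

definition pp :: real where "pp = 61 * ex / (30 * ex + 1)"

lemma pp: "2 < pp" "pp < ex" "(pp - 2) * (ex / (ex - pp)) = 1 / 30"
proof -
 have p: "0 < 30 * ex + 1" using ex(1) by simp
 show "2 < pp" "pp < ex" using p ex(1) by (auto simp: pp_def field_simps)
 have "pp - 2 = (ex - 2) / (30 * ex + 1)" "ex - pp = 30 * ex * (ex - 2) / (30 * ex + 1)"
  using p by (simp_all add: pp_def field_simps)
 thus "(pp - 2) * (ex / (ex - pp)) = 1 / 30" using p ex(1) by simp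
qed

text \<open>Of the power \<open>pp\<close> of the derivative of \<open>Phi\<close>, two factors are
  the Jacobian. Young's inequality splits the remaining \<open>pp - 2\<close> from \<open>t\<close>,
  leaving \<open>t powr ex\<close> and the derivative to the power 1/30. By \<open>bd_Phi\<close>
  the latter is at most a multiple of \<open>1 / sqrt (bd g)\<close>, which is integrable over the
  triangle.\<close>

lemma disc_Lp:
 "EX B. \<forall>t :: complex => real. continuous_on UNIV t --> (ALL g. 0 <= t g) -->
  integrable M (%r. (cmod (deriv Phi r) * t (Phi r)) powr pp) &
  (LINT r|M. (cmod (deriv Phi r) * t (Phi r)) powr pp) <= integral QQ (%g. t g powr ex) + B"
proof -
 obtain C where C: "0 < C" "!!r. r \<in> ball 0 1 ==> cmod (deriv Phi r) <= C / bd (Phi r) ^ 15" using bd_Phi by blast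
 define C1 where "C1 = C powr (1/30)"
 define B where "B = C1 * set_lebesgue_integral lborel TT (%g. 1 / sqrt (bd g))"
 have "integrable M (%r. (cmod (deriv Phi r) * t (Phi r)) powr pp) &
  (LINT r|M. (cmod (deriv Phi r) * t (Phi r)) powr pp) <= integral QQ (%g. t g powr ex) + B"
  if t: "continuous_on UNIV t" "!!g. 0 <= t g" for t :: "complex => real"
 proof -
  define f where "f g = t g powr ex + C1 * (1 / sqrt (bd g))" for g
  have ct: "continuous_on S (%g. t g powr ex)" for S
   using t ex(1) by (intro continuous_on_powr' continuous_on_subset[OF t(1)] continuous_intros) auto
  have cf: "continuous_on TT f" unfolding f_def
   by (intro continuous_intros ct) (auto simp: bd_TT)
  have i1: "set_integrable lborel TT (%g. t g powr ex)" by (rule set_integral_TT_le_QQ(1)[OF ct]) simp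
  have i2: "set_integrable lborel TT (%g. C1 * (1 / sqrt (bd g)))" using bd_singular_integrable by (rule set_integrable_mult_right)
  have fi: "set_integrable lborel TT f" unfolding f_def using i1 i2 by (rule set_integral_add)
  have pw: "(cmod (deriv Phi r) * t (Phi r)) powr pp <= (cmod (deriv Phi r))^2 * f (Phi r)" if r: "r \<in> ball 0 1" for r
  proof (cases "deriv Phi r = 0")
   case False
   define D where "D = cmod (deriv Phi r)"
   define b where "b = bd (Phi r)"
   have D: "0 < D" using False by (simp add: D_def)
   have b: "0 < b" using Phi[OF r] by (simp add: b_def bd_TT)
   have "(D * t (Phi r)) powr pp = D powr pp * t (Phi r) powr pp" using D t by (simp add: powr_mult)
   also have "D powr pp = D^2 * D powr (pp - 2)" using D by (simp add: powr_diff)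
   also have "D^2 * D powr (pp - 2) * t (Phi r) powr pp = D^2 * (t (Phi r) powr pp * D powr (pp - 2))" by simp
   also have "... <= D^2 * (t (Phi r) powr ex + (D powr (pp - 2)) powr (ex / (ex - pp)))"
    using pp t by (intro mult_left_mono powr_Young) auto
   also have "(D powr (pp - 2)) powr (ex / (ex - pp)) = D powr (1 / 30)" by (simp only: powr_powr pp(3))
   also have "D^2 * (t (Phi r) powr ex + D powr (1 / 30)) <= D^2 * f (Phi r)"
   proof (intro mult_left_mono)
    have "D powr (1/30) <= (C / b ^ 15) powr (1/30)" using C(2)[OF r] D by (intro powr_mono2) (auto simp: D_def b_def)
    also have "... = C1 * (1 / sqrt b)"
    proof -
     have "(b ^ 15) powr (1/30) = (b powr 15) powr (1/30)" using b by simp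
     also have "... = sqrt b" unfolding powr_powr using b by (simp add: powr_half_sqrt)
     finally show ?thesis using b C(1) by (simp add: C1_def powr_divide)
    qed
    finally show "t (Phi r) powr ex + D powr (1 / 30) <= f (Phi r)" by (simp add: f_def b_def)
   qed simp
   finally show ?thesis by (simp add: D_def)
  qed (use pp in simp)
  have I: "integrable M (%r. (cmod (deriv Phi r) * t (Phi r)) powr pp)"
  proof (rule Bochner_Integration.integrable_bound[OF disc_integral(1)[OF cf fi]])
   have "continuous_on (ball 0 1) (%r. (cmod (deriv Phi r) * t (Phi r)) powr pp)"
    using pp t by (intro continuous_on_powr' continuous_intros continuous_Phi continuous_on_compose2[OF t(1) continuous_Phi(1)]) auto
   thus "(%r. (cmod (deriv Phi r) * t (Phi r)) powr pp) \<in> borel_measurable M"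
    by (rule continuous_imp_measurable_on_sets_lebesgue) simp
   show "AE r in M. norm ((cmod (deriv Phi r) * t (Phi r)) powr pp) <= norm ((cmod (deriv Phi r))^2 * f (Phi r))"
    by (rule AE_I2) (use pw in "auto intro!: order_trans[OF _ abs_ge_self]")
  qed
  have "(LINT r|M. (cmod (deriv Phi r) * t (Phi r)) powr pp) <= (LINT r|M. (cmod (deriv Phi r))^2 * f (Phi r))"
   by (rule integral_mono[OF I disc_integral(1)[OF cf fi]]) (use pw in auto)
  also have "... = set_lebesgue_integral lborel TT f" by (rule disc_integral(2)[OF cf fi])
  also have "... = set_lebesgue_integral lborel TT (%g. t g powr ex) + B"
   unfolding f_def B_def set_integral_mult_right[symmetric] by (rule set_integral_add(2)[OF i1 i2])
  also have "... <= integral QQ (%g. t g powr ex) + B" using set_integral_TT_le_QQ(2)[OF ct] by simp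
  finally show ?thesis using I by blast
 qed
 thus ?thesis by blast
qed

text \<open>Over the cell, Parseval gives 16 because \<open>c\<close> has mean zero and
  \<open>S\<close> keeps the modulus of every other coefficient. The integrand is invariant under
  the reflections, so the triangle has an eighth of this.\<close>

lemma Galerkin_area:
 assumes G: "Galerkin P N c Y"
 shows "set_lebesgue_integral lborel TT (%g. (norm (e0 + Sop N c g))^2 - (norm (vtp N c g))^2) = 2"
proof -
 have cs: "csym 1 1 (-1) (c j)" and c0: "c j 0 = 0" for j using Galerkin_csym[OF G] Galerkin_c0[OF G] by auto
 have S: "norm (e0 + Sop N c (fold_TC g)) = norm (e0 + Sop N c g)" for g
  by (rule norm_fold_ssym[OF ssym_Sop[OF cs] cnj_e0])
 have S': "norm (e0 + Sop N c (cnj g)) = norm (e0 + Sop N c g)" "norm (e0 + Sop N c (- cnj g)) = norm (e0 + Sop N c g)"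
  "norm (e0 + Sop N c (\<i> * cnj g)) = norm (e0 + Sop N c g)" for g
  using S[of "cnj g"] S[of "- cnj g"] S[of "\<i> * cnj g"] S[of g] by (simp_all only: fold_cnj)
 have V: "(norm (vtp N c (cnj g)))^2 = (norm (vtp N c g))^2" "(norm (vtp N c (- cnj g)))^2 = (norm (vtp N c g))^2"
  "(norm (vtp N c (\<i> * cnj g)))^2 = (norm (vtp N c g))^2" for g
  unfolding norm_vec_sq using fsym_tp[OF cs] by (simp_all add: fsym_def norm_mult)
 have "8 * set_lebesgue_integral lborel TT (%g. (norm (e0 + Sop N c g))^2 - (norm (vtp N c g))^2) =
   integral QQ (%g. (norm (e0 + Sop N c g))^2 - (norm (vtp N c g))^2)"
  by (rule integral_QQ_eq_TT[symmetric]) (intro continuous_intros, simp_all only: S' V)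
 also have "... = integral QQ (%g. (norm (e0 + Sop N c g))^2) - integral QQ (%g. (norm (vtp N c g))^2)"
  by (rule integral_diff) (intro integrable_QQ continuous_intros)+
 also have "... = 16 * (norm e0)^2 + csq N (%j. Smul (c j)) - csq N c"
  using Parseval_const_add[of "%j. Smul (c j)" e0 N] by (simp add: Sop_def Parseval_vtp)
 also have "csq N (%j. Smul (c j)) = csq N c"
 proof -
  have "cmod (Smul (c j) l) = cmod (c j l)" for j l using c0 by (cases "l = 0") (auto simp: Smul_def norm_mult norm_divide)
  thus ?thesis by (simp add: csq_def)
 qed
 finally show ?thesis by (simp add: norm_e0)
qed

end

context disc_solution begin

definition ka :: complex where "ka = 1 / (1 + \<i>)"

lemma ka: "(cmod ka)^2 = 1 / 2" "cmod ka <= 1" "ka * \<i> = cnj ka"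
proof -
 have k: "ka = Complex (1/2) (-1/2)" using onei_ne by (simp add: ka_def complex_eq_iff Re_divide Im_divide power2_eq_square)
 show 1: "(cmod ka)^2 = 1 / 2" unfolding cmod_power2 by (simp add: k power2_eq_square)
 thus "cmod ka <= 1" using power2_le_imp_le[of "cmod ka" 1] by simp
 show "ka * \<i> = cnj ka" by (simp add: k complex_eq_iff)
qed

text \<open>The value at \<open>b\<close> of the real-linear map with complex-linear part \<open>fst q\<close> and antilinear part \<open>snd q\<close>.\<close>

definition LL :: "complex => (complex^'n) \<times> (complex^'n) => complex^'n" where
 "LL b q = b *s fst q + cnj b *s snd q"

lemma bounded_linear_LL: "bounded_linear (LL b)"
 unfolding LL_def
 by (intro bounded_linear_add bounded_linear_compose[OF bounded_linear_svec(1)] bounded_linear_fst bounded_linear_snd)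

lemma norm_LL: "cmod b = 1 ==> norm (LL b q) <= 2 * norm q"
 using norm_triangle_ineq[of "b *s fst q" "cnj b *s snd q"] norm_fst_le[of "fst q" "snd q"] norm_snd_le[of "snd q" "fst q"]
 by (simp add: LL_def norm_svec)

lemma LL_diff: "LL b (p - q) = LL b p - LL b q"
 using bounded_linear_LL by (simp add: bounded_linear.linear linear_diff)

lemma LL_dbar: "(1 / 2) *s (LL 1 q + \<i> *s LL \<i> q) = snd q"
 "(1 / 2) *s (cnj_vec (LL 1 q) + \<i> *s cnj_vec (LL \<i> q)) = cnj_vec (fst q)"
 by (auto simp: vec_eq_iff LL_def cnj_vec_def complex_eq_iff field_simps)

lemma LL_symplectic: "std_symplectic (LL 1 q) (LL \<i> q) = (norm (fst q))^2 - (norm (snd q))^2"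
proof -
 have e: "Re (\<i> / 2 * (LL 1 q $ j * cnj (LL \<i> q $ j) - LL \<i> q $ j * cnj (LL 1 q $ j))) = (cmod (fst q $ j))^2 - (cmod (snd q $ j))^2" for j
  unfolding cmod_power2 by (simp add: LL_def power2_eq_square algebra_simps)
 show ?thesis
  unfolding std_symplectic_def norm_vec_sq sum_subtractf[symmetric] sum_distrib_left Re_sum by (rule sum.cong[OF refl e])
qed

lemma Zmap_ka: "Zmap P F u v = ka *s (v *s e0 + F v) + (\<chi> j. if j = k then -1 else P $ j - ka * F u $ j)"
 by (simp add: vec_eq_iff Zmap_def ka_def e0_def axis_def diff_divide_distrib add_divide_distrib)

text \<open>The derivatives in the disc variable and in its conjugate of the Galerkin map composed
  with \<open>Phi\<close>. The factor \<open>ka\<close> has squared modulus 1/2, which turns the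
  area 2 of \<open>TT\<close> into 1.\<close>

definition qD :: "nat => ('n => int * int => complex) => complex => (complex^'n) \<times> (complex^'n)" where
 "qD N c z = ((deriv Phi z * ka) *s (e0 + Sop N c (Phi z)), (cnj (deriv Phi z) * ka) *s vtp N c (Phi z))"

lemma continuous_svec: "continuous_on S f ==> continuous_on S g ==> continuous_on S (%x. f x *s (g x :: complex^'n))"
 unfolding vector_scalar_mult_def by (intro continuous_on_vec_lambda continuous_intros)

lemma continuous_qD: "continuous_on (ball 0 1) (qD N c)"
 unfolding qD_def
 by (intro continuous_on_Pair continuous_svec continuous_intros continuous_Phi)

lemma norm_qD: "(norm (fst (qD N c z)))^2 = (cmod (deriv Phi z))^2 * (norm (e0 + Sop N c (Phi z)))^2 / 2"
 "(norm (snd (qD N c z)))^2 = (cmod (deriv Phi z))^2 * (norm (vtp N c (Phi z)))^2 / 2"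
 "(norm (qD N c z - qD N' c' z))^2 = (cmod (deriv Phi z))^2 * (norm (Sop N c (Phi z) - Sop N' c' (Phi z)))^2 / 2
  + (cmod (deriv Phi z))^2 * (norm (vtp N c (Phi z) - vtp N' c' (Phi z)))^2 / 2"
proof -
 have d: "qD N c z - qD N' c' z = ((deriv Phi z * ka) *s (Sop N c (Phi z) - Sop N' c' (Phi z)),
   (cnj (deriv Phi z) * ka) *s (vtp N c (Phi z) - vtp N' c' (Phi z)))"
  by (simp add: qD_def vec_eq_iff algebra_simps)
 show "(norm (qD N c z - qD N' c' z))^2 = (cmod (deriv Phi z))^2 * (norm (Sop N c (Phi z) - Sop N' c' (Phi z)))^2 / 2
  + (cmod (deriv Phi z))^2 * (norm (vtp N c (Phi z) - vtp N' c' (Phi z)))^2 / 2"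
  unfolding d norm_Pair norm_svec by (simp add: norm_mult power_mult_distrib ka)
qed (simp_all only: qD_def fst_conv snd_conv norm_svec, simp_all add: norm_mult power_mult_distrib ka)

lemma integrable_qD: "integrable M (%z. (norm (fst (qD N c z)))^2)" "integrable M (%z. (norm (snd (qD N c z)))^2)"
 "integrable M (%z. (norm (qD N c z))^2)"
proof -
 have c: "continuous_on UNIV (%v. e0 + Sop N c v)" "continuous_on UNIV (vtp N c)" by (intro continuous_intros)+
 show 1: "integrable M (%z. (norm (fst (qD N c z)))^2)" "integrable M (%z. (norm (snd (qD N c z)))^2)"
  unfolding norm_qD using disc_L2(1)[OF c(1)] disc_L2(1)[OF c(2)] by simp_all
 have "(norm q)^2 = (norm (fst q))^2 + (norm (snd q))^2" for q :: "(complex^'n) \<times> (complex^'n)"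
  by (simp add: norm_prod_def)
 thus "integrable M (%z. (norm (qD N c z))^2)" using 1 by simp
qed

lemma qD_area:
 assumes "Galerkin P N c u"
 shows "(LINT z|M. (norm (fst (qD N c z)))^2) - (LINT z|M. (norm (snd (qD N c z)))^2) = 1"
proof -
 let ?f = "%v. (norm (e0 + Sop N c v))^2 - (norm (vtp N c v))^2"
 have c: "continuous_on S (%v. (norm (e0 + Sop N c v))^2)" "continuous_on S (%v. (norm (vtp N c v))^2)" for S
  by (intro continuous_intros)+
 have "set_integrable lborel TT ?f"
  by (intro set_integral_diff set_integral_TT_le_QQ c) auto
 hence "(LINT z|M. (cmod (deriv Phi z))^2 * ?f (Phi z)) = 2"
  using disc_integral(2)[of ?f] Galerkin_area[OF assms] c by (simp add: continuous_on_diff)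
 moreover have "(LINT z|M. (norm (fst (qD N c z)))^2) - (LINT z|M. (norm (snd (qD N c z)))^2)
   = (LINT z|M. (norm (fst (qD N c z)))^2 - (norm (snd (qD N c z)))^2)"
  using integrable_qD by simp
 moreover have "(norm (fst (qD N c z)))^2 - (norm (snd (qD N c z)))^2 = (cmod (deriv Phi z))^2 * ?f (Phi z) / 2" for z
  unfolding norm_qD by (simp add: algebra_simps diff_divide_distrib)
 ultimately show ?thesis by simp
qed

lemma disc_map_derivative:
 assumes c0: "!!j. c j 0 = 0" and z: "z \<in> ball 0 1"
 shows "((%z. ka *s (Phi z *s e0 + Fop N c (Phi z)) + w) has_derivative (%h. LL h (qD N c z))) (at z)"
proof -
 have dPhi: "(Phi has_derivative (%h. deriv Phi z * h)) (at z)"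
  using Phi_deriv[OF z] by (simp add: has_field_derivative_def)
 have "((%z. Phi z *s e0) has_derivative (%h. (deriv Phi z * h) *s e0)) (at z)"
  by (rule bounded_linear.has_derivative[OF bounded_linear_svec(2) dPhi])
 moreover have "((%z. Fop N c (Phi z)) has_derivative (%h. (deriv Phi z * h) *s Sop N c (Phi z) + cnj (deriv Phi z * h) *s vtp N c (Phi z))) (at z)"
  by (rule has_derivative_compose[OF dPhi Fop_has_derivative]) (rule c0)
 ultimately have "((%z. Phi z *s e0 + Fop N c (Phi z)) has_derivative
   (%h. (deriv Phi z * h) *s e0 + ((deriv Phi z * h) *s Sop N c (Phi z) + cnj (deriv Phi z * h) *s vtp N c (Phi z)))) (at z)"
  by (rule has_derivative_add)
 from has_derivative_add_const[OF bounded_linear.has_derivative[OF bounded_linear_svec(1) this]] show ?thesis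
  by (rule has_derivative_eq_rhs) (simp add: fun_eq_iff vec_eq_iff LL_def qD_def algebra_simps)
qed

lemma Galerkin_disc_Lp:
 "EX B. ALL P N c u. Galerkin P N c u --> integrable M (%z. norm (qD N c z) powr pp) & (LINT z|M. norm (qD N c z) powr pp) <= B"
proof -
 obtain B where B0: "\<forall>t :: complex => real. continuous_on UNIV t --> (ALL v. 0 <= t v) -->
  integrable M (%z. (cmod (deriv Phi z) * t (Phi z)) powr pp) &
  (LINT z|M. (cmod (deriv Phi z) * t (Phi z)) powr pp) <= integral QQ (%v. t v powr ex) + B" using disc_Lp ..
 have "integrable M (%z. norm (qD N c z) powr pp) & (LINT z|M. norm (qD N c z) powr pp) <= 3 powr ex * (16 + 2 * Cp) + B"
  if G: "Galerkin P N c u" for P N c u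
 proof -
  define t where "t v = 1 + norm (Sop N c v) + norm (vtp N c v)" for v
  have ct: "continuous_on S t" for S unfolding t_def by (intro continuous_intros)
  have t0: "0 <= t v" for v by (simp add: t_def)
  note b = B0[rule_format, OF ct t0]
  have cs: "continuous_on QQ (%v. norm (Sop N c v) powr ex)" "continuous_on QQ (%v. norm (vtp N c v) powr ex)"
   using ex(1) by (auto intro!: continuous_on_powr' continuous_intros)
  have "integral QQ (%v. t v powr ex) <= integral QQ (%v. 3 powr ex * (1 + norm (Sop N c v) powr ex + norm (vtp N c v) powr ex))"
  proof (rule integral_le)
   show "(%v. t v powr ex) integrable_on QQ"
    using ex(1) t0 by (intro integrable_QQ continuous_on_powr' ct continuous_intros) auto
   show "(%v. 3 powr ex * (1 + norm (Sop N c v) powr ex + norm (vtp N c v) powr ex)) integrable_on QQ"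
    by (intro integrable_QQ continuous_intros cs)
   fix v
   \<comment> \<open>The three summands of \<open>t\<close> are at most their maximum, whence
     \<open>3 powr ex\<close>.\<close>
   define m where "m = max 1 (max (norm (Sop N c v)) (norm (vtp N c v)))"
   have "t v powr ex <= (3 * m) powr ex" using ex(1) t0 by (intro powr_mono2) (auto simp: t_def m_def)
   also have "... = 3 powr ex * m powr ex" by (simp add: powr_mult m_def)
   also have "m powr ex <= 1 + norm (Sop N c v) powr ex + norm (vtp N c v) powr ex"
    by (auto simp: m_def max_def add_nonneg_nonneg)
   finally show "t v powr ex <= 3 powr ex * (1 + norm (Sop N c v) powr ex + norm (vtp N c v) powr ex)" by simp
  qed
  also have "... = 3 powr ex * (16 + integral QQ (%v. norm (Sop N c v) powr ex) + integral QQ (%v. norm (vtp N c v) powr ex))"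
  proof -
   have "integral QQ (%v. 1 + norm (Sop N c v) powr ex + norm (vtp N c v) powr ex) =
     integral QQ (%v. 1 + norm (Sop N c v) powr ex) + integral QQ (%v. norm (vtp N c v) powr ex)"
    by (rule integral_add) (intro integrable_QQ continuous_intros cs)+
   also have "integral QQ (%v. 1 + norm (Sop N c v) powr ex) = integral QQ (%v. 1 :: real) + integral QQ (%v. norm (Sop N c v) powr ex)"
    by (rule integral_add) (intro integrable_QQ continuous_intros cs)+
   also have "integral QQ (%v. 1 :: real) = 16" using content_QQ by (simp add: QQ_def)
   finally show ?thesis by simp
  qed
  also have "... <= 3 powr ex * (16 + 2 * Cp)" using Galerkin_Lp[OF G] by (intro mult_left_mono) auto
  finally have I: "(LINT z|M. (cmod (deriv Phi z) * t (Phi z)) powr pp) <= 3 powr ex * (16 + 2 * Cp) + B" using b by linarith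
  have le: "norm (qD N c z) powr pp <= (cmod (deriv Phi z) * t (Phi z)) powr pp" for z
  proof (rule powr_mono2)
   have "norm (qD N c z) <= norm (fst (qD N c z)) + norm (snd (qD N c z))"
    using norm_Pair_le[of "fst (qD N c z)" "snd (qD N c z)"] by simp
   also have "... = cmod ka * (cmod (deriv Phi z) * (norm (e0 + Sop N c (Phi z)) + norm (vtp N c (Phi z))))"
    unfolding qD_def fst_conv snd_conv norm_svec by (simp add: norm_mult algebra_simps)
   also have "... <= 1 * (cmod (deriv Phi z) * t (Phi z))"
    using norm_triangle_ineq[of e0 "Sop N c (Phi z)"] by (intro mult_mono ka) (auto simp: t_def norm_e0)
   finally show "norm (qD N c z) <= cmod (deriv Phi z) * t (Phi z)" by simp
  qed (use pp in auto)
  have "continuous_on (ball 0 1) (%z. norm (qD N c z) powr pp)"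
   using pp by (intro continuous_on_powr' continuous_intros continuous_qD) auto
  hence m: "(%z. norm (qD N c z) powr pp) \<in> borel_measurable M"
   by (rule continuous_imp_measurable_on_sets_lebesgue) simp
  have i: "integrable M (%z. norm (qD N c z) powr pp)"
   by (rule Bochner_Integration.integrable_bound[OF conjunct1[OF b] m]) (use le in auto)
  have "(LINT z|M. norm (qD N c z) powr pp) <= (LINT z|M. (cmod (deriv Phi z) * t (Phi z)) powr pp)"
   by (rule integral_mono[OF i conjunct1[OF b] le])
  thus ?thesis using i I by linarith
 qed
 thus ?thesis by blast
qed

end

text \<open>Only \<open>g\<close> is assumed measurable: Lebesgue measure is complete, so
  \<open>f\<close> inherits measurability. This suits chosen representatives of weak derivatives,
  which are known only almost everywhere.\<close>

lemma integral_lebesgue_on_cong_AE: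
 fixes f g :: "'a::euclidean_space => 'b::euclidean_space"
 assumes U: "U \<in> sets lebesgue" and m: "g \<in> borel_measurable (lebesgue_on U)" and ae: "AE x in lebesgue_on U. f x = g x"
 shows "(LINT x|lebesgue_on U. f x) = (LINT x|lebesgue_on U. g x)"
proof -
 have g: "(%x. indicator U x *\<^sub>R g x) \<in> borel_measurable lebesgue"
  using m U by (simp add: borel_measurable_restrict_space_iff)
 have ae': "AE x in lebesgue. indicator U x *\<^sub>R g x = indicator U x *\<^sub>R f x"
  using ae U by (simp add: AE_restrict_space_iff) (auto elim!: eventually_mono simp: indicator_def)
 have "(%x. indicator U x *\<^sub>R f x) \<in> borel_measurable lebesgue" by (rule borel_measurable_AE[OF g ae'])
 hence "(LINT x|lebesgue. indicator U x *\<^sub>R g x) = (LINT x|lebesgue. indicator U x *\<^sub>R f x)"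
  by (intro integral_cong_AE g ae')
 thus ?thesis using U by (simp add: integral_restrict_space)
qed

lemma integrable_lebesgue_on_subset:
 fixes f :: "'a::euclidean_space => 'b::euclidean_space"
 assumes "integrable (lebesgue_on U) f" "K \<subseteq> U" "U \<in> sets lebesgue" "K \<in> sets lebesgue"
 shows "integrable (lebesgue_on K) f"
proof -
 have "set_integrable lebesgue U f" using assms by (simp add: integrable_restrict_space set_integrable_def)
 hence "set_integrable lebesgue K f" by (rule set_integrable_subset) (use assms in auto)
 thus ?thesis using assms by (simp add: integrable_restrict_space set_integrable_def)
qed

context disc_solution begin

lemma finite_M: "finite_measure M" by (rule finite_measure_lebesgue_on) simp

lemma measurable_M: "continuous_on (ball 0 1) f ==> f \<in> borel_measurable M" for f :: "complex => 'b::euclidean_space"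
 by (rule continuous_imp_measurable_on_sets_lebesgue) simp_all

text \<open>The Galerkin maps are C^1 on the disc and converge uniformly, their derivatives converge
  in L^2. Both imply L^1 convergence on compact sets, so \<open>has_weak_deriv_limit\<close>
  applies.\<close>

lemma has_weak_deriv_disc_limit:
 assumes Z: "continuous_on (ball 0 1) Z"
  and u: "uniform_limit (ball 0 1) (%i y. ka *s (Phi y *s e0 + Fop (N i) (c i) (Phi y)) + w) Z sequentially"
  and c0: "!!i j. c i j 0 = 0"
  and p: "p \<in> borel_measurable M" "integrable M (%x. (norm (p x))^2)" "!!i. integrable M (%x. (norm (qD (N i) (c i) x - p x))^2)"
   "(%i. LINT x|M. (norm (qD (N i) (c i) x - p x))^2) \<longlonglongrightarrow> 0"
  and b: "b \<in> Basis"
 shows "has_weak_deriv Z (%y. LL b (p y)) b (ball 0 1)"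
proof (rule has_weak_deriv_limit[where F = "%i y. ka *s (Phi y *s e0 + Fop (N i) (c i) (Phi y)) + w" and p = "%i y. LL b (qD (N i) (c i) y)"])
 have b1: "cmod b = 1" using b by (auto simp: Basis_complex_def)
 let ?V = "%i y. ka *s (Phi y *s e0 + Fop (N i) (c i) (Phi y)) + w"
 have d: "(?V i has_derivative (%h. LL h (qD (N i) (c i) x))) (at x)" if "x \<in> ball 0 1" for i x
  by (rule disc_map_derivative[OF _ that]) (rule c0)
 have cL: "continuous_on (ball 0 1) (%y. LL b (qD (N i) (c i) y))" for i
  by (rule bounded_linear.continuous_on[OF bounded_linear_LL continuous_qD])
 have cV: "continuous_on (ball 0 1) (?V i)" for i
  by (intro continuous_on_add continuous_svec continuous_intros continuous_Phi)
 show "has_weak_deriv (?V i) (%y. LL b (qD (N i) (c i) y)) b (ball 0 1)" for i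
  by (rule has_weak_deriv_C1[OF d cL b])
 show "locally_integrable_on Z (ball 0 1)" by (rule continuous_imp_locally_integrable[OF Z])
 have ip: "integrable M p"
 proof (rule L1_le_of_L2(1)[OF finite_M p(1,2)])
  define I where "I = (LINT x|M. (norm (p x))^2)"
  have I: "0 <= I" unfolding I_def by simp
  thus "(LINT x|M. (norm (p x))^2) <= (I + 1)^2" unfolding I_def[symmetric] by (simp add: power2_eq_square algebra_simps)
  show "0 < I + 1" using I by simp
 qed
 show "locally_integrable_on (%y. LL b (p y)) (ball 0 1)"
  unfolding locally_integrable_on_def
  using integrable_lebesgue_on_subset[OF integrable_bounded_linear[OF bounded_linear_LL ip]]
  by (auto intro: fmeasurableD lmeasurable_compact)
 fix K :: "complex set" assume K: "compact K" "K \<subseteq> ball 0 1"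
 have Ks: "K \<in> sets lebesgue" "K \<in> lmeasurable" using K(1) compact_imp_closed lmeasurable_compact by auto
 show "(%i. LINT x|lebesgue_on K. norm (?V i x - Z x)) \<longlonglongrightarrow> 0"
 proof (rule LIMSEQ_I)
  fix e :: real assume e: "0 < e"
  define t where "t = e / (measure lebesgue K + 1)"
  have mk: "measure lebesgue K + 1 > 0" by (simp add: add_nonneg_pos)
  have t: "0 < t" using e mk by (simp add: t_def)
  have "\<forall>\<^sub>F i in sequentially. ALL x:ball 0 1. dist (?V i x) (Z x) < t" using uniform_limitD[OF u t] .
  then obtain i0 where i0: "!!i x. i \<ge> i0 ==> x \<in> ball 0 1 ==> dist (?V i x) (Z x) < t"
   unfolding eventually_sequentially by blast
  have "norm ((LINT x|lebesgue_on K. norm (?V i x - Z x)) - 0) < e" if i: "i \<ge> i0" for i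
  proof -
   have "integrable (lebesgue_on K) (%x. ?V i x - Z x)"
    using continuous_imp_locally_integrable[OF continuous_on_diff[OF cV Z]] K unfolding locally_integrable_on_def by blast
   hence "(LINT x|lebesgue_on K. norm (?V i x - Z x)) <= (LINT x|lebesgue_on K. t)"
    using i0[OF i] K(2) Ks(1) finite_measure.integrable_const[OF finite_measure_lebesgue_on[OF Ks(2)]]
    by (intro integral_mono) (auto simp: dist_norm less_imp_le subset_iff simp del: mem_ball)
   also have "... = t * measure lebesgue K" using Ks by (simp add: measure_restrict_space)
   also have "... < t * (measure lebesgue K + 1)" using t by simp
   also have "... = e" using mk by (simp add: t_def)
   finally show ?thesis by (simp add: Bochner_Integration.integral_nonneg)
  qed
  thus "EX no. ALL i>=no. norm ((LINT x|lebesgue_on K. norm (?V i x - Z x)) - 0) < e" by blast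
 qed
 define d where "d i x = LL b (qD (N i) (c i) x) - LL b (p x)" for i x
 have dm: "d i \<in> borel_measurable M" for i
 proof -
  have "(%x. LL b (p x)) \<in> borel_measurable M" using integrable_bounded_linear[OF bounded_linear_LL ip] by simp
  thus ?thesis unfolding d_def using measurable_M[OF cL] by simp
 qed
 have dle: "(norm (d i x))^2 <= 4 * (norm (qD (N i) (c i) x - p x))^2" for i x
 proof -
  have "(norm (d i x))^2 <= (2 * norm (qD (N i) (c i) x - p x))^2"
   unfolding d_def LL_diff[symmetric] using norm_LL[OF b1] by (intro power_mono) auto
  thus ?thesis by (simp add: power_mult_distrib)
 qed
 have di: "integrable M (%x. (norm (d i x))^2)" for i
  by (rule Bochner_Integration.integrable_bound[of _ "%x. 4 * (norm (qD (N i) (c i) x - p x))^2"]) (use p(3) dm dle in auto)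
 have "(%i. LINT x|lebesgue_on K. norm (d i x)) \<longlonglongrightarrow> 0"
 proof (rule L2_imp_L1_tendsto[OF _ Ks(1) K(2) dm di])
  show "(%i. LINT x|M. (norm (d i x))^2) \<longlonglongrightarrow> 0"
  proof (rule tendsto_sandwich[OF _ _ tendsto_const tendsto_mult_right_zero[OF p(4), of 4]])
   have "(LINT x|M. (norm (d i x))^2) <= (LINT x|M. 4 * (norm (qD (N i) (c i) x - p x))^2)" for i
    by (rule integral_mono[OF di]) (use p(3) dle in auto)
   thus "\<forall>\<^sub>F i in sequentially. (LINT x|M. (norm (d i x))^2) <= 4 * (LINT x|M. (norm (qD (N i) (c i) x - p x))^2)" by simp
  qed simp
 qed simp
 thus "(%i. LINT x|lebesgue_on K. norm (LL b (qD (N i) (c i) x) - LL b (p x))) \<longlonglongrightarrow> 0" by (simp add: d_def)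
qed (use b in auto)

lemma RHS_TT:
 assumes "Y \<in> TT" shows "RHS P F T w Y = \<i> *s (A (Zmap P F T Y) *v cnj_vec (w Y))"
 unfolding RHS_def TW_def by (simp add: vec_eq_iff tw_TT[OF assms])

text \<open>Composition with \<open>Phi\<close> multiplies both sides of the equation by the
  conjugate of its derivative. Conjugating also replaces \<open>ka\<close> by
  \<open>cnj ka = ka * \<i>\<close>, which accounts for the factor \<open>\<i>\<close> in the
  right-hand side on the triangle.\<close>

lemma residual:
 assumes y: "y \<in> ball 0 1" and Z: "Z = Zmap P F T (Phi y)"
 shows "(norm (snd (qD N c y) - A Z *v cnj_vec (fst (qD N c y))))^2 =
  (cmod (deriv Phi y))^2 * (norm (vtp N c (Phi y) - RHS P F T (%Y. e0 + Sop N c Y) (Phi y)))^2 / 2"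
proof -
 define D where "D = deriv Phi y"
 define X where "X = A Z *v cnj_vec (e0 + Sop N c (Phi y))"
 have "Phi y \<in> TT" using Phi[OF y] by blast
 from RHS_TT[OF this] have R: "RHS P F T (%Y. e0 + Sop N c Y) (Phi y) = \<i> *s X" by (simp add: X_def Z)
 have "cnj_vec (fst (qD N c y)) = (cnj D * cnj ka) *s cnj_vec (e0 + Sop N c (Phi y))"
  by (simp add: qD_def D_def vec_eq_iff cnj_vec_def distrib_left)
 hence "A Z *v cnj_vec (fst (qD N c y)) = (cnj D * cnj ka) *s X" by (simp add: X_def vector_scalar_commute)
 also have "... = (cnj D * ka) *s (\<i> *s X)" unfolding ka(3)[symmetric] by (simp add: vec_eq_iff)
 finally have "snd (qD N c y) - A Z *v cnj_vec (fst (qD N c y)) = (cnj D * ka) *s (vtp N c (Phi y) - \<i> *s X)"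
  by (simp add: qD_def D_def vector_ssub_ldistrib)
 thus ?thesis unfolding R D_def by (simp only: norm_svec) (simp add: norm_mult power_mult_distrib ka)
qed

lemma Zmap_geometry:
 assumes adm: "admissible F" and TC: "!!z. z \<in> TC ==> z + F z $ k \<in> TC"
  and G: "!!y. y \<in> cball 0 1 ==> G y \<in> TC" "!!y. y \<in> sphere 0 1 ==> G y \<in> TC - TT"
 shows "(%y. Zmap P F T (G y)) ` cball 0 1 \<subseteq> closure (Cylinder k)"
  "(%y. Zmap P F T (G y)) ` sphere 0 1 \<subseteq> frontier (Cylinder k)"
proof -
 have cl: "Zmap P F T (G y) \<in> closure (Cylinder k)" if "y \<in> cball 0 1" for y
  using closure_Triangle[OF TC[OF G(1)[OF that]]] by (simp add: closure_Cylinder Zmap_def)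
 thus "(%y. Zmap P F T (G y)) ` cball 0 1 \<subseteq> closure (Cylinder k)" by blast
 have "Zmap P F T (G y) \<notin> Cylinder k" if "y \<in> sphere 0 1" for y
  unfolding Zmap_in_Cylinder
  using boundary_to_lines[of "%Y. F Y $ k" "G y"] G(2)[OF that] adm by (simp add: admissible_def biperiodic_def)
 thus "(%y. Zmap P F T (G y)) ` sphere 0 1 \<subseteq> frontier (Cylinder k)"
  using cl interior_subset by (fastforce simp: frontier_def)
qed

lemma exists_solution:
 assumes P: "P \<in> Cylinder k"
 shows "EX Z. Z \<in> W1p pp unit_disc & continuous_on (closure unit_disc) Z &
  (AE y in lebesgue_on unit_disc. dbar Z y = A (Z y) *v dbar (%H. cnj_vec (Z H)) y) &
  Z ` closure unit_disc \<subseteq> closure (Cylinder k) & P \<in> Z ` unit_disc & symplectic_area Z = 1 &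
  Z ` frontier unit_disc \<subseteq> frontier (Cylinder k) & frontier (Cylinder k) = {W. W $ k \<in> frontier Triangle}"
proof -
 obtain G where cG: "continuous_on (cball 0 1) G" and G: "!!y. y \<in> ball 0 1 ==> G y = Phi y"
  and Gb: "!!y. y \<in> sphere 0 1 ==> G y \<in> TC - TT" using radial_limit by blast
 have GTC: "G y \<in> TC" if "y \<in> cball 0 1" for y
 proof (cases "y \<in> ball 0 1")
  case True thus ?thesis using G Phi TT_subset by auto
 next
  case False thus ?thesis using Gb[of y] that by auto
 qed
 from Galerkin_limit[OF P] obtain F T N c where adm: "admissible F" and T: "T \<in> TC" "Zmap P F T T = P"
  and Gal: "!!i. \<exists>\<tau>'. Galerkin P (N i) (c i) \<tau>'" and u: "uniform_limit UNIV (%i. Fop (N i) (c i)) F sequentially"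
  and Cau: "!!e. e > 0 ==> EX i0. ALL i>=i0. ALL i'>=i0. N2 (%Y. vtp (N i) (c i) Y - vtp (N i') (c i') Y) <= e &
    N2 (%Y. Sop (N i) (c i) Y - Sop (N i') (c i') Y) <= e"
  and Res: "!!e. e > 0 ==> EX i0. ALL i>=i0. N2 (%Y. vtp (N i) (c i) Y - RHS P F T (%Y. e0 + Sop (N i) (c i) Y) Y) <= e"
  by auto
 have c0: "c i j 0 = 0" for i j using Gal[of i] Galerkin_c0 by blast
 have cF: "continuous_on UNIV F" using adm by (simp add: admissible_def)
 have Cau': "EX i0. ALL i>=i0. ALL i'>=i0. N2 (%Y. Sop (N i) (c i) Y - Sop (N i') (c i') Y) <= e" if "e > 0" for e
  using Cau[OF that] by blast
 have inTC: "z + F z $ k \<in> TC" if "z \<in> TC" for z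
  by (rule Galerkin_limit_in_TC[OF adm c0 u Cau' Res that])
 define Z where "Z y = Zmap P F T (G y)" for y
 have geo: "Z ` cball 0 1 \<subseteq> closure (Cylinder k)" "Z ` sphere 0 1 \<subseteq> frontier (Cylinder k)"
  unfolding Z_def[abs_def] by (rule Zmap_geometry[OF adm inTC GTC Gb]; assumption)+
 have cZ: "continuous_on (cball 0 1) Z" unfolding Z_def
  by (rule continuous_on_compose2[OF continuous_Zmap[OF cF, of UNIV] cG]) simp
 have cZb: "continuous_on (ball 0 1) Z" by (rule continuous_on_subset[OF cZ]) auto
 \<comment> \<open>The parameter \<open>T\<close> cannot lie on the boundary of the triangle, since
   boundary points are mapped outside the open cylinder; so it has a preimage in the open
   disc.\<close>
 have PZ: "P \<in> Z ` ball 0 1"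
 proof -
  have "T + F T $ k \<in> TT" using P T(2) Zmap_in_Cylinder[of P F T T] by simp
  hence "T \<in> TT" using boundary_to_lines[of "%Y. F Y $ k" T] T(1) adm by (auto simp: admissible_def biperiodic_def)
  hence t: "Psi T \<in> ball 0 1" "Phi (Psi T) = T" using Psi by auto
  hence "Z (Psi T) = P" by (simp add: Z_def G[OF t(1)] T(2))
  thus ?thesis using t(1) by blast
 qed
 define q where "q i = qD (N i) (c i)" for i
 have qm: "q i \<in> borel_measurable M" for i unfolding q_def by (rule measurable_M[OF continuous_qD])
 have qi: "integrable M (%x. (norm (fst (q i x)))^2)" "integrable M (%x. (norm (snd (q i x)))^2)" "integrable M (%x. (norm (q i x))^2)" for i
  unfolding q_def by (rule integrable_qD)+
 have qC: "EX i0. ALL i>=i0. ALL j>=i0. (LINT x|M. (norm (q i x - q j x))^2) <= e" if e: "0 < e" for e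
 proof -
  obtain i0 where i0: "!!i j. i \<ge> i0 ==> j \<ge> i0 ==> N2 (%Y. vtp (N i) (c i) Y - vtp (N j) (c j) Y) <= sqrt e &
    N2 (%Y. Sop (N i) (c i) Y - Sop (N j) (c j) Y) <= sqrt e" using Cau[of "sqrt e"] e by auto
  have "(LINT x|M. (norm (q i x - q j x))^2) <= e" if "i \<ge> i0" "j \<ge> i0" for i j
  proof -
   have c: "continuous_on S (%Y. Sop (N i) (c i) Y - Sop (N j) (c j) Y)" "continuous_on S (%Y. vtp (N i) (c i) Y - vtp (N j) (c j) Y)" for S
    by (intro continuous_intros)+
   have le: "(N2 f)^2 <= e" if "N2 f <= sqrt e" "continuous_on QQ f" for f
    using power_mono[OF that(1) N2_nonneg[OF that(2)], of 2] e by simp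
   have "(LINT x|M. (norm (q i x - q j x))^2) = (LINT x|M. (cmod (deriv Phi x))^2 * (norm (Sop (N i) (c i) (Phi x) - Sop (N j) (c j) (Phi x)))^2) / 2
     + (LINT x|M. (cmod (deriv Phi x))^2 * (norm (vtp (N i) (c i) (Phi x) - vtp (N j) (c j) (Phi x)))^2) / 2"
    unfolding q_def norm_qD(3) using disc_L2(1)[OF c(1)] disc_L2(1)[OF c(2)] by simp
   also have "... <= e / 2 + e / 2"
    using order_trans[OF disc_L2(2)[OF c(1)] le[OF conjunct2[OF i0[OF that]] c(1)]]
     order_trans[OF disc_L2(2)[OF c(2)] le[OF conjunct1[OF i0[OF that]] c(2)]] by linarith
   finally show ?thesis by simp
  qed
  thus ?thesis by blast
 qed
 obtain p r where p: "p \<in> borel_measurable M" "strict_mono (r :: nat => nat)" "AE x in M. (%i. q (r i) x) \<longlonglongrightarrow> p x"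
  "integrable M (%x. (norm (p x))^2)" "!!i. integrable M (%x. (norm (q i x - p x))^2)"
  "(%i. LINT x|M. (norm (q i x - p x))^2) \<longlonglongrightarrow> 0"
  by (rule L2_complete[OF finite_M qm qi(3) qC]) blast+
 have w: "has_weak_deriv Z (%y. LL b (p y)) b (ball 0 1)" if b: "b \<in> Basis" for b
 proof (rule has_weak_deriv_disc_limit[OF cZb _ c0 p(1,4) p(5,6)[unfolded q_def] b])
  show "uniform_limit (ball 0 1) (%i y. ka *s (Phi y *s e0 + Fop (N i) (c i) (Phi y)) + (\<chi> j. if j = k then -1 else P $ j - ka * F T $ j)) Z sequentially"
  proof (rule uniform_limitI)
   fix e :: real assume "0 < e"
   from uniform_limitD[OF u this]
   show "\<forall>\<^sub>F i in sequentially. ALL y:ball 0 1. dist (ka *s (Phi y *s e0 + Fop (N i) (c i) (Phi y)) + (\<chi> j. if j = k then -1 else P $ j - ka * F T $ j)) (Z y) < e"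
   proof eventually_elim
    case (elim i)
    show ?case
    proof
     fix y :: complex assume y: "y \<in> ball 0 1"
     have "dist (ka *s (Phi y *s e0 + Fop (N i) (c i) (Phi y)) + (\<chi> j. if j = k then -1 else P $ j - ka * F T $ j)) (Z y)
      = norm (ka *s (Fop (N i) (c i) (Phi y) - F (Phi y)))"
      unfolding dist_norm Z_def Zmap_ka G[OF y] by (rule arg_cong[of _ _ norm]) (simp add: vec_eq_iff algebra_simps)
     also have "... <= 1 * norm (Fop (N i) (c i) (Phi y) - F (Phi y))"
      unfolding norm_svec by (intro mult_right_mono ka) simp
     also have "... < e" using elim by (simp add: dist_norm)
     finally show "dist (ka *s (Phi y *s e0 + Fop (N i) (c i) (Phi y)) + (\<chi> j. if j = k then -1 else P $ j - ka * F T $ j)) (Z y) < e" .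
    qed
   qed
  qed
 qed
 have wd: "AE x in M. weak_deriv unit_disc 1 Z x = LL 1 (p x)" "AE x in M. weak_deriv unit_disc \<i> Z x = LL \<i> (p x)"
  by (rule weak_deriv_AE[OF w]; simp add: Basis_complex_def)+
 have wdc: "AE x in M. weak_deriv unit_disc 1 (%H. cnj_vec (Z H)) x = cnj_vec (LL 1 (p x))"
  "AE x in M. weak_deriv unit_disc \<i> (%H. cnj_vec (Z H)) x = cnj_vec (LL \<i> (p x))"
  by (rule weak_deriv_AE[OF has_weak_deriv_bounded_linear[OF w bounded_linear_cnj_vec]]; simp add: Basis_complex_def)+
 obtain B where B: "!!i. integrable M (%y. norm (q i y) powr pp) & (LINT y|M. norm (q i y) powr pp) <= B"
  using Galerkin_disc_Lp Gal unfolding q_def by metis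
 \<comment> \<open>Fatou's lemma along the almost everywhere convergent subsequence, with the
   uniform bound \<open>B\<close>.\<close>
 have pLp: "integrable M (%x. norm (p x) powr pp)"
 proof (rule integrableI_bounded)
  have "(\<integral>\<^sup>+x. ennreal (norm (norm (p x) powr pp)) \<partial>M) = (\<integral>\<^sup>+x. liminf (%i. ennreal (norm (q (r i) x) powr pp)) \<partial>M)"
   using p(3)
  proof (intro nn_integral_cong_AE, eventually_elim)
   case (elim x)
   have "(%i. ennreal (norm (q (r i) x) powr pp)) \<longlonglongrightarrow> ennreal (norm (p x) powr pp)"
    using pp by (intro tendsto_ennrealI tendsto_powr' tendsto_norm elim tendsto_const) auto
   from lim_imp_Liminf[OF sequentially_bot this] show ?case by simp
  qed
  also have "... <= liminf (%i. \<integral>\<^sup>+x. ennreal (norm (q (r i) x) powr pp) \<partial>M)"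
   by (rule nn_integral_liminf) (use qm in measurable)
  also have "... <= liminf (%i::nat. ennreal B)"
   using B by (intro Liminf_mono always_eventually allI) (auto simp: nn_integral_eq_integral intro!: ennreal_leI)
  finally show "(\<integral>\<^sup>+x. ennreal (norm (norm (p x) powr pp)) \<partial>M) < \<infinity>" by (simp add: Liminf_const le_less_trans)
 qed (use p(1) in measurable)
 have W: "Z \<in> W1p pp unit_disc"
  unfolding W1p_def mem_Collect_eq
 proof (intro conjI ballI)
  obtain C where C: "!!x. x \<in> cball 0 1 ==> norm (Z x) <= C"
   using compact_imp_bounded[OF compact_continuous_image[OF cZ compact_cball]] unfolding bounded_iff by blast
  have Zm: "Z \<in> borel_measurable M" by (rule measurable_M[OF cZb])
  have "integrable M (%x. norm (Z x) powr pp)"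
  proof (rule finite_measure.integrable_const_bound[OF finite_M])
   show "AE x in M. norm (norm (Z x) powr pp) <= C powr pp"
    by (rule AE_I2) (use C pp in "auto intro!: powr_mono2")
  qed (use Zm in measurable)
  thus "Z \<in> Lp_on pp unit_disc" using Zm by (simp add: Lp_on_def)
  fix b :: complex assume b: "b \<in> Basis"
  have b1: "cmod b = 1" using b by (auto simp: Basis_complex_def)
  have lm: "(%x. LL b (p x)) \<in> borel_measurable M"
   using measurable_compose[OF p(1) borel_measurable_continuous_onI[OF linear_continuous_on[OF bounded_linear_LL]]] .
  have "integrable M (%x. norm (LL b (p x)) powr pp)"
  proof (rule Bochner_Integration.integrable_bound[of _ "%x. 2 powr pp * norm (p x) powr pp"])
   have "norm (LL b (p x)) powr pp <= 2 powr pp * norm (p x) powr pp" for x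
    using powr_mono2[OF _ _ norm_LL[OF b1, of "p x"], of pp] pp by (simp add: powr_mult)
   thus "AE x in M. norm (norm (LL b (p x)) powr pp) <= norm (2 powr pp * norm (p x) powr pp)" by simp
  qed (use pLp lm in simp_all)
  thus "EX g:Lp_on pp unit_disc. has_weak_deriv Z g b unit_disc"
   using w[OF b] lm by (intro bexI[of _ "%x. LL b (p x)"]) (auto simp: Lp_on_def)
 qed
 \<comment> \<open>The residuals use the limiting coefficient \<open>A (Z x)\<close> and tend to 0
   in L^2. A further subsequence makes them tend to 0 almost everywhere, where they also converge to
   the residual of \<open>p\<close>.\<close>
 have eq: "AE x in M. snd (p x) = A (Z x) *v cnj_vec (fst (p x))"
 proof -
  define R where "R i x = snd (q i x) - A (Z x) *v cnj_vec (fst (q i x))" for i x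
  define g where "g i Y = vtp (N i) (c i) Y - RHS P F T (%Y. e0 + Sop (N i) (c i) Y) Y" for i Y
  have cg: "continuous_on S (g i)" for S i
   unfolding g_def RHS_def by (intro continuous_intros continuous_on_subset[OF continuous_TW[OF good_Zmap[OF adm]]]) auto
  have R2: "(norm (R i x))^2 = (cmod (deriv Phi x))^2 * (norm (g i (Phi x)))^2 / 2" if "x \<in> ball 0 1" for i x
   unfolding R_def q_def g_def by (rule residual[OF that]) (simp add: Z_def G[OF that])
  have Ri: "integrable M (%x. (norm (R i x))^2)" "(LINT x|M. (norm (R i x))^2) <= (N2 (g i))^2" for i
  proof -
   have h: "integrable M (%x. (cmod (deriv Phi x))^2 * (norm (g i (Phi x)))^2 / 2)" using disc_L2(1)[OF cg] by simp
   show "integrable M (%x. (norm (R i x))^2)"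
    using h by (rule Bochner_Integration.integrable_cong[THEN iffD1, rotated -1]) (auto simp: R2)
   have "(LINT x|M. (norm (R i x))^2) = (LINT x|M. (cmod (deriv Phi x))^2 * (norm (g i (Phi x)))^2 / 2)"
    by (rule Bochner_Integration.integral_cong) (auto simp: R2)
   also have "... <= (N2 (g i))^2 / 2" using disc_L2(2)[OF cg, of i] by simp
   finally show "(LINT x|M. (norm (R i x))^2) <= (N2 (g i))^2" using zero_le_power2[of "N2 (g i)"] by linarith
  qed
  have N0: "(%i. N2 (g i)) \<longlonglongrightarrow> 0"
  proof (rule LIMSEQ_I)
   fix e :: real assume e: "0 < e"
   then obtain i0 where i0: "!!i. i \<ge> i0 ==> N2 (g i) <= e / 2" using Res[of "e/2"] unfolding g_def by auto
   have "norm (N2 (g i) - 0) < e" if "i \<ge> i0" for i using i0[OF that] N2_nonneg[OF cg, of i] e by simp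
   thus "EX no. ALL i>=no. norm (N2 (g i) - 0) < e" by blast
  qed
  have "(%i. LINT x|M. (norm (R i x))^2) \<longlonglongrightarrow> 0"
  proof (rule tendsto_sandwich[OF _ _ tendsto_const])
   show "(%i. (N2 (g i))^2) \<longlonglongrightarrow> 0" using tendsto_power[OF N0, of 2] by simp
  qed (use Ri in simp_all)
  hence "(%i. LINT x|M. norm ((norm (R (r i) x))^2)) \<longlonglongrightarrow> 0"
   using LIMSEQ_subseq_LIMSEQ[OF _ p(2)] by (simp add: o_def)
  from tendsto_L1_AE_subseq[OF Ri(1) this]
  obtain r' where r': "strict_mono (r' :: nat => nat)" "AE x in M. (%i. (norm (R (r (r' i)) x))^2) \<longlonglongrightarrow> 0" by blast
  show ?thesis using p(3) r'(2)
  proof eventually_elim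
   case (elim x)
   have "(%i. q (r (r' i)) x) \<longlonglongrightarrow> p x" using LIMSEQ_subseq_LIMSEQ[OF elim(1) r'(1)] by (simp add: o_def)
   moreover have "continuous_on UNIV (%v. (norm (snd v - A (Z x) *v cnj_vec (fst v)))^2)" by (intro continuous_intros)
   ultimately have "(%i. (norm (R (r (r' i)) x))^2) \<longlonglongrightarrow> (norm (snd (p x) - A (Z x) *v cnj_vec (fst (p x))))^2"
    unfolding R_def using continuous_on_tendsto_compose[of UNIV "%v. (norm (snd v - A (Z x) *v cnj_vec (fst v)))^2"] by simp
   from LIMSEQ_unique[OF this elim(2)] show ?case by simp
  qed
 qed
 have dbar: "AE y in M. dbar Z y = A (Z y) *v dbar (%H. cnj_vec (Z H)) y"
  using wd wdc eq by eventually_elim (simp only: dbar_def LL_dbar)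
 \<comment> \<open>Each Galerkin map has area exactly 1 on the disc, and the two squared L^2 norms
   are continuous under strong convergence; weak convergence would not suffice for the
   difference.\<close>
 have area: "symplectic_area Z = 1"
 proof -
  have pm: "(%x. fst (p x)) \<in> borel_measurable M" "(%x. snd (p x)) \<in> borel_measurable M"
   using measurable_compose[OF p(1) borel_measurable_continuous_onI[OF linear_continuous_on[OF bounded_linear_fst]]]
    measurable_compose[OF p(1) borel_measurable_continuous_onI[OF linear_continuous_on[OF bounded_linear_snd]]] by auto
  have le: "(norm (fst v))^2 <= (norm v)^2" "(norm (snd v))^2 <= (norm v)^2" for v :: "(complex^'n) \<times> (complex^'n)"
   by (simp_all add: norm_prod_def)
  have i: "integrable M (%x. (norm (fst (p x)))^2)" "integrable M (%x. (norm (snd (p x)))^2)"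
   by (rule Bochner_Integration.integrable_bound[OF p(4)]; use pm le in simp)+
  have qfm: "(%x. fst (q i x)) \<in> borel_measurable M" "(%x. snd (q i x)) \<in> borel_measurable M" for i
   using measurable_compose[OF qm borel_measurable_continuous_onI[OF linear_continuous_on[OF bounded_linear_fst]]]
    measurable_compose[OF qm borel_measurable_continuous_onI[OF linear_continuous_on[OF bounded_linear_snd]]] by auto
  have di: "integrable M (%x. (norm (fst (q i x) - fst (p x)))^2)" "integrable M (%x. (norm (snd (q i x) - snd (p x)))^2)" for i
   using le(1)[of "q i _ - p _"] le(2)[of "q i _ - p _"] pm qfm
   by (intro Bochner_Integration.integrable_bound[OF p(5)[of i]]; simp add: fst_diff snd_diff)+
  have l: "(%i. LINT x|M. (norm (fst (q i x) - fst (p x)))^2) \<longlonglongrightarrow> 0" "(%i. LINT x|M. (norm (snd (q i x) - snd (p x)))^2) \<longlonglongrightarrow> 0"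
  proof -
   have "(LINT x|M. (norm (fst (q i x) - fst (p x)))^2) <= (LINT x|M. (norm (q i x - p x))^2)"
    "(LINT x|M. (norm (snd (q i x) - snd (p x)))^2) <= (LINT x|M. (norm (q i x - p x))^2)" for i
    using le(1)[of "q i _ - p _"] le(2)[of "q i _ - p _"] by (intro integral_mono di p(5); simp add: fst_diff snd_diff)+
   thus "(%i. LINT x|M. (norm (fst (q i x) - fst (p x)))^2) \<longlonglongrightarrow> 0" "(%i. LINT x|M. (norm (snd (q i x) - snd (p x)))^2) \<longlonglongrightarrow> 0"
    by (intro tendsto_sandwich[OF _ _ tendsto_const p(6)]; simp)+
  qed
  have "(%i. (LINT x|M. (norm (fst (q i x)))^2) - (LINT x|M. (norm (snd (q i x)))^2)) \<longlonglongrightarrow>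
    (LINT x|M. (norm (fst (p x)))^2) - (LINT x|M. (norm (snd (p x)))^2)"
   by (intro tendsto_diff L2_norm_tendsto qi(1,2) i di l)
  moreover have "(LINT x|M. (norm (fst (q i x)))^2) - (LINT x|M. (norm (snd (q i x)))^2) = 1" for i
   using Gal[of i] qD_area unfolding q_def by blast
  ultimately have 1: "(LINT x|M. (norm (fst (p x)))^2) - (LINT x|M. (norm (snd (p x)))^2) = 1"
   by (simp add: LIMSEQ_const_iff)
  have ae: "AE x in M. std_symplectic (weak_deriv unit_disc 1 Z x) (weak_deriv unit_disc \<i> Z x) = (norm (fst (p x)))^2 - (norm (snd (p x)))^2"
   using wd by eventually_elim (simp add: LL_symplectic)
  have "symplectic_area Z = (LINT x|M. (norm (fst (p x)))^2 - (norm (snd (p x)))^2)"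
   unfolding symplectic_area_def by (rule integral_lebesgue_on_cong_AE[OF _ _ ae]) (use i in simp_all)
  thus ?thesis using 1 i by simp
 qed
 show ?thesis
  using W cZ dbar geo PZ area by (intro exI[of _ Z] conjI frontier_Cylinder) simp_all
qed

end

theorem theorem3p1:
  fixes A :: "complex^'n \<Rightarrow> complex^'n^'n" and k :: 'n and a :: real
  assumes "continuous_on UNIV A"
    and "\<forall>Z. Z \<notin> Cylinder k \<longrightarrow> A Z = 0"
    and "0 < a" and "a < 1"
    and "\<forall>Z\<in>Cylinder k. onorm (\<lambda>v. A Z *v v) \<le> a"
  shows "\<exists>p>2. \<forall>P\<in>Cylinder k. \<exists>Z :: complex \<Rightarrow> complex^'n.
           Z \<in> W1p p unit_disc \<and>
           continuous_on (closure unit_disc) Z \<and>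
           (AE \<zeta> in lebesgue_on unit_disc.
              dbar Z \<zeta> = A (Z \<zeta>) *v dbar (\<lambda>\<xi>. cnj_vec (Z \<xi>)) \<zeta>) \<and>
           Z ` closure unit_disc \<subseteq> closure (Cylinder k) \<and>
           P \<in> Z ` unit_disc \<and>
           symplectic_area Z = 1 \<and>
           Z ` frontier unit_disc \<subseteq> frontier (Cylinder k) \<and>
           frontier (Cylinder k) = {W. W $ k \<in> frontier Triangle}"
proof -
 have bl: "bounded_linear (%v. B *v v)" for B :: "complex^'n^'n"
 proof (rule bounded_linear_intro[where K = "(real CARD('n))^2 * norm B"])
  show "B *v (x + y) = B *v x + B *v y" for x y by (rule matrix_vector_right_distrib)
  show "B *v (r *\<^sub>R x) = r *\<^sub>R (B *v x)" for r x
   by (simp add: vec_eq_iff matrix_vector_mult_def scaleR_sum_right)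
  show "norm (B *v x) <= norm x * ((real CARD('n))^2 * norm B)" for x
   using norm_matrix_vector_le[of B x] by (simp add: mult_ac)
 qed
 have Aa: "norm (A Z *v v) <= a * norm v" for Z v
 proof (cases "Z \<in> Cylinder k")
  case True
  have "norm (A Z *v v) <= onorm (%v. A Z *v v) * norm v" by (rule onorm[OF bl])
  also have "... <= a * norm v" using assms(5) True by (intro mult_right_mono) auto
  finally show ?thesis .
 qed (use assms(2,3) in simp)
 obtain Phi Psi where R: "Phi holomorphic_on ball 0 1" "Psi holomorphic_on TT"
  "!!\<zeta>. \<zeta> \<in> ball 0 1 ==> Phi \<zeta> \<in> TT & Psi (Phi \<zeta>) = \<zeta>" "!!\<eta>. \<eta> \<in> TT ==> Psi \<eta> \<in> ball 0 1 & Phi (Psi \<eta>) = \<eta>"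
  by (rule Riemann_TT) blast
 interpret disc_solution A k a Phi Psi
  by unfold_locales (use assms Aa R in blast)+
 show ?thesis
  \<comment> \<open>The exponent \<open>pp\<close> depends on \<open>a\<close> and the dimension
    only, so it serves all points \<open>P\<close> at once.\<close>
  by (intro exI[of _ pp] conjI ballI pp(1) exists_solution)
qed

end
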